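(* Let $0<q<1$, $n\in\mathbb{N}$, and let $m,l,k\in\mathbb{N}_0$ with $m+l+k=n$. Let $\mathcal{K}\neq\{0\}$ be a Hilbert space, let $A$ be a self-adjoint operator on $\mathcal{K}$ such that $\sigma(A)\subset[q,1]$ and $q$ is not an eigenvalue of $A$, and, when $l>0$, let $v$ be a unitary operator on $\mathcal{K}$ with $Av=vA$. Let $\mathcal{H}$ be the orthogonal direct sum of copies of $\mathcal{K}$ indexed by the tuples with entries $i_n,\dots,i_{n-m+1}\in\mathbb{N}_0$, $i_k\in\mathbb{Z}$, $i_{k-1},\dots,i_1\in\mathbb{N}$, let $\eta_{i_n\dots i_1}$ denote the vector having $\eta\in\mathcal{K}$ in the component with this index and zero in all others, and let $D=\mathrm{Lin}\{\eta_{i_n\dots i_1}\}$. (For $l>0$ there are no indices $i_{n-m},\dots,i_{k+1}$, but the notation $\eta_{i_n\dots i_1}$ is retained. If $k=0$ the indices $i_1,\dots,i_k$ are omitted, and if $m=0$ the indices $i_{n-m+1},\dots,i_n$ are omitted.) Define operators $z_1,\dots,z_n$ on $D$ as follows. Series $(m,0,k)$ (i.e. $l=0$): $$z_j\eta_{i_n\dots i_1}=q^{i_{j+1}+\dots+i_n}\lambda_{i_j+1}\,\eta_{i_n\dots i_j+1\dots i_1}\quad(k<j\le n),$$ $$z_k\eta_{i_n\dots i_1}=q^{i_{k+1}+\dots+i_n}\mu_{i_k-1}(A^2)\,\eta_{i_n\dots i_k-1\dots i_1},$$ $$z_j\eta_{i_n\dots i_1}=q^{-(i_{j+1}+\dots+i_k)+(i_{k+1}+\dots+i_n)}\beta_{i_j-1}A\,\eta_{i_n\dots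 i_j-1\dots i_1}\quad(1\le j<k).$$ Series $(m,l,k)$ with $l>0$: $$z_j\eta_{i_n\dots i_1}=q^{i_{j+1}+\dots+i_n}\lambda_{i_j+1}\,\eta_{i_n\dots i_j+1\dots i_1}\quad(n-m<j\le n),$$ $$z_{n-m}\eta_{i_n\dots i_1}=q^{i_{n-m+1}+\dots+i_n}\,v\,\eta_{i_n\dots i_k-1\dots i_1},\qquad z_j\equiv0\quad(k<j<n-m),$$ $$z_k\eta_{i_n\dots i_1}=q^{-(i_k-1)+(i_{n-m+1}+\dots+i_n)}A\,\eta_{i_n\dots i_k-1\dots i_1},$$ $$z_j\eta_{i_n\dots i_1}=q^{-(i_{j+1}+\dots+i_k)+(i_{n-m+1}+\dots+i_n)}\beta_{i_j-1}A\,\eta_{i_n\dots i_j-1\dots i_1}\quad(1\le j<k).$$ Then these operators define a $*$-representation of $\mathcal{O}_q(\mathrm{Mat}_{n,1})$ on $D$, where the action of $z_j^*$ is obtained by restricting the adjoint of $z_j$ to $D$. Representations belonging to different series $(m,l,k)$ are not unitarily equivalent, and two representations of the same series given by different operators $A$ and $v$ (different up to unitary equivalence, that is, there is no unitary operator between the corresponding spaces $\mathcal{K}$ intertwining simultaneously those of the operators $A$, $v$ which occur in the formulas) are not unitarily equivalent. A representation of these series is irreducible if and only if $\mathcal{K}=\mathbb{C}$; in this case $v$ is a complex number of modulus one and $A\in(q,1]$. Only the representations $(m,0,k)$ are faithful (that is, a representation of the series $(m,l,k)$ is faithful if and only if $l=0$).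
   Context: $\mathbb{N}_0=\{0,1,2,\dots\}$, $\mathbb{N}=\{1,2,\dots\}$. $\lambda_j=(1-q^{2j})^{1/2}$ and $\beta_j=(q^{-2j}-1)^{1/2}$ for $j\in\mathbb{N}_0$; for a positive operator $B$ and $j\in\mathbb{Z}$, $\mu_j(B)=(1+q^{-2j}B)^{1/2}$. Operators on $\mathcal{K}$ act on the $\mathcal{K}$-entry: $T\eta_{i_n\dots i_1}:=(T\eta)_{i_n\dots i_1}$. When $k=0$, $l>0$, $z_{n-m}\eta_{i_n\dots i_1}=q^{i_{n-m+1}+\dots+i_n}v\,\eta_{i_n\dots i_1}$, and the formula for $z_k$ is absent when $k=0$. $\mathcal{O}_q(\mathrm{Mat}_{n,1})$ is the unital $*$-algebra generated by $z_1,\dots,z_n$ with relations $z_kz_l=qz_lz_k$ ($k<l$), $z_l^*z_k=qz_kz_l^*$ ($k\ne l$), $z_k^*z_k=q^2z_kz_k^*-(1-q^2)\sum_{j=k+1}^nz_jz_j^*+(1-q^2)$ ($k<n$), $z_n^*z_n=q^2z_nz_n^*+(1-q^2)$. For a dense subspace $D\subset\mathcal{H}$, $\mathcal{L}^+(D)=\{x\in\mathrm{End}(D): D\subset D(x^* ),\ x^*D\subset D\}$ with involution $x\mapsto x^*\lceil D$. A $*$-representation of a $*$-algebra on $D$ is a $*$-homomorphism into $\mathcal{L}^+(D)$. It is irreducible if each decomposition $\pi=\pi_1\oplus\pi_2$ as a direct sum of $*$-representations implies that $\pi_1=0$ or $\pi_2=0$. Unitary equivalence is by a unitary operator mapping one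 domain onto the other and intertwining the representations. *)

theory Defs
  imports "HOL-Analysis.Analysis" "HOL-Library.Poly_Mapping"
    "HOL-Algebra.QuotRing" "HOL-Algebra.Module"
begin

section \<open>Complex Hilbert spaces\<close>

text \<open>Real inner product spaces with a compatible complex structure. The complex inner product is
  linear in the first argument, and the real inner product of \<^class>\<open>real_inner\<close> is its real part;
  hence the norm is \<open>sqrt \<langle>x, x\<rangle>\<close>.\<close>

class complex_inner = real_inner +
  fixes scaleC :: "complex \<Rightarrow> 'a \<Rightarrow> 'a" (infixr \<open>*\<^sub>C\<close> 75)
    and cinner :: "'a \<Rightarrow> 'a \<Rightarrow> complex"
  assumes scaleC_add_right: "a *\<^sub>C (x + y) = a *\<^sub>C x + a *\<^sub>C y"
    and scaleC_add_left: "(a + b) *\<^sub>C x = a *\<^sub>C x + b *\<^sub>C x"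
    and scaleC_scaleC: "a *\<^sub>C (b *\<^sub>C x) = (a * b) *\<^sub>C x"
    and scaleC_one: "1 *\<^sub>C x = x"
    and scaleR_scaleC: "scaleR r x = complex_of_real r *\<^sub>C x"
    and cinner_commute: "cinner x y = cnj (cinner y x)"
    and cinner_add_left: "cinner (x + y) z = cinner x z + cinner y z"
    and cinner_scaleC_left: "cinner (a *\<^sub>C x) y = a * cinner x y"
    and Re_cinner: "Re (cinner x y) = inner x y"

class complex_hilbert = complex_inner + complete_space

global_interpretation complex_vector:
  vector_space "scaleC :: complex \<Rightarrow> 'a \<Rightarrow> 'a::complex_inner"
  by standard (simp_all add: scaleC_add_right scaleC_add_left scaleC_scaleC scaleC_one)

instantiation complex :: complex_hilbert
begin

definition scaleC_complex :: "complex \<Rightarrow> complex \<Rightarrow> complex"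
  where "scaleC_complex a x = a * x"

definition cinner_complex :: "complex \<Rightarrow> complex \<Rightarrow> complex"
  where "cinner_complex x y = x * cnj y"

instance
  by standard
    (simp_all add: scaleC_complex_def cinner_complex_def algebra_simps scaleR_conv_of_real
      inner_complex_def)

end

lemma norm_scaleC: "norm (a *\<^sub>C x) = cmod a * norm (x :: 'a::complex_inner)"
proof -
  have "cinner (a *\<^sub>C x) (a *\<^sub>C x) = a * cnj a * cinner x x"
    using cinner_commute[of x "a *\<^sub>C x"] cinner_commute[of x x]
    by (simp add: cinner_scaleC_left mult.assoc)
  then have "inner (a *\<^sub>C x) (a *\<^sub>C x) = (cmod a)\<^sup>2 * inner x x"
    by (simp add: complex_norm_square[symmetric] flip: Re_cinner)
  then show ?thesis
    by (simp add: norm_eq_sqrt_inner real_sqrt_mult)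
qed

section \<open>The square-summable direct sum of copies of a Hilbert space\<close>

typedef (overloaded) ('i, 'a) ell2 =
  "{f :: 'i \<Rightarrow> 'a::complex_inner. (\<lambda>i. (norm (f i))\<^sup>2) summable_on UNIV}"
  morphisms coord Abs_ell2
  by (rule exI[of _ "\<lambda>_. 0"]) simp

lemma ell2_eqI: "(\<And>i. coord f i = coord g i) \<Longrightarrow> f = g"
  by (simp add: coord_inject[symmetric] fun_eq_iff)

lemma summable_coord: "(\<lambda>i. (norm (coord f i))\<^sup>2) summable_on UNIV"
  using coord[of f] by simp

lemma ell2_add_closed:
  fixes f g :: "'i \<Rightarrow> 'a::complex_inner"
  assumes "(\<lambda>i. (norm (f i))\<^sup>2) summable_on UNIV" "(\<lambda>i. (norm (g i))\<^sup>2) summable_on UNIV"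
  shows "(\<lambda>i. (norm (f i + g i))\<^sup>2) summable_on UNIV"
proof (rule summable_on_comparison_test)
  show "(\<lambda>i. 2 * (norm (f i))\<^sup>2 + 2 * (norm (g i))\<^sup>2) summable_on UNIV"
    by (intro summable_on_add summable_on_cmult_right assms)
next
  fix i
  have "(norm (f i + g i))\<^sup>2 \<le> (norm (f i) + norm (g i))\<^sup>2"
    by (simp add: norm_triangle_ineq)
  also have "\<dots> \<le> 2 * (norm (f i))\<^sup>2 + 2 * (norm (g i))\<^sup>2"
    using sum_squares_bound[of "norm (f i)" "norm (g i)"]
    by (simp add: power2_eq_square algebra_simps)
  finally show "(norm (f i + g i))\<^sup>2 \<le> 2 * (norm (f i))\<^sup>2 + 2 * (norm (g i))\<^sup>2" .
qed auto

lemma ell2_scale_closed: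
  fixes f :: "'i \<Rightarrow> 'a::complex_inner"
  assumes "(\<lambda>i. (norm (f i))\<^sup>2) summable_on UNIV"
  shows "(\<lambda>i. (norm (a *\<^sub>C f i))\<^sup>2) summable_on UNIV"
  unfolding norm_scaleC power_mult_distrib by (intro summable_on_cmult_right assms)

instantiation ell2 :: (type, complex_inner) complex_inner
begin

definition zero_ell2 :: "('a, 'b) ell2" where "0 = Abs_ell2 (\<lambda>_. 0)"
definition plus_ell2 :: "('a, 'b) ell2 \<Rightarrow> ('a, 'b) ell2 \<Rightarrow> ('a, 'b) ell2"
  where "f + g = Abs_ell2 (\<lambda>i. coord f i + coord g i)"
definition scaleC_ell2 :: "complex \<Rightarrow> ('a, 'b) ell2 \<Rightarrow> ('a, 'b) ell2"
  where "c *\<^sub>C f = Abs_ell2 (\<lambda>i. c *\<^sub>C coord f i)"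
definition scaleR_ell2 :: "real \<Rightarrow> ('a, 'b) ell2 \<Rightarrow> ('a, 'b) ell2"
  where "scaleR r (f :: ('a, 'b) ell2) = complex_of_real r *\<^sub>C f"
definition uminus_ell2 :: "('a, 'b) ell2 \<Rightarrow> ('a, 'b) ell2" where "- (f :: ('a, 'b) ell2) = (- 1) *\<^sub>C f"
definition minus_ell2 :: "('a, 'b) ell2 \<Rightarrow> ('a, 'b) ell2 \<Rightarrow> ('a, 'b) ell2"
  where "f - g = f + - (g :: ('a, 'b) ell2)"
definition cinner_ell2 :: "('a, 'b) ell2 \<Rightarrow> ('a, 'b) ell2 \<Rightarrow> complex"
  where "cinner f g = (\<Sum>\<^sub>\<infinity>i. cinner (coord f i) (coord g i))"
definition inner_ell2 :: "('a, 'b) ell2 \<Rightarrow> ('a, 'b) ell2 \<Rightarrow> real"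
  where "inner (f :: ('a, 'b) ell2) g = Re (cinner f g)"
definition norm_ell2 :: "('a, 'b) ell2 \<Rightarrow> real" where "norm (f :: ('a, 'b) ell2) = sqrt (inner f f)"
definition sgn_ell2 :: "('a, 'b) ell2 \<Rightarrow> ('a, 'b) ell2" where "sgn (f :: ('a, 'b) ell2) = scaleR (inverse (norm f)) f"
definition dist_ell2 :: "('a, 'b) ell2 \<Rightarrow> ('a, 'b) ell2 \<Rightarrow> real" where "dist (f :: ('a, 'b) ell2) g = norm (f - g)"
definition uniformity_ell2 :: "(('a, 'b) ell2 \<times> ('a, 'b) ell2) filter"
  where "uniformity_ell2 = (INF e\<in>{0 <..}. principal {(f, g). dist f g < e})"
definition open_ell2 :: "('a, 'b) ell2 set \<Rightarrow> bool"
  where "open_ell2 U \<longleftrightarrow> (\<forall>x\<in>U. eventually (\<lambda>(x', y). x' = x \<longrightarrow> y \<in> U) uniformity)"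

lemma coord_zero [simp]: "coord (0 :: ('a, 'b) ell2) i = 0"
  by (simp add: zero_ell2_def Abs_ell2_inverse)

lemma coord_add [simp]: "coord (f + g :: ('a, 'b) ell2) i = coord f i + coord g i"
  unfolding plus_ell2_def
  by (subst Abs_ell2_inverse) (auto intro: ell2_add_closed summable_coord)

lemma coord_scaleC [simp]: "coord (c *\<^sub>C f :: ('a, 'b) ell2) i = c *\<^sub>C coord f i"
  unfolding scaleC_ell2_def
  by (subst Abs_ell2_inverse) (auto intro: ell2_scale_closed summable_coord)

lemma coord_uminus [simp]: "coord (- f :: ('a, 'b) ell2) i = - coord f i"
  by (simp add: uminus_ell2_def)

lemma coord_minus [simp]: "coord (f - g :: ('a, 'b) ell2) i = coord f i - coord g i"
  by (simp add: minus_ell2_def)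

lemma norm_cinner_le:
  fixes x y :: "'c::complex_inner"
  shows "cmod (cinner x y) \<le> (norm x)\<^sup>2 + (norm y)\<^sup>2"
proof -
  obtain u :: complex where u: "cmod u = 1" "u * cinner x y = complex_of_real (cmod (cinner x y))"
  proof (cases "cinner x y = 0")
    case True
    then show ?thesis using that[of 1] by simp
  next
    case False
    let ?z = "cinner x y"
    have "cnj ?z / cmod ?z * ?z = complex_of_real (cmod ?z)"
      using False complex_norm_square[of ?z]
      by (simp add: field_simps power2_eq_square)
    then show ?thesis using that[of "cnj ?z / cmod ?z"] False by (simp add: norm_divide)
  qed
  have "cmod (cinner x y) = Re (cinner (u *\<^sub>C x) y)"
    by (simp add: cinner_scaleC_left u)
  also have "\<dots> \<le> norm (u *\<^sub>C x) * norm y"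
    unfolding Re_cinner by (rule norm_cauchy_schwarz)
  also have "\<dots> = norm x * norm y" by (simp add: norm_scaleC u)
  also have "\<dots> \<le> (norm x)\<^sup>2 + (norm y)\<^sup>2"
  proof -
    have "2 * norm x * norm y \<le> (norm x)\<^sup>2 + (norm y)\<^sup>2" by (rule sum_squares_bound)
    moreover have "0 \<le> norm x * norm y" by simp
    ultimately show ?thesis by linarith
  qed
  finally show ?thesis .
qed

lemma summable_cinner:
  "(\<lambda>i. cinner (coord (f :: ('a, 'b) ell2) i) (coord g i)) summable_on UNIV"
proof (rule abs_summable_summable, rule summable_on_comparison_test)
  show "(\<lambda>i. (norm (coord f i))\<^sup>2 + (norm (coord g i))\<^sup>2) summable_on UNIV"
    by (intro summable_on_add summable_coord)
qed (auto intro: norm_cinner_le)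

lemma cinner_self: "cinner (x :: 'c::complex_inner) x = complex_of_real ((norm x)\<^sup>2)"
proof -
  have "Im (cinner x x) = 0" using cinner_commute[of x x] by (simp add: complex_eq_iff)
  then show ?thesis by (simp add: complex_eq_iff Re_cinner power2_norm_eq_inner)
qed

lemma cinner_ell2_self:
  "cinner (f :: ('a, 'b) ell2) f = complex_of_real (\<Sum>\<^sub>\<infinity>i. (norm (coord f i))\<^sup>2)"
  unfolding cinner_ell2_def cinner_self
  using has_sum_of_real[OF has_sum_infsum[OF summable_coord[of f]]] by (intro infsumI) auto

instance
proof
  fix f g h :: "('a, 'b) ell2" and a b :: complex and r s :: real
  show "f + g + h = f + (g + h)" by (rule ell2_eqI) (simp add: add.assoc)
  show "f + g = g + f" by (rule ell2_eqI) (simp add: add.commute)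
  show "0 + f = f" by (rule ell2_eqI) simp
  show "- f + f = 0" by (rule ell2_eqI) simp
  show "f - g = f + - g" by (rule ell2_eqI) simp
  show scaleR_add: "scaleR r (f + g) = scaleR r f + scaleR r g"
    by (rule ell2_eqI) (simp add: scaleR_ell2_def complex_vector.scale_right_distrib)
  show "scaleR (r + s) f = scaleR r f + scaleR s f"
    by (rule ell2_eqI) (simp add: scaleR_ell2_def complex_vector.scale_left_distrib)
  show "scaleR r (scaleR s f) = scaleR (r * s) f"
    by (rule ell2_eqI) (simp add: scaleR_ell2_def)
  show "scaleR 1 f = f" by (rule ell2_eqI) (simp add: scaleR_ell2_def)
  show "dist f g = norm (f - g)" by (simp add: dist_ell2_def)
  show "sgn f = scaleR (inverse (norm f)) f" by (simp add: sgn_ell2_def)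
  show "uniformity = (INF e\<in>{0 <..}. principal {(f :: ('a, 'b) ell2, g). dist f g < e})"
    by (simp add: uniformity_ell2_def)
  show "open U \<longleftrightarrow> (\<forall>x\<in>U. \<forall>\<^sub>F (x', y) in uniformity. x' = x \<longrightarrow> y \<in> U)"
    for U :: "('a, 'b) ell2 set"
    by (simp add: open_ell2_def)
  show commute: "cinner f g = cnj (cinner g f)" for f g :: "('a, 'b) ell2"
    unfolding cinner_ell2_def infsum_cnj[symmetric] by (subst cinner_commute) simp
  show add: "cinner (f + g) h = cinner f h + cinner g h"
    unfolding cinner_ell2_def
    by (simp add: cinner_add_left infsum_add[OF summable_cinner summable_cinner])
  show scale: "cinner (a *\<^sub>C f) g = a * cinner f g" for a and f g :: "('a, 'b) ell2"
    unfolding cinner_ell2_def by (simp add: cinner_scaleC_left infsum_cmult_right')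
  show "inner f g = inner g f" using commute[of f g] by (simp add: inner_ell2_def)
  show "inner (f + g) h = inner f h + inner g h" by (simp add: inner_ell2_def add)
  show "inner (scaleR r f) g = r * inner f g" by (simp add: inner_ell2_def scaleR_ell2_def scale)
  show "0 \<le> inner f f"
    by (simp add: inner_ell2_def cinner_ell2_self infsum_nonneg)
  show "inner f f = 0 \<longleftrightarrow> f = 0"
  proof
    assume "inner f f = 0"
    then have "(\<Sum>\<^sub>\<infinity>i. (norm (coord f i))\<^sup>2) = 0" by (simp add: inner_ell2_def cinner_ell2_self)
    then have "(norm (coord f i))\<^sup>2 = 0" for i
      using nonneg_infsum_le_0D[OF _ summable_coord[of f], of i] by simp
    then show "f = 0" by (intro ell2_eqI) simp
  qed (simp add: inner_ell2_def cinner_ell2_self)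
  show "norm f = sqrt (inner f f)" by (simp add: norm_ell2_def)
  show "a *\<^sub>C (f + g) = a *\<^sub>C f + a *\<^sub>C g"
    by (rule ell2_eqI) (simp add: complex_vector.scale_right_distrib)
  show "(a + b) *\<^sub>C f = a *\<^sub>C f + b *\<^sub>C f"
    by (rule ell2_eqI) (simp add: complex_vector.scale_left_distrib)
  show "a *\<^sub>C (b *\<^sub>C f) = (a * b) *\<^sub>C f" by (rule ell2_eqI) simp
  show "1 *\<^sub>C f = f" by (rule ell2_eqI) simp
  show "scaleR r f = complex_of_real r *\<^sub>C f" by (simp add: scaleR_ell2_def)
  show "Re (cinner f g) = inner f g" by (simp add: inner_ell2_def)
qed

end

lemma norm_ell2_sq: "(norm f)\<^sup>2 = (\<Sum>\<^sub>\<infinity>i. (norm (coord f i))\<^sup>2)"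
  by (simp add: power2_norm_eq_inner inner_ell2_def cinner_ell2_self)

lemma ell2_partial_le: "finite F \<Longrightarrow> (\<Sum>i\<in>F. (norm (coord f i))\<^sup>2) \<le> (norm f)\<^sup>2"
  unfolding norm_ell2_sq by (rule finite_sum_le_infsum) (auto intro: summable_coord)

instance ell2 :: (type, complex_hilbert) complex_hilbert
proof
  fix X :: "nat \<Rightarrow> ('a, 'b) ell2"
  assume X: "Cauchy X"
  have coord_le: "norm (coord f i) \<le> norm f" for f :: "('a, 'b) ell2" and i
    using ell2_partial_le[of "{i}" f] by (simp add: power2_le_iff_abs_le)
  have "Cauchy (\<lambda>n. coord (X n) i)" for i
  proof (rule metric_CauchyI)
    fix e :: real assume e: "0 < e"
    then obtain M where "\<forall>m\<ge>M. \<forall>n\<ge>M. dist (X m) (X n) < e" using metric_CauchyD[OF X e] by blast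
    moreover have "dist (coord (X m) i) (coord (X n) i) \<le> dist (X m) (X n)" for m n
      using coord_le[of "X m - X n" i] by (simp add: dist_norm)
    ultimately have "\<forall>m\<ge>M. \<forall>n\<ge>M. dist (coord (X m) i) (coord (X n) i) < e"
      by (meson le_less_trans)
    then show "\<exists>M. \<forall>m\<ge>M. \<forall>n\<ge>M. dist (coord (X m) i) (coord (X n) i) < e" ..
  qed
  then have "\<forall>i. \<exists>l. (\<lambda>n. coord (X n) i) \<longlonglongrightarrow> l" by (simp add: Cauchy_convergent_iff convergent_def)
  then obtain L where L: "\<And>i. (\<lambda>n. coord (X n) i) \<longlonglongrightarrow> L i" by metis
  have tail: "\<exists>M. \<forall>m\<ge>M. \<forall>F. finite F \<longrightarrow> (\<Sum>i\<in>F. (norm (coord (X m) i - L i))\<^sup>2) \<le> e\<^sup>2"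
    if e: "0 < e" for e :: real
  proof -
    obtain M where M: "\<forall>m\<ge>M. \<forall>n\<ge>M. dist (X m) (X n) < e" using metric_CauchyD[OF X e] by blast
    have "(\<Sum>i\<in>F. (norm (coord (X m) i - L i))\<^sup>2) \<le> e\<^sup>2" if "m \<ge> M" "finite F" for m F
    proof (rule LIMSEQ_le_const2)
      show "(\<lambda>n. \<Sum>i\<in>F. (norm (coord (X m) i - coord (X n) i))\<^sup>2)
          \<longlonglongrightarrow> (\<Sum>i\<in>F. (norm (coord (X m) i - L i))\<^sup>2)"
        by (intro tendsto_intros L)
      have "(\<Sum>i\<in>F. (norm (coord (X m) i - coord (X n) i))\<^sup>2) \<le> e\<^sup>2" if "n \<ge> M" for n
      proof -
        have "norm (X m - X n) \<le> e" using M \<open>m \<ge> M\<close> that by (fastforce simp: dist_norm)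
        then have "(norm (X m - X n))\<^sup>2 \<le> e\<^sup>2" by (simp add: power_mono)
        then show ?thesis using ell2_partial_le[OF \<open>finite F\<close>, of "X m - X n"] by simp
      qed
      then show "\<exists>N. \<forall>n\<ge>N. (\<Sum>i\<in>F. (norm (coord (X m) i - coord (X n) i))\<^sup>2) \<le> e\<^sup>2" by blast
    qed
    then show ?thesis by blast
  qed
  have summ: "(\<lambda>i. (norm (coord (X m) i - L i))\<^sup>2) summable_on UNIV"
    if "\<forall>F. finite F \<longrightarrow> (\<Sum>i\<in>F. (norm (coord (X m) i - L i))\<^sup>2) \<le> e\<^sup>2" for m and e :: real
    by (rule nonneg_bdd_above_summable_on) (use that in \<open>auto intro!: bdd_aboveI\<close>)
  obtain M1 where "\<forall>F. finite F \<longrightarrow> (\<Sum>i\<in>F. (norm (coord (X M1) i - L i))\<^sup>2) \<le> 1\<^sup>2"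
    using tail[of 1] by auto
  then have "(\<lambda>i. (norm (coord (X M1) i + (- 1) *\<^sub>C (coord (X M1) i - L i)))\<^sup>2) summable_on UNIV"
    by (intro ell2_add_closed ell2_scale_closed summable_coord summ)
  then have "(\<lambda>i. (norm (L i))\<^sup>2) summable_on UNIV" by simp
  then have cL: "coord (Abs_ell2 L) = L" by (simp add: Abs_ell2_inverse)
  have "X \<longlonglongrightarrow> Abs_ell2 L"
  proof (rule LIMSEQ_I)
    fix r :: real assume "0 < r"
    then obtain M where M: "\<And>m F. m \<ge> M \<Longrightarrow> finite F \<Longrightarrow>
        (\<Sum>i\<in>F. (norm (coord (X m) i - L i))\<^sup>2) \<le> (r / 2)\<^sup>2"
      using tail[of "r / 2"] by auto
    have "norm (X m - Abs_ell2 L) < r" if "m \<ge> M" for m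
    proof -
      have "(norm (X m - Abs_ell2 L))\<^sup>2 \<le> (r / 2)\<^sup>2"
        unfolding norm_ell2_sq coord_minus cL
        by (rule infsum_le_finite_sums) (use M[OF that] summ[of m "r / 2"] in auto)
      then have "norm (X m - Abs_ell2 L) \<le> r / 2"
        using \<open>0 < r\<close> by (simp add: power2_le_iff_abs_le)
      then show ?thesis using \<open>0 < r\<close> by simp
    qed
    then show "\<exists>no. \<forall>n\<ge>no. norm (X n - Abs_ell2 L) < r" by blast
  qed
  then show "convergent X" by (auto simp: convergent_def)
qed

text \<open>\<open>ket i \<eta>\<close> is the vector with \<open>\<eta>\<close> in component \<open>i\<close> and zero in all others.\<close>

definition ket :: "'i \<Rightarrow> 'a \<Rightarrow> ('i, 'a::complex_inner) ell2"
  where "ket i \<eta> = Abs_ell2 (\<lambda>j. if j = i then \<eta> else 0)"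

lemma coord_ket: "coord (ket i \<eta>) j = (if j = i then \<eta> else 0)"
proof -
  have "(\<lambda>j. (norm (if j = i then \<eta> else 0))\<^sup>2) summable_on UNIV
      \<longleftrightarrow> (\<lambda>j. (norm (if j = i then \<eta> else 0))\<^sup>2) summable_on {i}"
    by (rule summable_on_cong_neutral) auto
  then show ?thesis by (simp add: ket_def Abs_ell2_inverse)
qed

section \<open>Operators\<close>

text \<open>A Hilbert space \<open>H\<close> is given as a closed subspace of the ambient space. An operator with
  domain \<open>D \<subseteq> H\<close> is a function of which only the values on \<open>D\<close> matter.\<close>

definition clinear_on :: "'a::complex_inner set \<Rightarrow> ('a \<Rightarrow> 'b::complex_inner) \<Rightarrow> bool"
  where "clinear_on D T \<longleftrightarrow>
    (\<forall>x\<in>D. \<forall>y\<in>D. T (x + y) = T x + T y) \<and> (\<forall>c. \<forall>x\<in>D. T (c *\<^sub>C x) = c *\<^sub>C T x)"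

definition dense_subspace :: "'a::complex_inner set \<Rightarrow> 'a set \<Rightarrow> bool"
  where "dense_subspace H D \<longleftrightarrow> complex_vector.subspace H \<and> closed H \<and>
    complex_vector.subspace D \<and> D \<subseteq> H \<and> H \<subseteq> closure D"

definition adj_dom :: "'a::complex_inner set \<Rightarrow> 'a set \<Rightarrow> ('a \<Rightarrow> 'a) \<Rightarrow> 'a set"
  where "adj_dom H D T = {y \<in> H. \<exists>z\<in>H. \<forall>x\<in>D. cinner (T x) y = cinner x z}"

definition adj :: "'a::complex_inner set \<Rightarrow> 'a set \<Rightarrow> ('a \<Rightarrow> 'a) \<Rightarrow> 'a \<Rightarrow> 'a"
  where "adj H D T y = (THE z. z \<in> H \<and> (\<forall>x\<in>D. cinner (T x) y = cinner x z))"

definition unitary_on ::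
  "'a::complex_inner set \<Rightarrow> 'b::complex_inner set \<Rightarrow> ('a \<Rightarrow> 'b) \<Rightarrow> bool"
  where "unitary_on H H' U \<longleftrightarrow> clinear_on H U \<and>
    (\<forall>x\<in>H. \<forall>y\<in>H. cinner (U x) (U y) = cinner x y) \<and> U ` H = H'"

abbreviation unitary :: "('a::complex_inner \<Rightarrow> 'b::complex_inner) \<Rightarrow> bool"
  where "unitary \<equiv> unitary_on UNIV UNIV"

text \<open>Everywhere defined self-adjoint operators.\<close>

definition selfadjoint :: "('a::complex_hilbert \<Rightarrow> 'a) \<Rightarrow> bool"
  where "selfadjoint T \<longleftrightarrow> clinear_on UNIV T \<and> adj_dom UNIV UNIV T = UNIV \<and> adj UNIV UNIV T = T"

definition op_spectrum :: "('a::complex_hilbert \<Rightarrow> 'a) \<Rightarrow> complex set"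
  where "op_spectrum T = {c. \<not> (\<exists>R. clinear_on UNIV R \<and> bounded_linear R \<and>
    (\<forall>x. R (T x - c *\<^sub>C x) = x) \<and> (\<forall>x. T (R x) - c *\<^sub>C R x = x))}"

definition op_eigenvalue :: "('a::complex_inner \<Rightarrow> 'a) \<Rightarrow> complex \<Rightarrow> bool"
  where "op_eigenvalue T c \<longleftrightarrow> (\<exists>x. x \<noteq> 0 \<and> T x = c *\<^sub>C x)"

definition positive_op :: "('a::complex_hilbert \<Rightarrow> 'a) \<Rightarrow> bool"
  where "positive_op T \<longleftrightarrow> selfadjoint T \<and> (\<forall>x. 0 \<le> Re (cinner (T x) x))"

text \<open>The unique positive square root of a positive operator.\<close>

definition op_sqrt :: "('a::complex_hilbert \<Rightarrow> 'a) \<Rightarrow> 'a \<Rightarrow> 'a"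
  where "op_sqrt T = (THE S. positive_op S \<and> S \<circ> S = T)"

section \<open>Unital *-algebras and their *-representations\<close>

record 'a star_algebra = "(complex, 'a) module" +
  star :: "'a \<Rightarrow> 'a"

locale unital_star_algebra = ring A for A (structure) +
  assumes smult_closed: "x \<in> carrier A \<Longrightarrow> c \<odot> x \<in> carrier A"
    and smult_l_distr: "x \<in> carrier A \<Longrightarrow> (c + d) \<odot> x = c \<odot> x \<oplus> d \<odot> x"
    and smult_r_distr: "x \<in> carrier A \<Longrightarrow> y \<in> carrier A \<Longrightarrow> c \<odot> (x \<oplus> y) = c \<odot> x \<oplus> c \<odot> y"
    and smult_assoc1: "x \<in> carrier A \<Longrightarrow> (c * d) \<odot> x = c \<odot> (d \<odot> x)"
    and smult_one: "x \<in> carrier A \<Longrightarrow> 1 \<odot> x = x"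
    and smult_assoc_left: "x \<in> carrier A \<Longrightarrow> y \<in> carrier A \<Longrightarrow> (c \<odot> x) \<otimes> y = c \<odot> (x \<otimes> y)"
    and smult_assoc_right: "x \<in> carrier A \<Longrightarrow> y \<in> carrier A \<Longrightarrow> x \<otimes> (c \<odot> y) = c \<odot> (x \<otimes> y)"
    and star_closed: "x \<in> carrier A \<Longrightarrow> star A x \<in> carrier A"
    and star_add: "x \<in> carrier A \<Longrightarrow> y \<in> carrier A \<Longrightarrow> star A (x \<oplus> y) = star A x \<oplus> star A y"
    and star_mult: "x \<in> carrier A \<Longrightarrow> y \<in> carrier A \<Longrightarrow> star A (x \<otimes> y) = star A y \<otimes> star A x"
    and star_smult: "x \<in> carrier A \<Longrightarrow> star A (c \<odot> x) = cnj c \<odot> star A x"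
    and star_star: "x \<in> carrier A \<Longrightarrow> star A (star A x) = x"

definition Lplus :: "'h::complex_inner set \<Rightarrow> 'h set \<Rightarrow> ('h \<Rightarrow> 'h) set"
  where "Lplus H D = {T. clinear_on D T \<and> T ` D \<subseteq> D \<and> D \<subseteq> adj_dom H D T \<and> adj H D T ` D \<subseteq> D}"

definition star_rep ::
  "('a, 'm) star_algebra_scheme \<Rightarrow> 'h::complex_hilbert set \<Rightarrow> 'h set \<Rightarrow> ('a \<Rightarrow> 'h \<Rightarrow> 'h) \<Rightarrow> bool"
  where "star_rep A H D \<pi> \<longleftrightarrow> dense_subspace H D \<and>
    (\<forall>a\<in>carrier A. \<pi> a \<in> Lplus H D) \<and>
    (\<forall>a\<in>carrier A. \<forall>b\<in>carrier A. \<forall>d\<in>D. \<pi> (a \<oplus>\<^bsub>A\<^esub> b) d = \<pi> a d + \<pi> b d) \<and>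
    (\<forall>c. \<forall>a\<in>carrier A. \<forall>d\<in>D. \<pi> (c \<odot>\<^bsub>A\<^esub> a) d = c *\<^sub>C \<pi> a d) \<and>
    (\<forall>a\<in>carrier A. \<forall>b\<in>carrier A. \<forall>d\<in>D. \<pi> (a \<otimes>\<^bsub>A\<^esub> b) d = \<pi> a (\<pi> b d)) \<and>
    (\<forall>d\<in>D. \<pi> \<one>\<^bsub>A\<^esub> d = d) \<and>
    (\<forall>a\<in>carrier A. \<forall>d\<in>D. \<pi> (star A a) d = adj H D (\<pi> a) d)"

text \<open>\<open>\<pi> = \<pi>\<^sub>1 \<oplus> \<pi>\<^sub>2\<close>, realised as an internal orthogonal direct sum.\<close>

definition rep_direct_sum ::
  "('a, 'm) star_algebra_scheme \<Rightarrow> 'h::complex_hilbert set \<Rightarrow> 'h set \<Rightarrow> ('a \<Rightarrow> 'h \<Rightarrow> 'h) \<Rightarrow>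
    'h set \<Rightarrow> 'h set \<Rightarrow> ('a \<Rightarrow> 'h \<Rightarrow> 'h) \<Rightarrow> 'h set \<Rightarrow> 'h set \<Rightarrow> ('a \<Rightarrow> 'h \<Rightarrow> 'h) \<Rightarrow> bool"
  where "rep_direct_sum A H D \<pi> H1 D1 \<pi>1 H2 D2 \<pi>2 \<longleftrightarrow>
    (\<forall>x\<in>H1. \<forall>y\<in>H2. cinner x y = 0) \<and>
    H = {x + y | x y. x \<in> H1 \<and> y \<in> H2} \<and> D = {x + y | x y. x \<in> D1 \<and> y \<in> D2} \<and>
    (\<forall>a\<in>carrier A. \<forall>x\<in>D1. \<forall>y\<in>D2. \<pi> a (x + y) = \<pi>1 a x + \<pi>2 a y)"

definition zero_rep ::
  "('a, 'm) star_algebra_scheme \<Rightarrow> 'h::complex_hilbert set \<Rightarrow> ('a \<Rightarrow> 'h \<Rightarrow> 'h) \<Rightarrow> bool"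
  where "zero_rep A D \<pi> \<longleftrightarrow> (\<forall>a\<in>carrier A. \<forall>d\<in>D. \<pi> a d = 0)"

definition irreducible_rep ::
  "('a, 'm) star_algebra_scheme \<Rightarrow> 'h::complex_hilbert set \<Rightarrow> 'h set \<Rightarrow> ('a \<Rightarrow> 'h \<Rightarrow> 'h) \<Rightarrow> bool"
  where "irreducible_rep A H D \<pi> \<longleftrightarrow> (\<forall>H1 D1 \<pi>1 H2 D2 \<pi>2.
    star_rep A H1 D1 \<pi>1 \<and> star_rep A H2 D2 \<pi>2 \<and> rep_direct_sum A H D \<pi> H1 D1 \<pi>1 H2 D2 \<pi>2 \<longrightarrow>
    zero_rep A D1 \<pi>1 \<or> zero_rep A D2 \<pi>2)"

definition faithful_rep ::
  "('a, 'm) star_algebra_scheme \<Rightarrow> 'h::complex_hilbert set \<Rightarrow> ('a \<Rightarrow> 'h \<Rightarrow> 'h) \<Rightarrow> bool"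
  where "faithful_rep A D \<pi> \<longleftrightarrow>
    (\<forall>a\<in>carrier A. \<forall>b\<in>carrier A. (\<forall>d\<in>D. \<pi> a d = \<pi> b d) \<longrightarrow> a = b)"

definition unitarily_equivalent ::
  "('a, 'm) star_algebra_scheme \<Rightarrow>
    'h::complex_hilbert set \<Rightarrow> 'h set \<Rightarrow> ('a \<Rightarrow> 'h \<Rightarrow> 'h) \<Rightarrow>
    'g::complex_hilbert set \<Rightarrow> 'g set \<Rightarrow> ('a \<Rightarrow> 'g \<Rightarrow> 'g) \<Rightarrow> bool"
  where "unitarily_equivalent A H D \<pi> H' D' \<pi>' \<longleftrightarrow>
    (\<exists>U. unitary_on H H' U \<and> U ` D = D' \<and> (\<forall>a\<in>carrier A. \<forall>d\<in>D. U (\<pi> a d) = \<pi>' a (U d)))"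

section \<open>The *-algebra \<open>\<O>\<^sub>q(Mat\<^bsub>n,1\<^esub>)\<close>\<close>

text \<open>Words in the letters \<open>z\<^sub>j\<close> (here \<open>Gen j\<close>) and \<open>z\<^sub>j\<^sup>*\<close> (here \<open>Gen_star j\<close>) form the free monoid.
  As \<^class>\<open>monoid_add\<close> is the class underlying convolution of \<^type>\<open>poly_mapping\<close>, concatenation is
  written additively; then \<open>letter list \<Rightarrow>\<^sub>0 complex\<close> is the free unital algebra.\<close>

datatype letter = Gen nat | Gen_star nat

instantiation list :: (type) monoid_add
begin
definition zero_list :: "'a list" where "zero_list = []"
definition plus_list :: "'a list \<Rightarrow> 'a list \<Rightarrow> 'a list" where "plus_list = append"
instance by standard (simp_all add: zero_list_def plus_list_def)
end

type_synonym free_alg = "letter list \<Rightarrow>\<^sub>0 complex"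

fun letter_index :: "letter \<Rightarrow> nat" where
  "letter_index (Gen j) = j"
| "letter_index (Gen_star j) = j"

fun letter_star :: "letter \<Rightarrow> letter" where
  "letter_star (Gen j) = Gen_star j"
| "letter_star (Gen_star j) = Gen j"

definition word_star :: "letter list \<Rightarrow> letter list"
  where "word_star w = rev (map letter_star w)"

definition free_star :: "free_alg \<Rightarrow> free_alg"
  where "free_star p = (\<Sum>w\<in>Poly_Mapping.keys p.
    Poly_Mapping.single (word_star w) (cnj (Poly_Mapping.lookup p w)))"

definition oq_const :: "complex \<Rightarrow> free_alg" where "oq_const c = Poly_Mapping.single [] c"
definition zgen :: "nat \<Rightarrow> free_alg" where "zgen j = Poly_Mapping.single [Gen j] 1"
definition zgen_star :: "nat \<Rightarrow> free_alg" where "zgen_star j = Poly_Mapping.single [Gen_star j] 1"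

definition free_ring :: "nat \<Rightarrow> free_alg ring"
  where "free_ring n =
    \<lparr>carrier = {p. \<forall>w\<in>Poly_Mapping.keys p. letter_index ` set w \<subseteq> {1..n}},
     mult = (*), one = 1, zero = 0, add = (+)\<rparr>"

definition oq_relators :: "real \<Rightarrow> nat \<Rightarrow> free_alg set"
  where "oq_relators q n =
    {zgen k * zgen l - oq_const q * (zgen l * zgen k) | k l. 1 \<le> k \<and> k < l \<and> l \<le> n} \<union>
    {zgen_star l * zgen k - oq_const q * (zgen k * zgen_star l) | k l. k \<in> {1..n} \<and> l \<in> {1..n} \<and> k \<noteq> l} \<union>
    {zgen_star k * zgen k - (oq_const (q\<^sup>2) * (zgen k * zgen_star k)
        - oq_const (1 - q\<^sup>2) * (\<Sum>j\<in>{k<..n}. zgen j * zgen_star j) + oq_const (1 - q\<^sup>2)) | k. 1 \<le> k \<and> k < n} \<union>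
    {zgen_star n * zgen n - (oq_const (q\<^sup>2) * (zgen n * zgen_star n) + oq_const (1 - q\<^sup>2))}"

definition oq_ideal :: "real \<Rightarrow> nat \<Rightarrow> free_alg set"
  where "oq_ideal q n = Idl\<^bsub>free_ring n\<^esub> (oq_relators q n \<union> free_star ` oq_relators q n)"

text \<open>The class in \<open>\<O>\<^sub>q(Mat\<^bsub>n,1\<^esub>)\<close> of an element of the free algebra.\<close>

definition oq_class :: "real \<Rightarrow> nat \<Rightarrow> free_alg \<Rightarrow> free_alg set"
  where "oq_class q n p = oq_ideal q n +>\<^bsub>free_ring n\<^esub> p"

definition Oq :: "real \<Rightarrow> nat \<Rightarrow> free_alg set star_algebra"
  where "Oq q n = ring.extend (free_ring n Quot oq_ideal q n)
    \<lparr>smult = (\<lambda>c X. oq_class q n (oq_const c) \<otimes>\<^bsub>free_ring n Quot oq_ideal q n\<^esub> X),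
     star = (\<lambda>X. free_star ` X)\<rparr>"

lemma ring_free_ring: "ring (free_ring n)"
proof (rule ringI)
  have keys_ok: "p \<in> carrier (free_ring n) \<Longrightarrow> p' \<in> carrier (free_ring n) \<Longrightarrow>
      p + p' \<in> carrier (free_ring n)" for p p'
    using keys_add[of p p'] unfolding free_ring_def by fastforce
  show "abelian_group (free_ring n)"
  proof (rule abelian_groupI)
    fix x assume "x \<in> carrier (free_ring n)"
    then have "- x \<in> carrier (free_ring n)" by (simp add: free_ring_def)
    then show "\<exists>y\<in>carrier (free_ring n). y \<oplus>\<^bsub>free_ring n\<^esub> x = \<zero>\<^bsub>free_ring n\<^esub>"
      by (rule rev_bexI) (simp add: free_ring_def)
  next
    show "x \<oplus>\<^bsub>free_ring n\<^esub> y \<in> carrier (free_ring n)"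
      if "x \<in> carrier (free_ring n)" "y \<in> carrier (free_ring n)" for x y
      using keys_ok[OF that] by (simp add: free_ring_def)
  qed (simp_all add: free_ring_def add_ac)
  show "Group.monoid (free_ring n)"
  proof (rule monoidI)
    fix x y assume "x \<in> carrier (free_ring n)" "y \<in> carrier (free_ring n)"
    then show "x \<otimes>\<^bsub>free_ring n\<^esub> y \<in> carrier (free_ring n)"
      using keys_mult[of x y] by (fastforce simp: free_ring_def plus_list_def)
  qed (simp_all add: free_ring_def mult.assoc zero_list_def)
qed (simp_all add: free_ring_def distrib_left distrib_right)

lemma lookup_free_star: "Poly_Mapping.lookup (free_star p) w = cnj (Poly_Mapping.lookup p (word_star w))"
proof -
  have ls: "letter_star (letter_star x) = x" for x by (cases x) auto
  have ws: "word_star (word_star w) = w" for w by (simp add: word_star_def rev_map o_def ls)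
  have eq: "word_star v = w \<longleftrightarrow> v = word_star w" for v using ws by metis
  show ?thesis
    unfolding free_star_def lookup_sum lookup_single when_def eq
    by (simp add: sum.delta in_keys_iff)
qed

lemma word_star_involution [simp]: "word_star (word_star w) = w"
proof -
  have "letter_star (letter_star x) = x" for x by (cases x) auto
  then show ?thesis by (simp add: word_star_def rev_map o_def)
qed

lemma free_star_star [simp]: "free_star (free_star p) = p"
  by (rule poly_mapping_eqI) (simp add: lookup_free_star)

lemma free_star_add: "free_star (p + p') = free_star p + free_star p'"
  by (rule poly_mapping_eqI) (simp add: lookup_free_star lookup_add)

lemma free_star_minus: "free_star (p - p') = free_star p - free_star p'"
  by (rule poly_mapping_eqI) (simp add: lookup_free_star lookup_minus)

lemma free_star_zero [simp]: "free_star 0 = 0"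
  by (rule poly_mapping_eqI) (simp add: lookup_free_star)

lemma free_star_sum: "free_star (sum f S) = (\<Sum>x\<in>S. free_star (f x))"
  by (induction S rule: infinite_finite_induct) (simp_all add: free_star_add)

lemma free_star_single:
  "free_star (Poly_Mapping.single w c) = Poly_Mapping.single (word_star w) (cnj c)"
proof (rule poly_mapping_eqI)
  fix v have "w = word_star v \<longleftrightarrow> word_star w = v" by auto
  then show "Poly_Mapping.lookup (free_star (Poly_Mapping.single w c)) v =
      Poly_Mapping.lookup (Poly_Mapping.single (word_star w) (cnj c)) v"
    by (simp add: lookup_free_star lookup_single when_def)
qed

lemma free_alg_expand:
  "(\<Sum>w\<in>Poly_Mapping.keys p. Poly_Mapping.single w (Poly_Mapping.lookup p w)) = p"
  by (rule poly_mapping_eqI) (simp add: lookup_sum lookup_single when_def sum.delta in_keys_iff)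

lemma free_star_mult: "free_star (p * p') = free_star p' * free_star p"
proof -
  have "free_star (Poly_Mapping.single v a * Poly_Mapping.single w b) =
      free_star (Poly_Mapping.single w b) * free_star (Poly_Mapping.single v a)" for v w a b
    by (simp add: mult_single free_star_single plus_list_def word_star_def mult.commute)
  then have "free_star ((\<Sum>v\<in>S. Poly_Mapping.single v (f v)) * (\<Sum>w\<in>T. Poly_Mapping.single w (g w)))
    = free_star (\<Sum>w\<in>T. Poly_Mapping.single w (g w)) * free_star (\<Sum>v\<in>S. Poly_Mapping.single v (f v))"
    for S T f g
    by (simp add: sum_product free_star_sum sum.swap[of _ S T])
  from this[where S = "Poly_Mapping.keys p" and f = "Poly_Mapping.lookup p"
      and T = "Poly_Mapping.keys p'" and g = "Poly_Mapping.lookup p'"]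
  show ?thesis by (simp only: free_alg_expand)
qed

lemma free_star_carrier: "p \<in> carrier (free_ring n) \<Longrightarrow> free_star p \<in> carrier (free_ring n)"
proof -
  have li: "letter_index (letter_star x) = letter_index x" for x by (cases x) auto
  have ki: "w \<in> Poly_Mapping.keys (free_star p) \<Longrightarrow> word_star w \<in> Poly_Mapping.keys p" for w
    by (simp add: in_keys_iff lookup_free_star)
  have si: "letter_index ` set (word_star w) = letter_index ` set w" for w
    by (force simp: word_star_def image_image li)
  show "p \<in> carrier (free_ring n) \<Longrightarrow> free_star p \<in> carrier (free_ring n)"
    using ki si unfolding free_ring_def by fastforce
qed

lemma free_ring_closed:
  assumes "p \<in> carrier (free_ring n)" "p' \<in> carrier (free_ring n)"
  shows "p + p' \<in> carrier (free_ring n)" "p - p' \<in> carrier (free_ring n)"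
    "p * p' \<in> carrier (free_ring n)"
proof -
  interpret ring "free_ring n" by (rule ring_free_ring)
  show "p + p' \<in> carrier (free_ring n)" using a_closed[OF assms] by (simp add: free_ring_def)
  show "p * p' \<in> carrier (free_ring n)" using m_closed[OF assms] by (simp add: free_ring_def)
  have "- p' \<in> carrier (free_ring n)" using assms(2) by (simp add: free_ring_def)
  from a_closed[OF assms(1) this] show "p - p' \<in> carrier (free_ring n)" by (simp add: free_ring_def)
qed

lemma oq_const_carrier: "oq_const c \<in> carrier (free_ring n)"
  by (auto simp: oq_const_def free_ring_def)

lemma oq_relators_carrier: 
  assumes n: "1 \<le> n"
  shows "oq_relators q n \<subseteq> carrier (free_ring n)"
proof -
  have gens: "zgen j \<in> carrier (free_ring n)" "zgen_star j \<in> carrier (free_ring n)"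
    if "j \<in> {1..n}" for j
    using that by (auto simp: zgen_def zgen_star_def free_ring_def)
  have "(\<Sum>j\<in>S. zgen j * zgen_star j) \<in> carrier (free_ring n)" if "S \<subseteq> {1..n}" for S
    using finite_subset[OF that finite_atLeastAtMost] that
  proof (induction S rule: finite_induct)
    case empty
    show ?case by (simp add: free_ring_def)
  next
    case (insert j S)
    then show ?case by (simp add: free_ring_closed gens)
  qed
  then have sums: "(\<Sum>j\<in>{k<..n}. zgen j * zgen_star j) \<in> carrier (free_ring n)" for k
    by (simp add: subset_eq)
  note closed = free_ring_closed oq_const_carrier gens sums
  show ?thesis
  proof
    fix p assume "p \<in> oq_relators q n"
    then show "p \<in> carrier (free_ring n)"
      unfolding oq_relators_def
    proof (elim UnE CollectE exE conjE singletonE, goal_cases)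
      case (1 k l)
      then have "k \<in> {1..n}" "l \<in> {1..n}" by auto
      then show ?case unfolding 1(1) by (intro closed)
    next
      case (2 k l)
      then show ?case unfolding 2(1) by (intro closed)
    next
      case (3 k)
      then have "k \<in> {1..n}" by auto
      then show ?case unfolding 3(1) by (intro closed)
    next
      case 4
      have "n \<in> {1..n}" using n by auto
      then show ?case unfolding 4 by (intro closed)
    qed
  qed
qed

lemma ideal_oq_ideal: "1 \<le> n \<Longrightarrow> ideal (oq_ideal q n) (free_ring n)"
  unfolding oq_ideal_def using oq_relators_carrier[of n q] free_star_carrier
  by (intro ring.genideal_ideal ring_free_ring) auto

lemma oq_ideal_star:
  assumes n: "1 \<le> n" and p: "p \<in> oq_ideal q n"
  shows "free_star p \<in> oq_ideal q n"
proof -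
  let ?R = "free_ring n" and ?I = "oq_ideal q n"
  interpret ideal ?I ?R by (rule ideal_oq_ideal[OF n])
  have sub: "oq_relators q n \<union> free_star ` oq_relators q n \<subseteq> ?I"
    unfolding oq_ideal_def using oq_relators_carrier[OF n, of q] free_star_carrier
    by (intro genideal_self) auto
  let ?J = "{p \<in> carrier ?R. free_star p \<in> ?I}"
  have closed: "x + y \<in> ?I" if "x \<in> ?I" "y \<in> ?I" for x y
    using additive_subgroup.a_closed[OF additive_subgroup_axioms that] by (simp add: free_ring_def)
  have closed_l: "y * x \<in> ?I" if "x \<in> ?I" "y \<in> carrier ?R" for x y
    using I_l_closed[OF that] by (simp add: free_ring_def)
  have closed_r: "x * y \<in> ?I" if "x \<in> ?I" "y \<in> carrier ?R" for x y
    using I_r_closed[OF that] by (simp add: free_ring_def)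
  have uminus: "- x = oq_const (- 1) * x" for x
    by (metis mult_minus1 oq_const_def single_one single_uminus zero_list_def)
  have inv: "\<ominus>\<^bsub>?R\<^esub> x = - x" if "x \<in> carrier ?R" for x
  proof -
    have "- x \<in> carrier ?R" using that by (simp add: free_ring_def)
    then show ?thesis using that
      by (intro minus_equality) (simp_all add: free_ring_def)
  qed
  have "ideal ?J ?R"
  proof (rule idealI[OF ring_free_ring])
    show "subgroup ?J (add_monoid ?R)"
    proof (rule add.subgroupI)
      have "0 \<in> ?I" using additive_subgroup.zero_closed[OF additive_subgroup_axioms]
        by (simp add: free_ring_def)
      then have "0 \<in> ?J" by (simp add: free_ring_def)
      then show "?J \<noteq> {}" by blast
      show "\<ominus>\<^bsub>?R\<^esub> x \<in> ?J" if "x \<in> ?J" for x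
      proof -
        have "free_star (- x) = oq_const (- 1) * free_star x"
          using free_star_minus[of 0 x] uminus[of "free_star x"] by simp
        moreover have "- x \<in> carrier ?R" using that by (simp add: free_ring_def)
        ultimately have "- x \<in> ?J" using that by (simp add: closed_l oq_const_carrier)
        then show ?thesis using that inv[of x] by simp
      qed
      show "x \<oplus>\<^bsub>?R\<^esub> y \<in> ?J" if "x \<in> ?J" "y \<in> ?J" for x y
      proof -
        have "x + y \<in> ?J" using that by (simp add: free_ring_closed free_star_add closed)
        then show ?thesis by (simp add: free_ring_def)
      qed
    qed auto
  next
    fix a x assume "a \<in> ?J" "x \<in> carrier ?R"
    then have "x * a \<in> ?J" "a * x \<in> ?J"
      by (simp_all add: free_star_mult free_star_carrier closed_l closed_r free_ring_closed)
    then show "x \<otimes>\<^bsub>?R\<^esub> a \<in> ?J" "a \<otimes>\<^bsub>?R\<^esub> x \<in> ?J" by (simp_all add: free_ring_def)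
  qed
  moreover have "oq_relators q n \<union> free_star ` oq_relators q n \<subseteq> ?J"
    using sub oq_relators_carrier[OF n, of q] by (auto simp: free_star_carrier)
  ultimately have "?I \<subseteq> ?J" unfolding oq_ideal_def by (rule genideal_minimal)
  then show ?thesis using p by auto
qed


lemma Oq_simps:
  shows "carrier (Oq q n) = carrier (free_ring n Quot oq_ideal q n)"
    "mult (Oq q n) = mult (free_ring n Quot oq_ideal q n)"
    "one (Oq q n) = one (free_ring n Quot oq_ideal q n)"
    "zero (Oq q n) = zero (free_ring n Quot oq_ideal q n)"
    "add (Oq q n) = add (free_ring n Quot oq_ideal q n)"
    "smult (Oq q n) = (\<lambda>c X. oq_class q n (oq_const c) \<otimes>\<^bsub>free_ring n Quot oq_ideal q n\<^esub> X)"
    "star (Oq q n) = (\<lambda>X. free_star ` X)"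
  by (simp_all add: Oq_def ring.defs)

lemma Oq_carrier: "carrier (Oq q n) = oq_class q n ` carrier (free_ring n)"
  by (auto simp: Oq_simps FactRing_def A_RCOSETS_def RCOSETS_def oq_class_def a_r_coset_def)

lemma Oq_class_ops:
  assumes n: "1 \<le> n" and p: "p \<in> carrier (free_ring n)"
  shows "p' \<in> carrier (free_ring n) \<Longrightarrow>
      oq_class q n p \<oplus>\<^bsub>Oq q n\<^esub> oq_class q n p' = oq_class q n (p + p')"
    "p' \<in> carrier (free_ring n) \<Longrightarrow>
      oq_class q n p \<otimes>\<^bsub>Oq q n\<^esub> oq_class q n p' = oq_class q n (p * p')"
    "c \<odot>\<^bsub>Oq q n\<^esub> oq_class q n p = oq_class q n (oq_const c * p)"
    "star (Oq q n) (oq_class q n p) = oq_class q n (free_star p)"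
proof -
  interpret ideal "oq_ideal q n" "free_ring n" by (rule ideal_oq_ideal[OF n])
  note hom = rcos_ring_hom
  have add: "p \<oplus>\<^bsub>free_ring n\<^esub> p' = p + p'" and mult: "x \<otimes>\<^bsub>free_ring n\<^esub> y = x * y" for p p' x y
    by (simp_all add: free_ring_def)
  show "oq_class q n p \<oplus>\<^bsub>Oq q n\<^esub> oq_class q n p' = oq_class q n (p + p')"
    if p': "p' \<in> carrier (free_ring n)"
    using ring_hom_add[OF hom p p'] by (simp add: Oq_simps oq_class_def add)
  show "oq_class q n p \<otimes>\<^bsub>Oq q n\<^esub> oq_class q n p' = oq_class q n (p * p')"
    if p': "p' \<in> carrier (free_ring n)"
    using ring_hom_mult[OF hom p p'] by (simp add: Oq_simps oq_class_def mult)
  show "c \<odot>\<^bsub>Oq q n\<^esub> oq_class q n p = oq_class q n (oq_const c * p)"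
    using ring_hom_mult[OF hom oq_const_carrier p] by (simp add: Oq_simps oq_class_def mult)
  have cls: "oq_class q n x = {y + x | y. y \<in> oq_ideal q n}" for x
    by (auto simp: oq_class_def a_r_coset_def r_coset_def free_ring_def)
  show "star (Oq q n) (oq_class q n p) = oq_class q n (free_star p)"
  proof
    show "star (Oq q n) (oq_class q n p) \<subseteq> oq_class q n (free_star p)"
      by (auto simp: Oq_simps cls free_star_add oq_ideal_star[OF n])
    show "oq_class q n (free_star p) \<subseteq> star (Oq q n) (oq_class q n p)"
    proof
      fix x assume "x \<in> oq_class q n (free_star p)"
      then obtain y where "y \<in> oq_ideal q n" "x = y + free_star p" by (auto simp: cls)
      then have "x = free_star (free_star y + p)" "free_star y + p \<in> oq_class q n p"
        by (auto simp: cls free_star_add oq_ideal_star[OF n])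
      then show "x \<in> star (Oq q n) (oq_class q n p)" by (auto simp: Oq_simps)
    qed
  qed
qed

lemma oq_const_simps:
  "oq_const (c + d) = oq_const c + oq_const d" "oq_const (c * d) = oq_const c * oq_const d"
  "oq_const 1 = 1" "free_star (oq_const c) = oq_const (cnj c)"
proof -
  show "oq_const (c + d) = oq_const c + oq_const d" "oq_const (c * d) = oq_const c * oq_const d"
    by (simp_all add: oq_const_def single_add mult_single plus_list_def)
  show "oq_const 1 = 1" using single_one[where ?'a = "letter list" and ?'b = complex]
    by (simp add: oq_const_def zero_list_def)
  show "free_star (oq_const c) = oq_const (cnj c)"
    by (simp add: oq_const_def free_star_single word_star_def)
qed

lemma oq_const_commute: "p * oq_const c = oq_const c * p"
proof -
  have "(\<Sum>w\<in>S. Poly_Mapping.single w (f w)) * oq_const c =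
      oq_const c * (\<Sum>w\<in>S. Poly_Mapping.single w (f w))" for S f
    by (simp add: sum_distrib_left sum_distrib_right oq_const_def mult_single plus_list_def
        mult.commute)
  from this[where S = "Poly_Mapping.keys p" and f = "Poly_Mapping.lookup p"]
  show ?thesis by (simp only: free_alg_expand)
qed

lemma unital_star_algebra_Oq:
  assumes n: "1 \<le> n"
  shows "unital_star_algebra (Oq q n)"
proof -
  interpret I: ideal "oq_ideal q n" "free_ring n" by (rule ideal_oq_ideal[OF n])
  interpret Q: ring "free_ring n Quot oq_ideal q n" by (rule I.quotient_is_ring)
  have "ring (Oq q n)"
  proof (rule ringI)
    show "abelian_group (Oq q n)"
    proof (rule abelian_groupI)
      show "\<exists>y\<in>carrier (Oq q n). y \<oplus>\<^bsub>Oq q n\<^esub> x = \<zero>\<^bsub>Oq q n\<^esub>" if "x \<in> carrier (Oq q n)" for x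
        using that Q.l_neg[of x] Q.a_inv_closed[of x] by (auto simp: Oq_simps)
    qed (simp_all add: Oq_simps Q.a_ac)
    show "Group.monoid (Oq q n)"
      by (rule monoidI) (simp_all add: Oq_simps Q.m_assoc)
  qed (simp_all add: Oq_simps Q.l_distr Q.r_distr)
  moreover have "unital_star_algebra_axioms (Oq q n)"
  proof -
    note [simp] = Oq_class_ops[OF n] free_ring_closed oq_const_carrier free_star_carrier
    have left: "p * (oq_const c * p') = oq_const c * (p * p')" for p p' c
      using oq_const_commute[of p c] by (metis mult.assoc)
    show ?thesis
    proof (rule unital_star_algebra_axioms.intro, goal_cases)
      case (1 x c)
      then obtain p where [simp]: "p \<in> carrier (free_ring n)" "x = oq_class q n p"
        by (auto simp: Oq_carrier)
      show ?case by (simp add: Oq_carrier)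
    next
      case (2 x c d)
      then obtain p where [simp]: "p \<in> carrier (free_ring n)" "x = oq_class q n p"
        by (auto simp: Oq_carrier)
      show ?case by (simp add: oq_const_simps distrib_right)
    next
      case (3 x y c)
      then obtain p p' where [simp]: "p \<in> carrier (free_ring n)" "x = oq_class q n p"
          "p' \<in> carrier (free_ring n)" "y = oq_class q n p'"
        by (auto simp: Oq_carrier)
      show ?case by (simp add: distrib_left)
    next
      case (4 x c d)
      then obtain p where [simp]: "p \<in> carrier (free_ring n)" "x = oq_class q n p"
        by (auto simp: Oq_carrier)
      show ?case by (simp add: oq_const_simps mult.assoc)
    next
      case (5 x)
      then obtain p where [simp]: "p \<in> carrier (free_ring n)" "x = oq_class q n p"
        by (auto simp: Oq_carrier)
      show ?case by (simp add: oq_const_simps)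
    next
      case (6 x y c)
      then obtain p p' where [simp]: "p \<in> carrier (free_ring n)" "x = oq_class q n p"
          "p' \<in> carrier (free_ring n)" "y = oq_class q n p'"
        by (auto simp: Oq_carrier)
      show ?case by (simp add: mult.assoc)
    next
      case (7 x y c)
      then obtain p p' where [simp]: "p \<in> carrier (free_ring n)" "x = oq_class q n p"
          "p' \<in> carrier (free_ring n)" "y = oq_class q n p'"
        by (auto simp: Oq_carrier)
      show ?case by (simp add: left)
    next
      case (8 x)
      then obtain p where [simp]: "p \<in> carrier (free_ring n)" "x = oq_class q n p"
        by (auto simp: Oq_carrier)
      show ?case by (simp add: Oq_carrier)
    next
      case (9 x y)
      then obtain p p' where [simp]: "p \<in> carrier (free_ring n)" "x = oq_class q n p"
          "p' \<in> carrier (free_ring n)" "y = oq_class q n p'"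
        by (auto simp: Oq_carrier)
      show ?case by (simp add: free_star_add)
    next
      case (10 x y)
      then obtain p p' where [simp]: "p \<in> carrier (free_ring n)" "x = oq_class q n p"
          "p' \<in> carrier (free_ring n)" "y = oq_class q n p'"
        by (auto simp: Oq_carrier)
      show ?case by (simp add: free_star_mult)
    next
      case (11 x c)
      then obtain p where [simp]: "p \<in> carrier (free_ring n)" "x = oq_class q n p"
        by (auto simp: Oq_carrier)
      show ?case by (simp add: free_star_mult oq_const_simps oq_const_commute)
    next
      case (12 x)
      then obtain p where [simp]: "p \<in> carrier (free_ring n)" "x = oq_class q n p"
        by (auto simp: Oq_carrier)
      show ?case by simp
    qed
  qed
  ultimately show ?thesis by (rule unital_star_algebra.intro)
qed

section \<open>The series \<open>(m, l, k)\<close>\<close>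

definition lambda_q :: "real \<Rightarrow> int \<Rightarrow> real" where "lambda_q q j = sqrt (1 - q powi (2 * j))"
definition beta_q :: "real \<Rightarrow> int \<Rightarrow> real" where "beta_q q j = sqrt (q powi (- 2 * j) - 1)"

definition mu_op :: "real \<Rightarrow> int \<Rightarrow> ('k::complex_hilbert \<Rightarrow> 'k) \<Rightarrow> 'k \<Rightarrow> 'k"
  where "mu_op q j B = op_sqrt (\<lambda>x. x + complex_of_real (q powi (- 2 * j)) *\<^sub>C B x)"

text \<open>With \<open>n = m + l + k\<close>, an index tuple has entries at the positions \<open>1, \<dots>, k\<close> and
  \<open>n - m + 1, \<dots>, n\<close> only; here \<open>n - m = l + k\<close>.\<close>

definition series_index :: "nat \<Rightarrow> nat \<Rightarrow> nat \<Rightarrow> (nat \<Rightarrow> int) set"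
  where "series_index m l k = (\<Pi>\<^sub>E j\<in>{1..k} \<union> {l + k<..m + l + k}.
    if l + k < j then {0..} else if j = k then UNIV else {1..})"

definition series_space :: "nat \<Rightarrow> nat \<Rightarrow> nat \<Rightarrow> (nat \<Rightarrow> int, 'k::complex_hilbert) ell2 set"
  where "series_space m l k = {f. \<forall>i. i \<notin> series_index m l k \<longrightarrow> coord f i = 0}"

definition series_dom :: "nat \<Rightarrow> nat \<Rightarrow> nat \<Rightarrow> (nat \<Rightarrow> int, 'k::complex_hilbert) ell2 set"
  where "series_dom m l k = complex_vector.span {ket i \<eta> | i \<eta>. i \<in> series_index m l k}"

text \<open>The vector \<open>z\<^sub>j \<eta>\<^sub>i\<close>. In the last case of either series a tuple with \<open>i\<^sub>j = 1\<close> is shifted out of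
  the index set, but then the coefficient \<open>\<beta>\<^sub>0\<close> vanishes.\<close>

definition gen_action :: "real \<Rightarrow> nat \<Rightarrow> nat \<Rightarrow> nat \<Rightarrow>
    ('k::complex_hilbert \<Rightarrow> 'k) \<Rightarrow> ('k \<Rightarrow> 'k) \<Rightarrow> nat \<Rightarrow> (nat \<Rightarrow> int) \<Rightarrow> 'k \<Rightarrow> (nat \<Rightarrow> int, 'k) ell2"
  where "gen_action q m l k A v j i \<eta> = (let n = m + l + k in
    if l = 0 then
      if k < j then
        complex_of_real (q powi (\<Sum>s\<in>{j<..n}. i s) * lambda_q q (i j + 1)) *\<^sub>C ket (i(j := i j + 1)) \<eta>
      else if j = k then
        complex_of_real (q powi (\<Sum>s\<in>{k<..n}. i s)) *\<^sub>C
          ket (i(k := i k - 1)) (mu_op q (i k - 1) (A \<circ> A) \<eta>)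
      else
        complex_of_real (q powi (- (\<Sum>s\<in>{j<..k}. i s) + (\<Sum>s\<in>{k<..n}. i s)) * beta_q q (i j - 1)) *\<^sub>C
          ket (i(j := i j - 1)) (A \<eta>)
    else
      if n - m < j then
        complex_of_real (q powi (\<Sum>s\<in>{j<..n}. i s) * lambda_q q (i j + 1)) *\<^sub>C ket (i(j := i j + 1)) \<eta>
      else if j = n - m then
        complex_of_real (q powi (\<Sum>s\<in>{n - m<..n}. i s)) *\<^sub>C
          ket (if k = 0 then i else i(k := i k - 1)) (v \<eta>)
      else if k < j then 0
      else if j = k then
        complex_of_real (q powi (- (i k - 1) + (\<Sum>s\<in>{n - m<..n}. i s))) *\<^sub>C
          ket (i(k := i k - 1)) (A \<eta>)
      else
        complex_of_real (q powi (- (\<Sum>s\<in>{j<..k}. i s) + (\<Sum>s\<in>{n - m<..n}. i s)) * beta_q q (i j - 1)) *\<^sub>C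
          ket (i(j := i j - 1)) (A \<eta>))"

text \<open>The standing assumptions on \<open>A\<close> and \<open>v\<close>; for \<open>l = 0\<close> there is no \<open>v\<close>.\<close>

definition admissible :: "real \<Rightarrow> nat \<Rightarrow> ('k::complex_hilbert \<Rightarrow> 'k) \<Rightarrow> ('k \<Rightarrow> 'k) \<Rightarrow> bool"
  where "admissible q l A v \<longleftrightarrow> selfadjoint A \<and> op_spectrum A \<subseteq> complex_of_real ` {q..1} \<and>
    \<not> op_eigenvalue A (complex_of_real q) \<and> (l > 0 \<longrightarrow> unitary v \<and> A \<circ> v = v \<circ> A)"

text \<open>\<open>\<pi>\<close> is the *-representation of the series \<open>(m, l, k)\<close> determined by \<open>A\<close> and \<open>v\<close>.\<close>

definition series_rep :: "real \<Rightarrow> nat \<Rightarrow> nat \<Rightarrow> nat \<Rightarrow> ('k::complex_hilbert \<Rightarrow> 'k) \<Rightarrow> ('k \<Rightarrow> 'k) \<Rightarrow>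
    (free_alg set \<Rightarrow> (nat \<Rightarrow> int, 'k) ell2 \<Rightarrow> (nat \<Rightarrow> int, 'k) ell2) \<Rightarrow> bool"
  where "series_rep q m l k A v \<pi> \<longleftrightarrow>
    star_rep (Oq q (m + l + k)) (series_space m l k) (series_dom m l k) \<pi> \<and>
    (\<forall>j\<in>{1..m + l + k}. \<forall>i\<in>series_index m l k. \<forall>\<eta>.
      \<pi> (oq_class q (m + l + k) (zgen j)) (ket i \<eta>) = gen_action q m l k A v j i \<eta>)"

text \<open>Unitary equivalence of those of the operators \<open>A\<close>, \<open>v\<close> which occur in \<^const>\<open>gen_action\<close>:
  \<open>A\<close> occurs iff \<open>k > 0\<close>, and \<open>v\<close> occurs iff \<open>l > 0\<close>.\<close>

definition data_equivalent :: "nat \<Rightarrow> nat \<Rightarrow> ('k::complex_hilbert \<Rightarrow> 'k) \<Rightarrow> ('k \<Rightarrow> 'k) \<Rightarrow>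
    ('k2::complex_hilbert \<Rightarrow> 'k2) \<Rightarrow> ('k2 \<Rightarrow> 'k2) \<Rightarrow> bool"
  where "data_equivalent l k A v A' v' \<longleftrightarrow> (\<exists>W. unitary W \<and>
    (k > 0 \<longrightarrow> (\<forall>x. W (A x) = A' (W x))) \<and> (l > 0 \<longrightarrow> (\<forall>x. W (v x) = v' (W x))))"

end

theory Submission imports Defs begin

text \<open>Each generator moves the components to shifted indices, and \<open>1 - \<Sum>\<^sub>j\<^sub>\<ge>\<^sub>a z\<^sub>j z\<^sub>j\<^sup>*\<close> is
  diagonal; the relations reduce to identities between these diagonal entries. Call a vector a vacuum if
  it is annihilated by \<open>z\<^sub>j\<^sup>*\<close> for \<open>j > l + k\<close> and by \<open>z\<^sub>j\<close> for \<open>j < k\<close>. Vacua occupy the components in which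
  only the \<open>k\<close>-th entry is free. The diagonal operator \<open>z\<^sub>k\<^sup>* z\<^sub>k - 1\<close> (or \<open>z\<^sub>k\<^sup>* z\<^sub>k\<close>, if \<open>l > 0\<close>)
  is a power of \<open>q\<^sup>2\<close> times \<open>A\<^sup>2\<close> there, and since \<open>A \<ge> q\<close> without eigenvalue \<open>q\<close>, the powers
  of \<open>A\<^sup>2\<close> decay strictly slower than \<open>q\<^bsup>2N\<^esup>\<close>, so a bounded intertwiner cannot change the \<open>k\<close>-th entry.
  It therefore restricts to an operator on \<open>\<K>\<close> that intertwines \<open>A\<^sup>2\<close> and \<open>v\<close>, hence \<open>A\<close>.
  Invariant subspaces of \<open>\<K>\<close> are obtained without the spectral theorem: if a self-adjoint \<open>T\<close> is not
  scalar, the kernel of \<open>\<bar>T - c\<bar> + (T - c)\<close> reduces everything commuting with \<open>T\<close>, for suitable \<open>c\<close>.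
  For \<open>l > 0\<close> normality of \<open>z\<^bsub>l+k\<^esub>\<close> is a relation that does not hold in the algebra. For \<open>l = 0\<close> the
  normally ordered monomials, which span the algebra, act linearly independently: their weights are
  separated one coordinate of the index at a time.\<close>

text \<open>Raising the \<open>k\<close>-th entry by one has the effect of dividing \<open>A\<close>
  by \<open>q\<close>, so \<open>A\<close> and \<open>q A\<close> would give the same
  representation; the interval from \<open>q\<close> to 1 without the eigenvalue \<open>q\<close> is
  a fundamental domain for this scaling. As \<open>q\<close> may still lie in the spectrum, no
  uniform gap is available and growth has to be compared vector by vector. Growth only shows that a
  bounded intertwiner does not raise the \<open>k\<close>-th entry; its adjoint excludes lowering.
  Both unitary equivalences and orthogonal projections onto summands have bounded intertwiners as
  adjoints, so one argument serves inequivalence and irreducibility. Three invariants tell the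
  series apart: the largest number of last generators whose adjoints share a kernel vector is
  \<open>m\<close>; the next generator is isometric on these vectors exactly if
  \<open>l > 0\<close>; in that case the vanishing generators give \<open>k\<close>. Independence of
  monomials is found in opposite regimes: a Fock entry is taken so small that higher powers of the
  adjoint vanish, any other entry tends to infinity, where longer monomials dominate.\<close>

lemma cinner_add_right: "cinner (x :: 'a::complex_inner) (y + z) = cinner x y + cinner x z"
  by (metis cinner_commute cinner_add_left complex_cnj_add)

lemma cinner_scaleC_right: "cinner (x :: 'a::complex_inner) (c *\<^sub>C y) = cnj c * cinner x y"
  by (metis cinner_commute cinner_scaleC_left complex_cnj_mult)

lemma cinner_zero [simp]: "cinner (0 :: 'a::complex_inner) x = 0" "cinner x (0 :: 'a) = 0"
  using cinner_add_left[of 0 0 x] cinner_add_right[of x 0 0] by simp_all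

lemma cinner_minus: "cinner (- x :: 'a::complex_inner) y = - cinner x y"
  "cinner x (- y :: 'a) = - cinner x y"
  using cinner_scaleC_left[of "- 1" x y] cinner_scaleC_right[of x "- 1" y]
  by simp_all

lemma cinner_diff: "cinner (x - y :: 'a::complex_inner) z = cinner x z - cinner y z"
  "cinner z (x - y :: 'a) = cinner z x - cinner z y"
  using cinner_add_left[of x "- y" z] cinner_add_right[of z x "- y"]
  by (simp_all add: cinner_minus)

lemma cinner_scaleR: "cinner (r *\<^sub>R x :: 'a::complex_inner) y = r * cinner x y"
  "cinner x (r *\<^sub>R y :: 'a) = r * cinner x y"
  by (simp_all add: scaleR_scaleC cinner_scaleC_left cinner_scaleC_right)

lemmas cinner_simps = cinner_add_left cinner_add_right cinner_scaleC_left cinner_scaleC_right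
  cinner_minus cinner_diff cinner_scaleR

lemma cinner_sum: "cinner (sum f S :: 'a::complex_inner) y = (\<Sum>i\<in>S. cinner (f i) y)"
  "cinner y (sum f S :: 'a) = (\<Sum>i\<in>S. cinner y (f i))"
  by (induction S rule: infinite_finite_induct) (simp_all add: cinner_simps)

lemma cinner_eq_zero_iff [simp]: "cinner (x :: 'a::complex_inner) x = 0 \<longleftrightarrow> x = 0"
  by (simp add: cinner_self)

lemma cinner_eqI:
  assumes "\<And>z. cinner (x :: 'a::complex_inner) z = cinner y z" shows "x = y"
proof -
  have "cinner (x - y) (x - y) = 0" using assms[of "x - y"] by (simp add: cinner_diff(1))
  then show ?thesis by simp
qed

lemma cinner_eqI_right:
  assumes "\<And>z. cinner z (x :: 'a::complex_inner) = cinner z y" shows "x = y"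
proof (rule cinner_eqI)
  show "cinner x z = cinner y z" for z
    using assms[of z] by (subst (1 2) cinner_commute) simp
qed

text \<open>Multiplying \<open>x\<close> by the phase \<open>u\<close> makes the inner product real
  and equal to its modulus, so the real Cauchy-Schwarz inequality applies.\<close>

lemma norm_cinner_le_mult: "cmod (cinner x y) \<le> norm (x :: 'a::complex_inner) * norm y"
proof (cases "cinner x y = 0")
  case False
  define u where "u = cnj (cinner x y) / cmod (cinner x y)"
  have u: "cmod u = 1" "u * cinner x y = complex_of_real (cmod (cinner x y))"
    using False complex_norm_square[of "cinner x y"]
    by (simp_all add: u_def norm_divide field_simps power2_eq_square)
  have "cmod (cinner x y) = Re (cinner (u *\<^sub>C x) y)" by (simp add: cinner_simps u)
  also have "\<dots> \<le> norm (u *\<^sub>C x) * norm y" unfolding Re_cinner by (rule norm_cauchy_schwarz)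
  finally show ?thesis by (simp add: norm_scaleC u)
qed simp

lemma bounded_linear_cinner_left: "bounded_linear (\<lambda>x :: 'a::complex_inner. cinner x y)"
  by (rule bounded_linear_intro[of _ "norm y"])
    (simp_all add: cinner_simps norm_cinner_le_mult scaleR_conv_of_real)

lemma bounded_linear_cinner_right: "bounded_linear (\<lambda>y :: 'a::complex_inner. cinner x y)"
  by (rule bounded_linear_intro[of _ "norm x"])
    (simp_all add: cinner_simps scaleR_conv_of_real norm_cinner_le_mult mult.commute[of "norm _" "norm x"])

lemma norm_sq_cinner: "(norm (x :: 'a::complex_inner))\<^sup>2 = Re (cinner x x)"
  by (simp add: cinner_self)

section \<open>Adjoint pairs of everywhere defined operators\<close>

text \<open>Replaces the partial function \<open>adj\<close> by a relation between everywhere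
  defined maps. The relation alone forces both members to be linear and, on a complete domain,
  bounded, and it passes to sums and compositions.\<close>

definition adjp :: "('a::complex_inner \<Rightarrow> 'b::complex_inner) \<Rightarrow> ('b \<Rightarrow> 'a) \<Rightarrow> bool"
  where "adjp T S \<longleftrightarrow> (\<forall>x y. cinner (T x) y = cinner x (S y))"

lemma adjpD: "adjp T S \<Longrightarrow> cinner (T x) y = cinner x (S y)"
  by (simp add: adjp_def)

lemma adjpI: "(\<And>x y. cinner (T x) y = cinner x (S y)) \<Longrightarrow> adjp T S"
  by (simp add: adjp_def)

lemma adjp_sym: "adjp T S \<Longrightarrow> adjp S T"
  unfolding adjp_def by (metis cinner_commute)

lemma adjp_linear:
  assumes "adjp T S"
  shows "T (x + y) = T x + T y" "T (c *\<^sub>C x) = c *\<^sub>C T x" "T 0 = 0" "T (- x) = - T x"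
    "T (x - y) = T x - T y" "T (r *\<^sub>R x) = r *\<^sub>R T x"
proof -
  show add: "T (x + y) = T x + T y" for x y
    by (rule cinner_eqI) (simp add: adjpD[OF assms] cinner_simps)
  show sc: "T (c *\<^sub>C x) = c *\<^sub>C T x" for c x
    by (rule cinner_eqI) (simp add: adjpD[OF assms] cinner_simps)
  show "T 0 = 0" using add[of 0 0] by simp
  show minus: "T (- x) = - T x" for x using sc[of "- 1" x] by simp
  show "T (x - y) = T x - T y" using add[of x "- y"] minus by simp
  show "T (r *\<^sub>R x) = r *\<^sub>R T x" by (simp add: scaleR_scaleC sc)
qed

lemma adjp_comp: "adjp T S \<Longrightarrow> adjp T' S' \<Longrightarrow> adjp (\<lambda>x. T (T' x)) (\<lambda>x. S' (S x))"
  by (simp add: adjp_def)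

lemma adjp_add: "adjp T S \<Longrightarrow> adjp T' S' \<Longrightarrow> adjp (\<lambda>x. T x + T' x) (\<lambda>x. S x + S' x)"
  by (simp add: adjp_def cinner_simps)

lemma adjp_diff: "adjp T S \<Longrightarrow> adjp T' S' \<Longrightarrow> adjp (\<lambda>x. T x - T' x) (\<lambda>x. S x - S' x)"
  by (simp add: adjp_def cinner_simps)

lemma adjp_scaleC: "adjp T S \<Longrightarrow> adjp (\<lambda>x. c *\<^sub>C T x) (\<lambda>x. cnj c *\<^sub>C S x)"
  by (simp add: adjp_def cinner_simps)

lemma adjp_scaleR: "adjp T S \<Longrightarrow> adjp (\<lambda>x. r *\<^sub>R T x) (\<lambda>x. r *\<^sub>R S x)"
  by (simp add: adjp_def cinner_simps)

lemma adjp_id: "adjp (\<lambda>x. x) (\<lambda>x. x)" by (simp add: adjp_def)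

lemma adj_UNIV_eq:
  fixes T S :: "'a::complex_inner \<Rightarrow> 'a"
  shows "adjp T S \<Longrightarrow> adj UNIV UNIV T = S"
  unfolding adj_def
  by (rule ext, rule the_equality) (auto simp: adjp_def intro: cinner_eqI_right)

lemma selfadjoint_iff: "selfadjoint T \<longleftrightarrow> adjp T T"
proof
  assume T: "selfadjoint T"
  show "adjp T T"
  proof (rule adjpI)
    fix x y
    have "y \<in> adj_dom UNIV UNIV T" using T by (simp add: selfadjoint_def)
    then obtain z where z: "\<forall>x. cinner (T x) y = cinner x z" by (auto simp: adj_dom_def)
    then have "adj UNIV UNIV T y = z"
      unfolding adj_def by (intro the_equality) (auto intro: cinner_eqI_right)
    then show "cinner (T x) y = cinner x (T y)" using z T by (simp add: selfadjoint_def)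
  qed
next
  assume T: "adjp T T"
  then show "selfadjoint T"
    by (auto simp: selfadjoint_def clinear_on_def adjp_linear[OF T] adj_UNIV_eq adj_dom_def
        intro: adjpD)
qed

text \<open>Hellinger--Toeplitz, by the Baire category theorem applied to the sets \<open>{y. norm (T y) \<le> n}\<close>,
  which are closed because \<open>norm (T y) \<le> n\<close> iff \<open>\<bar>\<langle>y, S x\<rangle>\<bar> \<le> n\<close> for all unit vectors \<open>x\<close>.\<close>

lemma adjp_bounded:
  fixes T :: "'a::complex_hilbert \<Rightarrow> 'b::complex_inner"
  assumes TS: "adjp T S"
  obtains C where "0 < C" "\<And>x. norm (T x) \<le> C * norm x"
proof -
  \<comment> \<open>The right-hand side mentions \<open>T\<close> only through \<open>S\<close>, so
    each of its conditions is continuous in \<open>y\<close> although continuity of \<open>T\<close>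
    is not yet known.\<close>
  have char: "norm (T y) \<le> r \<longleftrightarrow> (\<forall>x. norm x \<le> 1 \<longrightarrow> cmod (cinner y (S x)) \<le> r)" if "0 \<le> r" for y r
  proof
    assume *: "norm (T y) \<le> r"
    show "\<forall>x. norm x \<le> 1 \<longrightarrow> cmod (cinner y (S x)) \<le> r"
    proof (intro allI impI)
      fix x :: 'b assume "norm x \<le> 1"
      then have "cmod (cinner (T y) x) \<le> r * 1"
        using norm_cinner_le_mult[of "T y" x] * that by (meson mult_mono norm_ge_zero order_trans)
      then show "cmod (cinner y (S x)) \<le> r" by (simp add: adjpD[OF TS])
    qed
  next
    assume *: "\<forall>x. norm x \<le> 1 \<longrightarrow> cmod (cinner y (S x)) \<le> r"
    show "norm (T y) \<le> r"
    proof (cases "T y = 0")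
      case False
      let ?x = "(1 / norm (T y)) *\<^sub>R T y"
      have "cinner (T y) ?x = norm (T y)"
        using False by (simp add: cinner_simps cinner_self power2_eq_square)
      moreover have "cmod (cinner y (S ?x)) \<le> r" using * False by simp
      ultimately show ?thesis by (simp flip: adjpD[OF TS])
    qed (simp add: that)
  qed
  have closed: "closed {y. norm (T y) \<le> real n}" for n
  proof -
    have "{y. norm (T y) \<le> real n} =
        (\<Inter>x\<in>{x. norm x \<le> 1}. {y. cmod (cinner y (S x)) \<le> real n})"
      by (auto simp: char)
    moreover have "closed {y. cmod (cinner y (S x)) \<le> real n}" for x
      by (intro closed_Collect_le continuous_intros continuous_on_norm
          bounded_linear.continuous_on[OF bounded_linear_cinner_left])
    ultimately show ?thesis by auto
  qed
  have "\<exists>n. interior {y. norm (T y) \<le> real n} \<noteq> {}"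
  proof (rule ccontr)
    assume "\<not> (\<exists>n. interior {y. norm (T y) \<le> real n} \<noteq> {})"
    then have "euclidean interior_of \<Union>(range (\<lambda>n. {y. norm (T y) \<le> real n})) = {}"
      by (intro Baire_category_alt) (auto simp: completely_metrizable_space_euclidean closed)
    moreover have "\<Union>(range (\<lambda>n. {y. norm (T y) \<le> real n})) = UNIV"
      by (auto intro: real_arch_simple)
    ultimately show False by simp
  qed
  then obtain n y0 where "y0 \<in> interior {y. norm (T y) \<le> real n}" by auto
  then obtain e where e: "0 < e" "ball y0 e \<subseteq> {y. norm (T y) \<le> real n}"
    using mem_interior by blast
  show ?thesis
  proof (rule that)
    \<comment> \<open>\<open>x\<close> is rescaled to length \<open>e / 2\<close>; the images of
      \<open>y0\<close> and of its translate have norm at most \<open>n\<close>, which gives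
      \<open>4 * n / e\<close>. The summand 1 keeps the constant positive when
      \<open>n = 0\<close>.\<close>
    show "0 < 4 * real n / e + 1" using e by (simp add: add_nonneg_pos)
    fix x
    show "norm (T x) \<le> (4 * real n / e + 1) * norm x"
    proof (cases "x = 0")
      case True
      then show ?thesis by (simp add: adjp_linear[OF TS])
    next
      case False
      define r where "r = e / (2 * norm x)"
      have r: "0 < r" using e False by (simp add: r_def)
      have "y0 + r *\<^sub>R x \<in> ball y0 e" "y0 \<in> ball y0 e"
        using e False by (simp_all add: r_def dist_norm)
      then have "norm (T (y0 + r *\<^sub>R x)) \<le> n" "norm (T y0) \<le> n" using e by blast+
      then have "norm (r *\<^sub>R T x) \<le> 2 * n"
        using norm_triangle_ineq4[of "T (y0 + r *\<^sub>R x)" "T y0"] by (simp add: adjp_linear[OF TS])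
      then have "norm (T x) \<le> 2 * n / r" using r by (simp add: field_simps)
      also have "\<dots> = 4 * real n / e * norm x" by (simp add: r_def)
      also have "\<dots> \<le> (4 * real n / e + 1) * norm x" by (simp add: distrib_right)
      finally show ?thesis .
    qed
  qed
qed

lemma adjp_bounded_linear:
  fixes T :: "'a::complex_hilbert \<Rightarrow> 'b::complex_inner"
  assumes "adjp T S" shows "bounded_linear T"
proof -
  obtain C where "\<And>x. norm (T x) \<le> C * norm x" using adjp_bounded[OF assms] by blast
  then show ?thesis
    by (intro bounded_linear_intro[of _ C]) (simp_all add: adjp_linear[OF assms] mult.commute)
qed

lemma adjp_tendsto:
  fixes T :: "'a::complex_hilbert \<Rightarrow> 'b::complex_inner"
  shows "adjp T S \<Longrightarrow> (f \<longlongrightarrow> l) F \<Longrightarrow> ((\<lambda>x. T (f x)) \<longlongrightarrow> T l) F"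
  using bounded_linear.tendsto[OF adjp_bounded_linear] .

lemma unitary_adjp:
  fixes v :: "'a::complex_inner \<Rightarrow> 'b::complex_inner"
  assumes "unitary v"
  shows "bij v" "adjp v (inv_into UNIV v)" "cinner (v x) (v y) = cinner x y" "norm (v x) = norm x"
    "v (inv_into UNIV v z) = z" "inv_into UNIV v (v x) = x"
proof -
  show isom: "cinner (v x) (v y) = cinner x y" for x y
    using assms by (simp add: unitary_on_def)
  show nrm: "norm (v x) = norm x" for x
    using isom[of x x] by (simp add: cinner_self flip: of_real_power)
  have lin: "v (x + y) = v x + v y" "v (c *\<^sub>C x) = c *\<^sub>C v x" for x y c
    using assms by (simp_all add: unitary_on_def clinear_on_def)
  have diff: "v (x - y) = v x - v y" for x y
    using lin(1)[of "x - y" y] by simp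
  have "inj v"
  proof (rule injI)
    fix x y assume "v x = v y"
    then have "norm (x - y) = 0" using nrm[of "x - y"] diff by simp
    then show "x = y" by simp
  qed
  moreover have surj: "surj v" using assms by (simp add: unitary_on_def)
  ultimately show "bij v" by (simp add: bij_def)
  then show inv: "v (inv_into UNIV v z) = z" "inv_into UNIV v (v x) = x" for x z
    by (simp_all add: bij_is_surj surj_f_inv_f bij_is_inj inv_f_f)
  show "adjp v (inv_into UNIV v)"
    by (rule adjpI) (metis inv(1) isom)
qed

section \<open>Positive operators\<close>

definition posop :: "('a::complex_inner \<Rightarrow> 'a) \<Rightarrow> bool"
  where "posop T \<longleftrightarrow> adjp T T \<and> (\<forall>x. 0 \<le> Re (cinner (T x) x))"

lemma posop_positive_op: "positive_op T \<longleftrightarrow> posop T"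
  by (simp add: positive_op_def posop_def selfadjoint_iff)

lemma adjp_self_real: "adjp T T \<Longrightarrow> cinner (T x) x = complex_of_real (Re (cinner (T x) x))"
  using cinner_commute[of "T x" x] by (auto simp: adjp_def complex_eq_iff)

text \<open>The Cauchy--Schwarz inequality of the form \<open>\<langle>T x, y\<rangle>\<close>, from the discriminant of
  \<open>t \<mapsto> \<langle>T (x + t u y), x + t u y\<rangle>\<close> with a phase \<open>u\<close>.\<close>

lemma posop_cauchy_schwarz:
  assumes "posop T"
  shows "(cmod (cinner (T x) y))\<^sup>2 \<le> Re (cinner (T x) x) * Re (cinner (T y) y)"
proof -
  have T: "adjp T T" and pos: "\<And>x. 0 \<le> Re (cinner (T x) x)" using assms by (auto simp: posop_def)
  note lin = adjp_linear[OF T]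
  let ?z = "cinner (T x) y"
  have quad: "0 \<le> Re (cinner (T x) x) + 2 * t * (cmod ?z)\<^sup>2 + t\<^sup>2 * (cmod ?z)\<^sup>2 * Re (cinner (T y) y)" for t
  proof -
    let ?u = "complex_of_real t * ?z"
    have "cinner (T (x + ?u *\<^sub>C y)) (x + ?u *\<^sub>C y) =
      cinner (T x) x + cnj ?u * ?z + ?u * cinner (T y) x + ?u * cnj ?u * cinner (T y) y"
      by (simp add: lin cinner_simps algebra_simps)
    also have "cinner (T y) x = cnj ?z"
      using adjpD[OF T, of y x] cinner_commute[of y "T x"] by simp
    also have "cnj ?u * ?z = complex_of_real (t * (cmod ?z)\<^sup>2)"
      using complex_norm_square[of ?z] by (simp add: mult_ac)
    also have "?u * cnj ?z = complex_of_real (t * (cmod ?z)\<^sup>2)"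
      using complex_norm_square[of ?z] by (simp add: mult_ac)
    also have "?u * cnj ?u = complex_of_real (t\<^sup>2 * (cmod ?z)\<^sup>2)"
      using complex_norm_square[of ?z] by (simp add: mult_ac power2_eq_square)
    finally have "Re (cinner (T (x + ?u *\<^sub>C y)) (x + ?u *\<^sub>C y)) =
      Re (cinner (T x) x) + 2 * t * (cmod ?z)\<^sup>2 + t\<^sup>2 * (cmod ?z)\<^sup>2 * Re (cinner (T y) y)"
      by simp
    then show ?thesis using pos by metis
  qed
  define a b c where "a = Re (cinner (T x) x)" and "b = Re (cinner (T y) y)" and "c = (cmod ?z)\<^sup>2"
  have q: "0 \<le> a + 2 * t * c + t\<^sup>2 * c * b" for t using quad[of t] by (simp add: a_def b_def c_def)
  have nn: "0 \<le> a" "0 \<le> b" "0 \<le> c" by (simp_all add: a_def b_def c_def pos)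
  have "c \<le> a * b"
  proof (cases "b = 0")
    case True
    have "c = 0"
    proof (rule ccontr)
      assume "c \<noteq> 0"
      \<comment> \<open>With \<open>b = 0\<close> the quadratic is affine in \<open>t\<close>, and
        this \<open>t\<close> gives it the value -1.\<close>
      then show False using q[of "- (a + 1) / (2 * c)"] True nn by (simp add: field_simps)
    qed
    then show ?thesis using True by simp
  next
    case False
    \<comment> \<open>The minimum of the quadratic in \<open>t\<close> is attained at
      \<open>t = - 1 / b\<close>.\<close>
    then have "0 \<le> a - c / b" using q[of "- 1 / b"] by (simp add: field_simps power2_eq_square)
    then show ?thesis using False nn by (simp add: field_simps)
  qed
  then show ?thesis by (simp add: a_def b_def c_def)
qed

lemma posop_zero:
  assumes "posop T" "Re (cinner (T x) x) = 0" shows "T x = 0"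
  using posop_cauchy_schwarz[OF assms(1), of x "T x"] assms(2) by (simp add: cinner_self)

text \<open>Cauchy-Schwarz for the form with \<open>y = T x\<close>, divided by the squared norm of
  \<open>T x\<close>. It makes \<open>posop_zero\<close> quantitative: where the form is small, so
  is the image.\<close>

lemma posop_norm_sq_le:
  assumes T: "posop T" and M: "\<And>x. norm (T x) \<le> M * norm x" and "0 \<le> M"
  shows "(norm (T x))\<^sup>2 \<le> M * Re (cinner (T x) x)"
proof (cases "T x = 0")
  case False
  have "((norm (T x))\<^sup>2)\<^sup>2 = (cmod (cinner (T x) (T x)))\<^sup>2" by (simp add: cinner_self norm_power)
  also have "\<dots> \<le> Re (cinner (T x) x) * Re (cinner (T (T x)) (T x))"
    by (rule posop_cauchy_schwarz[OF T])
  also have "\<dots> \<le> Re (cinner (T x) x) * (M * (norm (T x))\<^sup>2)"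
  proof (rule mult_left_mono)
    have "Re (cinner (T (T x)) (T x)) \<le> norm (T (T x)) * norm (T x)"
      using norm_cinner_le_mult complex_Re_le_cmod order_trans by blast
    also have "\<dots> \<le> M * norm (T x) * norm (T x)" using M by (intro mult_right_mono) auto
    finally show "Re (cinner (T (T x)) (T x)) \<le> M * (norm (T x))\<^sup>2" by (simp add: power2_eq_square)
    show "0 \<le> Re (cinner (T x) x)" using T by (simp add: posop_def)
  qed
  finally have "(norm (T x))\<^sup>2 * (norm (T x))\<^sup>2 \<le> (M * Re (cinner (T x) x)) * (norm (T x))\<^sup>2"
    by (simp add: power2_eq_square mult_ac)
  then show ?thesis by (rule mult_right_le_imp_le) (use False in simp)
qed (use T \<open>0 \<le> M\<close> in \<open>simp add: posop_def\<close>)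

text \<open>Cauchy-Schwarz with \<open>y = T x\<close> again, now with both form values estimated by
  \<open>M\<close>: for a positive operator a bound on the form is a bound on the norm.\<close>

lemma posop_contraction:
  assumes T: "posop T" and le: "\<And>x. Re (cinner (T x) x) \<le> M * (norm x)\<^sup>2" and "0 \<le> M"
  shows "norm (T x) \<le> M * norm x"
proof (cases "T x = 0")
  case False
  have "((norm (T x))\<^sup>2)\<^sup>2 = (cmod (cinner (T x) (T x)))\<^sup>2" by (simp add: cinner_self norm_power)
  also have "\<dots> \<le> Re (cinner (T x) x) * Re (cinner (T (T x)) (T x))"
    by (rule posop_cauchy_schwarz[OF T])
  also have "\<dots> \<le> (M * (norm x)\<^sup>2) * (M * (norm (T x))\<^sup>2)"
    using T \<open>0 \<le> M\<close> by (intro mult_mono le) (auto simp: posop_def)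
  finally have "(norm (T x))\<^sup>2 * (norm (T x))\<^sup>2 \<le> (M * norm x)\<^sup>2 * (norm (T x))\<^sup>2"
    by (simp add: power2_eq_square mult_ac)
  then have "(norm (T x))\<^sup>2 \<le> (M * norm x)\<^sup>2" by (rule mult_right_le_imp_le) (use False in simp)
  then show ?thesis using \<open>0 \<le> M\<close> by (simp add: power2_le_iff_abs_le)
qed (use \<open>0 \<le> M\<close> in simp)

text \<open>The square root of \<open>1 - C\<close> is \<open>1 - L\<close>, where \<open>L\<close> is the limit of \<open>Y\<^sub>0 = 0\<close>,
  \<open>Y\<^sub>n\<^sub>+\<^sub>1 = (C + Y\<^sub>n\<^sup>2) / 2\<close>. The same recursion with \<open>C\<close> replaced by \<open>1\<close> gives real numbers that
  dominate the operator norms of \<open>Y\<^sub>n\<close> and of the increments.\<close>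

lemma sqrt_of_contraction:
  fixes C :: "'a::complex_hilbert \<Rightarrow> 'a"
  assumes C: "adjp C C" and le: "\<And>x. norm (C x) \<le> norm x"
  shows "\<exists>S. posop S \<and> (\<forall>x. S (S x) = x - C x) \<and>
    (\<forall>B B'. adjp B B' \<longrightarrow> (\<forall>x. B (C x) = C (B x)) \<longrightarrow> (\<forall>x. (B :: 'a \<Rightarrow> 'a) (S x) = S (B x)))"
proof -
  define Y where "Y = rec_nat (\<lambda>_. 0) (\<lambda>_ Z x. (1 / 2) *\<^sub>R (C x + Z (Z x)))"
  have Y0: "Y 0 x = 0" and YS: "Y (Suc n) x = (1 / 2) *\<^sub>R (C x + Y n (Y n x))" for n x
    by (simp_all add: Y_def)
  define y :: "nat \<Rightarrow> real" where "y = rec_nat 0 (\<lambda>_ z. (1 + z\<^sup>2) / 2)"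
  have y0: "y 0 = 0" and yS: "y (Suc n) = (1 + (y n)\<^sup>2) / 2" for n
    by (simp_all add: y_def)
  have y_bd: "0 \<le> y n \<and> y n \<le> 1" for n
  proof (induction n)
    case (Suc n)
    then have "(y n)\<^sup>2 \<le> 1" by (simp add: power_le_one)
    then show ?case by (simp add: yS)
  qed (simp add: y0)
  \<comment> \<open>This is the nonnegativity of \<open>(1 - y n)^2\<close>.\<close>
  have y_Suc: "y n \<le> y (Suc n)" for n
    using sum_squares_bound[of "y n" 1] by (simp add: yS)
  have y_mono: "m \<le> n \<Longrightarrow> y m \<le> y n" for m n
    by (rule lift_Suc_mono_le[of y]) (use y_Suc in auto)
  have adjY: "adjp (Y n) (Y n)" for n
  proof (induction n)
    case 0
    then show ?case by (simp add: adjp_def Y0)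
  next
    case (Suc n)
    have "Y (Suc n) = (\<lambda>x. (1 / 2) *\<^sub>R (C x + Y n (Y n x)))" by (simp add: YS fun_eq_iff)
    then show ?case
      using adjp_scaleR[OF adjp_add[OF C adjp_comp[OF Suc Suc]], of "1 / 2"] by simp
  qed
  have comm: "B (Y n x) = Y n (B x)"
    if B: "adjp B B'" and BC: "\<And>x. B (C x) = C (B x)" for B :: "'a \<Rightarrow> 'a" and B' n x
  proof (induction n arbitrary: x)
    case 0
    then show ?case by (simp add: Y0 adjp_linear[OF B])
  next
    case (Suc n)
    then show ?case by (simp add: YS adjp_linear[OF B] BC)
  qed
  have nrm: "norm (Y n x) \<le> y n * norm x" for n x
  proof (induction n arbitrary: x)
    case 0
    then show ?case by (simp add: Y0 y0)
  next
    case (Suc n)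
    have "norm (Y n (Y n x)) \<le> y n * (y n * norm x)"
      using Suc[of "Y n x"] mult_left_mono[OF Suc[of x], of "y n"] y_bd[of n] by linarith
    then have "norm (C x + Y n (Y n x)) \<le> norm x + y n * (y n * norm x)"
      using norm_triangle_mono[OF le] by blast
    then show ?case unfolding YS yS norm_scaleR by (simp add: algebra_simps power2_eq_square)
  qed
  have step: "norm (Y (Suc n) x - Y n x) \<le> (y (Suc n) - y n) * norm x" for n x
  proof (induction n arbitrary: x)
    case 0
    then show ?case using nrm[of 1 x] by (simp add: Y0 y0)
  next
    case (Suc n)
    let ?d = "y (Suc n) - y n"
    \<comment> \<open>The difference of squares is split into \<open>Y (Suc n)\<close> applied to an
      increment plus an increment applied to \<open>Y n x\<close>. The norm bounds of the factors
      then add up to the increment of the real recursion.\<close>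
    have eq: "Y (Suc (Suc n)) x - Y (Suc n) x = (1 / 2) *\<^sub>R (Y (Suc n) (Y (Suc n) x - Y n x) +
      (Y (Suc n) (Y n x) - Y n (Y n x)))"
      by (subst (1 2) YS) (simp add: adjp_linear[OF adjY] algebra_simps)
    have "norm (Y (Suc n) (Y (Suc n) x - Y n x)) \<le> y (Suc n) * (?d * norm x)"
      using nrm[of "Suc n" "Y (Suc n) x - Y n x"] mult_left_mono[OF Suc[of x], of "y (Suc n)"]
        y_bd[of "Suc n"] by linarith
    moreover have "norm (Y (Suc n) (Y n x) - Y n (Y n x)) \<le> ?d * (y n * norm x)"
      using Suc[of "Y n x"] mult_left_mono[OF nrm[of n x], of ?d] y_Suc[of n] by linarith
    ultimately have "norm (Y (Suc (Suc n)) x - Y (Suc n) x) \<le>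
        (1 / 2) * (y (Suc n) * (?d * norm x) + ?d * (y n * norm x))"
      unfolding eq norm_scaleR by (simp add: norm_triangle_mono)
    also have "\<dots> = (y (Suc (Suc n)) - y (Suc n)) * norm x"
      unfolding yS[of "Suc n"] using yS[of n] by (simp add: algebra_simps power2_eq_square)
    finally show ?case .
  qed
  have tele: "norm (Y (m + j) x - Y m x) \<le> (y (m + j) - y m) * norm x" for m j x
  proof (induction j)
    case (Suc j)
    have "norm (Y (m + Suc j) x - Y m x) \<le>
        norm (Y (Suc (m + j)) x - Y (m + j) x) + norm (Y (m + j) x - Y m x)"
      using norm_triangle_ineq[of "Y (Suc (m + j)) x - Y (m + j) x" "Y (m + j) x - Y m x"] by simp
    then show ?case using Suc step[of "m + j" x] by (simp add: algebra_simps)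
  qed simp
  \<comment> \<open>\<open>y\<close> is monotone and bounded by 1; \<open>tele\<close> transfers its
    Cauchy property to \<open>Y n x\<close>.\<close>
  have "convergent y"
  proof (rule Bseq_monoseq_convergent)
    show "Bseq y" by (rule BseqI'[of _ 1]) (use y_bd in auto)
    show "monoseq y" using y_mono by (auto simp: monoseq_def)
  qed
  then have yC: "Cauchy y" by (rule convergent_Cauchy)
  have "convergent (\<lambda>n. Y n x)" for x
  proof (rule Cauchy_convergent, rule metric_CauchyI)
    fix e :: real assume e: "0 < e"
    then obtain N where N: "\<forall>m\<ge>N. \<forall>n\<ge>N. dist (y m) (y n) < e / (norm x + 1)"
      using metric_CauchyD[OF yC, of "e / (norm x + 1)"] by (auto simp: add_nonneg_pos)
    have main: "norm (Y n x - Y m x) < e" if "N \<le> m" "m \<le> n" for m n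
    proof -
      have "norm (Y n x - Y m x) \<le> (y n - y m) * norm x" using tele[of m "n - m" x] that by simp
      also have "\<dots> \<le> (y n - y m) * (norm x + 1)"
        using y_mono[OF that(2)] by (intro mult_left_mono) auto
      also have "\<dots> < e"
      proof -
        have "0 < norm x + 1" by (simp add: add_nonneg_pos)
        moreover have "y n - y m < e / (norm x + 1)"
          using N[rule_format, of n m] that y_mono[OF that(2)] by (simp add: dist_real_def)
        ultimately show ?thesis by (simp only: pos_less_divide_eq)
      qed
      finally show ?thesis .
    qed
    show "\<exists>M. \<forall>m\<ge>M. \<forall>n\<ge>M. dist (Y m x) (Y n x) < e"
    proof (intro exI[of _ N] allI impI)
      fix m n assume "N \<le> m" "N \<le> n"
      then show "dist (Y m x) (Y n x) < e"
        using main[of m n] main[of n m] by (cases "m \<le> n") (auto simp: dist_norm norm_minus_commute)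
    qed
  qed
  then obtain L where L: "\<And>x. (\<lambda>n. Y n x) \<longlonglongrightarrow> L x" unfolding convergent_def by metis
  have adjL: "adjp L L"
  proof (rule adjpI)
    fix x z
    have "(\<lambda>n. cinner (Y n x) z) \<longlonglongrightarrow> cinner (L x) z"
      by (rule bounded_linear.tendsto[OF bounded_linear_cinner_left L])
    moreover have "(\<lambda>n. cinner (Y n x) z) \<longlonglongrightarrow> cinner x (L z)"
      unfolding adjpD[OF adjY] by (rule bounded_linear.tendsto[OF bounded_linear_cinner_right L])
    ultimately show "cinner (L x) z = cinner x (L z)" by (rule LIMSEQ_unique)
  qed
  have nrmY1: "norm (Y n x) \<le> norm x" for n x
    using nrm[of n x] mult_right_mono[of "y n" 1 "norm x"] y_bd[of n] by simp
  have nrmL: "norm (L x) \<le> norm x" for x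
    by (rule LIMSEQ_le_const2[OF tendsto_norm[OF L]]) (use nrmY1 in auto)
  have "(\<lambda>n. Y n (Y n x)) \<longlonglongrightarrow> L (L x)" for x
  proof -
    have "(\<lambda>n. Y n (Y n x - L x)) \<longlonglongrightarrow> 0"
    proof (rule tendsto_0_le[where K = 1])
      show "(\<lambda>n. Y n x - L x) \<longlonglongrightarrow> 0" using L LIM_zero by blast
      show "\<forall>\<^sub>F n in sequentially. norm (Y n (Y n x - L x)) \<le> norm (Y n x - L x) * 1"
        using nrmY1 by simp
    qed
    from tendsto_add[OF this L[of "L x"]] show ?thesis by (simp add: adjp_linear[OF adjY])
  qed
  then have "(\<lambda>n. (1 / 2) *\<^sub>R (C x + Y n (Y n x))) \<longlonglongrightarrow> (1 / 2) *\<^sub>R (C x + L (L x))" for x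
    by (intro tendsto_intros)
  then have "(\<lambda>n. Y (Suc n) x) \<longlonglongrightarrow> (1 / 2) *\<^sub>R (C x + L (L x))" for x by (simp add: YS)
  then have Leq: "L x = (1 / 2) *\<^sub>R (C x + L (L x))" for x
    using LIMSEQ_Suc[OF L] LIMSEQ_unique by blast
  have LL: "L (L x) = L x + L x - C x" for x
  proof -
    have "2 *\<^sub>R L x = C x + L (L x)" by (subst Leq) simp
    then show ?thesis by (simp add: scaleR_2 algebra_simps)
  qed
  have S: "adjp (\<lambda>x. x - L x) (\<lambda>x. x - L x)" by (rule adjp_diff[OF adjp_id adjL])
  show ?thesis
  proof (intro exI[of _ "\<lambda>x. x - L x"] conjI allI impI)
    have "Re (cinner (L x) x) \<le> (norm x)\<^sup>2" for x
    proof -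
      have "Re (cinner (L x) x) \<le> norm (L x) * norm x"
        using norm_cinner_le_mult complex_Re_le_cmod order_trans by blast
      also have "\<dots> \<le> norm x * norm x" by (intro mult_right_mono nrmL) simp
      finally show ?thesis by (simp add: power2_eq_square)
    qed
    then show "posop (\<lambda>x. x - L x)"
      using S by (simp add: posop_def cinner_simps flip: norm_sq_cinner)
    fix x
    show "x - L x - L (x - L x) = x - C x" by (simp add: adjp_linear[OF adjL] LL)
  next
    fix B B' x assume B: "adjp (B :: 'a \<Rightarrow> 'a) B'" and BC: "\<forall>x. B (C x) = C (B x)"
    have "(\<lambda>n. B (Y n x)) \<longlonglongrightarrow> B (L x)" by (rule adjp_tendsto[OF B L])
    moreover have "(\<lambda>n. B (Y n x)) \<longlonglongrightarrow> L (B x)"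
      using L[of "B x"] comm[OF B] BC by simp
    ultimately have "B (L x) = L (B x)" by (rule LIMSEQ_unique)
    then show "B (x - L x) = B x - L (B x)" by (simp add: adjp_linear[OF B])
  qed
qed

text \<open>After division by a norm bound \<open>M\<close> the form of \<open>C = 1 - T / M\<close>
  lies between 0 and 1 on unit vectors, so \<open>C\<close> is a contraction and
  \<open>sqrt_of_contraction\<close> applies. The commutation clause is what later lets
  \<open>mu_op\<close> commute with \<open>A\<close> and \<open>v\<close>.\<close>

lemma posop_sqrt_exists:
  fixes T :: "'a::complex_hilbert \<Rightarrow> 'a"
  assumes T: "posop T"
  shows "\<exists>S. posop S \<and> (\<forall>x. S (S x) = T x) \<and>
    (\<forall>B B'. adjp B B' \<longrightarrow> (\<forall>x. B (T x) = T (B x)) \<longrightarrow> (\<forall>x. (B :: 'a \<Rightarrow> 'a) (S x) = S (B x)))"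
proof -
  have adjT: "adjp T T" and pos: "\<And>x. 0 \<le> Re (cinner (T x) x)" using T by (auto simp: posop_def)
  obtain M where M: "0 < M" "\<And>x. norm (T x) \<le> M * norm x" using adjp_bounded[OF adjT] by blast
  define C where "C = (\<lambda>x. x - (1 / M) *\<^sub>R T x)"
  have C: "adjp C C" unfolding C_def by (intro adjp_diff adjp_id adjp_scaleR adjT)
  have form: "Re (cinner (C x) x) = (norm x)\<^sup>2 - Re (cinner (T x) x) / M" for x
    by (simp add: C_def cinner_simps norm_sq_cinner)
  have "Re (cinner (T x) x) \<le> M * (norm x)\<^sup>2" for x
  proof -
    have "Re (cinner (T x) x) \<le> norm (T x) * norm x"
      using norm_cinner_le_mult complex_Re_le_cmod order_trans by blast
    also have "\<dots> \<le> M * norm x * norm x" by (intro mult_right_mono M) simp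
    finally show ?thesis by (simp add: power2_eq_square)
  qed
  then have "posop C" using C M(1) by (simp add: posop_def form field_simps)
  moreover have "Re (cinner (C x) x) \<le> 1 * (norm x)\<^sup>2" for x
    using pos[of x] M(1) by (simp add: form)
  ultimately have "norm (C x) \<le> norm x" for x using posop_contraction[of C 1 x] by simp
  from sqrt_of_contraction[OF C this] obtain S where S: "posop S" "\<And>x. S (S x) = x - C x"
    and comm: "\<And>B B' x. adjp B B' \<Longrightarrow> (\<forall>x. B (C x) = C (B x)) \<Longrightarrow> (B :: 'a \<Rightarrow> 'a) (S x) = S (B x)"
    by blast
  have adjS: "adjp S S" using S by (simp add: posop_def)
  show ?thesis
  proof (intro exI[of _ "\<lambda>x. sqrt M *\<^sub>R S x"] conjI allI impI)
    show "posop (\<lambda>x. sqrt M *\<^sub>R S x)"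
      using S(1) M(1) by (auto simp: posop_def cinner_simps intro: adjp_scaleR)
    show "sqrt M *\<^sub>R S (sqrt M *\<^sub>R S x) = T x" for x
      using M(1) by (simp add: adjp_linear[OF adjS] S(2) C_def)
    fix B B' x assume B: "adjp (B :: 'a \<Rightarrow> 'a) B'" and BT: "\<forall>x. B (T x) = T (B x)"
    have "B (S x) = S (B x)"
      by (rule comm[OF B]) (simp add: C_def adjp_linear[OF B] BT)
    then show "B (sqrt M *\<^sub>R S x) = sqrt M *\<^sub>R S (B x)" by (simp add: adjp_linear[OF B])
  qed
qed

text \<open>Both roots are compared with the root \<open>R\<close> that commutes with everything
  commuting with the square. For a root \<open>Q\<close>, commutation gives
  \<open>(Q + R) (Q - R) = 0\<close>, so at \<open>d = Q x - R x\<close> both nonnegative forms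
  vanish and \<open>Q d = R d = 0\<close>.\<close>

lemma posop_sqrt_unique:
  fixes S S' :: "'a::complex_hilbert \<Rightarrow> 'a"
  assumes "posop S" "posop S'" and sq: "\<And>x. S (S x) = S' (S' x)"
  shows "S = S'"
proof -
  have adjS: "adjp S S" and adjS': "adjp S' S'"
    and pos: "\<And>x. 0 \<le> Re (cinner (S x) x)" "\<And>x. 0 \<le> Re (cinner (S' x) x)"
    using assms by (auto simp: posop_def)
  have "posop (\<lambda>x. S (S x))"
    unfolding posop_def by (auto simp: adjpD[OF adjS] cinner_self intro: adjp_comp[OF adjS adjS])
  from posop_sqrt_exists[OF this] obtain R where R: "posop R" "\<And>x. R (R x) = S (S x)"
    and comm: "\<And>B B' x. adjp B B' \<Longrightarrow> (\<forall>x. B (S (S x)) = S (S (B x))) \<Longrightarrow> (B :: 'a \<Rightarrow> 'a) (R x) = R (B x)"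
    by metis
  have adjR: "adjp R R" and posR: "\<And>x. 0 \<le> Re (cinner (R x) x)" using R by (auto simp: posop_def)
  have root: "Q x = R x" if Q: "posop Q" "\<And>x. Q (Q x) = S (S x)" for Q x
  proof -
    have adjQ: "adjp Q Q" and posQ: "\<And>x. 0 \<le> Re (cinner (Q x) x)" using Q by (auto simp: posop_def)
    have QR: "Q (R x) = R (Q x)" for x
      by (rule comm[OF adjQ]) (metis Q(2))
    define d where "d = Q x - R x"
    have "Q d + R d = 0"
      by (simp add: d_def adjp_linear[OF adjQ] adjp_linear[OF adjR] Q(2) R(2) QR)
    then have "cinner (Q d) d + cinner (R d) d = 0" by (simp flip: cinner_add_left)
    then have "Re (cinner (Q d) d) + Re (cinner (R d) d) = 0" by (metis plus_complex.sel(1) zero_complex.sel(1))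
    then have "Re (cinner (Q d) d) = 0" "Re (cinner (R d) d) = 0"
      using posQ[of d] posR[of d] by linarith+
    then have "Q d = 0" "R d = 0" using posop_zero Q(1) R(1) by blast+
    \<comment> \<open>Moving \<open>Q - R\<close> to the other side puts it onto \<open>d\<close>,
      where it vanishes.\<close>
    have "cinner d d = cinner x (Q d - R d)"
      by (subst (1) d_def) (simp add: cinner_simps adjpD[OF adjQ] adjpD[OF adjR])
    then have "d = 0" using \<open>Q d = 0\<close> \<open>R d = 0\<close> by simp
    then show ?thesis by (simp add: d_def)
  qed
  show ?thesis
  proof
    fix x
    have "S x = R x" by (rule root) (use assms in auto)
    moreover have "S' x = R x" by (rule root) (use assms in auto)
    ultimately show "S x = S' x" by simp
  qed
qed

lemma op_sqrt_props:
  fixes T :: "'a::complex_hilbert \<Rightarrow> 'a"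
  assumes T: "posop T"
  shows "posop (op_sqrt T)" "op_sqrt T (op_sqrt T x) = T x"
    "adjp B B' \<Longrightarrow> (\<And>x. B (T x) = T (B x)) \<Longrightarrow> B (op_sqrt T x) = op_sqrt T (B x)"
proof -
  obtain S where S: "posop S" "\<And>x. S (S x) = T x"
    and comm: "\<And>B B' x. adjp B B' \<Longrightarrow> (\<forall>x. B (T x) = T (B x)) \<Longrightarrow> (B :: 'a \<Rightarrow> 'a) (S x) = S (B x)"
    using posop_sqrt_exists[OF T] by blast
  have "op_sqrt T = S"
    unfolding op_sqrt_def posop_positive_op
  proof (rule the_equality)
    show "posop S \<and> S \<circ> S = T" using S by (auto simp: fun_eq_iff)
    fix S' assume S': "posop S' \<and> S' \<circ> S' = T"
    then have "S' (S' x) = S (S x)" for x using S(2) by (metis comp_apply)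
    with posop_sqrt_unique[of S' S] S' S show "S' = S" by blast
  qed
  then show "posop (op_sqrt T)" "op_sqrt T (op_sqrt T x) = T x"
    "adjp B B' \<Longrightarrow> (\<And>x. B (T x) = T (B x)) \<Longrightarrow> B (op_sqrt T x) = op_sqrt T (B x)"
    using S comm by blast+
qed

section \<open>Orthogonal projections\<close>

text \<open>The nearest point is the limit of a minimizing sequence. If \<open>B\<close> and its
  adjoint leave \<open>M\<close> invariant, \<open>B x - B (P x)\<close> stays orthogonal to
  \<open>M\<close>, so \<open>B (P x)\<close> is the projection of \<open>B x\<close>.\<close>

lemma closed_subspace_projection:
  fixes M :: "'a::complex_hilbert set"
  assumes M: "complex_vector.subspace M" and cl: "closed M"
  shows "\<exists>P. adjp P P \<and> (\<forall>x. P x \<in> M) \<and> (\<forall>x\<in>M. P x = x) \<and>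
    (\<forall>B B'. adjp B B' \<longrightarrow> B ` M \<subseteq> M \<longrightarrow> B' ` M \<subseteq> M \<longrightarrow> (\<forall>x. B (P x) = P (B x)))"
proof -
  note sub = complex_vector.subspace_0[OF M] complex_vector.subspace_add[OF M]
    complex_vector.subspace_scale[OF M] complex_vector.subspace_diff[OF M]
  have subR: "x \<in> M \<Longrightarrow> r *\<^sub>R x \<in> M" for r x by (simp add: scaleR_scaleC sub)
  have "\<exists>p\<in>M. \<forall>m\<in>M. cinner (x - p) m = 0" for x
  proof -
    define S where "S = (\<lambda>m. (norm (x - m))\<^sup>2) ` M"
    define d where "d = Inf S"
    have bdd: "bdd_below S" by (rule bdd_belowI[of _ 0]) (auto simp: S_def)
    have ne: "S \<noteq> {}" using sub(1) by (auto simp: S_def)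
    have d: "d \<le> (norm (x - m))\<^sup>2" if "m \<in> M" for m
      unfolding d_def by (rule cInf_lower[OF _ bdd]) (use that in \<open>auto simp: S_def\<close>)
    have "\<exists>m\<in>M. (norm (x - m))\<^sup>2 < d + 1 / real (Suc n)" for n
      using cInf_lessD[OF ne, of "d + 1 / real (Suc n)"] by (auto simp: S_def d_def)
    then obtain u where u: "\<And>n. u n \<in> M" "\<And>n. (norm (x - u n))\<^sup>2 < d + 1 / real (Suc n)" by metis
    \<comment> \<open>Parallelogram law: the midpoint of \<open>u n\<close> and \<open>u m\<close>
      lies in \<open>M\<close>, so its squared distance to \<open>x\<close> is at least the
      infimum.\<close>
    have par: "(norm (u n - u m))\<^sup>2 \<le> 2 / real (Suc n) + 2 / real (Suc m)" for m n
    proof -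
      have "(norm (u n - u m))\<^sup>2 + 4 * (norm (x - (1 / 2) *\<^sub>R (u n + u m)))\<^sup>2 =
          2 * (norm (x - u n))\<^sup>2 + 2 * (norm (x - u m))\<^sup>2"
        by (simp add: power2_norm_eq_inner inner_simps inner_commute field_simps)
      moreover have "d \<le> (norm (x - (1 / 2) *\<^sub>R (u n + u m)))\<^sup>2"
        by (intro d subR sub u)
      ultimately show ?thesis using u(2)[of n] u(2)[of m] by simp
    qed
    have "Cauchy u"
    proof (rule metric_CauchyI)
      fix e :: real assume "0 < e"
      then obtain N where N: "4 / e\<^sup>2 < real N" using reals_Archimedean2 by blast
      have "norm (u m - u n) < e" if "m \<ge> N" "n \<ge> N" for m n
      proof -
        have "0 < real N" using N \<open>0 < e\<close> by (meson divide_pos_pos less_trans zero_less_numeral zero_less_power)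
        then have "2 / real (Suc m) + 2 / real (Suc n) \<le> 2 / real N + 2 / real N"
          using that by (intro add_mono divide_left_mono) auto
        also have "\<dots> < e\<^sup>2" using N \<open>0 < e\<close> \<open>0 < real N\<close> by (simp add: field_simps)
        finally have "(norm (u m - u n))\<^sup>2 < e\<^sup>2" using par[of m n] by linarith
        then show ?thesis using \<open>0 < e\<close> power_less_imp_less_base by fastforce
      qed
      then show "\<exists>M. \<forall>m\<ge>M. \<forall>n\<ge>M. dist (u m) (u n) < e" by (auto simp: dist_norm)
    qed
    then obtain p where p: "u \<longlonglongrightarrow> p" using Cauchy_convergent_iff convergent_def by blast
    have pM: "p \<in> M" using closed_sequentially[OF cl u(1) p] .
    have "(norm (x - p))\<^sup>2 \<le> d"
    proof (rule LIMSEQ_le)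
      show "(\<lambda>n. (norm (x - u n))\<^sup>2) \<longlonglongrightarrow> (norm (x - p))\<^sup>2" by (intro tendsto_intros p)
      show "(\<lambda>n. d + 1 / real (Suc n)) \<longlonglongrightarrow> d"
        using tendsto_add[OF tendsto_const lim_inverse_n'[THEN LIMSEQ_Suc], of d] by simp
      show "\<exists>N. \<forall>n\<ge>N. (norm (x - u n))\<^sup>2 \<le> d + 1 / real (Suc n)" using u(2) less_imp_le by blast
    qed
    then have min: "(norm (x - p))\<^sup>2 \<le> (norm (x - p - t *\<^sub>R m))\<^sup>2" if "m \<in> M" for m t
      unfolding diff_diff_add by (rule order_trans) (intro d sub subR pM that)
    have inner0: "inner (x - p) m = 0" if "m \<in> M" for m
    proof (cases "m = 0")
      case False
      define a where "a = x - p"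
      define s where "s = inner a m"
      \<comment> \<open>The minimizer of the quadratic in \<open>t\<close>; minimality of
        \<open>p\<close> then forces \<open>s = 0\<close>.\<close>
      define t where "t = s / (norm m)\<^sup>2"
      have "(norm (a - t *\<^sub>R m))\<^sup>2 = (norm a)\<^sup>2 - 2 * t * s + t\<^sup>2 * (norm m)\<^sup>2"
        unfolding s_def power2_norm_eq_inner
        by (simp add: inner_simps inner_commute[of m a] power2_eq_square
            algebra_simps)
      also have "\<dots> = (norm a)\<^sup>2 - s\<^sup>2 / (norm m)\<^sup>2"
        using False by (simp add: t_def field_simps power2_eq_square)
      finally have "s\<^sup>2 / (norm m)\<^sup>2 \<le> 0" using min[OF that, of t] by (simp add: a_def)
      then show ?thesis using False by (simp add: divide_le_0_iff s_def a_def)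
    qed simp
    have "cinner (x - p) m = 0" if "m \<in> M" for m
    proof -
      \<comment> \<open>Real orthogonality to \<open>m\<close> and to its multiple by the imaginary
        unit gives both parts of the complex inner product.\<close>
      have "Re (cinner (x - p) m) = 0" "Re (cinner (x - p) (\<i> *\<^sub>C m)) = 0"
        unfolding Re_cinner using that by (auto intro: inner0 sub)
      then show ?thesis by (simp add: complex_eq_iff cinner_scaleC_right)
    qed
    then show ?thesis using pM by blast
  qed
  then obtain P where P: "\<And>x. P x \<in> M" "\<And>x m. m \<in> M \<Longrightarrow> cinner (x - P x) m = 0" by metis
  have P2: "cinner m (x - P x) = 0" if "m \<in> M" for x m
    using P(2)[OF that, of x] cinner_commute[of m "x - P x"] by simp
  have uniq: "P x = p" if p: "p \<in> M" "\<And>m. m \<in> M \<Longrightarrow> cinner (x - p) m = 0" for x p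
  proof -
    have "P x - p \<in> M" by (intro sub P p)
    from p(2)[OF this] P(2)[OF this, of x] have "cinner (x - p - (x - P x)) (P x - p) = 0"
      by (simp only: cinner_diff(1)[of "x - p"]) simp
    then show ?thesis by simp
  qed
  show ?thesis
  proof (intro exI[of _ P] conjI allI impI ballI)
    show "adjp P P"
    proof (rule adjpI)
      fix x y
      have "cinner (P x) y = cinner (P x) (P y)" using P2[OF P(1), of x y] by (simp add: cinner_diff)
      also have "\<dots> = cinner x (P y)" using P(2)[OF P(1), of x y] by (simp add: cinner_diff)
      finally show "cinner (P x) y = cinner x (P y)" .
    qed
    show "P x \<in> M" for x by (rule P)
    show "P x = x" if "x \<in> M" for x by (rule uniq) (use that in auto)
    fix B B' x assume B: "adjp B B'" "B ` M \<subseteq> M" "B' ` M \<subseteq> M"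
    have "P (B x) = B (P x)"
    proof (rule uniq)
      show "B (P x) \<in> M" using B P by blast
      fix m assume "m \<in> M"
      have "cinner (B x - B (P x)) m = cinner (x - P x) (B' m)"
        by (simp add: adjp_linear[OF B(1), symmetric] adjpD[OF B(1)])
      moreover have "B' m \<in> M" using B(3) \<open>m \<in> M\<close> by blast
      ultimately show "cinner (B x - B (P x)) m = 0" using P(2) by simp
    qed
    then show "B (P x) = P (B x)" by simp
  qed
qed

definition nontrivial_projection :: "('a::complex_hilbert \<Rightarrow> 'a) \<Rightarrow> bool"
  where "nontrivial_projection P \<longleftrightarrow> adjp P P \<and> (\<forall>x. P (P x) = P x) \<and> (\<exists>x. P x \<noteq> 0) \<and> (\<exists>x. P x \<noteq> x)"

text \<open>If \<open>R = T - c\<close> is neither positive nor negative, the kernel of \<open>\<bar>R\<bar> + R\<close> is a nontrivial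
  reducing subspace.\<close>

lemma nonscalar_reducing:
  fixes T :: "'a::complex_hilbert \<Rightarrow> 'a"
  assumes T: "adjp T T" and ns: "\<not> (\<exists>c. \<forall>x. T x = c *\<^sub>C x)"
  shows "\<exists>P. nontrivial_projection P \<and>
    (\<forall>B B'. adjp B B' \<longrightarrow> (\<forall>x. B (T x) = T (B x)) \<longrightarrow> (\<forall>x. B (P x) = P (B x)))"
proof -
  \<comment> \<open>The Rayleigh quotient. If it had a constant value \<open>c\<close>, the form of
    \<open>T - c\<close> would vanish and \<open>T\<close> would be the scalar
    \<open>c\<close>.\<close>
  define f where "f x = Re (cinner (T x) x) / (norm x)\<^sup>2" for x
  have shift: "adjp (\<lambda>x. T x - complex_of_real c *\<^sub>C x) (\<lambda>x. T x - complex_of_real c *\<^sub>C x)" for c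
    using adjp_diff[OF T adjp_scaleC[OF adjp_id, of "complex_of_real c"]] by simp
  have form: "Re (cinner (T x - complex_of_real c *\<^sub>C x) x) = (f x - c) * (norm x)\<^sup>2" for x c
    by (cases "x = 0")
      (simp_all add: f_def cinner_simps adjp_linear[OF T] norm_sq_cinner[symmetric] left_diff_distrib)
  have "\<exists>x y. x \<noteq> 0 \<and> y \<noteq> 0 \<and> f x < f y"
  proof (rule ccontr)
    assume neg: "\<not> (\<exists>x y. x \<noteq> 0 \<and> y \<noteq> 0 \<and> f x < f y)"
    have "\<exists>c. \<forall>x. x \<noteq> 0 \<longrightarrow> f x = c" using neg by (metis linorder_neqE)
    then obtain c where c: "\<And>x. x \<noteq> 0 \<Longrightarrow> f x = c" by blast
    have zero: "Re (cinner (T x - complex_of_real c *\<^sub>C x) x) = 0" for x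
      unfolding form using c[of x] by (cases "x = 0") auto
    then have "posop (\<lambda>x. T x - complex_of_real c *\<^sub>C x)" using shift by (simp add: posop_def)
    from posop_zero[OF this zero] have "T x = complex_of_real c *\<^sub>C x" for x by simp
    then show False using ns by blast
  qed
  then obtain x0 y0 where xy: "x0 \<noteq> 0" "y0 \<noteq> 0" "f x0 < f y0" by blast
  \<comment> \<open>The midpoint makes the form of \<open>R\<close> negative at \<open>x0\<close>
    and positive at \<open>y0\<close>.\<close>
  define c where "c = (f x0 + f y0) / 2"
  define R where "R = (\<lambda>x. T x - complex_of_real c *\<^sub>C x)"
  have R: "adjp R R" unfolding R_def by (rule shift)
  have neg: "Re (cinner (R x0) x0) < 0" and pos: "0 < Re (cinner (R y0) y0)"
    unfolding R_def form using xy by (auto simp: c_def mult_less_0_iff zero_less_mult_iff)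
  have RR: "posop (\<lambda>x. R (R x))"
    unfolding posop_def by (auto simp: adjpD[OF R] cinner_self intro: adjp_comp[OF R R])
  define N where "N = op_sqrt (\<lambda>x. R (R x))"
  have N: "posop N" "\<And>x. N (N x) = R (R x)"
    and Ncomm: "\<And>B B' x. adjp B B' \<Longrightarrow> (\<And>x. B (R (R x)) = R (R (B x))) \<Longrightarrow> B (N x) = N (B x)"
    unfolding N_def using op_sqrt_props[OF RR] by blast+
  have adjN: "adjp N N" using N by (simp add: posop_def)
  have RN: "R (N x) = N (R x)" for x by (rule Ncomm[OF R]) simp
  define G where "G = (\<lambda>x. N x + R x)"
  have G: "adjp G G" unfolding G_def by (rule adjp_add[OF adjN R])
  define M where "M = {x. G x = 0}"
  have "complex_vector.subspace M"
    by (auto simp: complex_vector.subspace_def M_def adjp_linear[OF G])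
  moreover have "closed M"
    unfolding M_def
    by (intro closed_Collect_eq continuous_intros
        linear_continuous_on[OF adjp_bounded_linear[OF G]])
  ultimately obtain P where P: "adjp P P" "\<And>x. P x \<in> M" "\<And>x. x \<in> M \<Longrightarrow> P x = x"
    and Pcomm: "\<And>B B' x. adjp B B' \<Longrightarrow> B ` M \<subseteq> M \<Longrightarrow> B' ` M \<subseteq> M \<Longrightarrow> B (P x) = P (B x)"
    using closed_subspace_projection[of M] by blast
  have posN: "0 \<le> Re (cinner (N x) x)" for x using N by (simp add: posop_def)
  have "\<exists>x. P x \<noteq> x"
  proof -
    have "G y0 \<noteq> 0"
    proof
      assume "G y0 = 0"
      then have "cinner (N y0) y0 + cinner (R y0) y0 = 0" by (simp add: G_def flip: cinner_add_left)
      then have "Re (cinner (N y0) y0) + Re (cinner (R y0) y0) = 0" by (metis plus_complex.sel(1) zero_complex.sel(1))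
      then show False using posN[of y0] pos by linarith
    qed
    then have "y0 \<notin> M" by (simp add: M_def)
    then show ?thesis using P(2)[of y0] by metis
  qed
  moreover have "\<exists>x. P x \<noteq> 0"
  proof -
    \<comment> \<open>It lies in the kernel of \<open>N + R\<close>, since \<open>N\<close> and
      \<open>R\<close> commute and have the same square.\<close>
    let ?x = "N x0 - R x0"
    have "?x \<noteq> 0" using neg posN[of x0] by auto
    moreover have "?x \<in> M"
      by (simp add: M_def G_def adjp_linear[OF adjN] adjp_linear[OF R] N(2) RN)
    ultimately show ?thesis using P(3) by metis
  qed
  ultimately have "nontrivial_projection P"
    using P by (auto simp: nontrivial_projection_def)
  moreover have "B (P x) = P (B x)" if B: "adjp B B'" and BT: "\<forall>x. B (T x) = T (B x)" for B B' x
  proof -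
    have GB: "G (B x) = B (G x)" if B: "adjp B B'" and BT: "\<forall>x. B (T x) = T (B x)" for B B' x
    proof -
      have BR: "B (R x) = R (B x)" for x by (simp add: R_def adjp_linear[OF B] BT)
      then have "B (N x) = N (B x)" for x by (intro Ncomm[OF B]) simp
      then show ?thesis using BR by (simp add: G_def adjp_linear[OF B])
    qed
    have B'T: "B' (T x) = T (B' x)" for x
      by (rule cinner_eqI_right) (simp add: adjpD[OF B, symmetric] adjpD[OF T, symmetric] BT)
    show ?thesis
    proof (rule Pcomm[OF B])
      show "B ` M \<subseteq> M" using GB[OF B BT] by (auto simp: M_def adjp_linear[OF B])
      show "B' ` M \<subseteq> M"
        using GB[OF adjp_sym[OF B]] B'T by (auto simp: M_def adjp_linear[OF adjp_sym[OF B]])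
    qed
  qed
  ultimately show ?thesis by blast
qed

text \<open>A unitary need not be self-adjoint, so \<open>nonscalar_reducing\<close> is tried on
  \<open>A\<close> and on two self-adjoint combinations of \<open>v\<close> and its inverse, which
  together determine \<open>v\<close>. If all three are scalar, every linear operator commutes with
  \<open>A\<close> and \<open>v\<close>, and a rank-one projection serves.\<close>

lemma commuting_reducing:
  fixes A v :: "'a::complex_hilbert \<Rightarrow> 'a"
  assumes A: "adjp A A" and v: "unitary v" and Av: "\<And>x. A (v x) = v (A x)"
    and dim: "\<not> (\<exists>U :: complex \<Rightarrow> 'a. unitary U)" and nz: "\<exists>x::'a. x \<noteq> 0"
  shows "\<exists>P. nontrivial_projection P \<and> (\<forall>x. A (P x) = P (A x)) \<and> (\<forall>x. v (P x) = P (v x))"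
proof -
  let ?w = "inv_into UNIV v"
  note V = unitary_adjp[OF v]
  note lin = adjp_linear[OF V(2)] adjp_linear[OF adjp_sym[OF V(2)]]
  have Aw: "A (?w x) = ?w (A x)" for x
    using Av[of "?w x"] V(5,6) by metis
  have T1: "adjp (\<lambda>x. v x + ?w x) (\<lambda>x. v x + ?w x)"
    using adjp_add[OF V(2) adjp_sym[OF V(2)]] by (simp add: add.commute)
  have T2: "adjp (\<lambda>x. \<i> *\<^sub>C (v x - ?w x)) (\<lambda>x. \<i> *\<^sub>C (v x - ?w x))"
    using adjp_scaleC[OF adjp_diff[OF V(2) adjp_sym[OF V(2)]], of \<i>]
    by (simp add: complex_vector.scale_right_diff_distrib)
  have v2: "v x = (1 / 2) *\<^sub>C ((v x + ?w x) - \<i> *\<^sub>C (\<i> *\<^sub>C (v x - ?w x)))" for x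
  proof -
    have "(v x + ?w x) - \<i> *\<^sub>C (\<i> *\<^sub>C (v x - ?w x)) = v x + v x" by simp
    also have "\<dots> = 2 *\<^sub>C v x" by (metis one_add_one scaleC_add_left scaleC_one)
    finally show ?thesis by simp
  qed
  consider (A) "\<not> (\<exists>c. \<forall>x. A x = c *\<^sub>C x)"
    | (T1) "\<not> (\<exists>c. \<forall>x. v x + ?w x = c *\<^sub>C x)"
    | (T2) "\<not> (\<exists>c. \<forall>x. \<i> *\<^sub>C (v x - ?w x) = c *\<^sub>C x)"
    | (scalar) a b c where "\<And>x. A x = a *\<^sub>C x" "\<And>x. v x + ?w x = b *\<^sub>C x"
        "\<And>x. \<i> *\<^sub>C (v x - ?w x) = c *\<^sub>C x"
    by blast
  then show ?thesis
  proof cases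
    case A
    obtain P where "nontrivial_projection P"
      and P: "\<And>B B' x. adjp B B' \<Longrightarrow> (\<And>x. B (A x) = A (B x)) \<Longrightarrow> B (P x) = P (B x)"
      using nonscalar_reducing[OF assms(1) A] by blast
    moreover have "A (P x) = P (A x)" "v (P x) = P (v x)" for x
      by (auto intro!: P[OF assms(1)] P[OF V(2)] simp: Av)
    ultimately show ?thesis by blast
  next
    case T1
    obtain P where "nontrivial_projection P"
      and P: "\<And>B B' x. adjp B B' \<Longrightarrow> (\<And>x. B (v x + ?w x) = v (B x) + ?w (B x)) \<Longrightarrow> B (P x) = P (B x)"
      using nonscalar_reducing[OF \<open>adjp (\<lambda>x. v x + ?w x) _\<close> T1] by blast
    moreover have "A (P x) = P (A x)" "v (P x) = P (v x)" for x
      by (auto intro!: P[OF assms(1)] P[OF V(2)] simp: Av Aw adjp_linear[OF assms(1)] lin V)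
    ultimately show ?thesis by blast
  next
    case T2
    obtain P where "nontrivial_projection P"
      and P: "\<And>B B' x. adjp B B' \<Longrightarrow>
        (\<And>x. B (\<i> *\<^sub>C (v x - ?w x)) = \<i> *\<^sub>C (v (B x) - ?w (B x))) \<Longrightarrow> B (P x) = P (B x)"
      using nonscalar_reducing[OF \<open>adjp (\<lambda>x. \<i> *\<^sub>C (v x - ?w x)) _\<close> T2] by blast
    moreover have "A (P x) = P (A x)" "v (P x) = P (v x)" for x
      by (auto intro!: P[OF assms(1)] P[OF V(2)] simp: Av Aw adjp_linear[OF assms(1)] lin V)
    ultimately show ?thesis by blast
  next
    case scalar
    obtain x0 :: 'a where "x0 \<noteq> 0" using nz by blast
    define e where "e = (1 / norm x0) *\<^sub>R x0"
    have "norm e = 1" using \<open>x0 \<noteq> 0\<close> by (simp add: e_def)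
    then have ee: "cinner e e = 1" by (simp add: cinner_self)
    define P where "P x = cinner x e *\<^sub>C e" for x
    have P: "adjp P P"
      by (rule adjpI) (simp add: P_def cinner_simps mult.commute flip: cinner_commute)
    have v_scalar: "v x = ((1 / 2) * (b - \<i> * c)) *\<^sub>C x" for x
      by (subst v2) (simp only: scalar scaleC_scaleC complex_vector.scale_left_diff_distrib[symmetric])
    have "\<exists>x. P x \<noteq> x"
    proof (rule ccontr)
      assume "\<not> (\<exists>x. P x \<noteq> x)"
      \<comment> \<open>Then \<open>e\<close> would span the space, and multiplication of
        \<open>e\<close> by scalars would be a unitary from the complex numbers.\<close>
      then have P_id: "P x = x" for x by blast
      have "unitary (\<lambda>c::complex. c *\<^sub>C e)"
        unfolding unitary_on_def
      proof (intro conjI ballI)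
        show "clinear_on UNIV (\<lambda>c::complex. c *\<^sub>C e)"
          by (auto simp: clinear_on_def scaleC_add_left scaleC_complex_def)
        show "cinner (x *\<^sub>C e) (y *\<^sub>C e) = cinner x y" for x y :: complex
          by (simp add: cinner_simps ee cinner_complex_def)
        show "(\<lambda>c. c *\<^sub>C e) ` UNIV = UNIV"
          using P_id unfolding P_def by (metis surjI)
      qed
      then show False using dim by blast
    qed
    moreover have "P e \<noteq> 0" using \<open>norm e = 1\<close> by (auto simp: P_def ee)
    moreover have "P (P x) = P x" for x by (simp add: P_def cinner_simps ee)
    ultimately have "nontrivial_projection P" using P unfolding nontrivial_projection_def by blast
    moreover have "A (P x) = P (A x)" "v (P x) = P (v x)" for x
      by (simp_all add: scalar(1) v_scalar adjp_linear[OF P])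
    ultimately show ?thesis by blast
  qed
qed

lemma one_dimensional:
  fixes U :: "complex \<Rightarrow> 'a::complex_inner"
  assumes "unitary U"
  shows "norm (U 1) = 1" "U c = c *\<^sub>C U 1" "\<exists>c. x = c *\<^sub>C U 1"
proof -
  show "norm (U 1) = 1" using unitary_adjp(4)[OF assms, of 1] by simp
  show U: "U c = c *\<^sub>C U 1" for c
    using adjp_linear(2)[OF unitary_adjp(2)[OF assms], of c 1] by (simp add: scaleC_complex_def)
  show "\<exists>c. x = c *\<^sub>C U 1" using U[of "inv_into UNIV U x"] unitary_adjp(5)[OF assms, of x] by metis
qed

section \<open>Spectral bounds\<close>

text \<open>A bounded left inverse \<open>R\<close> bounds \<open>norm x\<close> by a multiple of
  \<open>norm (B x)\<close>, and \<open>posop_norm_sq_le\<close> bounds the latter by the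
  form.\<close>

lemma posop_resolvent_gap:
  fixes B R :: "'a::complex_hilbert \<Rightarrow> 'a"
  assumes B: "posop B" and R: "bounded_linear R" "\<And>x. R (B x) = x"
  shows "\<exists>e>0. \<forall>x. e * (norm x)\<^sup>2 \<le> Re (cinner (B x) x)"
proof -
  obtain M where M: "0 < M" "\<And>x. norm (B x) \<le> M * norm x"
    using adjp_bounded[of B B] B by (auto simp: posop_def)
  obtain K where K: "0 < K" "\<And>x. norm (R x) \<le> norm x * K"
    using bounded_linear.pos_bounded[OF R(1)] by blast
  have "(norm x)\<^sup>2 \<le> K\<^sup>2 * (M * Re (cinner (B x) x))" for x
  proof -
    have "norm x \<le> K * norm (B x)" using K(2)[of "B x"] R(2) by (simp add: mult.commute)
    then have "(norm x)\<^sup>2 \<le> (K * norm (B x))\<^sup>2" by (intro power_mono) auto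
    also have "\<dots> \<le> K\<^sup>2 * (M * Re (cinner (B x) x))"
      unfolding power_mult_distrib using M by (intro mult_left_mono posop_norm_sq_le[OF B]) auto
    finally show ?thesis .
  qed
  then show ?thesis using K M by (intro exI[of _ "1 / (K\<^sup>2 * M)"]) (auto simp: field_simps)
qed

text \<open>For the greatest lower bound \<open>m\<close> of the form on unit vectors,
  \<open>A - m\<close> is positive. Were it invertible, the gap of
  \<open>posop_resolvent_gap\<close> would make a larger number a lower bound.\<close>

lemma numerical_range_inf_in_spectrum:
  fixes A :: "'a::complex_hilbert \<Rightarrow> 'a"
  assumes A: "adjp A A" and nz: "\<exists>x::'a. x \<noteq> 0"
  shows "\<exists>m. complex_of_real m \<in> op_spectrum A \<and> (\<forall>x. m * (norm x)\<^sup>2 \<le> Re (cinner (A x) x))"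
proof -
  obtain M where M: "0 < M" "\<And>x. norm (A x) \<le> M * norm x" using adjp_bounded[OF A] by blast
  define L where "L = {r. \<forall>x. r * (norm x)\<^sup>2 \<le> Re (cinner (A x) x)}"
  have "- M \<in> L"
  proof -
    have "- M * (norm x)\<^sup>2 \<le> Re (cinner (A x) x)" for x
    proof -
      have "\<bar>Re (cinner (A x) x)\<bar> \<le> norm (A x) * norm x"
        using norm_cinner_le_mult abs_Re_le_cmod order_trans by blast
      also have "\<dots> \<le> M * norm x * norm x" by (intro mult_right_mono M) simp
      finally show ?thesis by (simp add: power2_eq_square)
    qed
    then show ?thesis by (simp add: L_def)
  qed
  then have ne: "L \<noteq> {}" by blast
  obtain x0 :: 'a where x0: "x0 \<noteq> 0" using nz by blast
  have le: "r \<le> Re (cinner (A x) x) / (norm x)\<^sup>2" if "r \<in> L" "x \<noteq> 0" for r x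
    using that by (simp add: L_def field_simps)
  have bdd: "bdd_above L" using le[OF _ x0] by (rule bdd_aboveI)
  define m where "m = Sup L"
  have m: "m * (norm x)\<^sup>2 \<le> Re (cinner (A x) x)" for x
  proof (cases "x = 0")
    case False
    have "m \<le> Re (cinner (A x) x) / (norm x)\<^sup>2"
      unfolding m_def by (rule cSup_least[OF ne le[OF _ False]])
    then show ?thesis using False by (simp add: field_simps)
  qed simp
  have "complex_of_real m \<in> op_spectrum A"
  proof (rule ccontr)
    assume "complex_of_real m \<notin> op_spectrum A"
    then obtain R where R: "bounded_linear R" "\<And>x. R (A x - complex_of_real m *\<^sub>C x) = x"
      by (auto simp: op_spectrum_def)
    let ?B = "\<lambda>x. A x - complex_of_real m *\<^sub>C x"
    have form: "Re (cinner (?B x) x) = Re (cinner (A x) x) - m * (norm x)\<^sup>2" for x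
      by (simp add: cinner_simps norm_sq_cinner)
    have "adjp ?B ?B" using adjp_diff[OF A adjp_scaleC[OF adjp_id, of "complex_of_real m"]] by simp
    then have "posop ?B" using m by (simp add: posop_def form)
    from posop_resolvent_gap[OF this R] obtain e where "0 < e"
      "\<And>x. e * (norm x)\<^sup>2 \<le> Re (cinner (?B x) x)" by blast
    then have "m + e \<in> L" by (simp add: L_def form algebra_simps)
    then show False using cSup_upper[OF _ bdd, of "m + e"] \<open>0 < e\<close> by (simp add: m_def)
  qed
  then show ?thesis using m by blast
qed

text \<open>Reduces the supremum of the numerical range of \<open>A\<close> to the infimum of that
  of \<open>- A\<close>.\<close>

lemma op_spectrum_uminus:
  fixes A :: "'a::complex_hilbert \<Rightarrow> 'a"
  assumes A: "adjp A A" and c: "c \<in> op_spectrum (\<lambda>x. - A x)"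
  shows "- c \<in> op_spectrum A"
proof (rule ccontr)
  assume "- c \<notin> op_spectrum A"
  then obtain R where R: "clinear_on UNIV R" "bounded_linear R"
    "\<And>x. R (A x + c *\<^sub>C x) = x" "\<And>x. A (R x) + c *\<^sub>C R x = x"
    by (auto simp: op_spectrum_def)
  have "- R (- A x - c *\<^sub>C x) = x" for x
    using R(3)[of x] linear_neg[OF bounded_linear.linear[OF R(2)], of "A x + c *\<^sub>C x"] by simp
  moreover have "- A (- R x) - c *\<^sub>C (- R x) = x" for x
    using R(4)[of x] by (simp add: adjp_linear[OF A])
  moreover have "clinear_on UNIV (\<lambda>x. - R x)" using R(1) by (simp add: clinear_on_def)
  moreover have "bounded_linear (\<lambda>x. - R x)" by (rule bounded_linear_minus[OF R(2)])
  ultimately have "\<exists>S. clinear_on UNIV S \<and> bounded_linear S \<and>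
      (\<forall>x. S (- A x - c *\<^sub>C x) = x) \<and> (\<forall>x. - A (S x) - c *\<^sub>C S x = x)"
    by (intro exI[of _ "\<lambda>x. - R x"]) simp
  then show False using c unfolding op_spectrum_def mem_Collect_eq by (elim notE)
qed

text \<open>Logarithmic convexity of \<open>N \<mapsto> norm (B\<^sup>N y)\<close>: if \<open>B \<ge> 1\<close>, this sequence is constant or grows
  exponentially.\<close>

lemma bounded_powers_trivial:
  assumes B: "adjp B B" and ge: "\<And>x. (norm x)\<^sup>2 \<le> Re (cinner (B x) x)"
    and ker: "\<And>x. B x = x \<Longrightarrow> x = 0" and bd: "\<And>N. norm ((B ^^ N) y) \<le> C"
  shows "y = (0 :: 'a::complex_inner)"
proof (rule ccontr)
  assume y: "y \<noteq> 0"
  define a where "a N = norm ((B ^^ N) y)" for N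
  have mono: "norm x \<le> norm (B x)" for x
  proof -
    have "norm x * norm x \<le> norm (B x) * norm x"
      using ge[of x] norm_cinner_le_mult[of "B x" x] complex_Re_le_cmod[of "cinner (B x) x"]
      by (simp add: power2_eq_square)
    then show ?thesis by (cases "x = 0") auto
  qed
  have a_mono: "a N \<le> a (Suc N)" for N using mono by (simp add: a_def)
  have a0: "0 < a 0" using y by (simp add: a_def)
  \<comment> \<open>Expanding \<open>B y\<close> as \<open>y\<close> plus \<open>B y - y\<close>
    leaves the squared norm of \<open>B y - y\<close> as a summand, which is positive since
    \<open>B\<close> fixes no nonzero vector.\<close>
  have "a 0 < a 1"
  proof -
    have "(norm (B y))\<^sup>2 = (norm y)\<^sup>2 + 2 * (Re (cinner (B y) y) - (norm y)\<^sup>2) + (norm (B y - y))\<^sup>2"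
      using cinner_commute[of y "B y"] by (simp add: norm_sq_cinner cinner_simps)
    moreover have "0 < (norm (B y - y))\<^sup>2" using ker[of y] y by auto
    moreover have "v < u" if "u = v + 2 * (w - v) + d" "0 < d" "v \<le> w" for u v w d :: real
      using that by argo
    ultimately have "(norm y)\<^sup>2 < (norm (B y))\<^sup>2" using ge[of y] by blast
    then show ?thesis using power_less_imp_less_base by (force simp: a_def)
  qed
  define r where "r = a 1 / a 0"
  have r: "1 < r" using a0 \<open>a 0 < a 1\<close> by (simp add: r_def)
  have conv: "(a (Suc N))\<^sup>2 \<le> a (Suc (Suc N)) * a N" for N
  proof -
    have "(a (Suc N))\<^sup>2 = Re (cinner (B (B ((B ^^ N) y))) ((B ^^ N) y))"
      by (simp add: a_def norm_sq_cinner adjpD[OF B])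
    also have "\<dots> \<le> a (Suc (Suc N)) * a N"
      unfolding a_def using norm_cinner_le_mult complex_Re_le_cmod order_trans
      by (metis comp_apply funpow.simps(2))
    finally show ?thesis .
  qed
  have apos: "0 < a N" for N using a0 a_mono by (induction N) (auto intro: less_le_trans)
  have ratio: "r * a N \<le> a (Suc N)" for N
  proof (induction N)
    case 0
    then show ?case using a0 by (simp add: r_def)
  next
    case (Suc N)
    have "r * a (Suc N) * a N \<le> a (Suc N) * a (Suc N)"
      using mult_left_mono[OF Suc, of "a (Suc N)"] apos[of "Suc N"] by (simp add: mult_ac)
    also have "\<dots> \<le> a (Suc (Suc N)) * a N" using conv[of N] by (simp add: power2_eq_square)
    finally show ?case using apos[of N] by simp
  qed
  have "r ^ N * a 0 \<le> a N" for N
  proof (induction N)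
    case (Suc N)
    have "r ^ Suc N * a 0 \<le> r * a N" using mult_left_mono[OF Suc, of r] r by (simp add: mult_ac)
    then show ?case using ratio[of N] by linarith
  qed simp
  then have bdd: "r ^ N * a 0 \<le> C" for N using bd[of N] unfolding a_def using order_trans by blast
  obtain N where "C / a 0 < r ^ N" using real_arch_pow[OF r] by blast
  then show False using bdd[of N] a0 by (simp add: field_simps)
qed

text \<open>The extremes of the form of \<open>A\<close> belong to the spectrum, hence to the
  interval. Surjectivity comes from the resolvent at 0, which lies outside the spectrum because
  \<open>q > 0\<close>.\<close>

lemma admissible_bounds:
  fixes A :: "'k::complex_hilbert \<Rightarrow> 'k"
  assumes q: "0 < q" and A: "selfadjoint A" and sp: "op_spectrum A \<subseteq> complex_of_real ` {q..1}"
  shows "q * (norm x)\<^sup>2 \<le> Re (cinner (A x) x)" "norm (A x) \<le> norm x" "q * norm x \<le> norm (A x)" "surj A"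
proof -
  have adjA: "adjp A A" using A by (simp add: selfadjoint_iff)
  have form: "q * (norm x)\<^sup>2 \<le> Re (cinner (A x) x) \<and> Re (cinner (A x) x) \<le> 1 * (norm x)\<^sup>2" for x
  proof (cases "x = 0")
    case False
    then have nz: "\<exists>x::'k. x \<noteq> 0" by blast
    have "adjp (\<lambda>x. - A x) (\<lambda>x. - A x)" using adjA by (simp add: adjp_def cinner_minus)
    from numerical_range_inf_in_spectrum[OF this nz] obtain m1 where
      m1: "complex_of_real m1 \<in> op_spectrum (\<lambda>x. - A x)" "m1 * (norm x)\<^sup>2 \<le> - Re (cinner (A x) x)"
      by (auto simp: cinner_minus)
    from op_spectrum_uminus[OF adjA m1(1)] have "complex_of_real (- m1) \<in> op_spectrum A" by simp
    then have "- m1 \<le> 1" using sp by (metis atLeastAtMost_iff image_iff of_real_eq_iff subsetD)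
    then have "- (1 * (norm x)\<^sup>2) \<le> m1 * (norm x)\<^sup>2"
      using mult_right_mono[of "- 1" m1 "(norm x)\<^sup>2"] by simp
    moreover obtain m2 where
      m2: "complex_of_real m2 \<in> op_spectrum A" "m2 * (norm x)\<^sup>2 \<le> Re (cinner (A x) x)"
      using numerical_range_inf_in_spectrum[OF adjA nz] by blast
    have "q \<le> m2" using sp m2(1) by (metis atLeastAtMost_iff image_iff of_real_eq_iff subsetD)
    then have "q * (norm x)\<^sup>2 \<le> m2 * (norm x)\<^sup>2" by (intro mult_right_mono) auto
    ultimately show ?thesis using m1(2) m2(2) by linarith
  qed simp
  then show low: "q * (norm x)\<^sup>2 \<le> Re (cinner (A x) x)" for x by blast
  have "posop A" using adjA low q unfolding posop_def
    by (meson mult_nonneg_nonneg less_imp_le order_trans zero_le_power2)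
  from posop_contraction[OF this, of 1] form show "norm (A x) \<le> norm x" by simp
  have "(q * norm x) * norm x \<le> norm (A x) * norm x"
    using low[of x] norm_cinner_le_mult[of "A x" x] complex_Re_le_cmod[of "cinner (A x) x"]
    by (simp add: power2_eq_square)
  then show "q * norm x \<le> norm (A x)" by (cases "x = 0") auto
  have "0 \<notin> op_spectrum A" using sp q by auto
  then obtain R where "\<And>x. A (R x) = x" by (auto simp: op_spectrum_def)
  then show "surj A" by (metis surjI)
qed

text \<open>Factor \<open>A^2 - q^2\<close> as \<open>(A - q) (A + q)\<close>: the vector
  \<open>A x + q x\<close> is 0 since \<open>q\<close> is no eigenvalue, and
  \<open>A x = - q x\<close> contradicts positivity unless \<open>x = 0\<close>.\<close>

lemma admissible_square_kernel:
  fixes A :: "'k::complex_hilbert \<Rightarrow> 'k"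
  assumes q: "0 < q" and A: "adjp A A" and low: "q * (norm x)\<^sup>2 \<le> Re (cinner (A x) x)"
    and ne: "\<not> op_eigenvalue A (complex_of_real q)" and x: "A (A x) = (q\<^sup>2) *\<^sub>R x"
  shows "x = 0"
proof -
  let ?z = "A x + q *\<^sub>R x"
  have "A ?z = complex_of_real q *\<^sub>C ?z"
    by (simp add: adjp_linear[OF A] x scaleC_add_right power2_eq_square add.commute flip: scaleR_scaleC)
  then have "?z = 0" using ne by (auto simp: op_eigenvalue_def)
  then have "A x = - (q *\<^sub>R x)" by (simp add: eq_neg_iff_add_eq_0)
  then have "Re (cinner (A x) x) = - (q * (norm x)\<^sup>2)" by (simp add: cinner_simps norm_sq_cinner)
  then have "q * (norm x)\<^sup>2 \<le> 0" using low by linarith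
  then show ?thesis using q by (simp add: mult_le_0_iff)
qed

text \<open>The form of \<open>1 + q^(-2 j) A^2\<close> is the squared norm of \<open>x\<close> plus
  a nonnegative multiple of that of \<open>A x\<close>, so the results on positive square roots
  apply.\<close>

lemma mu_op_props:
  fixes A :: "'k::complex_hilbert \<Rightarrow> 'k"
  assumes q: "0 < q" and A: "adjp A A"
  shows "adjp (mu_op q j (A \<circ> A)) (mu_op q j (A \<circ> A))"
    "mu_op q j (A \<circ> A) (mu_op q j (A \<circ> A) x) = x + (q powi (- 2 * j)) *\<^sub>R A (A x)"
    "adjp B B' \<Longrightarrow> (\<And>x. B (A x) = A (B x)) \<Longrightarrow> B (mu_op q j (A \<circ> A) x) = mu_op q j (A \<circ> A) (B x)"
proof -
  let ?T = "\<lambda>x. x + complex_of_real (q powi (- 2 * j)) *\<^sub>C (A \<circ> A) x"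
  have "adjp ?T ?T"
    using adjp_add[OF adjp_id adjp_scaleC[OF adjp_comp[OF A A], of "complex_of_real (q powi (- 2 * j))"]]
    by simp
  moreover have "Re (cinner (?T x) x) = (norm x)\<^sup>2 + q powi (- 2 * j) * (norm (A x))\<^sup>2" for x
    by (simp add: cinner_simps norm_sq_cinner adjpD[OF A] flip: of_real_power_int)
  ultimately have T: "posop ?T" using q by (simp add: posop_def)
  note props = op_sqrt_props[OF T, folded mu_op_def]
  show "adjp (mu_op q j (A \<circ> A)) (mu_op q j (A \<circ> A))" using props(1) unfolding posop_def by blast
  show "mu_op q j (A \<circ> A) (mu_op q j (A \<circ> A) x) = x + (q powi (- 2 * j)) *\<^sub>R A (A x)"
    using props(2) by (simp add: scaleR_scaleC o_def)
  show "adjp B B' \<Longrightarrow> (\<And>x. B (A x) = A (B x)) \<Longrightarrow> B (mu_op q j (A \<circ> A) x) = mu_op q j (A \<circ> A) (B x)"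
    by (rule props(3)) (simp_all add: adjp_linear o_def)
qed

section \<open>Representations from generators and relations\<close>

lemma dense_subspace_orthogonal:
  fixes D H :: "'h::complex_inner set"
  assumes D: "dense_subspace H D" and z: "z \<in> H" "\<And>x. x \<in> D \<Longrightarrow> cinner x z = 0"
  shows "z = 0"
proof -
  have "z \<in> closure D" using D z by (auto simp: dense_subspace_def)
  then obtain f where f: "\<And>n. f n \<in> D" "f \<longlonglongrightarrow> z" unfolding closure_sequential by blast
  have "(\<lambda>n. cinner (f n) z) \<longlonglongrightarrow> cinner z z"
    by (rule bounded_linear.tendsto[OF bounded_linear_cinner_left f(2)])
  then have "(\<lambda>n. 0) \<longlonglongrightarrow> cinner z z" using f(1) z(2) by simp
  then have "cinner z z = 0" by (rule LIMSEQ_unique) (rule tendsto_const)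
  then show ?thesis by simp
qed

text \<open>Density of \<open>D\<close> makes the vector in the definite description of
  \<open>adj\<close> unique.\<close>

lemma adj_eqI:
  fixes D H :: "'h::complex_inner set"
  assumes D: "dense_subspace H D" and z: "z \<in> H" "\<And>x. x \<in> D \<Longrightarrow> cinner (T x) y = cinner x z"
  shows "adj H D T y = z"
  unfolding adj_def
proof (rule the_equality)
  show "z \<in> H \<and> (\<forall>x\<in>D. cinner (T x) y = cinner x z)" using z by blast
  fix z' assume z': "z' \<in> H \<and> (\<forall>x\<in>D. cinner (T x) y = cinner x z')"
  have "z' - z \<in> H"
    using D z z' by (auto simp: dense_subspace_def complex_vector.subspace_diff)
  moreover have "cinner x (z' - z) = 0" if "x \<in> D" for x
    using z(2)[OF that] z' that by (simp add: cinner_diff)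
  ultimately have "z' - z = 0" by (rule dense_subspace_orthogonal[OF D])
  then show "z' = z" by simp
qed

lemma clinear_on_zero: "clinear_on D T \<Longrightarrow> 0 \<in> D \<Longrightarrow> T 0 = 0"
  unfolding clinear_on_def by (metis complex_vector.scale_zero_left)

lemma star_rep_props:
  fixes D H :: "'h::complex_hilbert set"
  assumes "star_rep R H D \<pi>" and a: "a \<in> carrier R" and d: "d \<in> D" "e \<in> D"
  shows "\<pi> a d \<in> D" "\<pi> a (d + e) = \<pi> a d + \<pi> a e" "\<pi> a (c *\<^sub>C d) = c *\<^sub>C \<pi> a d"
    "cinner (\<pi> a d) e = cinner d (\<pi> (star R a) e)" "\<pi> a 0 = 0" "\<pi> a (d - e) = \<pi> a d - \<pi> a e"
proof -
  have D: "dense_subspace H D" and L: "\<pi> a \<in> Lplus H D"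
    and st: "\<pi> (star R a) e = adj H D (\<pi> a) e"
    using assms by (auto simp: star_rep_def)
  have sub: "complex_vector.subspace D" using D by (simp add: dense_subspace_def)
  show "\<pi> a d \<in> D" using L d by (auto simp: Lplus_def)
  have add: "\<pi> a (d + e) = \<pi> a d + \<pi> a e" if "d \<in> D" "e \<in> D" for d e
    using L that by (auto simp: Lplus_def clinear_on_def)
  have sc: "\<pi> a (c *\<^sub>C d) = c *\<^sub>C \<pi> a d" if "d \<in> D" for c d
    using L that by (auto simp: Lplus_def clinear_on_def)
  show "\<pi> a (d + e) = \<pi> a d + \<pi> a e" "\<pi> a (c *\<^sub>C d) = c *\<^sub>C \<pi> a d"
    using add sc d by blast+
  from sc[OF d(1), of 0] show "\<pi> a 0 = 0" by simp
  show "\<pi> a (d - e) = \<pi> a d - \<pi> a e"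
    using add[of "d - e" e] d complex_vector.subspace_diff[OF sub] by simp
  have "e \<in> adj_dom H D (\<pi> a)" using L d by (auto simp: Lplus_def)
  then obtain z where z: "z \<in> H" "\<And>x. x \<in> D \<Longrightarrow> cinner (\<pi> a x) e = cinner x z"
    by (auto simp: adj_dom_def)
  show "cinner (\<pi> a d) e = cinner d (\<pi> (star R a) e)"
    using z(2)[OF d(1)] adj_eqI[OF D z] st by simp
qed

fun letter_act :: "(nat \<Rightarrow> 'h \<Rightarrow> 'h) \<Rightarrow> (nat \<Rightarrow> 'h \<Rightarrow> 'h) \<Rightarrow> letter \<Rightarrow> 'h \<Rightarrow> 'h" where
  "letter_act Z Y (Gen j) = Z j"
| "letter_act Z Y (Gen_star j) = Y j"

definition word_act :: "(nat \<Rightarrow> 'h \<Rightarrow> 'h) \<Rightarrow> (nat \<Rightarrow> 'h \<Rightarrow> 'h) \<Rightarrow> letter list \<Rightarrow> 'h \<Rightarrow> 'h"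
  where "word_act Z Y w = foldr (letter_act Z Y) w"

definition free_act ::
  "(nat \<Rightarrow> 'h \<Rightarrow> 'h) \<Rightarrow> (nat \<Rightarrow> 'h \<Rightarrow> 'h) \<Rightarrow> free_alg \<Rightarrow> 'h \<Rightarrow> 'h::complex_inner"
  where "free_act Z Y p d = (\<Sum>w\<in>Poly_Mapping.keys p. Poly_Mapping.lookup p w *\<^sub>C word_act Z Y w d)"

lemma word_act_simps [simp]: "word_act Z Y [] d = d"
  "word_act Z Y (x # w) d = letter_act Z Y x (word_act Z Y w d)"
  "word_act Z Y (v @ w) d = word_act Z Y v (word_act Z Y w d)"
  by (simp_all add: word_act_def)

lemma free_act_superset:
  "finite S \<Longrightarrow> Poly_Mapping.keys p \<subseteq> S \<Longrightarrow>
    free_act Z Y p d = (\<Sum>w\<in>S. Poly_Mapping.lookup p w *\<^sub>C word_act Z Y w d)"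
  unfolding free_act_def by (rule sum.mono_neutral_left) (auto simp: in_keys_iff)

lemma free_act_add: "free_act Z Y (p + p') d = free_act Z Y p d + free_act Z Y p' d"
proof -
  let ?S = "Poly_Mapping.keys p \<union> Poly_Mapping.keys p'"
  have "free_act Z Y p'' d = (\<Sum>w\<in>?S. Poly_Mapping.lookup p'' w *\<^sub>C word_act Z Y w d)"
    if "p'' \<in> {p, p', p + p'}" for p''
    using that keys_add[of p p'] by (intro free_act_superset) auto
  then show ?thesis by (simp add: lookup_add scaleC_add_left sum.distrib)
qed

lemma free_act_single [simp]: "free_act Z Y (Poly_Mapping.single w c) d = c *\<^sub>C word_act Z Y w d"
  by (simp add: free_act_def)

lemma free_act_zero [simp]: "free_act Z Y 0 d = 0"
  by (simp add: free_act_def)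

lemma free_act_uminus: "free_act Z Y (- p) d = - free_act Z Y p d"
  using free_act_add[of Z Y p "- p" d] by (simp add: eq_neg_iff_add_eq_0 add.commute)

lemma free_act_diff: "free_act Z Y (p - p') d = free_act Z Y p d - free_act Z Y p' d"
  using free_act_add[of Z Y p "- p'" d] by (simp add: free_act_uminus)

lemma free_act_sum: "free_act Z Y (sum f S) d = (\<Sum>i\<in>S. free_act Z Y (f i) d)"
  by (induction S rule: infinite_finite_induct) (simp_all add: free_act_add)

lemma one_free_alg: "(1 :: free_alg) = Poly_Mapping.single [] 1"
  using single_one[where ?'a = "letter list" and ?'b = complex] by (simp only: zero_list_def)

lemma free_act_gens [simp]: "free_act Z Y (zgen j) d = Z j d" "free_act Z Y (zgen_star j) d = Y j d"
  "free_act Z Y (oq_const c) d = c *\<^sub>C d" "free_act Z Y 1 d = d"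
  by (simp_all add: zgen_def zgen_star_def oq_const_def one_free_alg)

abbreviation words :: "nat \<Rightarrow> letter list set" where
  "words n \<equiv> {w. letter_index ` set w \<subseteq> {1..n}}"

lemma free_ring_carrier: "carrier (free_ring n) = {p. Poly_Mapping.keys p \<subseteq> words n}"
  by (auto simp: free_ring_def)

lemma zgen_carrier: "j \<in> {1..n} \<Longrightarrow> zgen j \<in> carrier (free_ring n)"
  "j \<in> {1..n} \<Longrightarrow> zgen_star j \<in> carrier (free_ring n)"
  by (auto simp: zgen_def zgen_star_def free_ring_def)

lemma free_ring_sum: "(\<And>i. i \<in> S \<Longrightarrow> f i \<in> carrier (free_ring n)) \<Longrightarrow> sum f S \<in> carrier (free_ring n)"
proof (induction S rule: infinite_finite_induct)
  case (insert x F)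
  then show ?case by (simp add: free_ring_closed)
qed (simp_all add: free_ring_def)

text \<open>Operators for the free algebra only, before relations and adjoints enter. In this form
  it covers the generators of an abstract representation as well as the concrete shift
  operators.\<close>

locale free_rep =
  fixes n :: nat and D :: "'h::complex_inner set" and Z Y :: "nat \<Rightarrow> 'h \<Rightarrow> 'h"
  assumes sub: "complex_vector.subspace D"
    and lin: "j \<in> {1..n} \<Longrightarrow> clinear_on D (Z j)" "j \<in> {1..n} \<Longrightarrow> clinear_on D (Y j)"
    and inv: "j \<in> {1..n} \<Longrightarrow> d \<in> D \<Longrightarrow> Z j d \<in> D" "j \<in> {1..n} \<Longrightarrow> d \<in> D \<Longrightarrow> Y j d \<in> D"
begin

lemma letter_act_linear:
  assumes "letter_index x \<in> {1..n}" "d \<in> D"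
  shows "letter_act Z Y x d \<in> D" "e \<in> D \<Longrightarrow> letter_act Z Y x (d + e) = letter_act Z Y x d + letter_act Z Y x e"
    "letter_act Z Y x (c *\<^sub>C d) = c *\<^sub>C letter_act Z Y x d"
  using assms inv lin by (cases x; auto simp: clinear_on_def)+

lemma word_act_closed: "w \<in> words n \<Longrightarrow> d \<in> D \<Longrightarrow> word_act Z Y w d \<in> D"
  by (induction w) (auto intro: letter_act_linear)

lemma word_act_linear:
  assumes "w \<in> words n" "d \<in> D"
  shows "e \<in> D \<Longrightarrow> word_act Z Y w (d + e) = word_act Z Y w d + word_act Z Y w e"
    "word_act Z Y w (c *\<^sub>C d) = c *\<^sub>C word_act Z Y w d"
  using assms(1) by (induction w) (simp_all add: letter_act_linear word_act_closed assms(2))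

lemma word_act_zero: "w \<in> words n \<Longrightarrow> word_act Z Y w 0 = 0"
  using word_act_linear(2)[of w 0 0] complex_vector.subspace_0[OF sub] by simp

lemma word_act_sum:
  assumes w: "w \<in> words n" and f: "\<And>i. i \<in> S \<Longrightarrow> f i \<in> D"
  shows "word_act Z Y w (\<Sum>i\<in>S. c i *\<^sub>C f i) = (\<Sum>i\<in>S. c i *\<^sub>C word_act Z Y w (f i))"
  using f
proof (induction S rule: infinite_finite_induct)
  case (insert x S)
  have "(\<Sum>i\<in>S. c i *\<^sub>C f i) \<in> D"
    using insert.prems by (intro complex_vector.subspace_sum sub complex_vector.subspace_scale) auto
  then show ?case
    using insert by (simp add: word_act_linear[OF w] complex_vector.subspace_scale[OF sub])
qed (simp_all add: word_act_zero[OF w])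

lemma free_act_closed: "p \<in> carrier (free_ring n) \<Longrightarrow> d \<in> D \<Longrightarrow> free_act Z Y p d \<in> D"
  unfolding free_act_def free_ring_carrier
  by (intro complex_vector.subspace_sum sub complex_vector.subspace_scale word_act_closed) auto

lemma free_act_linear:
  assumes "p \<in> carrier (free_ring n)"
  shows "clinear_on D (free_act Z Y p)"
proof -
  have w: "w \<in> words n" if "w \<in> Poly_Mapping.keys p" for w using assms that by (auto simp: free_ring_carrier)
  show ?thesis
    unfolding clinear_on_def free_act_def
    by (auto simp: word_act_linear[OF w] scaleC_add_right sum.distrib complex_vector.scale_sum_right
        mult.commute intro!: sum.cong)
qed

lemma free_act_mult:
  assumes p: "p \<in> carrier (free_ring n)" "p' \<in> carrier (free_ring n)" and d: "d \<in> D"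
  shows "free_act Z Y (p * p') d = free_act Z Y p (free_act Z Y p' d)"
proof -
  let ?K = "Poly_Mapping.keys p" and ?K' = "Poly_Mapping.keys p'"
  let ?l = "Poly_Mapping.lookup"
  have "free_act Z Y (p * p') d =
    free_act Z Y ((\<Sum>v\<in>?K. Poly_Mapping.single v (?l p v)) * (\<Sum>w\<in>?K'. Poly_Mapping.single w (?l p' w))) d"
    by (simp only: free_alg_expand)
  also have "\<dots> = (\<Sum>v\<in>?K. \<Sum>w\<in>?K'. ?l p v *\<^sub>C (?l p' w *\<^sub>C word_act Z Y v (word_act Z Y w d)))"
    by (simp add: sum_product free_act_sum mult_single plus_list_def)
  also have "\<dots> = (\<Sum>v\<in>?K. ?l p v *\<^sub>C word_act Z Y v (\<Sum>w\<in>?K'. ?l p' w *\<^sub>C word_act Z Y w d))"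
  proof (rule sum.cong[OF refl])
    fix v assume "v \<in> ?K"
    then have v: "v \<in> words n" using p by (auto simp: free_ring_carrier)
    have "word_act Z Y v (\<Sum>w\<in>?K'. ?l p' w *\<^sub>C word_act Z Y w d) =
        (\<Sum>w\<in>?K'. ?l p' w *\<^sub>C word_act Z Y v (word_act Z Y w d))"
      using p d by (intro word_act_sum v word_act_closed) (auto simp: free_ring_carrier)
    then show "(\<Sum>w\<in>?K'. ?l p v *\<^sub>C (?l p' w *\<^sub>C word_act Z Y v (word_act Z Y w d))) =
        ?l p v *\<^sub>C word_act Z Y v (\<Sum>w\<in>?K'. ?l p' w *\<^sub>C word_act Z Y w d)"
      by (simp only: complex_vector.scale_sum_right)
  qed
  finally show ?thesis by (simp add: free_act_def)
qed

lemma free_act_const_mult: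
  "p \<in> carrier (free_ring n) \<Longrightarrow> d \<in> D \<Longrightarrow> free_act Z Y (oq_const c * p) d = c *\<^sub>C free_act Z Y p d"
  by (simp add: free_act_mult oq_const_carrier)

end

lemma free_act_intertwine:
  assumes "free_rep n D Z Y" "free_rep n D' Z' Y'"
    and T: "clinear_on D T" "T ` D \<subseteq> D'"
    and gens: "\<And>j d. j \<in> {1..n} \<Longrightarrow> d \<in> D \<Longrightarrow> T (Z j d) = Z' j (T d)"
      "\<And>j d. j \<in> {1..n} \<Longrightarrow> d \<in> D \<Longrightarrow> T (Y j d) = Y' j (T d)"
    and p: "p \<in> carrier (free_ring n)" and d: "d \<in> D"
  shows "T (free_act Z Y p d) = free_act Z' Y' p (T d)"
proof -
  interpret A: free_rep n D Z Y by fact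
  have w: "T (word_act Z Y w d) = word_act Z' Y' w (T d)" if "w \<in> words n" for w
    using that
  proof (induction w)
    case (Cons x w)
    then have "word_act Z Y w d \<in> D" by (intro A.word_act_closed d) auto
    then show ?case using Cons by (cases x) (auto simp: gens)
  qed simp
  have "T (\<Sum>w\<in>S. c w *\<^sub>C word_act Z Y w d) = (\<Sum>w\<in>S. c w *\<^sub>C word_act Z' Y' w (T d))"
    if "S \<subseteq> words n" for S c
    using that
  proof (induction S rule: infinite_finite_induct)
    case (insert x S)
    have "(\<Sum>w\<in>S. c w *\<^sub>C word_act Z Y w d) \<in> D"
      using insert.prems
      by (intro complex_vector.subspace_sum A.sub complex_vector.subspace_scale A.word_act_closed d)
        (use insert.prems in blast)
    moreover have "word_act Z Y x d \<in> D" using insert.prems by (intro A.word_act_closed d) auto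
    moreover have "c x *\<^sub>C word_act Z Y x d \<in> D"
      using calculation by (intro complex_vector.subspace_scale A.sub)
    ultimately show ?case
      using insert T(1) w[of x] by (simp add: clinear_on_def)
  qed (use clinear_on_zero[OF T(1)] complex_vector.subspace_0[OF A.sub] in auto)
  then show ?thesis using p unfolding free_act_def free_ring_carrier by auto
qed

lemma free_star_zgen [simp]: "free_star (zgen j) = zgen_star j" "free_star (zgen_star j) = zgen j"
  by (simp_all add: zgen_def zgen_star_def free_star_single word_star_def)

lemma Oq_carrier_class: "p \<in> carrier (free_ring n) \<Longrightarrow> oq_class q n p \<in> carrier (Oq q n)"
  by (auto simp: Oq_carrier)

lemma Oq_one: "\<one>\<^bsub>Oq q n\<^esub> = oq_class q n 1"
  by (simp add: Oq_simps FactRing_def oq_class_def free_ring_def)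

lemma single_carrier: "w \<in> words n \<Longrightarrow> Poly_Mapping.single w c \<in> carrier (free_ring n)"
  by (auto simp: free_ring_carrier)

lemma single_const: "Poly_Mapping.single w c = oq_const c * Poly_Mapping.single w 1"
  by (simp add: oq_const_def mult_single plus_list_def)

section \<open>Recovering a representation from its generators\<close>

context
  fixes q :: real and n :: nat and H D :: "'h::complex_hilbert set" and \<pi> :: "free_alg set \<Rightarrow> 'h \<Rightarrow> 'h"
  assumes n: "1 \<le> n" and rep: "star_rep (Oq q n) H D \<pi>"
begin

definition rep_gen :: "nat \<Rightarrow> 'h \<Rightarrow> 'h" where "rep_gen j = \<pi> (oq_class q n (zgen j))"
definition rep_gen_star :: "nat \<Rightarrow> 'h \<Rightarrow> 'h" where "rep_gen_star j = \<pi> (oq_class q n (zgen_star j))"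

lemma free_rep_of_star_rep: "free_rep n D rep_gen rep_gen_star"
proof
  show "complex_vector.subspace D" using rep by (simp add: star_rep_def dense_subspace_def)
  show "clinear_on D (rep_gen j)" "clinear_on D (rep_gen_star j)" if "j \<in> {1..n}" for j
    using star_rep_props(2,3)[OF rep] zgen_carrier[OF that]
    by (auto simp: clinear_on_def rep_gen_def rep_gen_star_def Oq_carrier_class)
  show "rep_gen j d \<in> D" "rep_gen_star j d \<in> D" if "j \<in> {1..n}" "d \<in> D" for j d
    using star_rep_props(1)[OF rep] zgen_carrier[OF that(1)] that(2)
    by (auto simp: rep_gen_def rep_gen_star_def Oq_carrier_class)
qed

lemma rep_gen_adjoint:
  assumes "j \<in> {1..n}" "d \<in> D" "e \<in> D"
  shows "cinner (rep_gen j d) e = cinner d (rep_gen_star j e)"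
  using star_rep_props(4)[OF rep Oq_carrier_class[OF zgen_carrier(1)[OF assms(1)]] assms(2,3)]
  by (simp add: rep_gen_def rep_gen_star_def Oq_class_ops(4)[OF n zgen_carrier(1)[OF assms(1)]])

lemma rep_word:
  assumes "w \<in> words n" "d \<in> D"
  shows "\<pi> (oq_class q n (Poly_Mapping.single w 1)) d = word_act rep_gen rep_gen_star w d"
  using assms(1)
proof (induction w)
  case Nil
  show ?case using rep assms by (simp add: star_rep_def Oq_one one_free_alg)
next
  case (Cons x w)
  let ?x = "Poly_Mapping.single [x] 1 :: free_alg" and ?w = "Poly_Mapping.single w 1 :: free_alg"
  have x: "?x \<in> carrier (free_ring n)" and w: "?w \<in> carrier (free_ring n)"
    using Cons.prems by (auto intro!: single_carrier)
  have "oq_class q n (Poly_Mapping.single (x # w) 1) = oq_class q n ?x \<otimes>\<^bsub>Oq q n\<^esub> oq_class q n ?w"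
    by (simp add: Oq_class_ops(2)[OF n x w] mult_single plus_list_def)
  then have "\<pi> (oq_class q n (Poly_Mapping.single (x # w) 1)) d =
      \<pi> (oq_class q n ?x) (\<pi> (oq_class q n ?w) d)"
    using rep assms(2) Oq_carrier_class[OF x] Oq_carrier_class[OF w] by (simp add: star_rep_def)
  also have "\<pi> (oq_class q n (Poly_Mapping.single w 1)) d = word_act rep_gen rep_gen_star w d"
    using Cons by simp
  also have "\<pi> (oq_class q n ?x) = letter_act rep_gen rep_gen_star x"
    by (cases x) (simp_all add: rep_gen_def rep_gen_star_def zgen_def zgen_star_def)
  finally show ?case by simp
qed

text \<open>The class of a word is the product of the classes of its letters, so the values on
  generators determine the whole representation.\<close>

lemma rep_free_act:
  assumes p: "p \<in> carrier (free_ring n)" and d: "d \<in> D"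
  shows "\<pi> (oq_class q n p) d = free_act rep_gen rep_gen_star p d"
proof -
  have "\<pi> (oq_class q n (\<Sum>w\<in>S. Poly_Mapping.single w (c w))) d =
      (\<Sum>w\<in>S. c w *\<^sub>C word_act rep_gen rep_gen_star w d)" if "finite S" "S \<subseteq> words n" for S c
    using that
  proof (induction S rule: finite_induct)
    case empty
    have "(1 :: free_alg) \<in> carrier (free_ring n)" by (simp add: free_ring_def zero_list_def)
    from Oq_class_ops(3)[OF n this, where c = 0 and q = q] Oq_carrier_class[OF this, of q]
    have eq: "0 \<odot>\<^bsub>Oq q n\<^esub> oq_class q n 1 = oq_class q n 0" and "oq_class q n 1 \<in> carrier (Oq q n)"
      by (simp_all add: oq_const_def)
    then have "\<pi> (0 \<odot>\<^bsub>Oq q n\<^esub> oq_class q n 1) d = 0 *\<^sub>C \<pi> (oq_class q n 1) d"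
      using rep d unfolding star_rep_def by blast
    then show ?case by (simp add: eq)
  next
    case (insert w S)
    let ?w = "Poly_Mapping.single w 1 :: free_alg"
    have w: "?w \<in> carrier (free_ring n)" "w \<in> words n" using insert.prems by (auto intro!: single_carrier)
    have cw: "Poly_Mapping.single w (c w) \<in> carrier (free_ring n)" using insert.prems by (intro single_carrier) auto
    have S: "(\<Sum>w\<in>S. Poly_Mapping.single w (c w)) \<in> carrier (free_ring n)"
      by (intro free_ring_sum single_carrier) (use insert.prems in blast)
    have "\<pi> (oq_class q n (Poly_Mapping.single w (c w))) d = c w *\<^sub>C word_act rep_gen rep_gen_star w d"
      unfolding single_const[of w "c w"] Oq_class_ops(3)[OF n w(1), symmetric]
      using rep d Oq_carrier_class[OF w(1)] by (simp add: star_rep_def rep_word[OF w(2) d])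
    then show ?case
      using rep d insert Oq_carrier_class[OF cw] Oq_carrier_class[OF S]
      by (simp add: star_rep_def flip: Oq_class_ops(1)[OF n cw S])
  qed
  from this[of "Poly_Mapping.keys p" "Poly_Mapping.lookup p"] p show ?thesis
    by (simp add: free_alg_expand free_act_def free_ring_carrier)
qed

end

lemma genideal_class_eq:
  assumes n: "1 \<le> n" and p: "p \<in> carrier (free_ring n)" "p' \<in> carrier (free_ring n)"
  shows "oq_class q n p = oq_class q n p' \<longleftrightarrow> p - p' \<in> oq_ideal q n"
proof -
  interpret ideal "oq_ideal q n" "free_ring n" by (rule ideal_oq_ideal[OF n])
  have minus: "p \<ominus>\<^bsub>free_ring n\<^esub> p' = p - p'"
  proof -
    have "- p' \<in> carrier (free_ring n)" using p by (simp add: free_ring_def)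
    then have "\<ominus>\<^bsub>free_ring n\<^esub> p' = - p'"
      using p by (intro minus_equality) (simp_all add: free_ring_def)
    then show ?thesis by (simp add: a_minus_def free_ring_def)
  qed
  show ?thesis
    unfolding oq_class_def minus[symmetric]
    using quotient_eq_iff_same_a_r_cos[OF ideal_axioms p] by simp
qed

text \<open>\<open>r3\<close> is the last relation of the algebra when \<open>a = n\<close>.\<close>

locale Oq_ops = free_rep n D Z Y for n D and Z Y :: "nat \<Rightarrow> 'h::complex_hilbert \<Rightarrow> 'h" +
  fixes q :: real and H G :: "'h set"
  assumes n: "1 \<le> n" and dense: "dense_subspace H D" and span: "D = complex_vector.span G"
    and adjoint: "j \<in> {1..n} \<Longrightarrow> x \<in> D \<Longrightarrow> y \<in> D \<Longrightarrow> cinner (Z j x) y = cinner x (Y j y)"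
    and r1: "1 \<le> a \<Longrightarrow> a < b \<Longrightarrow> b \<le> n \<Longrightarrow> d \<in> G \<Longrightarrow> Z a (Z b d) = complex_of_real q *\<^sub>C Z b (Z a d)"
    and r2: "a \<in> {1..n} \<Longrightarrow> b \<in> {1..n} \<Longrightarrow> a \<noteq> b \<Longrightarrow> d \<in> G \<Longrightarrow>
      Y b (Z a d) = complex_of_real q *\<^sub>C Z a (Y b d)"
    and r3: "a \<in> {1..n} \<Longrightarrow> d \<in> G \<Longrightarrow> Y a (Z a d) = complex_of_real (q\<^sup>2) *\<^sub>C Z a (Y a d) +
      complex_of_real (1 - q\<^sup>2) *\<^sub>C (d - (\<Sum>j\<in>{a<..n}. Z j (Y j d)))"
begin

lemma free_act_adjoint:
  assumes p: "p \<in> carrier (free_ring n)" and xy: "x \<in> D" "y \<in> D"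
  shows "cinner (free_act Z Y p x) y = cinner x (free_act Z Y (free_star p) y)"
proof -
  have word: "cinner (word_act Z Y w x) y = cinner x (word_act Z Y (word_star w) y)"
    if "w \<in> words n" "x \<in> D" "y \<in> D" for w x y
    using that
  proof (induction w arbitrary: y)
    case Nil
    then show ?case by (simp add: word_star_def)
  next
    case (Cons l w)
    have wD: "word_act Z Y w x \<in> D" using Cons.prems by (intro word_act_closed) auto
    have lD: "letter_act Z Y (letter_star l) y \<in> D"
      using Cons.prems by (intro letter_act_linear) (cases l; auto)+
    have "cinner (letter_act Z Y l (word_act Z Y w x)) y =
        cinner (word_act Z Y w x) (letter_act Z Y (letter_star l) y)"
    proof (cases l)
      case (Gen j)
      then show ?thesis using Cons.prems wD by (simp add: adjoint)
    next
      case (Gen_star j)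
      then have "cinner (Z j y) (word_act Z Y w x) = cinner y (Y j (word_act Z Y w x))"
        using Cons.prems wD by (simp add: adjoint)
      then show ?thesis using Gen_star by (metis cinner_commute letter_act.simps letter_star.simps(2))
    qed
    also have "\<dots> = cinner x (word_act Z Y (word_star w) (letter_act Z Y (letter_star l) y))"
      using Cons.prems lD by (intro Cons.IH) auto
    finally show ?case by (simp add: word_star_def)
  qed
  let ?K = "Poly_Mapping.keys p"
  have "free_act Z Y (free_star p) y = (\<Sum>w\<in>?K. cnj (Poly_Mapping.lookup p w) *\<^sub>C word_act Z Y (word_star w) y)"
    by (simp add: free_star_def free_act_sum)
  moreover have "cinner (Poly_Mapping.lookup p w *\<^sub>C word_act Z Y w x) y =
      cinner x (cnj (Poly_Mapping.lookup p w) *\<^sub>C word_act Z Y (word_star w) y)" if "w \<in> ?K" for w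
    using word[OF _ xy, of w] p that by (auto simp: cinner_simps free_ring_carrier)
  ultimately show ?thesis unfolding free_act_def[of Z Y p] by (simp add: cinner_sum)
qed

lemma relators_act_zero_gens:
  assumes "p \<in> oq_relators q n" and d: "d \<in> G" shows "free_act Z Y p d = 0"
proof -
  have dD: "d \<in> D" using d unfolding span by (rule complex_vector.span_base)
  note act = free_act_mult zgen_carrier free_act_diff free_act_add free_act_sum free_ring_sum
    free_ring_closed oq_const_carrier
  have last: "zgen_star n * zgen n - (oq_const (q\<^sup>2) * (zgen n * zgen_star n) + oq_const (1 - q\<^sup>2)) =
    zgen_star n * zgen n - (oq_const (q\<^sup>2) * (zgen n * zgen_star n)
        - oq_const (1 - q\<^sup>2) * (\<Sum>j\<in>{n<..n}. zgen j * zgen_star j) + oq_const (1 - q\<^sup>2))" by simp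
  have r3': "free_act Z Y (zgen_star k * zgen k - (oq_const (q\<^sup>2) * (zgen k * zgen_star k)
        - oq_const (1 - q\<^sup>2) * (\<Sum>j\<in>{k<..n}. zgen j * zgen_star j) + oq_const (1 - q\<^sup>2))) d = 0"
    if k: "k \<in> {1..n}" for k
  proof -
    have s: "(\<Sum>j\<in>{k<..n}. zgen j * zgen_star j) \<in> carrier (free_ring n)"
      using k by (intro free_ring_sum free_ring_closed zgen_carrier) auto
    have "free_act Z Y (\<Sum>j\<in>{k<..n}. zgen j * zgen_star j) d = (\<Sum>j\<in>{k<..n}. Z j (Y j d))"
      using k dD by (auto simp: act intro!: sum.cong)
    then show ?thesis
      using k s dD r3[OF k d] by (simp add: act inv complex_vector.scale_right_diff_distrib)
  qed
  from assms(1) show ?thesis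
    unfolding oq_relators_def
  proof (elim UnE CollectE exE conjE singletonE, goal_cases)
    case (1 k l)
    then have "k \<in> {1..n}" "l \<in> {1..n}" by auto
    then show ?case using r1[OF 1(2-4) d] dD by (simp add: 1(1) act inv)
  next
    case (2 k l)
    then show ?case using r2[OF 2(2-4) d] dD by (simp add: 2(1) act inv)
  next
    case (3 k)
    then show ?case using r3'[of k] by simp
  next
    case 4
    then show ?case using r3'[of n] n unfolding last by simp
  qed
qed

lemma relators_act_zero:
  assumes p: "p \<in> oq_relators q n" and d: "d \<in> D" shows "free_act Z Y p d = 0"
proof -
  have pc: "p \<in> carrier (free_ring n)" using p oq_relators_carrier[OF n] by blast
  have lin: "clinear_on D (free_act Z Y p)" by (rule free_act_linear[OF pc])
  have "complex_vector.span G \<subseteq> {d \<in> D. free_act Z Y p d = 0}"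
  proof (rule complex_vector.span_minimal)
    show "complex_vector.subspace {d \<in> D. free_act Z Y p d = 0}"
      using lin clinear_on_zero[OF lin]
      by (auto simp: complex_vector.subspace_def clinear_on_def span complex_vector.span_zero
          complex_vector.span_add complex_vector.span_scale)
    show "G \<subseteq> {d \<in> D. free_act Z Y p d = 0}"
      using relators_act_zero_gens[OF p] by (auto simp: span intro: complex_vector.span_base)
  qed
  then show ?thesis using d span by blast
qed

text \<open>The elements acting by 0 form an ideal. The adjoint relators come for free: the squared
  norm of \<open>free_star p\<close> acting on \<open>d\<close> is the inner product of
  \<open>d\<close> with \<open>p\<close> acting on another vector of \<open>D\<close>, hence
  0.\<close>

lemma ideal_act_zero:
  assumes p: "p \<in> oq_ideal q n" and d: "d \<in> D" shows "free_act Z Y p d = 0"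
proof -
  let ?R = "free_ring n" and ?J = "{p \<in> carrier (free_ring n). \<forall>d\<in>D. free_act Z Y p d = 0}"
  interpret ring ?R by (rule ring_free_ring)
  have star0: "free_act Z Y (free_star p) d = 0" if "p \<in> oq_relators q n" "d \<in> D" for p d
  proof -
    have p: "p \<in> carrier ?R" using that oq_relators_carrier[OF n] by blast
    have "free_act Z Y (free_star p) d \<in> D" by (intro free_act_closed free_star_carrier p that)
    then have "cinner (free_act Z Y (free_star p) d) (free_act Z Y (free_star p) d) =
        cinner d (free_act Z Y p (free_act Z Y (free_star p) d))"
      using free_act_adjoint[OF free_star_carrier[OF p] that(2)] by simp
    also have "\<dots> = 0"
      using relators_act_zero[OF that(1)] free_act_closed[OF free_star_carrier[OF p] that(2)] by simp
    finally show ?thesis by simp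
  qed
  have "ideal ?J ?R"
  proof (rule idealI[OF ring_free_ring])
    show "subgroup ?J (add_monoid ?R)"
    proof (rule add.subgroupI)
      have "0 \<in> ?J" by (simp add: free_ring_def)
      then show "?J \<noteq> {}" by blast
      fix x assume x: "x \<in> ?J"
      have "- x \<in> carrier ?R" using x by (simp add: free_ring_def)
      then have "\<ominus>\<^bsub>?R\<^esub> x = - x"
        using x by (intro minus_equality) (simp_all add: free_ring_def)
      then show "\<ominus>\<^bsub>?R\<^esub> x \<in> ?J" using x \<open>- x \<in> carrier ?R\<close> by (simp add: free_act_uminus)
    next
      fix x y assume "x \<in> ?J" "y \<in> ?J"
      then have "x + y \<in> ?J" by (simp add: free_act_add free_ring_closed)
      then show "x \<oplus>\<^bsub>?R\<^esub> y \<in> ?J" by (simp add: free_ring_def)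
    qed auto
  next
    fix a x assume "a \<in> ?J" "x \<in> carrier ?R"
    then have "x * a \<in> ?J" "a * x \<in> ?J"
      using clinear_on_zero[OF free_act_linear[of x] complex_vector.subspace_0[OF sub]]
      by (auto simp: free_act_mult free_ring_closed free_act_closed)
    then show "x \<otimes>\<^bsub>?R\<^esub> a \<in> ?J" "a \<otimes>\<^bsub>?R\<^esub> x \<in> ?J" by (simp_all add: free_ring_def)
  qed
  moreover have "oq_relators q n \<union> free_star ` oq_relators q n \<subseteq> ?J"
    using oq_relators_carrier[OF n, of q] relators_act_zero star0 by (auto simp: free_star_carrier)
  ultimately have "oq_ideal q n \<subseteq> ?J"
    unfolding oq_ideal_def by (rule genideal_minimal)
  then show ?thesis using p d by blast
qed

text \<open>A representative of the class is chosen; by \<open>ideal_act_zero\<close> all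
  representatives act alike on \<open>D\<close>.\<close>

definition quotient_rep :: "free_alg set \<Rightarrow> 'h \<Rightarrow> 'h"
  where "quotient_rep a = free_act Z Y (SOME p. p \<in> carrier (free_ring n) \<and> oq_class q n p = a)"

lemma quotient_rep_class:
  assumes p: "p \<in> carrier (free_ring n)" and d: "d \<in> D"
  shows "quotient_rep (oq_class q n p) d = free_act Z Y p d"
proof -
  define p' where "p' = (SOME p'. p' \<in> carrier (free_ring n) \<and> oq_class q n p' = oq_class q n p)"
  have p': "p' \<in> carrier (free_ring n) \<and> oq_class q n p' = oq_class q n p"
    unfolding p'_def by (rule someI[of _ p]) (use p in simp)
  then have "p' - p \<in> oq_ideal q n" using genideal_class_eq[OF n _ p] by blast
  then have "free_act Z Y (p' - p) d = 0" by (rule ideal_act_zero[OF _ d])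
  then show ?thesis by (simp add: quotient_rep_def p'_def[symmetric] free_act_diff)
qed

lemma star_rep_quotient_rep: "star_rep (Oq q n) H D quotient_rep"
proof -
  have adj: "adj H D (quotient_rep (oq_class q n p)) d = free_act Z Y (free_star p) d"
    if p: "p \<in> carrier (free_ring n)" and d: "d \<in> D" for p d
  proof (rule adj_eqI[OF dense])
    show "free_act Z Y (free_star p) d \<in> H"
      using free_act_closed[OF free_star_carrier[OF p] d] dense by (auto simp: dense_subspace_def)
    show "cinner (quotient_rep (oq_class q n p) x) d = cinner x (free_act Z Y (free_star p) d)"
      if "x \<in> D" for x
      using that d p by (simp add: quotient_rep_class free_act_adjoint)
  qed
  note cls = quotient_rep_class free_act_closed
  have D0: "x + y \<in> D" "c *\<^sub>C x \<in> D" if "x \<in> D" "y \<in> D" for x y c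
    using that sub by (auto simp: complex_vector.subspace_add complex_vector.subspace_scale)
  have "quotient_rep a \<in> Lplus H D" if a: "a \<in> carrier (Oq q n)" for a
  proof -
    obtain p where p: "p \<in> carrier (free_ring n)" "a = oq_class q n p" using a by (auto simp: Oq_carrier)
    have "d \<in> adj_dom H D (quotient_rep a)" if d: "d \<in> D" for d
      unfolding adj_dom_def
    proof (intro CollectI conjI bexI ballI)
      show "d \<in> H" "free_act Z Y (free_star p) d \<in> H"
        using free_act_closed[OF free_star_carrier[OF p(1)] d] d dense by (auto simp: dense_subspace_def)
      show "cinner (quotient_rep a x) d = cinner x (free_act Z Y (free_star p) d)" if "x \<in> D" for x
        using that d p by (simp add: quotient_rep_class free_act_adjoint)
    qed
    then show ?thesis
      using p(1) free_act_linear[OF p(1)] D0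
      by (auto simp: Lplus_def p(2) clinear_on_def cls adj free_star_carrier)
  qed
  then show ?thesis
    unfolding star_rep_def
  proof (intro conjI ballI allI)
    fix a b d c assume a: "a \<in> carrier (Oq q n)" and b: "b \<in> carrier (Oq q n)" and d: "d \<in> D"
    obtain p p' where p: "p \<in> carrier (free_ring n)" "a = oq_class q n p"
      "p' \<in> carrier (free_ring n)" "b = oq_class q n p'" using a b by (auto simp: Oq_carrier)
    show "quotient_rep (a \<oplus>\<^bsub>Oq q n\<^esub> b) d = quotient_rep a d + quotient_rep b d"
      "quotient_rep (a \<otimes>\<^bsub>Oq q n\<^esub> b) d = quotient_rep a (quotient_rep b d)"
      using p d by (simp_all add: Oq_class_ops[OF n] cls free_ring_closed free_act_add free_act_mult)
  next
    fix a d and c :: complex assume a: "a \<in> carrier (Oq q n)" and d: "d \<in> D"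
    obtain p where p: "p \<in> carrier (free_ring n)" "a = oq_class q n p" using a by (auto simp: Oq_carrier)
    show "quotient_rep (c \<odot>\<^bsub>Oq q n\<^esub> a) d = c *\<^sub>C quotient_rep a d"
      "quotient_rep (star (Oq q n) a) d = adj H D (quotient_rep a) d"
      using p d by (simp_all add: Oq_class_ops[OF n] cls free_ring_closed oq_const_carrier
          free_act_const_mult free_star_carrier adj)
  next
    have "(1 :: free_alg) \<in> carrier (free_ring n)" by (simp add: free_ring_def zero_list_def)
    then show "quotient_rep \<one>\<^bsub>Oq q n\<^esub> d = d" if "d \<in> D" for d
      using that by (simp add: Oq_one cls)
  qed (use dense in auto)
qed

end

section \<open>Finitely supported vectors\<close>

lemma ket_add: "ket i (x + y) = ket i x + ket i y"
  by (rule ell2_eqI) (simp add: coord_ket)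

lemma ket_scaleC: "ket i (c *\<^sub>C x) = c *\<^sub>C ket i x"
  by (rule ell2_eqI) (simp add: coord_ket)

lemma ket_zero [simp]: "ket i 0 = 0"
  by (rule ell2_eqI) (simp add: coord_ket)

lemma ket_eq_zero_iff [simp]: "ket i x = 0 \<longleftrightarrow> x = 0"
  by (metis coord_ket coord_zero ket_zero)

lemma ket_diff: "ket i (x - y) = ket i x - ket i y"
  by (rule ell2_eqI) (simp add: coord_ket)

lemma coord_scaleR [simp]: "coord (r *\<^sub>R f :: ('i, 'a::complex_inner) ell2) i = r *\<^sub>R coord f i"
  by (simp add: scaleR_scaleC)

lemma coord_sum: "coord (sum f S) i = (\<Sum>x\<in>S. coord (f x) i)"
  by (induction S rule: infinite_finite_induct) simp_all

lemma ket_sum: "ket i (sum f S) = (\<Sum>x\<in>S. ket i (f x))"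
  by (induction S rule: infinite_finite_induct) (simp_all add: ket_add)

lemma cinner_ket: "cinner f (ket i y) = cinner (coord f i) y"
proof -
  have "cinner f (ket i y) = infsum (\<lambda>j. cinner (coord f j) (if j = i then y else 0)) {i}"
    unfolding cinner_ell2_def coord_ket by (rule infsum_cong_neutral) auto
  then show ?thesis by simp
qed

lemma cinner_ket_left: "cinner (ket i y) f = cinner y (coord f i)"
  by (metis cinner_commute cinner_ket)

lemma norm_ket: "norm (ket i x) = norm x"
proof -
  have "(norm (ket i x))\<^sup>2 = (norm x)\<^sup>2" by (simp add: norm_sq_cinner cinner_ket coord_ket)
  then show ?thesis by simp
qed

lemma norm_coord_le: "norm (coord f i) \<le> norm f"
  using ell2_partial_le[of "{i}" f] by (simp add: power2_le_iff_abs_le)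

lemma bounded_linear_coord: "bounded_linear (\<lambda>f. coord f i)"
  by (rule bounded_linear_intro[of _ 1]) (simp_all add: norm_coord_le)

definition fin_supp :: "('i, 'a::complex_inner) ell2 \<Rightarrow> bool"
  where "fin_supp f \<longleftrightarrow> finite {i. coord f i \<noteq> 0}"

text \<open>For \<open>M = UNIV\<close> this becomes the domain of the series, and for a reducing
  subspace \<open>M\<close> of \<K> the domain of a subrepresentation.\<close>

definition fdom :: "'i set \<Rightarrow> 'a set \<Rightarrow> ('i, 'a::complex_inner) ell2 set"
  where "fdom I M = {f. fin_supp f \<and> (\<forall>i. coord f i \<noteq> 0 \<longrightarrow> i \<in> I \<and> coord f i \<in> M)}"

definition fspace :: "'i set \<Rightarrow> 'a set \<Rightarrow> ('i, 'a::complex_inner) ell2 set"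
  where "fspace I M = {f. \<forall>i. (i \<notin> I \<longrightarrow> coord f i = 0) \<and> coord f i \<in> M}"

lemma ket_expand: "fin_supp f \<Longrightarrow> f = (\<Sum>i | coord f i \<noteq> 0. ket i (coord f i))"
  by (rule ell2_eqI) (simp add: coord_sum coord_ket fin_supp_def sum.delta)

lemma fdom_subspace:
  assumes M: "complex_vector.subspace M" shows "complex_vector.subspace (fdom I M)"
proof -
  note sub = complex_vector.subspace_0[OF M] complex_vector.subspace_add[OF M]
    complex_vector.subspace_scale[OF M]
  have add: "f + g \<in> fdom I M" if f: "f \<in> fdom I M" and g: "g \<in> fdom I M" for f g
  proof -
    have "{i. coord (f + g) i \<noteq> 0} \<subseteq> {i. coord f i \<noteq> 0} \<union> {i. coord g i \<noteq> 0}" by auto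
    then have "fin_supp (f + g)" using f g by (auto simp: fdom_def fin_supp_def elim: finite_subset)
    moreover have "coord f i \<in> M" "coord g i \<in> M" for i
      using f g sub(1) by (cases "coord f i = 0"; cases "coord g i = 0"; auto simp: fdom_def)+
    then have "coord (f + g) i \<in> M" for i using sub(2) by simp
    moreover have "i \<in> I" if "coord (f + g) i \<noteq> 0" for i
      using that f g by (cases "coord f i = 0") (auto simp: fdom_def)
    ultimately show ?thesis by (auto simp: fdom_def)
  qed
  have scale: "c *\<^sub>C f \<in> fdom I M" if f: "f \<in> fdom I M" for c f
  proof -
    have "{i. coord (c *\<^sub>C f) i \<noteq> 0} \<subseteq> {i. coord f i \<noteq> 0}" by auto
    then have "fin_supp (c *\<^sub>C f)" using f by (auto simp: fdom_def fin_supp_def elim: finite_subset)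
    then show ?thesis using f sub(3) by (auto simp: fdom_def)
  qed
  show ?thesis
  proof (intro complex_vector.subspaceI add scale)
    show "0 \<in> fdom I M" by (simp add: fdom_def fin_supp_def)
  qed
qed

lemma ket_in_fdom: "i \<in> I \<Longrightarrow> x \<in> M \<Longrightarrow> ket i x \<in> fdom I M"
  by (auto simp: fdom_def fin_supp_def coord_ket)

lemma fdom_span:
  assumes M: "complex_vector.subspace M"
  shows "fdom I M = complex_vector.span {ket i \<eta> | i \<eta>. i \<in> I \<and> \<eta> \<in> M}"
proof
  show "fdom I M \<subseteq> complex_vector.span {ket i \<eta> | i \<eta>. i \<in> I \<and> \<eta> \<in> M}"
  proof
    fix f assume f: "f \<in> fdom I M"
    then have "f = (\<Sum>i | coord f i \<noteq> 0. ket i (coord f i))" by (intro ket_expand) (simp add: fdom_def)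
    also have "\<dots> \<in> complex_vector.span {ket i \<eta> | i \<eta>. i \<in> I \<and> \<eta> \<in> M}"
      using f by (intro complex_vector.span_sum complex_vector.span_base) (auto simp: fdom_def)
    finally show "f \<in> complex_vector.span {ket i \<eta> | i \<eta>. i \<in> I \<and> \<eta> \<in> M}" .
  qed
  show "complex_vector.span {ket i \<eta> | i \<eta>. i \<in> I \<and> \<eta> \<in> M} \<subseteq> fdom I M"
    by (rule complex_vector.span_minimal[OF _ fdom_subspace[OF M]]) (auto intro: ket_in_fdom)
qed

text \<open>Truncation to a finite index set carrying all but \<open>e^2\<close> of the squared norm
  leaves an error orthogonal to the truncation.\<close>

lemma dense_fdom:
  assumes M: "complex_vector.subspace M" "closed M"
  shows "dense_subspace (fspace I M) (fdom I M)"
  unfolding dense_subspace_def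
proof (intro conjI)
  note sub = complex_vector.subspace_0[OF M(1)] complex_vector.subspace_add[OF M(1)]
    complex_vector.subspace_scale[OF M(1)]
  show "complex_vector.subspace (fspace I M)"
    by (auto simp: complex_vector.subspace_def fspace_def sub)
  show "complex_vector.subspace (fdom I M)" by (rule fdom_subspace[OF M(1)])
  show "fdom I M \<subseteq> fspace I M"
    by (auto simp: fdom_def fspace_def) (metis sub(1))
  have "coord f i \<in> M" if "\<forall>i. coord f i \<in> (if i \<in> I then M else {0})" for f i
    using that[rule_format, of i] sub(1) by (auto split: if_splits)
  then have "fspace I M = (\<Inter>i. (\<lambda>f. coord f i) -` (if i \<in> I then M else {0}))"
    by (auto simp: fspace_def split: if_splits)
  moreover have "closed ((\<lambda>f. coord f i) -` (if i \<in> I then M else {0}))" for i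
    using M(2) by (intro continuous_closed_vimage linear_continuous_at bounded_linear_coord) auto
  ultimately show "closed (fspace I M)" by auto
  show "fspace I M \<subseteq> closure (fdom I M)"
  proof
    fix f assume f: "f \<in> fspace I M"
    show "f \<in> closure (fdom I M)"
      unfolding closure_approachable
    proof (intro allI impI)
      fix e :: real assume e: "0 < e"
      have "((\<lambda>i. (norm (coord f i))\<^sup>2) has_sum (norm f)\<^sup>2) UNIV"
        unfolding norm_ell2_sq by (rule has_sum_infsum[OF summable_coord])
      then have "\<forall>\<^sub>F F in finite_subsets_at_top UNIV. dist (\<Sum>i\<in>F. (norm (coord f i))\<^sup>2) ((norm f)\<^sup>2) < e\<^sup>2"
        using e unfolding has_sum_def by (intro tendstoD) auto
      then obtain F where F: "finite F" "dist (\<Sum>i\<in>F. (norm (coord f i))\<^sup>2) ((norm f)\<^sup>2) < e\<^sup>2"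
        unfolding eventually_finite_subsets_at_top by blast
      define g where "g = (\<Sum>i\<in>F. ket i (coord f i))"
      have cg: "coord g i = (if i \<in> F then coord f i else 0)" for i
        using F by (simp add: g_def coord_sum coord_ket sum.delta)
      have "ket i (coord f i) \<in> fdom I M" for i
        using f by (cases "i \<in> I")
          (auto simp: fspace_def intro!: ket_in_fdom complex_vector.subspace_0[OF fdom_subspace[OF M(1)]])
      then have gD: "g \<in> fdom I M"
        unfolding g_def by (intro complex_vector.subspace_sum fdom_subspace[OF M(1)])
      have fg: "cinner h g = (\<Sum>i\<in>F. cinner (coord h i) (coord f i))" for h
        by (simp add: g_def cinner_sum cinner_ket)
      have "cinner f g = complex_of_real (\<Sum>i\<in>F. (norm (coord f i))\<^sup>2)"
        "cinner g g = complex_of_real (\<Sum>i\<in>F. (norm (coord f i))\<^sup>2)"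
        unfolding fg by (simp_all add: cg cinner_self)
      moreover from this have "cinner g f = complex_of_real (\<Sum>i\<in>F. (norm (coord f i))\<^sup>2)"
        using cinner_commute[of g f] by simp
      ultimately have "(norm (g - f))\<^sup>2 = (norm f)\<^sup>2 - (\<Sum>i\<in>F. (norm (coord f i))\<^sup>2)"
        by (simp only: norm_sq_cinner[of "g - f"] norm_sq_cinner[of f] cinner_diff minus_complex.sel Re_complex_of_real)
      then have "(norm (g - f))\<^sup>2 < e\<^sup>2" using F(2) by (simp add: dist_real_def)
      then have "dist g f < e" using e power_less_imp_less_base by (fastforce simp: dist_norm)
      then show "\<exists>g\<in>fdom I M. dist g f < e" using gD by blast
    qed
  qed
qed

text \<open>A weighted composition operator; it is meant for finitely supported \<open>f\<close> and injective \<open>t\<close>,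
  otherwise \<open>Abs_ell2\<close> may be applied outside its domain.\<close>

definition wop :: "('i \<Rightarrow> 'i) \<Rightarrow> ('i \<Rightarrow> 'a \<Rightarrow> 'a) \<Rightarrow> ('i, 'a::complex_inner) ell2 \<Rightarrow> ('i, 'a) ell2"
  where "wop t u f = Abs_ell2 (\<lambda>j. u j (coord f (t j)))"

lemma coord_wop:
  assumes f: "fin_supp f" and t: "inj t" and u: "\<And>j. u j 0 = 0"
  shows "coord (wop t u f) j = u j (coord f (t j))" "fin_supp (wop t u f)"
proof -
  let ?S = "{j. u j (coord f (t j)) \<noteq> 0}"
  have "?S \<subseteq> t -` {i. coord f i \<noteq> 0}" using u by auto
  then have fin: "finite ?S" using f finite_vimageI[OF _ t] unfolding fin_supp_def by (metis finite_subset)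
  have "(\<lambda>j. (norm (u j (coord f (t j))))\<^sup>2) summable_on UNIV \<longleftrightarrow>
      (\<lambda>j. (norm (u j (coord f (t j))))\<^sup>2) summable_on ?S"
    by (rule summable_on_cong_neutral) auto
  then have "(\<lambda>j. (norm (u j (coord f (t j))))\<^sup>2) summable_on UNIV" using fin by simp
  then show c: "coord (wop t u f) j = u j (coord f (t j))" for j
    by (simp add: wop_def Abs_ell2_inverse)
  then show "fin_supp (wop t u f)" using fin by (simp add: fin_supp_def)
qed

section \<open>The operators of the series\<close>

lemma lambda_q_sq:
  assumes "0 < q" "q < 1" "0 \<le> j" shows "lambda_q q j * lambda_q q j = 1 - q powi (2 * j)"
proof -
  have "q powi (2 * j) \<le> q powi 0" using assms by (intro power_int_decreasing) auto
  then show ?thesis using assms by (simp add: lambda_q_def)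
qed

lemma beta_q_sq:
  assumes "0 < q" "q < 1" "0 \<le> j" shows "beta_q q j * beta_q q j = q powi (- 2 * j) - 1"
proof -
  have "q powi 0 \<le> q powi (- 2 * j)" using assms by (intro power_int_decreasing) auto
  then show ?thesis using assms by (simp add: beta_q_def)
qed

lemma lambda_q_0 [simp]: "lambda_q q 0 = 0" and beta_q_0 [simp]: "beta_q q 0 = 0"
  by (simp_all add: lambda_q_def beta_q_def)

text \<open>The spectral hypotheses on \<open>A\<close> are replaced by the bounds they imply, and
  the adjoint of \<open>v\<close> is an explicit parameter \<open>w\<close>. The conditions on
  \<open>A\<close> do not involve \<open>m\<close>, \<open>l\<close>, \<open>k\<close>, so one
  \<open>A\<close> can serve for another series.\<close>

locale series =
  fixes q :: real and m l k :: nat and A v w :: "'k::complex_hilbert \<Rightarrow> 'k"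
  assumes q: "0 < q" "q < 1" and n1: "1 \<le> m + l + k"
    and A: "adjp A A" and A_le: "norm (A x) \<le> norm x" and A_low: "q * norm x \<le> norm (A x)"
    and A_ker: "A (A x) = q\<^sup>2 *\<^sub>R x \<Longrightarrow> x = 0" and A_pos: "q * (norm x)\<^sup>2 \<le> Re (cinner (A x) x)"
    and A_surj: "surj A"
    and v: "0 < l \<Longrightarrow> adjp v w" "0 < l \<Longrightarrow> v (w x) = x" "0 < l \<Longrightarrow> w (v x) = x"
      "0 < l \<Longrightarrow> A (v x) = v (A x)"
begin

abbreviation "n \<equiv> m + l + k"
abbreviation "I \<equiv> series_index m l k"
abbreviation mu where "mu j \<equiv> mu_op q j (A \<circ> A)"

text \<open>The generator \<open>z\<^sub>j\<close> maps \<open>\<eta>\<^sub>i\<close> to \<open>q\<^bsup>ex j i\<^esup> (C j i \<eta>)\<close> at the index \<open>i + sh j\<close>. For \<open>k < j < l + k\<close>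
  the operator \<open>C j i\<close> vanishes.\<close>

definition sh :: "nat \<Rightarrow> nat \<Rightarrow> int"
  where "sh j x = (if l + k < j then (if x = j then 1 else 0)
    else if j \<le> k then (if x = j then - 1 else 0)
    else if j = l + k then (if 0 < k \<and> x = k then - 1 else 0) else 0)"

abbreviation up where "up j i \<equiv> (\<lambda>x. i x + sh j x)"
abbreviation dn where "dn j i \<equiv> (\<lambda>x. i x - sh j x)"

definition S :: "(nat \<Rightarrow> int) \<Rightarrow> int" where "S i = (\<Sum>s\<in>{l + k<..n}. i s)"

definition ex :: "nat \<Rightarrow> (nat \<Rightarrow> int) \<Rightarrow> int"
  where "ex j i = (if l + k < j then (\<Sum>s\<in>{j<..n}. i s)
    else if j < k then S i - (\<Sum>s\<in>{j<..k}. i s)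
    else if j = k then (if l = 0 then S i else S i - (i k - 1))
    else if j = l + k then S i else 0)"

definition C :: "nat \<Rightarrow> (nat \<Rightarrow> int) \<Rightarrow> 'k \<Rightarrow> 'k"
  where "C j i = (if l + k < j then (\<lambda>\<eta>. lambda_q q (i j + 1) *\<^sub>R \<eta>)
    else if j < k then (\<lambda>\<eta>. beta_q q (i j - 1) *\<^sub>R A \<eta>)
    else if j = k then (if l = 0 then mu (i k - 1) else A)
    else if j = l + k then v else (\<lambda>_. 0))"

text \<open>Every coefficient operator other than \<open>v\<close> is self-adjoint, so only
  \<open>v\<close> is replaced, by its adjoint \<open>w\<close>.\<close>

definition Cs :: "nat \<Rightarrow> (nat \<Rightarrow> int) \<Rightarrow> 'k \<Rightarrow> 'k"
  where "Cs j i = (if j = l + k \<and> 0 < l then w else C j i)"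

definition wt where "wt j i \<eta> = (q powi ex j i) *\<^sub>R C j i \<eta>"
definition wts where "wts j i \<eta> = (q powi ex j i) *\<^sub>R Cs j i \<eta>"

text \<open>The coefficient of a generator is attached to the index from which it starts. For
  \<open>Z\<close> this is \<open>dn j i\<close>; for the adjoint \<open>Y\<close> it is the index
  \<open>i\<close> of arrival, so both share \<open>ex\<close>.\<close>

definition Z :: "nat \<Rightarrow> (nat \<Rightarrow> int, 'k) ell2 \<Rightarrow> (nat \<Rightarrow> int, 'k) ell2"
  where "Z j = wop (dn j) (\<lambda>i. wt j (dn j i))"
definition Y :: "nat \<Rightarrow> (nat \<Rightarrow> int, 'k) ell2 \<Rightarrow> (nat \<Rightarrow> int, 'k) ell2"
  where "Y j = wop (up j) (wts j)"

lemma mu: "adjp (mu j) (mu j)" "mu j (mu j x) = x + (q powi (- 2 * j)) *\<^sub>R A (A x)"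
  using mu_op_props(1,2)[OF q(1) A] by blast+

lemma mu_comm: "A (mu j x) = mu j (A x)" "mu i (mu j x) = mu j (mu i x)"
proof -
  have Amu: "A (mu j x) = mu j (A x)" for j x
    by (rule mu_op_props(3)[OF q(1) A A]) simp
  then show "A (mu j x) = mu j (A x)" .
  show "mu i (mu j x) = mu j (mu i x)"
    by (rule mu_op_props(3)[OF q(1) A mu(1)]) (simp add: Amu)
qed

lemma w_comm: "0 < l \<Longrightarrow> A (w x) = w (A x)"
  using v(2-4) by metis

lemma C_adjoint: "adjp (C j i) (Cs j i)"
proof -
  have "adjp (\<lambda>_. 0) (\<lambda>_. 0 :: 'k)" by (simp add: adjp_def)
  then show ?thesis
    unfolding C_def Cs_def using A v(1) mu(1) by (auto intro: adjp_scaleR adjp_id)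
qed

lemma C_linear: "C j i (x + y) = C j i x + C j i y" "C j i (c *\<^sub>C x) = c *\<^sub>C C j i x" "C j i 0 = 0"
  "C j i (r *\<^sub>R x) = r *\<^sub>R C j i x"
  by (rule adjp_linear[OF C_adjoint])+

lemma Cs_linear: "Cs j i (x + y) = Cs j i x + Cs j i y" "Cs j i (c *\<^sub>C x) = c *\<^sub>C Cs j i x" "Cs j i 0 = 0"
  "Cs j i (r *\<^sub>R x) = r *\<^sub>R Cs j i x"
  by (rule adjp_linear[OF adjp_sym[OF C_adjoint]])+

lemma wt_linear [simp]: "wt j i (x + y) = wt j i x + wt j i y" "wt j i (c *\<^sub>C x) = c *\<^sub>C wt j i x" "wt j i 0 = 0"
  "wts j i (x + y) = wts j i x + wts j i y" "wts j i (c *\<^sub>C x) = c *\<^sub>C wts j i x" "wts j i 0 = 0"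
  by (simp_all add: wt_def wts_def C_linear Cs_linear scaleR_add_right scaleR_scaleC scaleC_add_right mult.commute)

lemma wt_adjoint: "adjp (wt j i) (wts j i)"
  unfolding wt_def wts_def by (intro adjp_scaleR C_adjoint)

lemma C_comm:
  "C a i (C b j x) = C b j (C a i x)" "C a i (Cs b j x) = Cs b j (C a i x)"
  by (auto simp: C_def Cs_def mu_comm adjp_linear[OF A] adjp_linear[OF mu(1)] v w_comm
      adjp_linear[OF v(1)] adjp_linear[OF adjp_sym[OF v(1)]])

lemma sum_sh: "(\<Sum>s\<in>{a<..b}. sh j s) = (if l + k < j then (if a < j \<and> j \<le> b then 1 else 0)
    else if j \<le> k then (if a < j \<and> j \<le> b then - 1 else 0)
    else if j = l + k then (if 0 < k \<and> a < k \<and> k \<le> b then - 1 else 0) else 0)"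
  unfolding sh_def by (cases "0 < k") (auto simp: sum.delta cong: if_cong)

text \<open>The positions of the generators that vanish identically; there are none for
  \<open>l\<close> at most 1.\<close>

definition null :: "nat \<Rightarrow> bool" where "null j \<longleftrightarrow> k < j \<and> j < l + k"

lemma C_null: "null j \<Longrightarrow> C j i x = 0" "null j \<Longrightarrow> Cs j i x = 0"
  unfolding null_def C_def Cs_def by auto

text \<open>The generator with the larger index raises the exponent of the one with the smaller
  index by one, and not conversely. This asymmetry is the source of the factor \<open>q\<close> in
  the relations between different generators.\<close>

lemma ex_up:
  assumes "1 \<le> a" "a < b" "b \<le> n" "\<not> null a" "\<not> null b"
  shows "ex a (up b i) = ex a i + 1" "ex b (up a i) = ex b i"
  using assms unfolding ex_def S_def sum.distrib sum_sh null_def unfolding sh_def by auto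

lemma C_up: "a \<noteq> b \<Longrightarrow> C a (up b i) = C a i" "a \<noteq> b \<Longrightarrow> Cs a (up b i) = Cs a i"
  unfolding C_def Cs_def sh_def by auto

lemma inj_shift [simp]: "inj (dn j)" "inj (up j)"
  by (auto simp: inj_def fun_eq_iff)

lemma coord_Z: "fin_supp f \<Longrightarrow> coord (Z j f) i = wt j (dn j i) (coord f (dn j i))"
  "fin_supp f \<Longrightarrow> coord (Y j f) i = wts j i (coord f (up j i))"
  "fin_supp f \<Longrightarrow> fin_supp (Z j f)" "fin_supp f \<Longrightarrow> fin_supp (Y j f)"
  by (simp_all add: Z_def Y_def coord_wop)

lemma fin_supp_ket [simp]: "fin_supp (ket i x)"
  by (simp add: fin_supp_def coord_ket)

lemma up_dn [simp]: "up j (dn j i) = i" "dn j (up j i) = i"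
  by (simp_all add: fun_eq_iff)

lemma dn_eq_iff: "dn j i = i' \<longleftrightarrow> i = up j i'" "up j i = i' \<longleftrightarrow> i = dn j i'"
  by auto

lemma Z_ket: "Z j (ket i x) = ket (up j i) (wt j i x)" "Y j (ket i x) = ket (dn j i) (wts j (dn j i) x)"
  by (rule ell2_eqI; simp add: coord_Z coord_ket dn_eq_iff)+

lemma index_iff: "i \<in> I \<longleftrightarrow> (\<forall>x. x \<notin> {1..k} \<union> {l + k<..n} \<longrightarrow> i x = undefined) \<and>
    (\<forall>x\<in>{l + k<..n}. 0 \<le> i x) \<and> (\<forall>x. 1 \<le> x \<and> x < k \<longrightarrow> 1 \<le> i x)"
proof -
  let ?P = "{1..k} \<union> {l + k<..n}"
  let ?B = "\<lambda>j. if l + k < j then {0..} else if j = k then UNIV else {1 :: int..}"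
  have mem: "i \<in> I \<longleftrightarrow> (\<forall>x\<in>?P. i x \<in> ?B x) \<and> (\<forall>x. x \<notin> ?P \<longrightarrow> i x = undefined)"
    unfolding series_index_def PiE_iff extensional_def by blast
  have B: "(\<forall>x\<in>?P. i x \<in> ?B x) \<longleftrightarrow> (\<forall>x\<in>{l + k<..n}. 0 \<le> i x) \<and> (\<forall>x. 1 \<le> x \<and> x < k \<longrightarrow> 1 \<le> i x)"
  proof (intro iffI conjI ballI allI impI)
    fix x assume *: "\<forall>x\<in>?P. i x \<in> ?B x"
    show "0 \<le> i x" if "x \<in> {l + k<..n}" using that *[rule_format, of x] by simp
    show "1 \<le> i x" if "1 \<le> x \<and> x < k" using that *[rule_format, of x] by simp
  next
    fix x assume "(\<forall>x\<in>{l + k<..n}. 0 \<le> i x) \<and> (\<forall>x. 1 \<le> x \<and> x < k \<longrightarrow> 1 \<le> i x)" "x \<in> ?P"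
    then show "i x \<in> ?B x" by (cases "l + k < x"; cases "x = k") auto
  qed
  show ?thesis unfolding mem B by blast
qed

lemma sh_values:
  "l + k < x \<Longrightarrow> sh j x = (if x = j then 1 else 0)"
  "x < k \<Longrightarrow> sh j x = (if x = j then - 1 else 0)"
  "1 \<le> j \<Longrightarrow> j \<le> n \<Longrightarrow> x \<notin> {1..k} \<union> {l + k<..n} \<Longrightarrow> sh j x = 0"
  unfolding sh_def by auto

lemma shift_index:
  assumes i: "i \<in> I" and j: "j \<in> {1..n}"
  shows "(j < k \<Longrightarrow> i j \<noteq> 1) \<Longrightarrow> up j i \<in> I" "(l + k < j \<Longrightarrow> i j \<noteq> 0) \<Longrightarrow> dn j i \<in> I"
proof -
  have out: "i x = undefined" "sh j x = 0" if "x \<notin> {1..k} \<union> {l + k<..n}" for x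
    using i j that sh_values(3)[of j x] unfolding index_iff by auto
  have fock: "0 \<le> i x" if "x \<in> {l + k<..n}" for x using i that unfolding index_iff by blast
  have low: "1 \<le> i x" if "1 \<le> x \<and> x < k" for x using i that unfolding index_iff by blast
  have int: "0 \<le> y - 1" "1 \<le> y' - 1" if "0 \<le> y" "y \<noteq> 0" "1 \<le> y'" "y' \<noteq> 1" for y y' :: int
    using that by linarith+
  show "up j i \<in> I" if nz: "j < k \<Longrightarrow> i j \<noteq> 1"
    unfolding index_iff
  proof (intro conjI allI impI ballI)
    show "i x + sh j x = undefined" if "x \<notin> {1..k} \<union> {l + k<..n}" for x using out[OF that] by simp
    show "0 \<le> i x + sh j x" if "x \<in> {l + k<..n}" for x
      using that fock[OF that] sh_values(1)[of x j] by simp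
    show "1 \<le> i x + sh j x" if "1 \<le> x \<and> x < k" for x
      using that low[OF that] sh_values(2)[of x j] nz by (cases "x = j") auto
  qed
  show "dn j i \<in> I" if nz: "l + k < j \<Longrightarrow> i j \<noteq> 0"
    unfolding index_iff
  proof (intro conjI allI impI ballI)
    show "i x - sh j x = undefined" if "x \<notin> {1..k} \<union> {l + k<..n}" for x using out[OF that] by simp
    show "0 \<le> i x - sh j x" if "x \<in> {l + k<..n}" for x
      using that fock[OF that] sh_values(1)[of x j] nz by (cases "x = j") auto
    show "1 \<le> i x - sh j x" if "1 \<le> x \<and> x < k" for x
      using that low[OF that] sh_values(2)[of x j] by (cases "x = j") auto
  qed
qed

text \<open>A shift can leave the index set only from \<open>i j = 1\<close> below \<open>k\<close>
  or from \<open>i j = 0\<close> in the Fock part, and there the coefficient is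
  \<open>beta_q q 0\<close> or \<open>lambda_q q 0\<close>, that is, 0.\<close>

lemma wt_index:
  assumes "i \<in> I" "j \<in> {1..n}"
  shows "wt j i x \<noteq> 0 \<Longrightarrow> up j i \<in> I" "wts j (dn j i) x \<noteq> 0 \<Longrightarrow> dn j i \<in> I"
proof -
  have "wt j i x = 0" if "j < k" "i j = 1" using that unfolding wt_def C_def by simp
  then show "wt j i x \<noteq> 0 \<Longrightarrow> up j i \<in> I" using shift_index(1)[OF assms] by blast
  have "wts j (dn j i) x = 0" if "l + k < j" "i j = 0"
    using that unfolding wts_def Cs_def C_def sh_def by simp
  then show "wts j (dn j i) x \<noteq> 0 \<Longrightarrow> dn j i \<in> I" using shift_index(2)[OF assms] by blast
qed

end

section \<open>Diagonal operators and the defining relations\<close>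

context series begin

lemma sum_head: "j \<le> b \<Longrightarrow> (\<Sum>s\<in>{j..b}. i s) = i j + (\<Sum>s\<in>{j<..b}. i s)" for i :: "nat \<Rightarrow> int"
  by (simp add: sum.head)

text \<open>\<open>Q a i\<close> is the eigenvalue of \<open>1 - \<Sum>\<^sub>j\<^sub>\<ge>\<^sub>a z\<^sub>j z\<^sub>j\<^sup>*\<close> on the component with index \<open>i\<close>.\<close>

definition Q :: "nat \<Rightarrow> (nat \<Rightarrow> int) \<Rightarrow> 'k \<Rightarrow> 'k"
  where "Q a i \<eta> = (if l + k < a then (q powi (2 * (\<Sum>s\<in>{a..n}. i s))) *\<^sub>R \<eta>
    else if k < a then 0
    else - (q powi (2 * (S i - (\<Sum>s\<in>{a..k}. i s)))) *\<^sub>R A (A \<eta>))"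

lemma powi_double: "q powi (2 * a) = q powi a * q powi a"
proof -
  have "q powi (a + a) = q powi a * q powi a" using q by (intro power_int_add) simp
  then show ?thesis by (simp only: mult_2)
qed

lemma q_powi: "q powi (a + b) = q powi a * q powi b" "q powi (a - b) = q powi a / q powi b"
  "q powi (- a) = 1 / q powi a"
  using q by (simp_all add: power_int_add power_int_diff power_int_minus divide_inverse)

lemma range_cases:
  assumes "j \<in> {1..n}"
  obtains (fock) "l + k < j" | (unit) "0 < l" "j = l + k" | (null) "k < j" "j < l + k"
    | (mid0) "l = 0" "j = k" | (mid) "0 < l" "j = k" | (low) "j < k"
proof -
  have "l + k < j \<or> (0 < l \<and> j = l + k) \<or> (k < j \<and> j < l + k) \<or> (l = 0 \<and> j = k) \<or> (0 < l \<and> j = k) \<or> j < k"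
    by linarith
  then show ?thesis using that by blast
qed

lemma C_fock: "l + k < j \<Longrightarrow> C j i x = lambda_q q (i j + 1) *\<^sub>R x" "l + k < j \<Longrightarrow> Cs j i x = lambda_q q (i j + 1) *\<^sub>R x"
  and C_unit: "0 < l \<Longrightarrow> C (l + k) i x = v x" "0 < l \<Longrightarrow> Cs (l + k) i x = w x"
  and C_mid0: "l = 0 \<Longrightarrow> C k i x = mu (i k - 1) x" "l = 0 \<Longrightarrow> Cs k i x = mu (i k - 1) x"
  and C_mid: "0 < l \<Longrightarrow> C k i x = A x" "0 < l \<Longrightarrow> Cs k i x = A x"
  and C_low: "j < k \<Longrightarrow> C j i x = beta_q q (i j - 1) *\<^sub>R A x" "j < k \<Longrightarrow> Cs j i x = beta_q q (i j - 1) *\<^sub>R A x"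
  unfolding Cs_def C_def by auto

lemma ex_values:
  "l + k < j \<Longrightarrow> ex j i = (\<Sum>s\<in>{j<..n}. i s)"
  "0 < l \<Longrightarrow> ex (l + k) i = S i"
  "l = 0 \<Longrightarrow> ex k i = S i"
  "0 < l \<Longrightarrow> ex k i = S i - (i k - 1)"
  "j < k \<Longrightarrow> ex j i = S i - (\<Sum>s\<in>{j<..k}. i s)"
  unfolding ex_def by auto

lemma ex_dn:
  assumes "1 \<le> j" "\<not> (0 < l \<and> j = k)" shows "ex j (dn j i) = ex j i"
  using assms unfolding ex_def S_def sum_subtractf sum_sh by auto

lemma S_dn: "j \<le> l + k \<Longrightarrow> S (dn j i) = S i"
  unfolding S_def sum_subtractf sum_sh by auto

lemma Q_values:
  "l + k < j \<Longrightarrow> Q j i x = (q powi (\<Sum>s\<in>{j..n}. i s) * q powi (\<Sum>s\<in>{j..n}. i s)) *\<^sub>R x"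
  "k < j \<Longrightarrow> j \<le> l + k \<Longrightarrow> Q j i x = 0"
  "j \<le> k \<Longrightarrow> Q j i x = - (q powi (S i - (\<Sum>s\<in>{j..k}. i s)) * q powi (S i - (\<Sum>s\<in>{j..k}. i s))) *\<^sub>R A (A x)"
  unfolding Q_def powi_double by auto

text \<open>These two identities contain all the relations between \<open>z\<^sub>j\<close> and \<open>z\<^sub>j\<^sup>*\<close>.\<close>

lemma ZY_diag:
  assumes i: "i \<in> I" and j: "j \<in> {1..n}"
  shows "wt j (dn j i) (wts j (dn j i) x) = Q (Suc j) i x - Q j i x" (is ?A)
    and "wts j i (wt j i x) = Q (Suc j) i x - q\<^sup>2 *\<^sub>R Q j i x" (is ?B)
proof -
  have qn: "q powi a \<noteq> 0" for a using q by simp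
  have rng: "{Suc j..b} = {j<..b}" for j b :: nat by auto
  note W = wt_def wts_def C_linear Cs_linear
  from j have "?A \<and> ?B"
  proof (cases rule: range_cases)
    case fock
    define E where "E = (\<Sum>s\<in>{j<..n}. i s)"
    \<comment> \<open>Membership in the index set keeps the radicands of \<open>lambda_q\<close>
      nonnegative, so that squaring removes the roots.\<close>
    have pos: "0 \<le> i j" using i fock j unfolding index_iff by auto
    have e: "ex j (dn j i) = E" "ex j i = E" "dn j i j = i j - 1"
      using fock j ex_dn[of j i] ex_values(1)[of j i] sh_values(1)[of j j] by (auto simp: E_def)
    have Qs: "Q (Suc j) i x = (q powi E * q powi E) *\<^sub>R x"
      "Q j i x = (q powi E * q powi E * (q powi i j * q powi i j)) *\<^sub>R x"
      using fock j by (simp_all add: Q_values(1) sum_head rng E_def q_powi)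
    have zy: "wt j (dn j i) (wts j (dn j i) x) =
        (q powi E * q powi E * (lambda_q q (i j) * lambda_q q (i j))) *\<^sub>R x"
      by (simp add: W C_fock[OF fock] e mult_ac)
    have yz: "wts j i (wt j i x) =
        (q powi E * q powi E * (lambda_q q (i j + 1) * lambda_q q (i j + 1))) *\<^sub>R x"
      by (simp add: W C_fock[OF fock] e mult_ac)
    have lq: "lambda_q q (i j) * lambda_q q (i j) = 1 - q powi i j * q powi i j"
      "lambda_q q (i j + 1) * lambda_q q (i j + 1) = 1 - q\<^sup>2 * (q powi i j * q powi i j)"
      using pos q by (simp_all only: lambda_q_sq powi_double)
        (simp_all add: q_powi power2_eq_square mult_ac)
    show ?thesis unfolding zy yz lq Qs by (simp add: algebra_simps)
  next
    case unit
    have e: "ex j (dn j i) = S i" "ex j i = S i"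
      using unit j ex_dn[of j i] ex_values(2)[of i] by auto
    have c: "l + k < Suc j" "k < j" "j \<le> l + k" "{Suc j..n} = {l + k<..n}" using unit by auto
    \<comment> \<open>The unitary exhausts what is left: \<open>Q\<close> is a full power of
      \<open>q\<close> just after position \<open>l + k\<close> and 0 at it.\<close>
    have Qs: "Q (Suc j) i x = (q powi S i * q powi S i) *\<^sub>R x" "Q j i x = 0"
      by (simp_all only: Q_values(1)[OF c(1)] Q_values(2)[OF c(2,3)] c(4) S_def)
    have Cj: "C j i' y = v y" "Cs j i' y = w y" for i' y
      using C_unit[OF unit(1)] by (simp_all only: unit(2))
    have "wt j (dn j i) (wts j (dn j i) x) = (q powi S i * q powi S i) *\<^sub>R x"
      "wts j i (wt j i x) = (q powi S i * q powi S i) *\<^sub>R x"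
      by (simp_all add: wt_def wts_def e Cj v(2,3)[OF unit(1)] adjp_linear[OF v(1)[OF unit(1)]]
          adjp_linear[OF adjp_sym[OF v(1)[OF unit(1)]]])
    then show ?thesis by (simp add: Qs)
  next
    case null
    then have "Q (Suc j) i x = 0" "Q j i x = 0" by (simp_all add: Q_values(2))
    moreover have "null j" using null unfolding null_def by simp
    ultimately show ?thesis by (simp add: W C_null)
  next
    case mid0
    have e: "ex j (dn j i) = S i" "ex j i = S i"
      using mid0 j ex_dn[of j i] ex_values(3)[of i] by auto
    have d: "dn j i k = i k + 1" using mid0 j unfolding sh_def by simp
    have c: "l + k < Suc j" "j \<le> k" "{Suc j..n} = {l + k<..n}" "{j..k} = {k}" using mid0 by auto
    have Qs: "Q (Suc j) i x = (q powi S i * q powi S i) *\<^sub>R x"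
      "Q j i x = - (q powi (S i - i k) * q powi (S i - i k)) *\<^sub>R A (A x)"
      by (simp_all only: Q_values(1)[OF c(1)] Q_values(3)[OF c(2)] c(3,4) S_def) simp
    have Cj: "C j i' y = mu (i' k - 1) y" "Cs j i' y = mu (i' k - 1) y" for i' y
      using C_mid0[OF mid0(1)] by (simp_all only: mid0(2))
    have p: "q powi (- 2 * a) = 1 / (q powi a * q powi a)" for a
      by (simp only: mult_minus_left q_powi(3) powi_double)
    have zy: "wt j (dn j i) (wts j (dn j i) x) =
        (q powi S i * q powi S i) *\<^sub>R (x + (1 / (q powi i k * q powi i k)) *\<^sub>R A (A x))"
      by (simp only: W e Cj d adjp_linear(6)[OF mu(1)] add_diff_cancel_right' scaleR_scaleR mu(2) p)
    have yz: "wts j i (wt j i x) =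
        (q powi S i * q powi S i) *\<^sub>R (x + (q\<^sup>2 / (q powi i k * q powi i k)) *\<^sub>R A (A x))"
      by (simp only: W e Cj adjp_linear(6)[OF mu(1)] scaleR_scaleR mu(2) p q_powi)
        (use q in \<open>simp add: power2_eq_square\<close>)
    show ?thesis
      unfolding zy yz Qs q_powi by (simp add: scaleR_add_right)
  next
    case mid
    have d: "dn j i k = i k + 1" using mid j unfolding sh_def by simp
    \<comment> \<open>For \<open>l > 0\<close> the exponent of \<open>z_k\<close> contains
      \<open>i k\<close> itself, so it differs by one between the two products; this yields the
      factor \<open>q^2\<close>.\<close>
    have e: "ex j (dn j i) = S i - i k" "ex j i = S i - (i k - 1)"
      using mid j ex_values(4)[of "dn j i"] ex_values(4)[of i] d S_dn[of j i] by auto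
    have c: "k < Suc j" "Suc j \<le> l + k" "j \<le> k" "{j..k} = {k}" using mid by auto
    have Qs: "Q (Suc j) i x = 0" "Q j i x = - (q powi (S i - i k) * q powi (S i - i k)) *\<^sub>R A (A x)"
      by (simp_all only: Q_values(2)[OF c(1,2)] Q_values(3)[OF c(3)] c(4)) simp
    have Cj: "C j i' y = A y" "Cs j i' y = A y" for i' y
      using C_mid[OF mid(1)] by (simp_all only: mid(2))
    have "wt j (dn j i) (wts j (dn j i) x) = (q powi (S i - i k) * q powi (S i - i k)) *\<^sub>R A (A x)"
      "wts j i (wt j i x) = (q powi (S i - (i k - 1)) * q powi (S i - (i k - 1))) *\<^sub>R A (A x)"
      by (simp_all only: W e Cj adjp_linear(6)[OF A] scaleR_scaleR)
    then show ?thesis using q by (simp add: Qs q_powi power2_eq_square)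
  next
    case low
    define E where "E = S i - (\<Sum>s\<in>{j<..k}. i s)"
    have pos: "1 \<le> i j" using i low j unfolding index_iff by auto
    have e: "ex j (dn j i) = E" "ex j i = E" "dn j i j = i j + 1"
      using low j ex_dn[of j i] ex_values(5)[of j i] sh_values(2)[of j j] by (auto simp: E_def)
    have Qs: "Q (Suc j) i x = - (q powi E * q powi E) *\<^sub>R A (A x)"
      "Q j i x = - (q powi (E - i j) * q powi (E - i j)) *\<^sub>R A (A x)"
      using low by (simp_all add: Q_values(3) sum_head rng E_def diff_diff_eq add.commute)
    have "wt j (dn j i) (wts j (dn j i) x) =
        (q powi E * q powi E * (beta_q q (i j) * beta_q q (i j))) *\<^sub>R A (A x)"
      by (simp add: W C_low[OF low] e mult_ac adjp_linear[OF A])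
    moreover have "wts j i (wt j i x) =
        (q powi E * q powi E * (beta_q q (i j - 1) * beta_q q (i j - 1))) *\<^sub>R A (A x)"
      by (simp add: W C_low[OF low] e mult_ac adjp_linear[OF A])
    moreover have "q powi (- 2 * a) = 1 / (q powi a * q powi a)" for a
      by (simp add: powi_double q_powi)
    ultimately show ?thesis
      using pos q unfolding Qs scaleR_scaleR scaleR_diff_left[symmetric]
      by (simp add: beta_q_sq q_powi power2_eq_square field_simps scaleR_diff_left)
  qed
  then show ?A ?B by blast+
qed

lemma Q_last: "Q (Suc n) i x = x"
  using Q_values(1)[of "Suc n" i x] by simp

text \<open>By \<open>ZY_diag\<close> each summand is a difference of consecutive \<open>Q\<close>,
  and \<open>Q (Suc n)\<close> is the identity.\<close>

lemma Q_telescope: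
  assumes "i \<in> I" "a \<in> {1..n}"
  shows "x - (\<Sum>j\<in>{a<..n}. wt j (dn j i) (wts j (dn j i) x)) = Q (Suc a) i x"
proof -
  have "(\<Sum>j\<in>{a<..n}. wt j (dn j i) (wts j (dn j i) x)) = (\<Sum>j\<in>{Suc a..<Suc n}. Q (Suc j) i x - Q j i x)"
    using assms by (intro sum.cong) (auto simp: ZY_diag(1))
  also have "\<dots> = Q (Suc n) i x - Q (Suc a) i x"
    using assms by (intro sum_Suc_diff') auto
  finally show ?thesis by (simp add: Q_last)
qed

lemma up_comm: "up a (up b i) = up b (up a i)" "dn b (up a i) = up a (dn b i)"
  by (auto simp: fun_eq_iff)

lemma ops_relation1:
  assumes "1 \<le> a" "a < b" "b \<le> n"
  shows "Z a (Z b (ket i x)) = complex_of_real q *\<^sub>C Z b (Z a (ket i x))"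
proof -
  have "wt a (up b i) (wt b i x) = q *\<^sub>R wt b (up a i) (wt a i x)"
  proof (cases "null a \<or> null b")
    case True
    then show ?thesis using C_null by (auto simp: wt_def C_linear)
  next
    case False
    have "C a (up b i) (C b i x) = C b (up a i) (C a i x)"
      using assms C_up(1)[of a b i] C_up(1)[of b a i] C_comm(1) by simp
    then show ?thesis
      using ex_up[of a b i] assms False q by (simp add: wt_def C_linear q_powi mult_ac)
  qed
  moreover have "up a (up b i) = up b (up a i)" by (rule up_comm(1))
  ultimately show ?thesis
    by (simp only: Z_ket ket_scaleC[symmetric] scaleR_scaleC[symmetric])
qed

lemma ops_relation2:
  assumes "a \<in> {1..n}" "b \<in> {1..n}" "a \<noteq> b"
  shows "Y b (Z a (ket i x)) = complex_of_real q *\<^sub>C Z a (Y b (ket i x))"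
proof -
  \<comment> \<open>Starting from \<open>i'\<close> instead of \<open>i\<close> turns both shifts
    into \<open>up\<close>.\<close>
  define i' where "i' = dn b i"
  have "wts b (up a i') (wt a (up b i') x) = q *\<^sub>R wt a i' (wts b i' x)"
  proof (cases "null a \<or> null b")
    case True
    then show ?thesis using C_null by (auto simp: wt_def wts_def C_linear Cs_linear)
  next
    case False
    \<comment> \<open>Whichever of \<open>a\<close> and \<open>b\<close> is smaller,
      \<open>ex_up\<close> adds one to exactly one of the two exponents.\<close>
    have e: "ex b (up a i') + ex a (up b i') = 1 + (ex a i' + ex b i')"
      using ex_up[of a b i'] ex_up[of b a i'] assms False by (cases "a < b") auto
    have "Cs b (up a i') (C a (up b i') x) = C a i' (Cs b i' x)"
      using assms C_up(2)[of b a i'] C_up(1)[of a b i'] C_comm(2) by simp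
    then have "wts b (up a i') (wt a (up b i') x) =
        (q powi (ex b (up a i') + ex a (up b i'))) *\<^sub>R C a i' (Cs b i' x)"
      by (simp add: wt_def wts_def Cs_linear q_powi(1))
    then show ?thesis unfolding e using q by (simp add: wt_def wts_def C_linear q_powi(1))
  qed
  then have "wts b (dn b (up a i)) (wt a i x) = q *\<^sub>R wt a (dn b i) (wts b (dn b i) x)"
    by (simp only: i'_def up_comm(2)[symmetric] up_dn)
  moreover have "dn b (up a i) = up a (dn b i)" by (rule up_comm(2))
  ultimately show ?thesis
    by (simp only: Z_ket ket_scaleC[symmetric] scaleR_scaleC[symmetric])
qed

text \<open>By \<open>ZY_diag\<close> the two products are \<open>Q (Suc a) - q^2 Q a\<close> and
  \<open>Q (Suc a) - Q a\<close>. Eliminating \<open>Q a\<close> leaves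
  \<open>(1 - q^2) Q (Suc a)\<close>, which \<open>Q_telescope\<close> identifies.\<close>

lemma ops_relation3:
  assumes i: "i \<in> I" and a: "a \<in> {1..n}"
  shows "Y a (Z a (ket i x)) = complex_of_real (q\<^sup>2) *\<^sub>C Z a (Y a (ket i x)) +
      complex_of_real (1 - q\<^sup>2) *\<^sub>C (ket i x - (\<Sum>j\<in>{a<..n}. Z j (Y j (ket i x))))"
proof -
  have "wts a i (wt a i x) = q\<^sup>2 *\<^sub>R wt a (dn a i) (wts a (dn a i) x) +
    (1 - q\<^sup>2) *\<^sub>R (x - (\<Sum>j\<in>{a<..n}. wt j (dn j i) (wts j (dn j i) x)))"
    unfolding Q_telescope[OF i a] ZY_diag[OF i a] by (simp add: algebra_simps)
  then show ?thesis
    by (simp only: Z_ket up_dn ket_sum[symmetric] ket_diff[symmetric] ket_scaleC[symmetric]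
        ket_add[symmetric] scaleR_scaleC[symmetric])
qed

end

lemma fin_supp_add: "fin_supp f \<Longrightarrow> fin_supp g \<Longrightarrow> fin_supp (f + g :: ('i, 'a::complex_inner) ell2)"
  unfolding fin_supp_def
  by (rule finite_subset[of _ "{i. coord f i \<noteq> 0} \<union> {i. coord g i \<noteq> 0}"]) auto

lemma fin_supp_scaleC: "fin_supp f \<Longrightarrow> fin_supp (c *\<^sub>C f :: ('i, 'a::complex_inner) ell2)"
  unfolding fin_supp_def by (rule finite_subset[of _ "{i. coord f i \<noteq> 0}"]) auto

lemma fdom_fin_supp: "f \<in> fdom J M \<Longrightarrow> fin_supp f"
  by (simp add: fdom_def)

section \<open>Reducing subspaces and construction of the representations\<close>

context series begin

definition reducing :: "'k set \<Rightarrow> bool"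
  where "reducing M \<longleftrightarrow> complex_vector.subspace M \<and> closed M \<and>
    (\<forall>j i. \<forall>x\<in>M. C j i x \<in> M \<and> Cs j i x \<in> M)"

lemma reducing_wt:
  assumes "reducing M" "x \<in> M" shows "wt j i x \<in> M" "wts j i x \<in> M"
  using assms by (auto simp: reducing_def wt_def wts_def scaleR_scaleC complex_vector.subspace_scale)

lemma ZY_linear: "fin_supp f \<Longrightarrow> fin_supp g \<Longrightarrow> Z j (f + g) = Z j f + Z j g"
  "fin_supp f \<Longrightarrow> Z j (c *\<^sub>C f) = c *\<^sub>C Z j f"
  "fin_supp f \<Longrightarrow> fin_supp g \<Longrightarrow> Y j (f + g) = Y j f + Y j g"
  "fin_supp f \<Longrightarrow> Y j (c *\<^sub>C f) = c *\<^sub>C Y j f"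
  by (rule ell2_eqI; simp add: coord_Z fin_supp_add fin_supp_scaleC)+

lemma ZY_closed:
  assumes M: "reducing M" and f: "f \<in> fdom I M" and j: "j \<in> {1..n}"
  shows "Z j f \<in> fdom I M" "Y j f \<in> fdom I M"
proof -
  have fs: "fin_supp f" using f by (simp add: fdom_def)
  have nz: "i \<in> I" "coord f i \<in> M" if "coord f i \<noteq> 0" for i using f that by (auto simp: fdom_def)
  show "Z j f \<in> fdom I M"
    unfolding fdom_def
  proof (intro CollectI conjI allI impI)
    fix i assume *: "coord (Z j f) i \<noteq> 0"
    then have c: "coord f (dn j i) \<noteq> 0" by (auto simp: coord_Z fs)
    show "i \<in> I" using wt_index(1)[OF nz(1)[OF c] j] * by (simp add: coord_Z fs)
    show "coord (Z j f) i \<in> M" using reducing_wt(1)[OF M nz(2)[OF c]] by (simp add: coord_Z fs)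
  qed (simp add: coord_Z fs)
  show "Y j f \<in> fdom I M"
    unfolding fdom_def
  proof (intro CollectI conjI allI impI)
    fix i assume *: "coord (Y j f) i \<noteq> 0"
    then have c: "coord f (up j i) \<noteq> 0" by (auto simp: coord_Z fs)
    show "i \<in> I" using wt_index(2)[OF nz(1)[OF c] j] * by (simp add: coord_Z fs)
    show "coord (Y j f) i \<in> M" using reducing_wt(2)[OF M nz(2)[OF c]] by (simp add: coord_Z fs)
  qed (simp add: coord_Z fs)
qed

lemma bij_up: "bij (up j)"
  by (rule o_bij[of "dn j"]) (simp_all add: fun_eq_iff)

lemma ZY_adjoint:
  assumes "fin_supp f" "fin_supp g" shows "cinner (Z j f) g = cinner f (Y j g)"
proof -
  have "cinner (Z j f) g = (\<Sum>\<^sub>\<infinity>i. cinner (coord f (dn j i)) (wts j (dn j i) (coord g i)))"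
    using assms by (simp add: cinner_ell2_def coord_Z adjpD[OF wt_adjoint])
  also have "\<dots> = (\<Sum>\<^sub>\<infinity>i. cinner (coord f (dn j (up j i))) (wts j (dn j (up j i)) (coord g (up j i))))"
    by (rule infsum_reindex_bij_betw[OF bij_up, symmetric])
  also have "\<dots> = cinner f (Y j g)"
    using assms by (simp add: cinner_ell2_def coord_Z)
  finally show ?thesis .
qed

lemma free_rep_ZY: "reducing M \<Longrightarrow> free_rep n (fdom I M) Z Y"
  by standard
    (auto simp: clinear_on_def ZY_linear fdom_fin_supp ZY_closed intro: fdom_subspace simp: reducing_def[of M])

text \<open>Stated for every reducing \<open>M\<close>, so that the representation and its candidate
  summands are constructed at once.\<close>

lemma Oq_ops_ZY:
  assumes M: "reducing M"
  shows "Oq_ops n (fdom I M) Z Y q (fspace I M) {ket i \<eta> | i \<eta>. i \<in> I \<and> \<eta> \<in> M}"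
proof -
  have M': "complex_vector.subspace M" "closed M" using M by (auto simp: reducing_def)
  interpret free_rep n "fdom I M" Z Y by (rule free_rep_ZY[OF M])
  show ?thesis
  proof
    show "1 \<le> n" by (rule n1)
    show "dense_subspace (fspace I M) (fdom I M)" by (rule dense_fdom[OF M'])
    show "fdom I M = complex_vector.span {ket i \<eta> | i \<eta>. i \<in> I \<and> \<eta> \<in> M}" by (rule fdom_span[OF M'(1)])
    show "cinner (Z j x) y = cinner x (Y j y)" if "x \<in> fdom I M" "y \<in> fdom I M" for j x y
      using that by (intro ZY_adjoint fdom_fin_supp)
  qed (blast intro: ops_relation1 ops_relation2 ops_relation3)+
qed

lemma reducing_UNIV: "reducing UNIV"
  by (simp add: reducing_def)

lemma series_dom_eq: "series_dom m l k = fdom I UNIV"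
  unfolding series_dom_def fdom_span[OF complex_vector.subspace_UNIV] by simp

lemma series_space_eq: "series_space m l k = fspace I UNIV"
  by (simp add: series_space_def fspace_def)

lemma up_values:
  "l + k < j \<Longrightarrow> up j i = i(j := i j + 1)"
  "1 \<le> j \<Longrightarrow> j \<le> k \<Longrightarrow> up j i = i(j := i j - 1)"
  "0 < l \<Longrightarrow> up (l + k) i = (if k = 0 then i else i(k := i k - 1))"
  unfolding sh_def by (auto simp: fun_eq_iff)

lemma gen_action_eq:
  assumes j: "j \<in> {1..n}"
  shows "gen_action q m l k A v j i x = Z j (ket i x)"
proof -
  have nm: "n - m = l + k" by simp
  have S0: "(\<Sum>s\<in>{k<..n}. i s) = S i" if "l = 0" unfolding S_def using that by simp
  from j have "gen_action q m l k A v j i x = ket (up j i) (wt j i x)"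
  proof (cases rule: range_cases)
    case fock
    have "gen_action q m l k A v j i x =
        complex_of_real (q powi (\<Sum>s\<in>{j<..n}. i s) * lambda_q q (i j + 1)) *\<^sub>C ket (i(j := i j + 1)) x"
      using fock unfolding gen_action_def Let_def nm by auto
    then show ?thesis
      using up_values(1)[OF fock, of i]
      by (simp only: wt_def C_fock(1)[OF fock] ex_values(1)[OF fock] ket_scaleC scaleR_scaleC scaleC_scaleC of_real_mult)
  next
    case unit
    have "gen_action q m l k A v j i x =
        complex_of_real (q powi S i) *\<^sub>C ket (if k = 0 then i else i(k := i k - 1)) (v x)"
      using unit unfolding gen_action_def Let_def nm S_def by auto
    then show ?thesis
      by (simp only: unit(2) up_values(3)[OF unit(1)] wt_def C_unit(1)[OF unit(1)] ex_values(2)[OF unit(1)]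
          ket_scaleC scaleR_scaleC scaleC_scaleC of_real_mult)
  next
    case null
    have "gen_action q m l k A v j i x = 0"
      using null unfolding gen_action_def Let_def nm by auto
    moreover have "C j i x = 0" using null C_null(1)[of j i x] unfolding null_def by simp
    ultimately show ?thesis by (simp add: wt_def)
  next
    case mid0
    have "gen_action q m l k A v j i x =
        complex_of_real (q powi (\<Sum>s\<in>{k<..n}. i s)) *\<^sub>C ket (i(k := i k - 1)) (mu (i k - 1) x)"
      using mid0 unfolding gen_action_def Let_def by auto
    moreover have "1 \<le> k" using mid0 j by simp
    ultimately show ?thesis
      by (simp only: mid0(2) up_values(2)[of k] order_refl wt_def C_mid0(1)[OF mid0(1)] S0[OF mid0(1)]
          ex_values(3)[OF mid0(1)] ket_scaleC scaleR_scaleC)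
  next
    case mid
    have "gen_action q m l k A v j i x =
        complex_of_real (q powi (- (i k - 1) + S i)) *\<^sub>C ket (i(k := i k - 1)) (A x)"
      using mid unfolding gen_action_def Let_def nm S_def by auto
    moreover have "1 \<le> k" using mid j by simp
    moreover have "- (i k - 1) + S i = S i - (i k - 1)" by simp
    ultimately show ?thesis
      by (simp only: mid(2) up_values(2)[of k] order_refl wt_def C_mid(1)[OF mid(1)]
          ex_values(4)[OF mid(1)] ket_scaleC scaleR_scaleC)
  next
    case low
    have "gen_action q m l k A v j i x =
        complex_of_real (q powi (- (\<Sum>s\<in>{j<..k}. i s) + S i) * beta_q q (i j - 1)) *\<^sub>C ket (i(j := i j - 1)) (A x)"
    proof (cases "l = 0")
      case True
      then show ?thesis using low S0[OF True] unfolding gen_action_def Let_def by auto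
    next
      case False
      then show ?thesis using low unfolding gen_action_def Let_def nm S_def by auto
    qed
    moreover have "- (\<Sum>s\<in>{j<..k}. i s) + S i = S i - (\<Sum>s\<in>{j<..k}. i s)" by simp
    moreover have "1 \<le> j" "j \<le> k" using low j by simp_all
    ultimately show ?thesis
      by (simp only: up_values(2)[of j] wt_def C_low(1)[OF low]
          ex_values(5)[OF low] ket_scaleC scaleR_scaleC scaleC_scaleC of_real_mult)
  qed
  then show ?thesis by (simp add: Z_ket)
qed

lemma series_rep_exists: "\<exists>\<pi>. series_rep q m l k A v \<pi>"
proof -
  interpret Oq_ops n "fdom I UNIV" Z Y q "fspace I UNIV" "{ket i \<eta> | i \<eta>. i \<in> I \<and> \<eta> \<in> UNIV}"
    by (rule Oq_ops_ZY[OF reducing_UNIV])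
  have "series_rep q m l k A v quotient_rep"
    unfolding series_rep_def series_dom_eq series_space_eq
  proof (intro conjI ballI allI)
    show "star_rep (Oq q n) (fspace I UNIV) (fdom I UNIV) quotient_rep" by (rule star_rep_quotient_rep)
    show "quotient_rep (oq_class q n (zgen j)) (ket i x) = gen_action q m l k A v j i x"
      if "j \<in> {1..n}" "i \<in> I" for j i x
      using that by (simp add: gen_action_eq quotient_rep_class zgen_carrier ket_in_fdom del: One_nat_def)
  qed
  then show ?thesis by (intro exI[of _ quotient_rep])
qed

text \<open>\<open>series_rep\<close> prescribes the generators on single components only; linearity
  extends this to the domain, and density then forces the starred generators.\<close>

lemma series_rep_gens:
  assumes \<pi>: "series_rep q m l k A v \<pi>" and j: "j \<in> {1..n}" and d: "d \<in> fdom I UNIV"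
  shows "rep_gen q n \<pi> j d = Z j d" "rep_gen_star q n \<pi> j d = Y j d"
proof -
  have rep: "star_rep (Oq q n) (fspace I UNIV) (fdom I UNIV) \<pi>"
    and gens: "\<And>i x. i \<in> I \<Longrightarrow> \<pi> (oq_class q n (zgen j)) (ket i x) = Z j (ket i x)"
    using \<pi> j by (auto simp: series_rep_def series_dom_eq series_space_eq gen_action_eq)
  interpret G: free_rep n "fdom I UNIV" "rep_gen q n \<pi>" "rep_gen_star q n \<pi>"
    by (rule free_rep_of_star_rep[OF n1 rep])
  interpret O: free_rep n "fdom I UNIV" Z Y by (rule free_rep_ZY[OF reducing_UNIV])
  have Z: "rep_gen q n \<pi> j d = Z j d" if "d \<in> fdom I UNIV" for d
  proof -
    let ?E = "{d \<in> fdom I UNIV. rep_gen q n \<pi> j d = Z j d}"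
    have lin: "clinear_on (fdom I UNIV) (rep_gen q n \<pi> j)" "clinear_on (fdom I UNIV) (Z j)"
      using G.lin O.lin j by blast+
    have "complex_vector.span {ket i \<eta> | i \<eta>. i \<in> I \<and> \<eta> \<in> UNIV} \<subseteq> ?E"
    proof (rule complex_vector.span_minimal)
      show "complex_vector.subspace ?E"
        using lin clinear_on_zero[OF lin(1)] clinear_on_zero[OF lin(2)] G.sub
        by (auto simp: complex_vector.subspace_def clinear_on_def)
      show "{ket i \<eta> | i \<eta>. i \<in> I \<and> \<eta> \<in> UNIV} \<subseteq> ?E"
        using gens by (auto simp: rep_gen_def[OF n1 rep] intro: ket_in_fdom)
    qed
    then show ?thesis using that unfolding fdom_span[OF complex_vector.subspace_UNIV] by blast
  qed
  then show "rep_gen q n \<pi> j d = Z j d" using d .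
  let ?y = "rep_gen_star q n \<pi> j d - Y j d"
  have yD: "rep_gen_star q n \<pi> j d \<in> fdom I UNIV" "Y j d \<in> fdom I UNIV"
    using G.inv(2) O.inv(2) j d by blast+
  have dense: "dense_subspace (fspace I UNIV) (fdom I (UNIV :: 'k set))" using rep by (simp add: star_rep_def)
  have "?y = 0"
  proof (rule dense_subspace_orthogonal[OF dense])
    have "?y \<in> fdom I UNIV" using yD G.sub by (rule_tac complex_vector.subspace_diff)
    then show "?y \<in> fspace I UNIV" using dense by (auto simp: dense_subspace_def)
    show "cinner x ?y = 0" if x: "x \<in> fdom I UNIV" for x
      using rep_gen_adjoint[OF n1 rep j x d] ZY_adjoint[OF fdom_fin_supp[OF x] fdom_fin_supp[OF d], of j] Z[OF x]
      by (simp add: cinner_diff)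
  qed
  then show "rep_gen_star q n \<pi> j d = Y j d" by simp
qed

lemma series_rep_act:
  assumes \<pi>: "series_rep q m l k A v \<pi>" and p: "p \<in> carrier (free_ring n)" and d: "d \<in> fdom I UNIV"
  shows "\<pi> (oq_class q n p) d = free_act Z Y p d"
proof -
  have rep: "star_rep (Oq q n) (fspace I UNIV) (fdom I UNIV) \<pi>"
    using \<pi> by (auto simp: series_rep_def series_dom_eq series_space_eq)
  have "\<pi> (oq_class q n p) d = free_act (rep_gen q n \<pi>) (rep_gen_star q n \<pi>) p d"
    by (rule rep_free_act[OF n1 rep p d])
  also have "\<dots> = free_act Z Y p d"
    using free_act_intertwine[OF free_rep_of_star_rep[OF n1 rep] free_rep_ZY[OF reducing_UNIV],
        of "\<lambda>x. x" p d] series_rep_gens[OF \<pi>] p d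
    by (auto simp: clinear_on_def)
  finally show ?thesis .
qed

end

lemma admissible_series:
  fixes A v :: "'k::complex_hilbert \<Rightarrow> 'k"
  assumes q: "0 < q" "q < 1" and n: "1 \<le> m + l + k" and adm: "admissible q l A v"
  shows "series q m l k A v (inv_into UNIV v)"
proof -
  have A: "selfadjoint A" "op_spectrum A \<subseteq> complex_of_real ` {q..1}"
    and ne: "\<not> op_eigenvalue A (complex_of_real q)"
    and v: "0 < l \<Longrightarrow> unitary v" "0 < l \<Longrightarrow> A \<circ> v = v \<circ> A" using adm by (auto simp: admissible_def)
  have adjA: "adjp A A" using A by (simp add: selfadjoint_iff)
  note bounds = admissible_bounds[OF q(1) A]
  show ?thesis
  proof
    show "x = 0" if "A (A x) = q\<^sup>2 *\<^sub>R x" for x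
      by (rule admissible_square_kernel[OF q(1) adjA bounds(1) ne that])
    show "adjp v (inv_into UNIV v)" if "0 < l" using unitary_adjp(2)[OF v(1)[OF that]] .
    show "v (inv_into UNIV v x) = x" if "0 < l" for x using unitary_adjp(5)[OF v(1)[OF that]] .
    show "inv_into UNIV v (v x) = x" if "0 < l" for x using unitary_adjp(6)[OF v(1)[OF that]] .
    show "A (v x) = v (A x)" if "0 < l" for x using v(2)[OF that] by (simp add: fun_eq_iff)
  qed (use q n adjA bounds in auto)
qed

section \<open>Vacuum vectors and the growth of powers on them\<close>

context series begin

lemma lambda_q_nz: "1 \<le> j \<Longrightarrow> lambda_q q j \<noteq> 0"
proof -
  assume "1 \<le> j"
  then have "q powi (2 * j) < q powi 0" using q by (intro power_int_strict_decreasing) auto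
  then show ?thesis by (simp add: lambda_q_def)
qed

lemma beta_q_nz: "1 \<le> j \<Longrightarrow> beta_q q j \<noteq> 0"
proof -
  assume "1 \<le> j"
  then have "q powi 0 < q powi (- 2 * j)" using q by (intro power_int_strict_decreasing) auto
  then show ?thesis by (simp add: beta_q_def)
qed

lemma A_nz: "A x = 0 \<longleftrightarrow> x = 0"
  using A_low[of x] q by (auto simp: adjp_linear[OF A] mult_le_0_iff)

text \<open>The index tuples \<open>om r\<close> are those of the vectors annihilated by \<open>z\<^sub>j\<^sup>*\<close> for \<open>j > l + k\<close> and by
  \<open>z\<^sub>j\<close> for \<open>j < k\<close>; for \<open>k = 0\<close> there is only one, independent of \<open>r\<close>.\<close>

definition om :: "int \<Rightarrow> nat \<Rightarrow> int"
  where "om r x = (if x \<in> {l + k<..n} then 0 else if 0 < k \<and> x = k then r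
    else if 1 \<le> x \<and> x < k then 1 else undefined)"

lemma om_index: "om r \<in> I"
  unfolding index_iff om_def by auto

lemma om_values: "l + k < j \<Longrightarrow> j \<le> n \<Longrightarrow> om r j = 0" "1 \<le> j \<Longrightarrow> j < k \<Longrightarrow> om r j = 1"
  "0 < k \<Longrightarrow> om r k = r" "S (om r) = 0"
  unfolding S_def om_def by auto

lemma om_dom: "ket (om r) (x :: 'k) \<in> fdom I UNIV"
  by (simp add: ket_in_fdom om_index)

lemma om_vacuum:
  "l + k < j \<Longrightarrow> j \<le> n \<Longrightarrow> Y j (ket (om r) x) = 0"
  "1 \<le> j \<Longrightarrow> j < k \<Longrightarrow> Z j (ket (om r) x) = 0"
proof -
  show "Y j (ket (om r) x) = 0" if "l + k < j" "j \<le> n"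
    using om_values(1)[OF that, of r] sh_values(1)[OF that(1), of j]
    by (simp add: Z_ket wts_def C_fock[OF that(1)])
  show "Z j (ket (om r) x) = 0" if "1 \<le> j" "j < k"
    using om_values(2)[OF that, of r] by (simp add: Z_ket wt_def C_low[OF that(2)])
qed

lemma fock_support:
  assumes y: "fin_supp y" and Y: "Y j y = 0" and j: "l + k < j" "j \<le> n" and i: "i \<in> I" "coord y i \<noteq> 0"
  shows "i j = 0"
proof (rule ccontr)
  assume "i j \<noteq> 0"
  moreover have "0 \<le> i j" using i(1) j unfolding index_iff by auto
  ultimately have "1 \<le> dn j i j + 1" using sh_values(1)[OF j(1), of j] by simp
  then have "lambda_q q (dn j i j + 1) \<noteq> 0" by (rule lambda_q_nz)
  moreover have "wts j (dn j i) (coord y i) = 0"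
    using Y coord_Z(2)[OF y, of j "dn j i"] by simp
  ultimately show False using i(2) q by (simp add: wts_def C_fock[OF j(1)])
qed

lemma low_support:
  assumes y: "fin_supp y" and Z: "Z j y = 0" and j: "1 \<le> j" "j < k" and i: "i \<in> I" "coord y i \<noteq> 0"
  shows "i j = 1"
proof (rule ccontr)
  assume "i j \<noteq> 1"
  moreover have "1 \<le> i j" using i(1) j unfolding index_iff by auto
  ultimately have "1 \<le> i j - 1" by simp
  then have "beta_q q (i j - 1) \<noteq> 0" by (rule beta_q_nz)
  moreover have "wt j i (coord y i) = 0"
    using Z coord_Z(1)[OF y, of j "up j i"] by simp
  ultimately show False using i(2) q by (simp add: wt_def C_low[OF j(2)] A_nz)
qed

text \<open>The coefficients lowering a Fock entry vanish only at 0, and those lowering an entry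
  below position \<open>k\<close> only at 1. Annihilation therefore pins every entry except the
  \<open>k\<close>-th.\<close>

lemma vacuum_support:
  assumes y: "y \<in> fdom I UNIV"
    and Y: "\<And>j. l + k < j \<Longrightarrow> j \<le> n \<Longrightarrow> Y j y = 0" and Z: "\<And>j. 1 \<le> j \<Longrightarrow> j < k \<Longrightarrow> Z j y = 0"
    and i: "coord y i \<noteq> 0"
  shows "i = om (i k)"
proof
  fix x
  have iI: "i \<in> I" and fs: "fin_supp y" using y i by (auto simp: fdom_def)
  have out: "i x = undefined" if "x \<notin> {1..k} \<union> {l + k<..n}" using iI that unfolding index_iff by blast
  show "i x = om (i k) x"
    unfolding om_def
    using fock_support[OF fs Y _ _ iI i, of x] low_support[OF fs Z _ _ iI i, of x] out by auto
qed

definition X where "X f = Y k (Z k f) - (if l = 0 then f else 0)"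

lemma coord_X:
  assumes k: "0 < k" and f: "fin_supp f"
  shows "coord (X f) (om r) = (q powi (2 * (1 - r))) *\<^sub>R A (A (coord f (om r)))"
proof -
  let ?x = "coord f (om r)"
  have kn: "k \<in> {1..n}" using k by simp
  have Qk: "Q k (om r) ?x = - (q powi (- r) * q powi (- r)) *\<^sub>R A (A ?x)"
    using Q_values(3)[of k "om r" ?x] om_values(3)[OF k, of r] om_values(4)[of r] by simp
  \<comment> \<open>This is exactly what \<open>X\<close> subtracts: the identity for
    \<open>l = 0\<close>, nothing for \<open>l > 0\<close>.\<close>
  have QS: "Q (Suc k) (om r) ?x = (if l = 0 then ?x else 0)"
  proof (cases "0 < l")
    case True
    then show ?thesis using Q_values(2)[of "Suc k" "om r" ?x] by simp
  next
    case False
    have "(\<Sum>s\<in>{Suc k..n}. om r s) = 0" using False om_values(1) by (intro sum.neutral) auto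
    then show ?thesis using False Q_values(1)[of "Suc k" "om r" ?x] by simp
  qed
  have "coord (Y k (Z k f)) (om r) = wts k (om r) (wt k (om r) ?x)"
    using f by (simp add: coord_Z)
  also have "\<dots> = (if l = 0 then ?x else 0) + (q\<^sup>2 * (q powi (- r) * q powi (- r))) *\<^sub>R A (A ?x)"
    unfolding ZY_diag(2)[OF om_index kn] Qk QS by simp
  also have "q\<^sup>2 * (q powi (- r) * q powi (- r)) = q powi (2 * (1 - r))"
    using q by (simp only: powi_double q_powi) (simp add: power2_eq_square)
  finally show ?thesis by (simp add: X_def)
qed

lemma X_ket:
  assumes k: "0 < k"
  shows "X (ket (om r) x) = ket (om r) ((q powi (2 * (1 - r))) *\<^sub>R A (A x))"
proof (rule ell2_eqI)
  fix i
  show "coord (X (ket (om r) x)) i = coord (ket (om r) ((q powi (2 * (1 - r))) *\<^sub>R A (A x))) i"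
  proof (cases "i = om r")
    case True
    then show ?thesis using coord_X[OF k fin_supp_ket] by (simp add: coord_ket)
  next
    case False
    then have "coord (ket (om r) y) i = 0" for y :: 'k by (simp add: coord_ket)
    moreover from this have "coord (if l = 0 then ket (om r) x else 0) i = 0" by (metis coord_zero)
    ultimately show ?thesis by (simp only: X_def Z_ket up_dn coord_minus) simp
  qed
qed

lemma X_closed: "0 < k \<Longrightarrow> f \<in> fdom I UNIV \<Longrightarrow> X f \<in> fdom I UNIV"
  unfolding X_def
  by (intro complex_vector.subspace_diff fdom_subspace ZY_closed[OF reducing_UNIV])
    (auto simp: complex_vector.subspace_0[OF fdom_subspace])

lemma X_pow_ket:
  assumes "0 < k"
  shows "(X ^^ N) (ket (om r) x) = ket (om r) ((q powi (2 * (1 - r))) ^ N *\<^sub>R ((\<lambda>x. A (A x)) ^^ N) x)"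
  by (induction N) (simp_all add: X_ket[OF assms] adjp_linear[OF A])

lemma coord_X_pow:
  assumes "0 < k" "f \<in> fdom I UNIV"
  shows "(X ^^ N) f \<in> fdom I UNIV"
    "coord ((X ^^ N) f) (om r) = (q powi (2 * (1 - r))) ^ N *\<^sub>R ((\<lambda>x. A (A x)) ^^ N) (coord f (om r))"
proof -
  show D: "(X ^^ N) f \<in> fdom I UNIV" for N
    using assms by (induction N) (auto intro: X_closed)
  show "coord ((X ^^ N) f) (om r) = (q powi (2 * (1 - r))) ^ N *\<^sub>R ((\<lambda>x. A (A x)) ^^ N) (coord f (om r))"
    by (induction N) (simp_all add: coord_X[OF assms(1) fdom_fin_supp[OF D]] adjp_linear[OF A])
qed

lemma A_sq_pow_le: "norm (((\<lambda>x. A (A x)) ^^ N) x) \<le> norm x"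
  by (induction N) (auto intro: order_trans[OF A_le] order_trans[OF A_le])

text \<open>The operator \<open>A^2 / q^2\<close> is at least 1 and fixes no nonzero vector, so its
  bounded orbits are trivial by \<open>bounded_powers_trivial\<close>.\<close>

lemma A_sq_growth:
  assumes "\<And>N. norm (((\<lambda>x. A (A x)) ^^ N) y) \<le> c * (q\<^sup>2) ^ N" shows "y = 0"
proof (rule bounded_powers_trivial)
  let ?B = "\<lambda>x. (1 / q\<^sup>2) *\<^sub>R A (A x)"
  show "adjp ?B ?B" by (rule adjp_scaleR[OF adjp_comp[OF A A]])
  show "(norm x)\<^sup>2 \<le> Re (cinner (?B x) x)" for x
  proof -
    have "(q * norm x)\<^sup>2 \<le> (norm (A x))\<^sup>2" using A_low[of x] q by (intro power_mono) auto
    then show ?thesis using q by (simp add: cinner_simps adjpD[OF A] norm_sq_cinner[symmetric] cinner_self field_simps)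
  qed
  show "x = 0" if "?B x = x" for x
  proof (rule A_ker)
    have "q\<^sup>2 *\<^sub>R ?B x = q\<^sup>2 *\<^sub>R x" using that by simp
    then show "A (A x) = q\<^sup>2 *\<^sub>R x" using q by simp
  qed
  have "(?B ^^ N) y = (1 / q\<^sup>2) ^ N *\<^sub>R ((\<lambda>x. A (A x)) ^^ N) y" for N
    by (induction N) (simp_all add: adjp_linear[OF A])
  then show "norm ((?B ^^ N) y) \<le> c" for N
    using assms[of N] q by (simp add: power_divide field_simps)
qed

end

text \<open>Of the norm only boundedness is asked, so the notion covers unitary equivalences, their
  inverses and projections onto summands.\<close>

definition intertwiner :: "nat \<Rightarrow> 'h::complex_inner set \<Rightarrow> 'g::complex_inner set \<Rightarrow>
    (nat \<Rightarrow> 'h \<Rightarrow> 'h) \<Rightarrow> (nat \<Rightarrow> 'h \<Rightarrow> 'h) \<Rightarrow> (nat \<Rightarrow> 'g \<Rightarrow> 'g) \<Rightarrow> (nat \<Rightarrow> 'g \<Rightarrow> 'g) \<Rightarrow> ('h \<Rightarrow> 'g) \<Rightarrow> bool"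
  where "intertwiner n D D' Z Y Z' Y' T \<longleftrightarrow> clinear_on D T \<and> T ` D \<subseteq> D' \<and>
    (\<exists>c. \<forall>x\<in>D. norm (T x) \<le> c * norm x) \<and>
    (\<forall>j\<in>{1..n}. \<forall>x\<in>D. T (Z j x) = Z' j (T x) \<and> T (Y j x) = Y' j (T x))"

lemma intertwiner_X:
  fixes A v w :: "'a::complex_hilbert \<Rightarrow> 'a" and A' v' w' :: "'b::complex_hilbert \<Rightarrow> 'b"
  assumes "series q m l k A v w" "series q m l k A' v' w'"
    and T: "intertwiner (m + l + k) (fdom (series_index m l k) UNIV) (fdom (series_index m l k) UNIV)
      (series.Z q m l k A v) (series.Y q m l k A v w) (series.Z q m l k A' v') (series.Y q m l k A' v' w') T"
    and k: "0 < k" and f: "f \<in> fdom (series_index m l k) UNIV"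
  shows "T (series.X q m l k A v w f) = series.X q m l k A' v' w' (T f)"
proof -
  interpret s: series q m l k A v w by fact
  interpret t: series q m l k A' v' w' by fact
  let ?D = "fdom (series_index m l k) UNIV :: (nat \<Rightarrow> int, 'a) ell2 set"
  have lin: "clinear_on ?D T" and TZ: "\<And>j x. j \<in> {1..s.n} \<Longrightarrow> x \<in> ?D \<Longrightarrow> T (s.Z j x) = t.Z j (T x)"
    and TY: "\<And>j x. j \<in> {1..s.n} \<Longrightarrow> x \<in> ?D \<Longrightarrow> T (s.Y j x) = t.Y j (T x)"
    using T by (auto simp: intertwiner_def)
  have kn: "k \<in> {1..s.n}" using k by simp
  have D0: "0 \<in> ?D" by (rule complex_vector.subspace_0[OF fdom_subspace]) simp
  have T0: "T 0 = 0" by (rule clinear_on_zero[OF lin D0])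
  have ZD: "s.Z k f \<in> ?D" and YZ: "s.Y k (s.Z k f) \<in> ?D"
    using s.ZY_closed[OF s.reducing_UNIV _ kn] f by blast+
  have "T (g + (- 1) *\<^sub>C h) = T g + (- 1) *\<^sub>C T h" if "g \<in> ?D" "h \<in> ?D" for g h
    using lin that complex_vector.subspace_scale[OF fdom_subspace that(2), of "- 1"]
    unfolding clinear_on_def by (metis complex_vector.subspace_UNIV complex_vector.subspace_scale fdom_subspace)
  then have Tdiff: "T (g - h) = T g - T h" if "g \<in> ?D" "h \<in> ?D" for g h
    using that by simp
  have h: "(if l = 0 then f else 0) \<in> ?D" using f D0 by metis
  have Th: "T (if l = 0 then f else 0) = (if l = 0 then T f else 0)" using T0 by metis
  show ?thesis unfolding s.X_def t.X_def Tdiff[OF YZ h] Th TY[OF kn ZD] TZ[OF kn f] ..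
qed

text \<open>Compare powers of \<open>X\<close> before and after \<open>T\<close>. On the vacuum at
  \<open>r\<close> they grow at most by \<open>q powi (2 * (1 - r))\<close> per step. A component
  \<open>u\<close> of the image at an entry \<open>s > r\<close> carries the larger factor
  \<open>q powi (2 * (1 - s))\<close>, so \<open>A'^(2 N) u\<close> would be of order
  \<open>q^(2 N)\<close>; by \<open>A_sq_growth\<close> then \<open>u = 0\<close>.\<close>

lemma intertwiner_vacuum:
  fixes A v w :: "'a::complex_hilbert \<Rightarrow> 'a" and A' v' w' :: "'b::complex_hilbert \<Rightarrow> 'b"
  assumes "series q m l k A v w" "series q m l k A' v' w'"
    and T: "intertwiner (m + l + k) (fdom (series_index m l k) UNIV) (fdom (series_index m l k) UNIV)
      (series.Z q m l k A v) (series.Y q m l k A v w) (series.Z q m l k A' v') (series.Y q m l k A' v' w') T"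
    and nz: "coord (T (ket (series.om m l k r) x)) i \<noteq> 0"
  shows "\<exists>s. i = series.om m l k s \<and> (0 < k \<longrightarrow> s \<le> r)"
proof -
  interpret s: series q m l k A v w by fact
  interpret t: series q m l k A' v' w' by fact
  let ?D = "fdom (series_index m l k) UNIV :: (nat \<Rightarrow> int, 'a) ell2 set"
  let ?y = "T (ket (s.om r) x)"
  obtain c where c: "\<And>x. x \<in> ?D \<Longrightarrow> norm (T x) \<le> c * norm x"
    using T unfolding intertwiner_def by blast
  have lin: "clinear_on ?D T" and TZ: "\<And>j x. j \<in> {1..s.n} \<Longrightarrow> x \<in> ?D \<Longrightarrow> T (s.Z j x) = t.Z j (T x)"
    and TY: "\<And>j x. j \<in> {1..s.n} \<Longrightarrow> x \<in> ?D \<Longrightarrow> T (s.Y j x) = t.Y j (T x)"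
    and TD: "\<And>x. x \<in> ?D \<Longrightarrow> T x \<in> fdom (series_index m l k) UNIV"
    using T by (auto simp: intertwiner_def)
  have T0: "T 0 = 0"
    by (rule clinear_on_zero[OF lin complex_vector.subspace_0[OF fdom_subspace]]) simp
  have i: "i = s.om (i k)"
  proof (rule t.vacuum_support[OF TD[OF s.om_dom] _ _ nz])
    show "t.Y j ?y = 0" if "l + k < j" "j \<le> s.n" for j
      using TY[OF _ s.om_dom, of j r x] that by (simp add: s.om_vacuum T0)
    show "t.Z j ?y = 0" if "1 \<le> j" "j < k" for j
      using TZ[OF _ s.om_dom, of j r x] that by (simp add: s.om_vacuum T0)
  qed
  have "i k \<le> r" if k: "0 < k"
  proof (rule ccontr)
    assume "\<not> i k \<le> r"
    \<comment> \<open>The distance beyond the one step that already suffices; it contributes a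
      factor at most 1, which is dropped at the end.\<close>
    define d where "d = nat (i k - r - 1)"
    have d: "i k = r + 1 + int d" using \<open>\<not> i k \<le> r\<close> by (simp add: d_def)
    let ?a = "\<lambda>N. norm (((\<lambda>x. A' (A' x)) ^^ N) (coord ?y i))"
    have kn: "k \<in> {1..s.n}" using k by simp
    have TX: "T (s.X f) = t.X (T f)" if f: "f \<in> ?D" for f
      by (rule intertwiner_X[OF assms(1,2) T k f])
    have TXN: "T ((s.X ^^ N) (ket (s.om r) x)) = (t.X ^^ N) ?y" for N
      by (induction N) (simp_all add: TX s.coord_X_pow(1)[OF k s.om_dom])
    have bound: "(q powi (2 * (1 - i k))) ^ N * ?a N \<le> c * (q powi (2 * (1 - r))) ^ N * norm x" for N
    proof -
      have cnn: "0 \<le> c * norm z" if "z \<in> ?D" for z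
        using c[OF that] norm_ge_zero order_trans by blast
      have "norm (coord ((t.X ^^ N) ?y) (s.om (i k))) \<le> norm (T ((s.X ^^ N) (ket (s.om r) x)))"
        unfolding TXN by (rule norm_coord_le)
      also have "\<dots> \<le> c * norm ((s.X ^^ N) (ket (s.om r) x))"
        by (rule c[OF s.coord_X_pow(1)[OF k s.om_dom]])
      also have "norm ((s.X ^^ N) (ket (s.om r) x)) =
          (q powi (2 * (1 - r))) ^ N * norm (((\<lambda>x. A (A x)) ^^ N) x)"
        unfolding s.X_pow_ket[OF k] norm_ket using s.q by simp
      also have "c * \<dots> \<le> c * ((q powi (2 * (1 - r))) ^ N * norm x)"
      proof (cases "x = 0")
        case True
        then show ?thesis using s.A_sq_pow_le[of N x] by simp
      next
        case False
        \<comment> \<open>The definition of \<open>intertwiner\<close> leaves the sign of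
          \<open>c\<close> open; a nonzero vector of the domain supplies it.\<close>
        then have "0 \<le> c" using cnn[OF s.om_dom[of r x]] by (simp add: norm_ket zero_le_mult_iff)
        then show ?thesis using s.q by (intro mult_left_mono s.A_sq_pow_le) auto
      qed
      finally show ?thesis
        using i s.q unfolding t.coord_X_pow(2)[OF k TD[OF s.om_dom]] by (simp add: mult_ac)
    qed
    have "?a N \<le> (c * norm x) * (q\<^sup>2) ^ N" for N
    proof -
      have "0 \<le> c * norm x" using c[OF s.om_dom[of r x]] norm_ge_zero order_trans unfolding norm_ket by blast
      let ?u = "q powi (2 * (1 - i k))"
      have u: "0 < ?u" using s.q by simp
      have "2 * (1 - r) = 2 * (1 - i k) + int (2 + 2 * d)" using d by simp
      then have "q powi (2 * (1 - r)) = ?u * (q\<^sup>2 * (q\<^sup>2) ^ d)"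
        by (simp only: s.q_powi(1) power_int_of_nat power_add power_mult)
      then have "?u ^ N * ?a N \<le> ?u ^ N * ((c * norm x) * ((q\<^sup>2) ^ N * ((q\<^sup>2) ^ d) ^ N))"
        using bound[of N] by (simp add: power_mult_distrib mult_ac)
      then have "?a N \<le> (c * norm x) * ((q\<^sup>2) ^ N * ((q\<^sup>2) ^ d) ^ N)"
        by (rule mult_left_le_imp_le) (use u in simp)
      also have "\<dots> \<le> (c * norm x) * ((q\<^sup>2) ^ N * 1)"
        using s.q \<open>0 \<le> c * norm x\<close> by (intro mult_left_mono) (auto simp: power_le_one)
      finally show ?thesis by simp
    qed
    then have "coord ?y i = 0" by (rule t.A_sq_growth)
    then show False using nz by simp
  qed
  then show ?thesis using i by blast
qed

text \<open>By \<open>intertwiner_vacuum\<close> neither \<open>T\<close> nor its adjoint raises the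
  \<open>k\<close>-th entry. A component of the image at an entry \<open>s < r\<close> is a matrix
  element of the adjoint from \<open>s\<close> up to \<open>r\<close>, hence 0.\<close>

lemma intertwiner_om:
  fixes A v w :: "'a::complex_hilbert \<Rightarrow> 'a" and A' v' w' :: "'b::complex_hilbert \<Rightarrow> 'b"
  assumes ser: "series q m l k A v w" "series q m l k A' v' w'"
    and T: "intertwiner (m + l + k) (fdom (series_index m l k) UNIV) (fdom (series_index m l k) UNIV)
      (series.Z q m l k A v) (series.Y q m l k A v w) (series.Z q m l k A' v') (series.Y q m l k A' v' w') T"
    and T': "intertwiner (m + l + k) (fdom (series_index m l k) UNIV) (fdom (series_index m l k) UNIV)
      (series.Z q m l k A' v') (series.Y q m l k A' v' w') (series.Z q m l k A v) (series.Y q m l k A v w) T'"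
    and adj: "\<And>x y. x \<in> fdom (series_index m l k) UNIV \<Longrightarrow> y \<in> fdom (series_index m l k) UNIV \<Longrightarrow>
      cinner (T x) y = cinner x (T' y)"
  shows "T (ket (series.om m l k r) x) = ket (series.om m l k r) (coord (T (ket (series.om m l k r) x)) (series.om m l k r))"
proof -
  interpret s: series q m l k A v w by (rule ser)
  interpret t: series q m l k A' v' w' by (rule ser)
  let ?y = "T (ket (s.om r) x)"
  have "coord ?y i = 0" if "i \<noteq> s.om r" for i
  proof (rule ccontr)
    assume nz: "coord ?y i \<noteq> 0"
    from intertwiner_vacuum[OF ser T nz] obtain s where s: "i = s.om s" "0 < k \<longrightarrow> s \<le> r" by blast
    have "0 < k \<and> s < r"
    proof (rule ccontr)
      assume "\<not> (0 < k \<and> s < r)"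
      then have "s.om s = s.om r" using s(2) by (auto simp: s.om_def fun_eq_iff)
      then show False using that s(1) by simp
    qed
    then have k: "0 < k" and sr: "s < r" by auto
    let ?u = "coord ?y i"
    have "cinner ?u ?u = cinner ?y (ket i ?u)" by (simp add: cinner_ket)
    also have "\<dots> = cinner (ket (s.om r) x) (T' (ket i ?u))"
      unfolding s(1) by (rule adj) (rule s.om_dom t.om_dom)+
    also have "\<dots> = cinner x (coord (T' (ket i ?u)) (s.om r))" by (simp add: cinner_ket_left)
    also have "coord (T' (ket i ?u)) (s.om r) = 0"
    proof (rule ccontr)
      assume nz: "coord (T' (ket i ?u)) (s.om r) \<noteq> 0"
      from intertwiner_vacuum[OF ser(2,1) T' nz[unfolded s(1)]] k obtain s' where
        s': "s.om r = s.om s'" "s' \<le> s" by blast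
      then have "r = s'" using s.om_values(3)[OF k] by metis
      then show False using s'(2) sr by simp
    qed
    finally show False using nz by simp
  qed
  then show ?thesis by (intro ell2_eqI) (simp add: coord_ket)
qed

section \<open>Cyclic vectors over a one-dimensional \<K>\<close>

context series begin

text \<open>The square of \<open>mu j\<close> is the identity plus a positive operator.\<close>

lemma mu_nz: "mu j x = 0 \<longleftrightarrow> x = 0"
proof
  assume "mu j x = 0"
  then have "x + (q powi (- 2 * j)) *\<^sub>R A (A x) = 0"
    using mu(2)[of j x] adjp_linear(3)[OF mu(1)] by simp
  then have "Re (cinner (x + (q powi (- 2 * j)) *\<^sub>R A (A x)) x) = 0" by simp
  then have "(norm x)\<^sup>2 + q powi (- 2 * j) * (norm (A x))\<^sup>2 = 0"
    by (simp add: cinner_simps adjpD[OF A] norm_sq_cinner[symmetric] cinner_self del: of_real_power_int flip: of_real_power)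
  moreover have "0 \<le> q powi (- 2 * j) * (norm (A x))\<^sup>2" using q by simp
  ultimately show "x = 0" by (smt (verit) zero_le_power2 norm_eq_zero power2_eq_iff_nonneg zero_eq_power2)
qed (simp add: adjp_linear(3)[OF mu(1)])

text \<open>If \<open>\<K>\<close> is one-dimensional, the vectors with index \<open>om 1\<close> are cyclic.\<close>

lemma intertwiner_zero:
  assumes e: "\<And>x :: 'k. \<exists>c. x = c *\<^sub>C e"
    and T: "intertwiner n (fdom I UNIV) (fdom I UNIV) Z Y Z Y T"
    and T0: "\<And>x. T (ket (om 1) x) = 0" and f: "f \<in> fdom I UNIV"
  shows "T f = 0"
proof -
  have lin: "clinear_on (fdom I UNIV) T"
    and TZ: "\<And>j x. j \<in> {1..n} \<Longrightarrow> x \<in> fdom I UNIV \<Longrightarrow> T (Z j x) = Z j (T x)"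
    and TY: "\<And>j x. j \<in> {1..n} \<Longrightarrow> x \<in> fdom I UNIV \<Longrightarrow> T (Y j x) = Y j (T x)"
    using T by (auto simp: intertwiner_def)
  have D: "complex_vector.subspace (fdom I (UNIV :: 'k set))" by (rule fdom_subspace) simp
  have zero: "T 0 = 0" by (rule clinear_on_zero[OF lin complex_vector.subspace_0[OF D]])
  have Z0: "Z j 0 = 0" "Y j 0 = 0" for j
    using ZY_linear(2,4)[of 0 j 0] by (simp_all add: fin_supp_def)
  \<comment> \<open>In dimension at most 1 an injective operator is onto, so a nonzero coefficient
    can be undone when passing to a neighbouring index.\<close>
  have surj: "\<exists>y. x = B y" if B: "adjp B B'" and inj: "\<And>y. B y = 0 \<Longrightarrow> y = 0" for B B' :: "'k \<Rightarrow> 'k" and x :: 'k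
  proof -
    obtain b where b: "B e = b *\<^sub>C e" using e by blast
    obtain c where c: "x = c *\<^sub>C e" using e by blast
    show ?thesis
    proof (cases "e = 0")
      case True
      then show ?thesis using c adjp_linear(3)[OF B] by (intro exI[of _ 0]) simp
    next
      case False
      then have "b \<noteq> 0" using inj[of e] b by auto
      then show ?thesis using c b adjp_linear(2)[OF B] by (intro exI[of _ "(c / b) *\<^sub>C e"]) simp
    qed
  qed
  define E where "E = {i \<in> I. \<forall>x. T (ket i x) = 0}"
  have upE: "up j i \<in> E" if "i \<in> E" "j \<in> {1..n}" "up j i \<in> I" "\<And>x. C j i x = 0 \<Longrightarrow> x = 0" for i j
  proof -
    have "T (ket (up j i) x) = 0" for x
    proof -
      have "wt j i x = 0 \<Longrightarrow> x = 0" for x using that(4) q by (simp add: wt_def)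
      then have "\<exists>y. x = wt j i y" by (rule surj[OF wt_adjoint[of j i]])
      then obtain y where "x = wt j i y" by (elim exE)
      then have "ket (up j i) x = Z j (ket i y)" by (simp add: Z_ket)
      then show ?thesis
        using that(1) TZ[OF that(2), of "ket i y"] Z0 by (simp add: E_def ket_in_fdom)
    qed
    then show ?thesis using that(3) by (simp add: E_def)
  qed
  have dnE: "dn j i \<in> E" if "i \<in> E" "j \<in> {1..n}" "dn j i \<in> I" "\<And>x. Cs j (dn j i) x = 0 \<Longrightarrow> x = 0" for i j
  proof -
    have "T (ket (dn j i) x) = 0" for x
    proof -
      have "wts j (dn j i) x = 0 \<Longrightarrow> x = 0" for x using that(4) q by (simp add: wts_def)
      then have "\<exists>y. x = wts j (dn j i) y" by (rule surj[OF adjp_sym[OF wt_adjoint[of j "dn j i"]]])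
      then obtain y where "x = wts j (dn j i) y" by (elim exE)
      then have "ket (dn j i) x = Y j (ket i y)" by (simp add: Z_ket)
      then show ?thesis
        using that(1) TY[OF that(2), of "ket i y"] Z0 by (simp add: E_def ket_in_fdom)
    qed
    then show ?thesis using that(3) by (simp add: E_def)
  qed
  have fockE: "i(j := int N) \<in> E" if i: "i \<in> E" "i j = 0" and j: "l + k < j" "j \<le> n" for i j N
  proof (induction N)
    case 0
    then show ?case using i by (metis fun_upd_triv of_nat_0)
  next
    case (Suc N)
    have jn: "j \<in> {1..n}" using j by simp
    have "up j (i(j := int N)) \<in> E"
    proof (rule upE[OF Suc jn])
      show "up j (i(j := int N)) \<in> I"
        using Suc j jn by (intro shift_index(1)) (auto simp: E_def)
      show "x = 0" if "C j (i(j := int N)) x = 0" for x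
        using that lambda_q_nz[of "int N + 1"] by (simp add: C_fock[OF j(1)])
    qed
    moreover have "up j (i(j := int N)) = i(j := int (Suc N))"
      by (rule ext) (use j in \<open>simp add: sh_def\<close>)
    ultimately show ?case by (simp only:)
  qed
  have lowE: "i(j := 1 + int N) \<in> E" if i: "i \<in> E" "i j = 1" and j: "1 \<le> j" "j < k" for i j N
  proof (induction N)
    case 0
    then show ?case using i by (metis fun_upd_triv of_nat_0 add_0_right)
  next
    case (Suc N)
    let ?i = "i(j := 1 + int N)"
    have jn: "j \<in> {1..n}" using j by simp
    have eq: "dn j ?i = i(j := 1 + int (Suc N))"
      by (rule ext) (use j in \<open>simp add: sh_def\<close>)
    have "dn j ?i \<in> E"
    proof (rule dnE[OF Suc jn])
      show "dn j ?i \<in> I" using Suc j jn by (intro shift_index(2)) (auto simp: E_def)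
      show "x = 0" if "Cs j (dn j ?i) x = 0" for x
        using that beta_q_nz[of "1 + int N"] unfolding eq by (simp add: C_low[OF j(2)] A_nz)
    qed
    then show ?case by (simp only: eq)
  qed
  have Ck: "x = 0" if "C k i x = 0" for i x
  proof (cases "0 < l")
    case True
    then show ?thesis using that by (simp add: C_mid A_nz)
  next
    case False
    then have "l = 0" by simp
    from that[unfolded C_mid0(1)[OF this]] show ?thesis by (simp add: mu_nz)
  qed
  have Csk: "x = 0" if "Cs k i x = 0" for i x
  proof (cases "0 < l")
    case True
    then show ?thesis using that by (simp add: C_mid A_nz)
  next
    case False
    then have "l = 0" by simp
    from that[unfolded C_mid0(2)[OF this]] show ?thesis by (simp add: mu_nz)
  qed
  \<comment> \<open>The \<open>k\<close>-th entry runs through all integers: \<open>Y k\<close>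
    raises it from 1, \<open>Z k\<close> lowers it, and the coefficient never vanishes.\<close>
  have midE1: "i(k := 1 + int N) \<in> E" and midE2: "i(k := 1 - int N) \<in> E"
    if i: "i \<in> E" "i k = 1" and k: "0 < k" for i N
  proof -
    have kn: "k \<in> {1..n}" "1 \<le> k" using k by auto
    show "i(k := 1 + int N) \<in> E"
    proof (induction N)
      case 0
      then show ?case using i by (metis fun_upd_triv of_nat_0 add_0_right)
    next
      case (Suc N)
      let ?i = "i(k := 1 + int N)"
      have eq: "dn k ?i = i(k := 1 + int (Suc N))"
        by (rule ext) (simp add: sh_def)
      have "dn k ?i \<in> E"
      proof (rule dnE[OF Suc kn(1) _ Csk])
        show "dn k ?i \<in> I" using Suc kn(1) by (intro shift_index(2)) (auto simp: E_def)
      qed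
      then show ?case by (simp only: eq)
    qed
    show "i(k := 1 - int N) \<in> E"
    proof (induction N)
      case 0
      then show ?case using i by (metis fun_upd_triv of_nat_0 diff_0_right)
    next
      case (Suc N)
      let ?i = "i(k := 1 - int N)"
      have eq: "up k ?i = i(k := 1 - int (Suc N))"
        by (rule ext) (simp add: sh_def)
      have "up k ?i \<in> E"
      proof (rule upE[OF Suc kn(1) _ Ck])
        show "up k ?i \<in> I" using Suc kn(1) by (intro shift_index(1)) (auto simp: E_def)
      qed
      then show ?case by (simp only: eq)
    qed
  qed
  have "T (ket i x) = 0" if i: "i \<in> I" for i x
  proof -
    let ?P = "{1..k} \<union> {l + k<..n}"
    \<comment> \<open>\<open>om 1\<close> is turned into \<open>i\<close> one position at a time;
      the induction runs over the set of positions already replaced.\<close>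
    let ?r = "\<lambda>F x. if x \<in> F then i x else om 1 x"
    have "?r F \<in> E" if "finite F" "F \<subseteq> ?P" for F
      using that
    proof (induction F rule: finite_induct)
      case empty
      then show ?case using T0 om_index by (simp add: E_def)
    next
      case (insert j F)
      then have r: "?r F \<in> E" and j: "j \<in> ?P" "j \<notin> F" by auto
      have eq: "?r (insert j F) = (?r F)(j := i j)" by auto
      have b: "?r F j = om 1 j" using j by simp
      have "(l + k < j \<and> j \<le> n) \<or> (1 \<le> j \<and> j < k) \<or> (j = k \<and> 0 < k)" using j(1) by auto
      then consider "l + k < j" "j \<le> n" | "1 \<le> j" "j < k" | "j = k" "0 < k" by blast
      then show ?case
      proof cases
        case 1
        have "0 \<le> i j" using i 1 unfolding index_iff by auto
        then obtain N where "i j = int N" using nonneg_int_cases by blast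
        then show ?thesis using fockE[OF r _ 1] b om_values(1)[OF 1] unfolding eq by simp
      next
        case 2
        have "0 \<le> i j - 1" using i 2 unfolding index_iff by auto
        then obtain N where "i j - 1 = int N" using nonneg_int_cases by blast
        then have "i j = 1 + int N" by simp
        then show ?thesis using lowE[OF r _ 2] b om_values(2)[OF 2] unfolding eq by simp
      next
        case 3
        have b1: "?r F k = 1" using b unfolding 3(1) om_values(3)[OF 3(2)] .
        show ?thesis
        proof (cases "1 \<le> i k")
          case True
          then have "1 + int (nat (i k - 1)) = i k" by simp
          with midE1[OF r b1 3(2), of "nat (i k - 1)"] show ?thesis unfolding eq unfolding 3(1) by (simp only:)
        next
          case False
          then have "1 - int (nat (1 - i k)) = i k" by simp
          with midE2[OF r b1 3(2), of "nat (1 - i k)"] show ?thesis unfolding eq unfolding 3(1) by (simp only:)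
        qed
      qed
    qed
    from this[of ?P] have "?r ?P \<in> E" by simp
    moreover have "?r ?P = i"
    proof
      fix x show "?r ?P x = i x"
        using i unfolding index_iff om_def by auto
    qed
    ultimately show ?thesis by (simp add: E_def)
  qed
  then have "complex_vector.span {ket i x | i x. i \<in> I \<and> x \<in> UNIV} \<subseteq> {f \<in> fdom I UNIV. T f = 0}"
    using lin zero D
    by (intro complex_vector.span_minimal)
      (auto simp: complex_vector.subspace_def clinear_on_def intro: ket_in_fdom)
  then show ?thesis using f unfolding fdom_span[OF complex_vector.subspace_UNIV] by blast
qed

section \<open>Invariants of the series\<close>

text \<open>Reads off \<open>m\<close> from the representation: vectors at \<open>om 1\<close> are
  killed by the last \<open>m\<close> starred generators, whereas the next one,
  \<open>Y (l + k)\<close>, is injective, its coefficient being \<open>w\<close> or a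
  \<open>mu\<close>.\<close>

lemma vacuum_exists_iff:
  assumes t: "t \<le> n" and nz: "\<exists>x::'k. x \<noteq> 0"
  shows "(\<exists>y\<in>fdom I UNIV. y \<noteq> 0 \<and> (\<forall>j\<in>{n - t<..n}. Y j y = 0)) \<longleftrightarrow> t \<le> m"
proof
  assume "t \<le> m"
  obtain x :: 'k where "x \<noteq> 0" using nz by blast
  then show "\<exists>y\<in>fdom I UNIV. y \<noteq> 0 \<and> (\<forall>j\<in>{n - t<..n}. Y j y = 0)"
    using \<open>t \<le> m\<close> om_vacuum(1) om_dom by (intro bexI[of _ "ket (om 1) x"]) auto
next
  assume "\<exists>y\<in>fdom I UNIV. y \<noteq> 0 \<and> (\<forall>j\<in>{n - t<..n}. Y j y = 0)"
  then obtain y where y: "y \<in> fdom I UNIV" "y \<noteq> 0" "\<And>j. j \<in> {n - t<..n} \<Longrightarrow> Y j y = 0" by blast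
  show "t \<le> m"
  proof (rule ccontr)
    assume "\<not> t \<le> m"
    then have lk: "l + k \<in> {n - t<..n}" using t by auto
    have inj: "Cs (l + k) i x = 0 \<Longrightarrow> x = 0" for i x
    proof (cases "0 < l")
      case True
      show "x = 0" if "Cs (l + k) i x = 0"
        using that v(2)[OF True, of x] adjp_linear(3)[OF v(1)[OF True]] unfolding C_unit(2)[OF True] by simp
    next
      case False
      then have l: "l = 0" "l + k = k" by simp_all
      show "x = 0" if "Cs (l + k) i x = 0"
        using that unfolding l(2) C_mid0(2)[OF l(1)] by (simp add: mu_nz)
    qed
    have "coord y i = 0" for i
    proof -
      have "wts (l + k) (dn (l + k) i) (coord y i) = 0"
        using y(3)[OF lk] coord_Z(2)[OF fdom_fin_supp[OF y(1)], of "l + k" "dn (l + k) i"] by simp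
      then have "Cs (l + k) (dn (l + k) i) (coord y i) = 0" using q by (simp add: wts_def)
      then show ?thesis by (rule inj)
    qed
    then have "y = 0" by (intro ell2_eqI) simp
    then show False using y(2) by blast
  qed
qed

text \<open>On Fock vacua \<open>z_{l+k}\<close> is the unitary \<open>v\<close> up to a shift when
  \<open>l > 0\<close>. For \<open>l = 0\<close> the operator \<open>X\<close> measures the defect,
  and at \<open>om 1\<close> it is the injective operator \<open>A^2\<close>.\<close>

lemma isometric_on_vacuum_iff:
  assumes lk: "0 < l + k" and nz: "\<exists>x::'k. x \<noteq> 0"
  shows "(\<forall>y\<in>fdom I UNIV. (\<forall>j\<in>{l + k<..n}. Y j y = 0) \<longrightarrow> Y (l + k) (Z (l + k) y) = y) \<longleftrightarrow> 0 < l"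
proof
  assume l: "0 < l"
  show "\<forall>y\<in>fdom I UNIV. (\<forall>j\<in>{l + k<..n}. Y j y = 0) \<longrightarrow> Y (l + k) (Z (l + k) y) = y"
  proof (intro ballI impI ell2_eqI)
    fix y i assume y: "y \<in> fdom I UNIV" "\<forall>j\<in>{l + k<..n}. Y j y = 0"
    have "coord (Y (l + k) (Z (l + k) y)) i = wts (l + k) i (wt (l + k) i (coord y i))"
      using y(1) by (simp add: coord_Z fdom_fin_supp)
    also have "\<dots> = coord y i"
    proof (cases "coord y i = 0")
      case False
      then have "i \<in> I" using y(1) by (auto simp: fdom_def)
      then have "i j = 0" if "j \<in> {l + k<..n}" for j
        using fock_support[OF fdom_fin_supp[OF y(1)], of j i] y(2) that False by auto
      then have "S i = 0" unfolding S_def by (intro sum.neutral) blast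
      then show ?thesis using v(3)[OF l] by (simp add: wt_def wts_def C_unit[OF l] ex_values(2)[OF l])
    qed simp
    finally show "coord (Y (l + k) (Z (l + k) y)) i = coord y i" .
  qed
next
  assume H: "\<forall>y\<in>fdom I UNIV. (\<forall>j\<in>{l + k<..n}. Y j y = 0) \<longrightarrow> Y (l + k) (Z (l + k) y) = y"
  show "0 < l"
  proof (rule ccontr)
    assume "\<not> 0 < l"
    then have l: "l = 0" "l + k = k" and k: "0 < k" using lk by auto
    obtain x :: 'k where x: "x \<noteq> 0" using nz by blast
    have "Y k (Z k (ket (om 1) x)) = ket (om 1) x"
      using H[rule_format, OF om_dom] om_vacuum(1) unfolding l(2) by auto
    moreover have "X (ket (om 1) x) = Y k (Z k (ket (om 1) x)) - ket (om 1) x"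
      unfolding X_def if_P[OF l(1)] ..
    ultimately have "ket (om 1) ((q powi (2 * (1 - 1))) *\<^sub>R A (A x)) = 0"
      unfolding X_ket[OF k] by simp
    then show False using x by (simp add: A_nz)
  qed
qed

text \<open>Locates \<open>k\<close> once \<open>l + k\<close> is known: for positions up to
  \<open>k\<close> the starred generator acts at \<open>om 1\<close> by a nonzero multiple of
  \<open>A\<close>.\<close>

lemma generator_vanishes_iff:
  assumes l: "0 < l" and j: "1 \<le> j" "j < l + k" and nz: "\<exists>x::'k. x \<noteq> 0"
  shows "(\<forall>y\<in>fdom I UNIV. Y j y = 0) \<longleftrightarrow> k < j"
proof
  assume "k < j"
  then have "null j" using j unfolding null_def by simp
  show "\<forall>y\<in>fdom I UNIV. Y j y = 0"
    using C_null(2)[OF \<open>null j\<close>] by (auto intro!: ell2_eqI simp: coord_Z fdom_fin_supp wts_def)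
next
  assume H: "\<forall>y\<in>fdom I UNIV. Y j y = 0"
  show "k < j"
  proof (rule ccontr)
    assume "\<not> k < j"
    then have jk: "j \<le> k" by simp
    obtain x :: 'k where x: "x \<noteq> 0" using nz by blast
    have "Cs j (dn j (om 1)) x \<noteq> 0"
    proof (cases "j = k")
      case True
      then show ?thesis using x C_mid(2)[OF l] by (simp add: A_nz)
    next
      case False
      then have "j < k" using jk by simp
      then show ?thesis
        using x j beta_q_nz[of 1] om_values(2)[OF j(1), of 1] sh_values(2)[of j j] by (simp add: C_low A_nz)
    qed
    moreover have "Y j (ket (om 1) x) = 0" using H om_dom by blast
    ultimately show False using q by (simp add: Z_ket wts_def)
  qed
qed

end

section \<open>Unitary equivalence\<close>

text \<open>Trades the unitary for two mutually inverse and mutually adjoint bounded intertwiners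
  between the algebraic domains, the form in which the growth argument applies.\<close>

lemma series_equivalence:
  fixes A v w :: "'a::complex_hilbert \<Rightarrow> 'a" and A' v' w' :: "'b::complex_hilbert \<Rightarrow> 'b"
  assumes "series q m l k A v w" "series q m' l' k' A' v' w'" and n: "m' + l' + k' = m + l + k"
    and \<pi>: "series_rep q m l k A v \<pi>" "series_rep q m' l' k' A' v' \<pi>'"
    and eq: "unitarily_equivalent (Oq q (m + l + k)) (series_space m l k) (series_dom m l k) \<pi>
      (series_space m' l' k') (series_dom m' l' k') \<pi>'"
  shows "\<exists>U U'.
    intertwiner (m + l + k) (fdom (series_index m l k) UNIV) (fdom (series_index m' l' k') UNIV)
      (series.Z q m l k A v) (series.Y q m l k A v w) (series.Z q m' l' k' A' v') (series.Y q m' l' k' A' v' w') U \<and>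
    intertwiner (m + l + k) (fdom (series_index m' l' k') UNIV) (fdom (series_index m l k) UNIV)
      (series.Z q m' l' k' A' v') (series.Y q m' l' k' A' v' w') (series.Z q m l k A v) (series.Y q m l k A v w) U' \<and>
    (\<forall>x\<in>fdom (series_index m l k) UNIV. U' (U x) = x) \<and>
    (\<forall>y\<in>fdom (series_index m' l' k') UNIV. U (U' y) = y) \<and>
    (\<forall>x\<in>fdom (series_index m l k) UNIV. \<forall>y\<in>fdom (series_index m' l' k') UNIV.
      cinner (U x) y = cinner x (U' y))"
proof -
  interpret s: series q m l k A v w by fact
  interpret t: series q m' l' k' A' v' w' by fact
  let ?D = "fdom (series_index m l k) UNIV :: (nat \<Rightarrow> int, 'a) ell2 set"
  let ?D' = "fdom (series_index m' l' k') UNIV :: (nat \<Rightarrow> int, 'b) ell2 set"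
  have "dense_subspace (series_space m l k) ?D"
    using \<pi>(1) by (simp add: series_rep_def star_rep_def s.series_dom_eq)
  then have DH: "?D \<subseteq> series_space m l k" by (simp add: dense_subspace_def)
  obtain U where U: "unitary_on (series_space m l k) (series_space m' l' k') U" "U ` ?D = ?D'"
    and int: "\<And>a d. a \<in> carrier (Oq q (m + l + k)) \<Longrightarrow> d \<in> ?D \<Longrightarrow> U (\<pi> a d) = \<pi>' a (U d)"
    using eq by (auto simp: unitarily_equivalent_def s.series_dom_eq t.series_dom_eq)
  have lin: "clinear_on ?D U"
    using U(1) subsetD[OF DH] unfolding unitary_on_def clinear_on_def by blast
  have iso: "cinner (U x) (U y) = cinner x y" if "x \<in> ?D" "y \<in> ?D" for x y
    using U(1) DH that by (auto simp: unitary_on_def)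
  have nrm: "norm (U x) = norm x" if "x \<in> ?D" for x
  proof -
    have "(norm (U x))\<^sup>2 = (norm x)\<^sup>2" using iso[OF that that] by (simp add: norm_sq_cinner)
    then show ?thesis by simp
  qed
  have UD: "U x \<in> ?D'" if "x \<in> ?D" for x using U(2) that by blast
  have ZU: "U (s.Z j x) = t.Z j (U x)" "U (s.Y j x) = t.Y j (U x)"
    if j: "j \<in> {1..s.n}" and x: "x \<in> ?D" for j x
  proof -
    have j': "j \<in> {1..t.n}" using j n by simp
    note gens = s.series_rep_gens[OF \<pi>(1) j x] t.series_rep_gens[OF \<pi>(2) j' UD[OF x]]
    have cls: "oq_class q s.n (zgen j) \<in> carrier (Oq q s.n)" "oq_class q s.n (zgen_star j) \<in> carrier (Oq q s.n)"
      by (intro Oq_carrier_class zgen_carrier j)+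
    have star: "star_rep (Oq q s.n) (series_space m l k) ?D \<pi>"
      "star_rep (Oq q t.n) (series_space m' l' k') ?D' \<pi>'"
      using \<pi> by (auto simp: series_rep_def s.series_dom_eq t.series_dom_eq)
    have "t.Z j (U x) = \<pi>' (oq_class q s.n (zgen j)) (U x)"
      using gens(3) unfolding rep_gen_def[OF t.n1 star(2)] unfolding n by simp
    moreover have "t.Y j (U x) = \<pi>' (oq_class q s.n (zgen_star j)) (U x)"
      using gens(4) unfolding rep_gen_star_def[OF t.n1 star(2)] unfolding n by simp
    moreover have "s.Z j x = \<pi> (oq_class q s.n (zgen j)) x" "s.Y j x = \<pi> (oq_class q s.n (zgen_star j)) x"
      using gens(1,2) unfolding rep_gen_def[OF s.n1 star(1)] rep_gen_star_def[OF s.n1 star(1)] by simp_all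
    ultimately show "U (s.Z j x) = t.Z j (U x)" "U (s.Y j x) = t.Y j (U x)"
      using int[OF cls(1) x] int[OF cls(2) x] by simp_all
  qed
  define U' where "U' = inv_into ?D U"
  have U'D: "U' y \<in> ?D" and UU': "U (U' y) = y" if "y \<in> ?D'" for y
    using that U(2) unfolding U'_def by (metis inv_into_into, metis f_inv_into_f)
  have sub: "complex_vector.subspace ?D" "complex_vector.subspace ?D'" by (intro fdom_subspace; simp)+
  have inj: "x = y" if xy: "x \<in> ?D" "y \<in> ?D" "U x = U y" for x y
  proof -
    have "cinner (x - y) (x - y) = 0"
      using iso[OF xy(1,1)] iso[OF xy(1,2)] iso[OF xy(2,1)] iso[OF xy(2,2)] xy(3)
      by (simp add: cinner_diff)
    then show ?thesis by simp
  qed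
  have U'U: "U' (U x) = x" if "x \<in> ?D" for x
    using inj[OF U'D[OF UD[OF that]] that UU'[OF UD[OF that]]] .
  have lin': "clinear_on ?D' U'"
    unfolding clinear_on_def
  proof (intro conjI ballI allI)
    fix x y c assume x: "x \<in> ?D'" and y: "y \<in> ?D'"
    have "U (U' x + U' y) = x + y" using lin U'D x y UU' by (simp add: clinear_on_def)
    moreover have "U' x + U' y \<in> ?D" using sub U'D x y by (simp add: complex_vector.subspace_add)
    ultimately show "U' (x + y) = U' x + U' y" using U'U by metis
  next
    fix c x assume x: "x \<in> ?D'"
    have "U (c *\<^sub>C U' x) = c *\<^sub>C x" using lin U'D x UU' by (simp add: clinear_on_def)
    moreover have "c *\<^sub>C U' x \<in> ?D" using sub U'D x by (simp add: complex_vector.subspace_scale)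
    ultimately show "U' (c *\<^sub>C x) = c *\<^sub>C U' x" using U'U by metis
  qed
  have ZU': "U' (t.Z j y) = s.Z j (U' y)" "U' (t.Y j y) = s.Y j (U' y)"
    if j: "j \<in> {1..s.n}" and y: "y \<in> ?D'" for j y
  proof -
    have D: "s.Z j (U' y) \<in> ?D" "s.Y j (U' y) \<in> ?D"
      using s.ZY_closed[OF s.reducing_UNIV U'D[OF y] j] by blast+
    show "U' (t.Z j y) = s.Z j (U' y)" "U' (t.Y j y) = s.Y j (U' y)"
      using ZU[OF j U'D[OF y]] U'U[OF D(1)] U'U[OF D(2)] UU'[OF y] by simp_all
  qed
  have nrm': "norm (U' y) = norm y" if "y \<in> ?D'" for y
    using nrm[OF U'D[OF that]] UU'[OF that] by simp
  show ?thesis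
  proof (intro exI[of _ U] exI[of _ U'] conjI ballI)
    show "intertwiner s.n ?D ?D' s.Z s.Y t.Z t.Y U"
      using lin UD ZU nrm by (auto simp: intertwiner_def intro!: exI[of _ 1])
    show "intertwiner s.n ?D' ?D t.Z t.Y s.Z s.Y U'"
      using lin' U'D ZU' nrm' by (auto simp: intertwiner_def intro!: exI[of _ 1])
    show "U' (U x) = x" if "x \<in> ?D" for x by (rule U'U[OF that])
    show "U (U' y) = y" if "y \<in> ?D'" for y by (rule UU'[OF that])
    show "cinner (U x) y = cinner x (U' y)" if "x \<in> ?D" "y \<in> ?D'" for x y
      using iso[OF that(1) U'D[OF that(2)]] UU'[OF that(2)] by simp
  qed
qed

text \<open>The three criteria above are phrased through the generators, hence are transported by an
  intertwiner. The first yields \<open>m\<close> and so \<open>l + k\<close>, the second whether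
  \<open>l > 0\<close>, the third \<open>k\<close>.\<close>

lemma equivalent_same_series:
  fixes A v w :: "'a::complex_hilbert \<Rightarrow> 'a" and A' v' w' :: "'b::complex_hilbert \<Rightarrow> 'b"
  assumes ser: "series q m l k A v w" "series q m' l' k' A' v' w'" and n: "m' + l' + k' = m + l + k"
    and \<pi>: "series_rep q m l k A v \<pi>" "series_rep q m' l' k' A' v' \<pi>'"
    and eq: "unitarily_equivalent (Oq q (m + l + k)) (series_space m l k) (series_dom m l k) \<pi>
      (series_space m' l' k') (series_dom m' l' k') \<pi>'"
    and nz: "\<exists>x::'a. x \<noteq> 0" "\<exists>x::'b. x \<noteq> 0"
  shows "(m, l, k) = (m', l', k')"
proof -
  interpret s: series q m l k A v w by fact
  interpret t: series q m' l' k' A' v' w' by fact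
  let ?D = "fdom (series_index m l k) UNIV :: (nat \<Rightarrow> int, 'a) ell2 set"
  let ?D' = "fdom (series_index m' l' k') UNIV :: (nat \<Rightarrow> int, 'b) ell2 set"
  obtain U U' where U: "intertwiner s.n ?D ?D' s.Z s.Y t.Z t.Y U" "intertwiner s.n ?D' ?D t.Z t.Y s.Z s.Y U'"
    and inv: "\<And>x. x \<in> ?D \<Longrightarrow> U' (U x) = x" "\<And>y. y \<in> ?D' \<Longrightarrow> U (U' y) = y"
    using series_equivalence[OF ser n \<pi> eq] by (elim exE conjE) blast
  have D: "x \<in> ?D \<Longrightarrow> U x \<in> ?D'" "y \<in> ?D' \<Longrightarrow> U' y \<in> ?D" for x y
    using U by (auto simp: intertwiner_def)
  have Z: "U (s.Z j x) = t.Z j (U x)" "U (s.Y j x) = t.Y j (U x)" if "j \<in> {1..s.n}" "x \<in> ?D" for j x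
    using U(1) that by (auto simp: intertwiner_def)
  have Z': "U' (t.Z j y) = s.Z j (U' y)" "U' (t.Y j y) = s.Y j (U' y)" if "j \<in> {1..s.n}" "y \<in> ?D'" for j y
    using U(2) that by (auto simp: intertwiner_def)
  have "clinear_on ?D U" "clinear_on ?D' U'" using U by (auto simp: intertwiner_def)
  moreover have "0 \<in> ?D" "0 \<in> ?D'" by (rule complex_vector.subspace_0[OF fdom_subspace]; simp)+
  ultimately have U0: "U 0 = 0" "U' 0 = 0" by (auto intro: clinear_on_zero)
  have U_nz: "U x = 0 \<longleftrightarrow> x = 0" if "x \<in> ?D" for x
    using inv(1)[OF that] U0 by (auto dest: arg_cong[of _ _ U'])
  have U'_nz: "U' y = 0 \<longleftrightarrow> y = 0" if "y \<in> ?D'" for y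
    using inv(2)[OF that] U0 by (auto dest: arg_cong[of _ _ U])
  have Y0: "s.Y j x = 0 \<longleftrightarrow> t.Y j (U x) = 0" if "j \<in> {1..s.n}" "x \<in> ?D" for j x
    unfolding Z(2)[OF that, symmetric]
    using U_nz[OF s.ZY_closed(2)[OF s.reducing_UNIV that(2,1)]] by simp
  have Y0': "t.Y j y = 0 \<longleftrightarrow> s.Y j (U' y) = 0" if "j \<in> {1..s.n}" "y \<in> ?D'" for j y
    using Y0[OF that(1) D(2)[OF that(2)]] inv(2)[OF that(2)] by simp
  have vac: "(\<exists>y\<in>?D. y \<noteq> 0 \<and> (\<forall>j\<in>J. s.Y j y = 0)) \<longleftrightarrow> (\<exists>y\<in>?D'. y \<noteq> 0 \<and> (\<forall>j\<in>J. t.Y j y = 0))"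
    if "J \<subseteq> {1..s.n}" for J
  proof
    assume "\<exists>y\<in>?D. y \<noteq> 0 \<and> (\<forall>j\<in>J. s.Y j y = 0)"
    then obtain y where "y \<in> ?D" "y \<noteq> 0" "\<forall>j\<in>J. s.Y j y = 0" by blast
    then show "\<exists>y\<in>?D'. y \<noteq> 0 \<and> (\<forall>j\<in>J. t.Y j y = 0)"
      using Y0[OF subsetD[OF that]] U_nz D(1) by (intro bexI[of _ "U y"]) auto
  next
    assume "\<exists>y\<in>?D'. y \<noteq> 0 \<and> (\<forall>j\<in>J. t.Y j y = 0)"
    then obtain y where "y \<in> ?D'" "y \<noteq> 0" "\<forall>j\<in>J. t.Y j y = 0" by blast
    then show "\<exists>y\<in>?D. y \<noteq> 0 \<and> (\<forall>j\<in>J. s.Y j y = 0)"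
      using Y0'[OF subsetD[OF that]] U'_nz D(2) by (intro bexI[of _ "U' y"]) auto
  qed
  have "t \<le> m \<longleftrightarrow> t \<le> m'" if "t \<le> s.n" for t
  proof -
    have J: "{s.n - t<..s.n} \<subseteq> {1..s.n}" by auto
    have tn: "t \<le> t.n" using that n by simp
    show ?thesis
      using vac[OF J] unfolding s.vacuum_exists_iff[OF that nz(1)] t.vacuum_exists_iff[OF tn nz(2), unfolded n] .
  qed
  \<comment> \<open>The choices \<open>t = m\<close> and \<open>t = m'\<close> give the two
    inequalities.\<close>
  from this[of m] this[of m'] have m: "m = m'" using n by simp
  then have lk: "l + k = l' + k'" using n by simp
  show ?thesis
  proof (cases "l + k = 0")
    case True
    then show ?thesis using m lk by simp
  next
    case False
    let ?j = "l + k"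
    have j: "?j \<in> {1..s.n}" using False by auto
    have J: "{l + k<..s.n} \<subseteq> {1..s.n}" by auto
    have "(\<forall>y\<in>?D. (\<forall>j\<in>{l + k<..s.n}. s.Y j y = 0) \<longrightarrow> s.Y ?j (s.Z ?j y) = y) \<longleftrightarrow>
      (\<forall>y\<in>?D'. (\<forall>j\<in>{l + k<..s.n}. t.Y j y = 0) \<longrightarrow> t.Y ?j (t.Z ?j y) = y)" (is "?L \<longleftrightarrow> ?R")
    proof
      assume L: ?L
      show ?R
      proof (intro ballI impI)
        fix y assume y: "y \<in> ?D'" "\<forall>j\<in>{l + k<..s.n}. t.Y j y = 0"
        have "\<forall>j\<in>{l + k<..s.n}. s.Y j (U' y) = 0" using y Y0' J by blast
        then have "s.Y ?j (s.Z ?j (U' y)) = U' y" using L D(2)[OF y(1)] by blast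
        then have "U (s.Y ?j (s.Z ?j (U' y))) = y" using inv(2)[OF y(1)] by simp
        then show "t.Y ?j (t.Z ?j y) = y"
          using Z[OF j] D(2)[OF y(1)] inv(2)[OF y(1)] s.ZY_closed(1)[OF s.reducing_UNIV _ j] by simp
      qed
    next
      assume R: ?R
      show ?L
      proof (intro ballI impI)
        fix x assume x: "x \<in> ?D" "\<forall>j\<in>{l + k<..s.n}. s.Y j x = 0"
        have "\<forall>j\<in>{l + k<..s.n}. t.Y j (U x) = 0" using x Y0 J by blast
        then have "t.Y ?j (t.Z ?j (U x)) = U x" using R D(1)[OF x(1)] by blast
        then have "U (s.Y ?j (s.Z ?j x)) = U x"
          using Z[OF j] x(1) s.ZY_closed(1)[OF s.reducing_UNIV x(1) j] by simp
        moreover have "s.Y ?j (s.Z ?j x) \<in> ?D"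
          using s.ZY_closed[OF s.reducing_UNIV _ j] x(1) by blast
        ultimately show "s.Y ?j (s.Z ?j x) = x" using inv(1) x(1) by metis
      qed
    qed
    then have l: "0 < l \<longleftrightarrow> 0 < l'"
      using s.isometric_on_vacuum_iff nz(1) t.isometric_on_vacuum_iff nz(2) False unfolding n lk by auto
    show ?thesis
    proof (cases "0 < l")
      case False
      then show ?thesis using m lk l by simp
    next
      case True
      have "k < j \<longleftrightarrow> k' < j" if "1 \<le> j" "j < l + k" for j
      proof -
        have jn: "j \<in> {1..s.n}" using that by auto
        have "(\<forall>y\<in>?D. s.Y j y = 0) \<longleftrightarrow> (\<forall>y\<in>?D'. t.Y j y = 0)"
          using Y0[OF jn] Y0'[OF jn] D by blast
        then show ?thesis
          using s.generator_vanishes_iff[OF True that nz(1)] t.generator_vanishes_iff[of j] l True that nz(2) lk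
          by auto
      qed
      moreover have kl: "k < l + k" "k' < l + k" using True l lk by auto
      ultimately have "k = k'"
      proof -
        assume iff: "\<And>j. 1 \<le> j \<Longrightarrow> j < l + k \<Longrightarrow> (k < j) = (k' < j)"
        show "k = k'"
        proof (rule ccontr)
          assume "k \<noteq> k'"
          then consider "k < k'" | "k' < k" by linarith
          \<comment> \<open>The larger of \<open>k\<close> and \<open>k'\<close>, taken as
            \<open>j\<close>, exceeds the one but not the other; it is positive, and below
            \<open>l + k\<close> by \<open>kl\<close>.\<close>
          then show False
            using iff[of k] iff[of k'] kl by cases auto
        qed
      qed
      then show ?thesis using m lk by simp
    qed
  qed
qed

text \<open>The equivalence preserves the component at \<open>om 1\<close> and so restricts to a
  unitary \<open>W\<close>. It intertwines the squares of \<open>A\<close> and \<open>A'\<close>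
  through \<open>X\<close>, hence these operators themselves by uniqueness of positive
  roots.\<close>

lemma equivalent_data_equivalent:
  fixes A v w :: "'a::complex_hilbert \<Rightarrow> 'a" and A' v' w' :: "'b::complex_hilbert \<Rightarrow> 'b"
  assumes ser: "series q m l k A v w" "series q m l k A' v' w'"
    and \<pi>: "series_rep q m l k A v \<pi>" "series_rep q m l k A' v' \<pi>'"
    and eq: "unitarily_equivalent (Oq q (m + l + k)) (series_space m l k) (series_dom m l k) \<pi>
      (series_space m l k) (series_dom m l k) \<pi>'"
  shows "data_equivalent l k A v A' v'"
proof -
  interpret s: series q m l k A v w by fact
  interpret t: series q m l k A' v' w' by fact
  let ?D = "fdom (series_index m l k) UNIV :: (nat \<Rightarrow> int, 'a) ell2 set"
  let ?D' = "fdom (series_index m l k) UNIV :: (nat \<Rightarrow> int, 'b) ell2 set"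
  obtain U U' where U: "intertwiner s.n ?D ?D' s.Z s.Y t.Z t.Y U" and U': "intertwiner s.n ?D' ?D t.Z t.Y s.Z s.Y U'"
    and inv: "\<And>x. x \<in> ?D \<Longrightarrow> U' (U x) = x" "\<And>y. y \<in> ?D' \<Longrightarrow> U (U' y) = y"
    and adj: "\<And>x y. x \<in> ?D \<Longrightarrow> y \<in> ?D' \<Longrightarrow> cinner (U x) y = cinner x (U' y)"
    using series_equivalence[OF ser refl \<pi> eq] by (elim exE conjE) blast
  have adj': "cinner (U' y) x = cinner y (U x)" if "y \<in> ?D'" "x \<in> ?D" for x y
    using adj[OF that(2,1)] by (metis cinner_commute)
  have Z: "U (s.Z j x) = t.Z j (U x)" "U (s.Y j x) = t.Y j (U x)" if "j \<in> {1..s.n}" "x \<in> ?D" for j x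
    using U that by (auto simp: intertwiner_def)
  define W where "W x = coord (U (ket (s.om 1) x)) (s.om 1)" for x
  define W' where "W' y = coord (U' (ket (s.om 1) y)) (s.om 1)" for y
  have W: "U (ket (s.om 1) x) = ket (s.om 1) (W x)" for x
    unfolding W_def by (rule intertwiner_om[OF ser U U' adj])
  have W': "U' (ket (s.om 1) y) = ket (s.om 1) (W' y)" for y
    unfolding W'_def by (rule intertwiner_om[OF ser(2,1) U' U adj'])
  have ket_inj: "x = y" if "ket (s.om 1) x = ket (s.om 1) y" for x y :: "'c::complex_hilbert"
    using that by (metis coord_ket)
  have W'W: "W' (W x) = x" for x
    using inv(1)[OF s.om_dom, of 1 x] unfolding W W' by (rule ket_inj)
  have WW': "W (W' y) = y" for y
    using inv(2)[OF t.om_dom, of 1 y] unfolding W W' by (rule ket_inj)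
  have adjW: "adjp W W'"
  proof (rule adjpI)
    show "cinner (W x) y = cinner x (W' y)" for x y
      using adj[OF s.om_dom t.om_dom, of 1 x 1 y] unfolding W W' by (simp add: cinner_ket coord_ket)
  qed
  have "unitary W"
    unfolding unitary_on_def
  proof (intro conjI ballI)
    show "clinear_on UNIV W" by (simp add: clinear_on_def adjp_linear[OF adjW])
    show "cinner (W x) (W y) = cinner x y" for x y by (simp add: adjpD[OF adjW] W'W)
    show "W ` UNIV = UNIV" using WW' by (metis surjI)
  qed
  moreover have WA: "W (A x) = A' (W x)" if k: "0 < k" for x
  proof -
    have sq: "W (A (A x)) = A' (A' (W x))" for x
    proof (rule ket_inj)
      have "U (s.X (ket (s.om 1) x)) = t.X (U (ket (s.om 1) x))"
        by (rule intertwiner_X[OF ser U k s.om_dom])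
      then show "ket (s.om 1) (W (A (A x))) = ket (s.om 1) (A' (A' (W x)))"
        unfolding W s.X_ket[OF k] t.X_ket[OF k] by (simp add: W)
    qed
    \<comment> \<open>The transport of \<open>A\<close> by \<open>W\<close> is positive and has the
      same square as \<open>A'\<close>.\<close>
    let ?B = "\<lambda>y. W (A (W' y))"
    have posA: "posop A" "posop A'"
      using s.A s.A_pos t.A t.A_pos s.q unfolding posop_def
      by (meson mult_nonneg_nonneg less_imp_le order_trans zero_le_power2)+
    have "posop ?B"
      unfolding posop_def
    proof (intro conjI allI)
      show "adjp ?B ?B" using adjW s.A by (simp add: adjp_def) (metis adjpD adjp_sym adjW)
      show "0 \<le> Re (cinner (?B y) y)" for y
        using posA(1) by (simp add: adjpD[OF adjW] posop_def)
    qed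
    moreover have "?B (?B y) = A' (A' y)" for y by (simp add: W'W sq WW')
    ultimately have "?B = A'" by (intro posop_sqrt_unique posA(2)) auto
    then have "W (A (W' (W x))) = A' (W x)" by metis
    then show ?thesis by (simp add: W'W)
  qed
  moreover have "W (v x) = v' (W x)" if l: "0 < l" for x
  proof (cases "0 < k")
    case False
    then have k: "k = 0" by simp
    have lkn: "l + k \<in> {1..s.n}" using l by simp
    have up: "s.up (l + k) (s.om 1) = s.om 1"
      unfolding s.up_values(3)[OF l] if_P[OF k] ..
    have Zv: "s.Z (l + k) (ket (s.om 1) x) = ket (s.om 1) (v x)" for x
      unfolding s.Z_ket up s.wt_def s.C_unit[OF l] s.ex_values(2)[OF l] s.om_values(4) by simp
    have Zv': "t.Z (l + k) (ket (s.om 1) x) = ket (s.om 1) (v' x)" for x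
      unfolding t.Z_ket up t.wt_def t.C_unit[OF l] t.ex_values(2)[OF l] t.om_values(4) by simp
    show ?thesis
      using Z(1)[OF lkn s.om_dom, of 1 x] unfolding W Zv Zv' by (rule ket_inj)
  next
    case True
    have kn: "l + k \<in> {1..s.n}" "k \<in> {1..s.n}" using True by auto
    have Sup: "s.S (s.up k (s.om 1)) = 0"
      using s.om_values(4)[of 1] unfolding s.S_def sum.distrib s.sum_sh by simp
    have updn: "s.dn (l + k) (s.up k (s.om 1)) = s.om 1"
      using l True unfolding s.sh_def by (auto simp: fun_eq_iff)
    \<comment> \<open>For \<open>k > 0\<close> the generator \<open>z_{l+k}\<close> alone moves the
      \<open>k\<close>-th entry away from 1. Following \<open>Z k\<close> by
      \<open>Y (l + k)\<close> returns to \<open>om 1\<close> and acts there as \<open>w\<close>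
      after \<open>A\<close>; surjectivity of \<open>A\<close> later removes that factor.\<close>
    have YZ: "s.Y (l + k) (s.Z k (ket (s.om 1) x)) = ket (s.om 1) (w (A x))" for x
      unfolding s.Z_ket updn
      by (simp add: s.wt_def s.wts_def s.C_unit[OF l] s.C_mid[OF l] s.ex_values(2)[OF l] s.ex_values(4)[OF l]
          s.om_values Sup True)
    have YZ': "t.Y (l + k) (t.Z k (ket (s.om 1) x)) = ket (s.om 1) (w' (A' x))" for x
      unfolding t.Z_ket updn
      by (simp add: t.wt_def t.wts_def t.C_unit[OF l] t.C_mid[OF l] t.ex_values(2)[OF l] t.ex_values(4)[OF l]
          t.om_values Sup True)
    have "W (w (A z)) = w' (A' (W z))" for z
    proof (rule ket_inj)
      have "U (s.Y (l + k) (s.Z k (ket (s.om 1) z))) = t.Y (l + k) (t.Z k (U (ket (s.om 1) z)))"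
        using Z(2)[OF kn(1) s.ZY_closed(1)[OF s.reducing_UNIV s.om_dom kn(2)]] Z(1)[OF kn(2) s.om_dom] by simp
      then show "ket (s.om 1) (W (w (A z))) = ket (s.om 1) (w' (A' (W z)))"
        unfolding YZ W YZ' .
    qed
    then have "W (w (A z)) = w' (W (A z))" for z by (simp add: WA[OF True])
    then have "W (w z) = w' (W z)" for z using s.A_surj by (metis surjD)
    then have "v' (W (w (v x))) = v' (w' (W (v x)))" by simp
    then show ?thesis using s.v(3)[OF l] t.v(2)[OF l] by simp
  qed
  ultimately show ?thesis unfolding data_equivalent_def by blast
qed

section \<open>Irreducibility\<close>

context series begin

text \<open>The projection \<open>T\<close> onto a summand is a bounded symmetric intertwiner, so it
  acts at \<open>om 1\<close> by a scalar, which is 0 or 1 because \<open>T\<close> is idempotent.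
  Accordingly \<open>T\<close> or \<open>1 - T\<close> kills cyclic vectors and vanishes.\<close>

lemma one_dimensional_irreducible:
  assumes \<pi>: "series_rep q m l k A v \<pi>" and e: "norm (e :: 'k) = 1" "\<And>x :: 'k. \<exists>c. x = c *\<^sub>C e"
  shows "irreducible_rep (Oq q n) (series_space m l k) (series_dom m l k) \<pi>"
  unfolding irreducible_rep_def
proof (intro allI impI, elim conjE)
  fix H1 D1 \<pi>1 H2 D2 \<pi>2
  let ?D = "fdom I UNIV :: (nat \<Rightarrow> int, 'k) ell2 set"
  assume r1: "star_rep (Oq q n) H1 D1 \<pi>1" and r2: "star_rep (Oq q n) H2 D2 \<pi>2"
    and "rep_direct_sum (Oq q n) (series_space m l k) (series_dom m l k) \<pi> H1 D1 \<pi>1 H2 D2 \<pi>2"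
  then have orth: "\<And>x y. x \<in> H1 \<Longrightarrow> y \<in> H2 \<Longrightarrow> cinner x y = 0"
    and D: "?D = {x + y | x y. x \<in> D1 \<and> y \<in> D2}"
    and sum: "\<And>a x y. a \<in> carrier (Oq q n) \<Longrightarrow> x \<in> D1 \<Longrightarrow> y \<in> D2 \<Longrightarrow> \<pi> a (x + y) = \<pi>1 a x + \<pi>2 a y"
    by (auto simp: rep_direct_sum_def series_dom_eq)
  have sub: "complex_vector.subspace D1" "complex_vector.subspace D2" "D1 \<subseteq> H1" "D2 \<subseteq> H2"
    using r1 r2 by (auto simp: star_rep_def dense_subspace_def)
  have orthD: "cinner x y = 0" "cinner y x = 0" if "x \<in> D1" "y \<in> D2" for x y
    using orth[of x y] sub that cinner_commute[of y x] by auto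
  \<comment> \<open>The projection is taken on the algebraic domain, from the decomposition of
    \<open>D\<close>; orthogonality makes the chosen summand unique.\<close>
  define T where "T x = (SOME y. y \<in> D1 \<and> x - y \<in> D2)" for x
  have T: "T x \<in> D1 \<and> x - T x \<in> D2" if x: "x \<in> ?D" for x
  proof -
    obtain y z where "y \<in> D1" "z \<in> D2" "x = y + z" using x unfolding D by blast
    then have "y \<in> D1 \<and> x - y \<in> D2" by simp
    then show ?thesis unfolding T_def by (rule someI)
  qed
  have mem: "x + y \<in> ?D" if "x \<in> D1" "y \<in> D2" for x y unfolding D using that by blast
  have T_eq: "T (x + y) = x" if "x \<in> D1" "y \<in> D2" for x y
  proof -
    let ?d = "T (x + y) - x"
    have t: "T (x + y) \<in> D1" "x + y - T (x + y) \<in> D2" using T[OF mem[OF that]] by auto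
    have "?d \<in> D1" using t that sub by (intro complex_vector.subspace_diff)
    moreover have "?d = y - (x + y - T (x + y))" by simp
    then have "?d \<in> D2" using complex_vector.subspace_diff[OF sub(2) that(2) t(2)] by simp
    ultimately have "cinner ?d ?d = 0" by (rule orthD(1))
    then show ?thesis by simp
  qed
  have zero: "0 \<in> D1" "0 \<in> D2" using sub complex_vector.subspace_0 by auto
  have DD: "x \<in> ?D" if "x \<in> D1" for x using mem[OF that zero(2)] by simp
  have closed1: "\<pi>1 a x \<in> D1" if "a \<in> carrier (Oq q n)" "x \<in> D1" for a x
    using star_rep_props(1)[OF r1 that zero(1)] .
  have closed2: "\<pi>2 a x \<in> D2" if "a \<in> carrier (Oq q n)" "x \<in> D2" for a x
    using star_rep_props(1)[OF r2 that zero(2)] .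
  have int: "T (\<pi> a x) = \<pi> a (T x)" if a: "a \<in> carrier (Oq q n)" and x: "x \<in> ?D" for a x
  proof -
    have t: "T x \<in> D1" "x - T x \<in> D2" using T[OF x] by auto
    have "\<pi> a x = \<pi>1 a (T x) + \<pi>2 a (x - T x)" using sum[OF a t] by simp
    then have "T (\<pi> a x) = \<pi>1 a (T x)" using T_eq closed1[OF a t(1)] closed2[OF a t(2)] by simp
    \<comment> \<open>As \<open>\<pi>2 a 0 = 0\<close>, the summand \<open>\<pi>1\<close> is the
      restriction of \<open>\<pi>\<close>.\<close>
    also have "\<dots> = \<pi> a (T x + 0)"
      using sum[OF a t(1) zero(2)] star_rep_props(5)[OF r2 a zero(2,2)] by simp
    finally show ?thesis by simp
  qed
  have lin: "clinear_on ?D T"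
    unfolding clinear_on_def
  proof (intro conjI ballI allI)
    fix x y assume xy: "x \<in> ?D" "y \<in> ?D"
    have "T ((T x + T y) + ((x - T x) + (y - T y))) = T x + T y"
      using T[OF xy(1)] T[OF xy(2)] sub by (intro T_eq complex_vector.subspace_add) auto
    then show "T (x + y) = T x + T y" by (simp add: algebra_simps)
  next
    fix c x assume x: "x \<in> ?D"
    have "T (c *\<^sub>C T x + c *\<^sub>C (x - T x)) = c *\<^sub>C T x"
      using T[OF x] sub by (intro T_eq complex_vector.subspace_scale) auto
    then show "T (c *\<^sub>C x) = c *\<^sub>C T x" by (simp add: complex_vector.scale_right_diff_distrib)
  qed
  have inner: "cinner (T x) y = cinner (T x) (T y)" if "x \<in> ?D" "y \<in> ?D" for x y
    using orthD(1)[of "T x" "y - T y"] T[OF that(1)] T[OF that(2)] by (simp add: cinner_diff)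
  have adj: "cinner (T x) y = cinner x (T y)" if "x \<in> ?D" "y \<in> ?D" for x y
  proof -
    have "cinner (T x) (T y) = cinner x (T y)"
      using orthD(2)[of "T y" "x - T x"] T[OF that(1)] T[OF that(2)] by (simp add: cinner_diff)
    then show ?thesis using inner[OF that] by simp
  qed
  have nrm: "norm (T x) \<le> norm x" if "x \<in> ?D" for x
  proof (cases "T x = 0")
    case False
    have "(norm (T x))\<^sup>2 = Re (cinner (T x) x)" by (simp add: inner[OF that that] norm_sq_cinner)
    also have "\<dots> \<le> norm (T x) * norm x"
      using norm_cinner_le_mult complex_Re_le_cmod order_trans by blast
    finally show ?thesis using False by (simp add: power2_eq_square)
  qed simp
  have rep: "star_rep (Oq q n) (series_space m l k) ?D \<pi>"
    using \<pi> by (simp add: series_rep_def series_dom_eq)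
  have gen: "Z j x = \<pi> (oq_class q n (zgen j)) x" "Y j x = \<pi> (oq_class q n (zgen_star j)) x"
    if "j \<in> {1..n}" "x \<in> ?D" for j x
    using series_rep_gens[OF \<pi> that] unfolding rep_gen_def[OF n1 rep] rep_gen_star_def[OF n1 rep] by simp_all
  have TD: "T x \<in> ?D" if "x \<in> ?D" for x using T[OF that] DD by blast
  have TZ: "T (Z j x) = Z j (T x)" "T (Y j x) = Y j (T x)" if "j \<in> {1..n}" "x \<in> ?D" for j x
  proof -
    have c: "oq_class q n (zgen j) \<in> carrier (Oq q n)" "oq_class q n (zgen_star j) \<in> carrier (Oq q n)"
      by (intro Oq_carrier_class zgen_carrier that)+
    show "T (Z j x) = Z j (T x)" "T (Y j x) = Y j (T x)"
      using int[OF c(1) that(2)] int[OF c(2) that(2)] gen[OF that] gen[OF that(1) TD[OF that(2)]] by simp_all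
  qed
  have bd: "\<exists>c. \<forall>x\<in>?D. norm (T x) \<le> c * norm x" using nrm by (intro exI[of _ 1]) simp
  have iT: "intertwiner n ?D ?D Z Y Z Y T"
    unfolding intertwiner_def using lin TD TZ bd by blast
  have ser: "series q m l k A v w" by (rule series_axioms)
  obtain c where c: "coord (T (ket (om 1) e)) (om 1) = c *\<^sub>C e" using e(2) by blast
  have "T (ket (om 1) e) = ket (om 1) (coord (T (ket (om 1) e)) (om 1))"
    by (rule intertwiner_om[OF ser ser iT iT adj])
  then have Te: "T (ket (om 1) e) = c *\<^sub>C ket (om 1) e" by (simp add: c ket_scaleC)
  have T_om: "T (ket (om 1) x) = c *\<^sub>C ket (om 1) x" for x
  proof -
    obtain b where b: "x = b *\<^sub>C e" using e(2) by blast
    have "T (ket (om 1) x) = b *\<^sub>C T (ket (om 1) e)"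
      using lin om_dom unfolding b ket_scaleC clinear_on_def by blast
    then show ?thesis by (simp add: Te b ket_scaleC mult.commute)
  qed
  have "T (T (ket (om 1) e)) = T (ket (om 1) e)"
    using T_eq[of "T (ket (om 1) e)" 0] T[OF om_dom, of 1 e] zero by simp
  then have "c *\<^sub>C (c *\<^sub>C ket (om 1) e) = c *\<^sub>C ket (om 1) e"
    using lin om_dom[of 1 e] unfolding Te clinear_on_def by (metis T_om)
  then have "(c * c - c) *\<^sub>C ket (om 1) e = 0" by (simp add: complex_vector.scale_left_diff_distrib)
  moreover have "e \<noteq> 0" using e(1) by auto
  ultimately have "c = 0 \<or> c = 1" by auto
  then show "zero_rep (Oq q n) D1 \<pi>1 \<or> zero_rep (Oq q n) D2 \<pi>2"
  proof
    assume "c = 0"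
    then have T0: "T f = 0" if "f \<in> ?D" for f
      using intertwiner_zero[OF e(2) iT _ that] T_om by simp
    have "x = 0" if "x \<in> D1" for x
      using T_eq[OF that zero(2)] T0[OF mem[OF that zero(2)]] by simp
    then have "zero_rep (Oq q n) D1 \<pi>1"
      using star_rep_props(5)[OF r1 _ zero(1) zero(1)] unfolding zero_rep_def by metis
    then show ?thesis ..
  next
    assume "c = 1"
    let ?S = "\<lambda>x. x - T x"
    have sD: "complex_vector.subspace ?D" by (rule fdom_subspace) simp
    have "intertwiner n ?D ?D Z Y Z Y ?S"
      unfolding intertwiner_def
    proof (intro conjI ballI)
      show "clinear_on ?D ?S"
        using lin by (auto simp: clinear_on_def complex_vector.scale_right_diff_distrib)
      show "?S ` ?D \<subseteq> ?D" using TD complex_vector.subspace_diff[OF sD] by blast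
      have "norm (?S x) \<le> 2 * norm x" if "x \<in> ?D" for x
        using norm_triangle_ineq4[of x "T x"] nrm[OF that] by simp
      then show "\<exists>c. \<forall>x\<in>?D. norm (?S x) \<le> c * norm x" by blast
      fix j x assume jx: "j \<in> {1..n}" "x \<in> ?D"
      have neg: "(- 1) *\<^sub>C T x \<in> ?D" using TD[OF jx(2)] sD complex_vector.subspace_scale by blast
      have fs: "fin_supp x" "fin_supp ((- 1) *\<^sub>C T x)" "fin_supp (T x)"
        using jx(2) neg TD fdom_fin_supp by blast+
      have "Z j (?S x) = Z j x - Z j (T x)" "Y j (?S x) = Y j x - Y j (T x)"
        using ZY_linear(1,3)[OF fs(1,2), of j] ZY_linear(2,4)[OF fs(3), of j "- 1"] by simp_all
      then show "?S (Z j x) = Z j (?S x)" "?S (Y j x) = Y j (?S x)" using TZ[OF jx] by simp_all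
    qed
    then have S0: "?S f = 0" if "f \<in> ?D" for f
      using intertwiner_zero[OF e(2) _ _ that, of ?S] T_om \<open>c = 1\<close> by simp
    have "x = 0" if "x \<in> D2" for x
      using T_eq[OF zero(1) that] S0[OF mem[OF zero(1) that]] by simp
    then have "zero_rep (Oq q n) D2 \<pi>2"
      using star_rep_props(5)[OF r2 _ zero(2) zero(2)] unfolding zero_rep_def by metis
    then show ?thesis ..
  qed
qed

text \<open>Range and kernel of \<open>P\<close> are stable under all coefficients, since
  \<open>P\<close> commutes with \<open>A\<close> and \<open>v\<close>, therefore with
  \<open>w\<close> and \<open>mu\<close>. Vectors with components in them form two complementary
  subrepresentations.\<close>

lemma reducible:
  assumes \<pi>: "series_rep q m l k A v \<pi>" and P: "nontrivial_projection P"
    and PA: "\<And>x. A (P x) = P (A x)" and Pv: "\<And>x. 0 < l \<Longrightarrow> v (P x) = P (v x)"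
  shows "\<not> irreducible_rep (Oq q n) (series_space m l k) (series_dom m l k) \<pi>"
proof -
  have adjP: "adjp P P" and PP: "\<And>x. P (P x) = P x" using P by (auto simp: nontrivial_projection_def)
  note lin = adjp_linear[OF adjP]
  have Pw: "w (P x) = P (w x)" if "0 < l" for x
    using Pv[OF that, of "w x"] v(2,3)[OF that] by metis
  have Pmu: "P (mu j x) = mu j (P x)" for j x
    by (rule mu_op_props(3)[OF q(1) A adjP]) (simp add: PA)
  have PC: "P (C j i x) = C j i (P x)" "P (Cs j i x) = Cs j i (P x)" for j i x
    unfolding C_def Cs_def by (auto simp: lin PA Pmu Pv Pw)
  have blin: "bounded_linear P" by (rule adjp_bounded_linear[OF adjP])
  define M1 where "M1 = {x. P x = x}"
  define M2 where "M2 = {x. P x = 0}"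
  have M1: "reducing M1"
    unfolding reducing_def
  proof (intro conjI allI ballI)
    show "complex_vector.subspace M1" by (auto simp: M1_def complex_vector.subspace_def lin)
    show "closed M1" unfolding M1_def by (intro closed_Collect_eq linear_continuous_on blin continuous_on_id)
    show "C j i x \<in> M1" "Cs j i x \<in> M1" if "x \<in> M1" for j i x using that by (simp_all add: M1_def PC)
  qed
  have M2: "reducing M2"
    unfolding reducing_def
  proof (intro conjI allI ballI)
    show "complex_vector.subspace M2" by (auto simp: M2_def complex_vector.subspace_def lin)
    show "closed M2" unfolding M2_def by (intro closed_Collect_eq linear_continuous_on blin continuous_on_const)
    show "C j i x \<in> M2" "Cs j i x \<in> M2" if "x \<in> M2" for j i x
      using that by (simp_all add: M2_def PC C_linear Cs_linear)
  qed
  interpret R1: Oq_ops n "fdom I M1" Z Y q "fspace I M1" "{ket i \<eta> | i \<eta>. i \<in> I \<and> \<eta> \<in> M1}"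
    by (rule Oq_ops_ZY[OF M1])
  interpret R2: Oq_ops n "fdom I M2" Z Y q "fspace I M2" "{ket i \<eta> | i \<eta>. i \<in> I \<and> \<eta> \<in> M2}"
    by (rule Oq_ops_ZY[OF M2])
  interpret R: Oq_ops n "fdom I UNIV" Z Y q "fspace I UNIV" "{ket i \<eta> | i \<eta>. i \<in> I \<and> \<eta> \<in> UNIV}"
    by (rule Oq_ops_ZY[OF reducing_UNIV])
  have Ple: "norm (P x) \<le> norm x" for x
  proof (cases "P x = 0")
    case False
    have "(norm (P x))\<^sup>2 = Re (cinner (P x) x)"
      using adjpD[OF adjP, of "P x" x] by (simp add: norm_sq_cinner PP)
    also have "\<dots> \<le> norm (P x) * norm x"
      using norm_cinner_le_mult complex_Re_le_cmod order_trans by blast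
    finally show ?thesis using False by (simp add: power2_eq_square)
  qed simp
  \<comment> \<open>\<open>F\<close> applies \<open>P\<close> in every component; square summability
    persists because a projection does not increase norms.\<close>
  define F where "F f = Abs_ell2 (\<lambda>i. P (coord f i))" for f :: "(nat \<Rightarrow> int, 'k) ell2"
  have F: "coord (F f) i = P (coord f i)" for f i
  proof -
    have "(\<lambda>i. (norm (P (coord f i)))\<^sup>2) summable_on UNIV"
      by (rule summable_on_comparison_test[OF summable_coord[of f]]) (auto intro: power_mono Ple)
    then show ?thesis by (simp add: F_def Abs_ell2_inverse)
  qed
  have split: "f = F f + (f - F f)" for f by simp
  have FH: "F f \<in> fspace I M1" "f - F f \<in> fspace I M2" if "f \<in> fspace I UNIV" for f
    using that by (auto simp: fspace_def F M1_def M2_def PP lin)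
  have FD: "F f \<in> fdom I M1" "f - F f \<in> fdom I M2" if "f \<in> fdom I UNIV" for f
  proof -
    have fin: "finite {i. coord f i \<noteq> 0}" using that by (auto simp: fdom_def fin_supp_def)
    have "fin_supp (F f)" "fin_supp (f - F f)"
      unfolding fin_supp_def by (rule finite_subset[OF _ fin]; auto simp: F lin)+
    moreover have "i \<in> I" if "coord (F f) i \<noteq> 0 \<or> coord (f - F f) i \<noteq> 0" for i
    proof -
      have "coord f i \<noteq> 0" using that by (auto simp: F lin)
      then show ?thesis using \<open>f \<in> fdom I UNIV\<close> by (auto simp: fdom_def)
    qed
    moreover have "coord (F f) i \<in> M1" "coord (f - F f) i \<in> M2" for i
      by (simp_all add: F M1_def M2_def PP lin)
    ultimately show "F f \<in> fdom I M1" "f - F f \<in> fdom I M2"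
      unfolding fdom_def by blast+
  qed
  have "rep_direct_sum (Oq q n) (fspace I UNIV) (fdom I UNIV) \<pi>
      (fspace I M1) (fdom I M1) R1.quotient_rep (fspace I M2) (fdom I M2) R2.quotient_rep"
    unfolding rep_direct_sum_def
  proof (intro conjI ballI)
    show "cinner x y = 0" if "x \<in> fspace I M1" "y \<in> fspace I M2" for x y
    proof -
      have "cinner (coord x i) (coord y i) = 0" for i
      proof -
        have "P (coord x i) = coord x i" "P (coord y i) = 0" using that by (auto simp: fspace_def M1_def M2_def)
        then show ?thesis using adjpD[OF adjP, of "coord x i" "coord y i"] by simp
      qed
      then show ?thesis by (simp add: cinner_ell2_def)
    qed
    have "x + y \<in> fspace I UNIV" if "x \<in> fspace I M1" "y \<in> fspace I M2" for x y
      using that by (auto simp: fspace_def)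
    then show "fspace I UNIV = {x + y | x y. x \<in> fspace I M1 \<and> y \<in> fspace I M2}"
      using FH split by blast
    have sum: "x \<in> fdom I UNIV" "y \<in> fdom I UNIV" if "x \<in> fdom I M1" "y \<in> fdom I M2" for x y
      using that by (auto simp: fdom_def)
    then have "x + y \<in> fdom I UNIV" if "x \<in> fdom I M1" "y \<in> fdom I M2" for x y
      using that complex_vector.subspace_add[OF R.sub] by blast
    then show "fdom I UNIV = {x + y | x y. x \<in> fdom I M1 \<and> y \<in> fdom I M2}"
      using FD split by blast
    fix a x y assume a: "a \<in> carrier (Oq q n)" and xy: "x \<in> fdom I M1" "y \<in> fdom I M2"
    obtain p where p: "p \<in> carrier (free_ring n)" "a = oq_class q n p" using a by (auto simp: Oq_carrier)
    have "x + y \<in> fdom I UNIV" using sum[OF xy] complex_vector.subspace_add[OF R.sub] by blast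
    then have "\<pi> a (x + y) = free_act Z Y p (x + y)"
      unfolding p(2) by (rule series_rep_act[OF \<pi> p(1)])
    also have "\<dots> = free_act Z Y p x + free_act Z Y p y"
      using R.free_act_linear[OF p(1)] sum[OF xy] by (simp add: clinear_on_def)
    finally show "\<pi> a (x + y) = R1.quotient_rep a x + R2.quotient_rep a y"
      using p xy by (simp add: R1.quotient_rep_class R2.quotient_rep_class)
  qed
  \<comment> \<open>The unit acts as the identity, so a summand with a nonzero vector in its domain
    is not the zero representation.\<close>
  moreover have "\<one>\<^bsub>Oq q n\<^esub> \<in> carrier (Oq q n)"
    unfolding Oq_one by (intro Oq_carrier_class) (simp add: free_ring_def zero_list_def)
  moreover have "ket (om 1) x \<in> fdom I M1 \<and> ket (om 1) x \<noteq> 0" if "x \<in> M1" "x \<noteq> 0" for x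
    using that by (simp add: ket_in_fdom om_index)
  moreover have "ket (om 1) x \<in> fdom I M2 \<and> ket (om 1) x \<noteq> 0" if "x \<in> M2" "x \<noteq> 0" for x
    using that by (simp add: ket_in_fdom om_index)
  moreover obtain x1 where "x1 \<in> M1" "x1 \<noteq> 0"
    using P by (auto simp: nontrivial_projection_def M1_def)
  moreover obtain x2 where "P x2 \<noteq> x2" using P by (auto simp: nontrivial_projection_def)
  then have "x2 - P x2 \<in> M2" "x2 - P x2 \<noteq> 0" by (auto simp: M2_def lin PP)
  ultimately have "\<not> zero_rep (Oq q n) (fdom I M1) R1.quotient_rep" "\<not> zero_rep (Oq q n) (fdom I M2) R2.quotient_rep"
    using R1.star_rep_quotient_rep R2.star_rep_quotient_rep unfolding zero_rep_def star_rep_def by metis+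
  then show ?thesis
    unfolding irreducible_rep_def series_dom_eq series_space_eq
    using R1.star_rep_quotient_rep R2.star_rep_quotient_rep \<open>rep_direct_sum _ _ _ _ _ _ _ _ _ _\<close> by blast
qed

end

section \<open>Faithfulness fails for \<open>l > 0\<close>\<close>

text \<open>For \<open>l > 0\<close> the generator \<open>z\<^sub>j\<close> with \<open>j = l + k\<close> is normal, which is not the case in the Fock
  representation, that is, in the series \<open>(n, 0, 0)\<close>.\<close>

lemma not_faithful:
  fixes A v w :: "'a::complex_hilbert \<Rightarrow> 'a"
  assumes "series q m l k A v w" and \<pi>: "series_rep q m l k A v \<pi>" and l: "0 < l" and nz: "\<exists>x::'a. x \<noteq> 0"
  shows "\<not> faithful_rep (Oq q (m + l + k)) (series_dom m l k) \<pi>"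
proof
  interpret s: series q m l k A v w by fact
  assume faithful: "faithful_rep (Oq q s.n) (series_dom m l k) \<pi>"
  let ?j = "l + k"
  have j: "?j \<in> {1..s.n}" using l by auto
  \<comment> \<open>The Fock series over the same \<K>, in which all generators are weighted shifts
    by \<open>lambda_q\<close>.\<close>
  interpret t: series q s.n 0 0 A v w
    by standard (use s.q s.n1 s.A s.A_le s.A_low s.A_ker s.A_pos s.A_surj in auto)
  have j': "?j \<in> {1..t.n}" using j by simp
  let ?a = "zgen_star ?j * zgen ?j" and ?b = "zgen ?j * zgen_star ?j"
  have ab: "?a \<in> carrier (free_ring s.n)" "?b \<in> carrier (free_ring s.n)"
    by (intro free_ring_closed zgen_carrier j)+
  interpret G: free_rep s.n "fdom s.I UNIV" s.Z s.Y by (rule s.free_rep_ZY[OF s.reducing_UNIV])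
  interpret F: free_rep t.n "fdom t.I UNIV" t.Z t.Y by (rule t.free_rep_ZY[OF t.reducing_UNIV])
  have "\<pi> (oq_class q s.n ?a) d = \<pi> (oq_class q s.n ?b) d" if d: "d \<in> fdom s.I UNIV" for d
  proof -
    have "s.Y ?j (s.Z ?j d) = s.Z ?j (s.Y ?j d)"
    proof (rule ell2_eqI)
      fix i
      show "coord (s.Y ?j (s.Z ?j d)) i = coord (s.Z ?j (s.Y ?j d)) i"
      proof (cases "coord d i = 0")
        case False
        then have i: "i \<in> s.I" using d by (auto simp: fdom_def)
        \<comment> \<open>\<open>Q\<close> vanishes at position \<open>l + k\<close> when
          \<open>l > 0\<close>, so by \<open>ZY_diag\<close> both products equal \<open>Q\<close> at
          the next position.\<close>
        have Q0: "s.Q ?j i x = 0" for x using l by (intro s.Q_values(2)) auto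
        show ?thesis
          using s.ZY_diag[OF i j, of "coord d i"] d by (simp add: s.coord_Z fdom_fin_supp Q0)
      qed (use d in \<open>simp add: s.coord_Z fdom_fin_supp\<close>)
    qed
    then show ?thesis
      using d ab j by (simp add: s.series_rep_act[OF \<pi>] G.free_act_mult zgen_carrier)
  qed
  then have eq: "oq_class q s.n ?a = oq_class q s.n ?b"
    using faithful Oq_carrier_class[OF ab(1)] Oq_carrier_class[OF ab(2)]
    unfolding faithful_rep_def s.series_dom_eq by blast
  obtain \<rho> where \<rho>: "series_rep q s.n 0 0 A v \<rho>" using t.series_rep_exists by blast
  obtain x :: 'a where x: "x \<noteq> 0" using nz by blast
  have ab': "?a \<in> carrier (free_ring t.n)" "?b \<in> carrier (free_ring t.n)" using ab by simp_all
  have "\<rho> (oq_class q t.n ?a) (ket (t.om 1) x) = \<rho> (oq_class q t.n ?b) (ket (t.om 1) x)"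
    using eq by simp
  then have "t.Y ?j (t.Z ?j (ket (t.om 1) x)) = t.Z ?j (t.Y ?j (ket (t.om 1) x))"
    unfolding t.series_rep_act[OF \<rho> ab'(1) t.om_dom] t.series_rep_act[OF \<rho> ab'(2) t.om_dom]
    using t.om_dom j' by (simp add: F.free_act_mult zgen_carrier)
  moreover have "t.Z ?j (t.Y ?j (ket (t.om 1) x)) = 0"
  proof -
    have "t.Y ?j (ket (t.om 1) x) = 0" using j' by (intro t.om_vacuum(1)) auto
    then show ?thesis by (simp add: F.word_act_zero[of "[Gen ?j]", simplified] t.Z_ket[of ?j _ 0, simplified])
  qed
  ultimately have "t.wts ?j (t.om 1) (t.wt ?j (t.om 1) x) = 0" by (simp add: t.Z_ket)
  moreover have "t.wt ?j (t.dn ?j (t.om 1)) (t.wts ?j (t.dn ?j (t.om 1)) x) = 0"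
    using t.om_vacuum(1)[of ?j 1 x] j' l by (simp add: t.Z_ket)
  \<comment> \<open>In the Fock representation both products would vanish at the vacuum, so
    \<open>Q (Suc j)\<close> would equal both \<open>Q j\<close> and \<open>q^2 Q j\<close>,
    although \<open>Q j\<close> is the identity there.\<close>
  ultimately have "t.Q ?j (t.om 1) x = q\<^sup>2 *\<^sub>R t.Q ?j (t.om 1) x"
    using t.ZY_diag[OF t.om_index j', of 1 x] by simp
  then have "(1 - q\<^sup>2) *\<^sub>R t.Q ?j (t.om 1) x = 0" by (simp add: scaleR_diff_left)
  moreover have "q\<^sup>2 \<noteq> 1" using s.q by (simp add: power2_eq_1_iff)
  ultimately have "t.Q ?j (t.om 1) x = 0" by simp
  moreover have "0 < ?j" using l by simp
  ultimately show False
    using x s.q t.Q_values(1)[of ?j "t.om 1" x] by simp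
qed

section \<open>A spanning set of \<open>\<O>\<^sub>q(Mat\<^bsub>n,1\<^esub>)\<close>\<close>

abbreviation word :: "letter list \<Rightarrow> free_alg" where "word w \<equiv> Poly_Mapping.single w 1"

lemma word_append: "word (v @ w) = word v * word w"
  by (simp add: mult_single plus_list_def)

lemma word_Cons: "word (x # w) = word [x] * word w"
  using word_append[of "[x]" w] by simp

definition gens_word :: "nat list \<Rightarrow> (nat \<Rightarrow> nat) \<Rightarrow> letter list"
  where "gens_word js a = concat (map (\<lambda>j. replicate (a j) (Gen j)) js)"

text \<open>Starred letters come in the reverse order of unstarred ones, so the monomial for
  \<open>j # js\<close> encloses that for \<open>js\<close> between a power of \<open>z_j\<close>
  and a power of its adjoint. The induction in \<open>normal_word_act\<close> follows this
  nesting.\<close>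

definition normal_word :: "nat list \<Rightarrow> (nat \<Rightarrow> nat) \<Rightarrow> (nat \<Rightarrow> nat) \<Rightarrow> letter list"
  where "normal_word js a b = gens_word js a @ word_star (gens_word js b)"

lemma gens_word_simps [simp]: "gens_word [] a = []"
  "gens_word (j # js) a = replicate (a j) (Gen j) @ gens_word js a"
  by (simp_all add: gens_word_def)

lemma word_star_simps [simp]: "word_star [] = []" "word_star (x # w) = word_star w @ [letter_star x]"
  "word_star (v @ w) = word_star w @ word_star v" "word_star (replicate N x) = replicate N (letter_star x)"
  by (simp_all add: word_star_def)

lemma gens_word_map: "\<exists>xs. gens_word js a = map Gen xs \<and> set xs \<subseteq> set js"
proof (induction js)
  case (Cons j js)
  then obtain xs where "gens_word js a = map Gen xs" "set xs \<subseteq> set js" by blast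
  then show ?case by (intro exI[of _ "replicate (a j) j @ xs"]) auto
qed simp

lemma word_star_map_Gen: "word_star (map Gen xs) = map Gen_star (rev xs)"
  by (induction xs) simp_all

lemma free_star_word: "free_star (word w) = word (word_star w)"
  by (simp add: free_star_single)

text \<open>Vanishing outside the range makes an exponent function determined by its values on
  \<open>{1..n}\<close>, so distinct pairs give distinct monomials.\<close>

definition exponents :: "nat \<Rightarrow> (nat \<Rightarrow> nat) set"
  where "exponents n = {a. \<forall>j. j \<notin> {1..n} \<longrightarrow> a j = 0}"

context
  fixes q :: real and n :: nat
  assumes q: "0 < q" and n: "1 \<le> n"
begin

definition equiv_mod (infix "\<asymp>" 50) where "p \<asymp> p' \<longleftrightarrow> p - p' \<in> oq_ideal q n"

lemma oq_ideal_closed: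
  "x \<in> oq_ideal q n \<Longrightarrow> y \<in> oq_ideal q n \<Longrightarrow> x + y \<in> oq_ideal q n"
  "x \<in> oq_ideal q n \<Longrightarrow> r \<in> carrier (free_ring n) \<Longrightarrow> r * x \<in> oq_ideal q n"
  "x \<in> oq_ideal q n \<Longrightarrow> r \<in> carrier (free_ring n) \<Longrightarrow> x * r \<in> oq_ideal q n"
  "0 \<in> oq_ideal q n" "x \<in> oq_ideal q n \<Longrightarrow> x \<in> carrier (free_ring n)"
proof -
  interpret ideal "oq_ideal q n" "free_ring n" by (rule ideal_oq_ideal[OF n])
  show "x \<in> oq_ideal q n \<Longrightarrow> y \<in> oq_ideal q n \<Longrightarrow> x + y \<in> oq_ideal q n"
    using additive_subgroup.a_closed[OF additive_subgroup_axioms, of x y] by (simp add: free_ring_def)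
  show "x \<in> oq_ideal q n \<Longrightarrow> r \<in> carrier (free_ring n) \<Longrightarrow> r * x \<in> oq_ideal q n"
    using I_l_closed[of x r] by (simp add: free_ring_def)
  show "x \<in> oq_ideal q n \<Longrightarrow> r \<in> carrier (free_ring n) \<Longrightarrow> x * r \<in> oq_ideal q n"
    using I_r_closed[of x r] by (simp add: free_ring_def)
  show "0 \<in> oq_ideal q n"
    using additive_subgroup.zero_closed[OF additive_subgroup_axioms] by (simp add: free_ring_def)
  show "x \<in> oq_ideal q n \<Longrightarrow> x \<in> carrier (free_ring n)" using a_subset by blast
qed

lemma relators_in_ideal: "oq_relators q n \<subseteq> oq_ideal q n"
proof -
  interpret ring "free_ring n" by (rule ring_free_ring)
  have "oq_relators q n \<union> free_star ` oq_relators q n \<subseteq> oq_ideal q n"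
    unfolding oq_ideal_def using oq_relators_carrier[OF n, of q] free_star_carrier
    by (intro genideal_self) auto
  then show ?thesis by blast
qed

lemma equiv_mod_refl: "p \<asymp> p"
  by (simp add: equiv_mod_def oq_ideal_closed)

lemma equiv_mod_trans [trans]: "p \<asymp> p' \<Longrightarrow> p' \<asymp> p'' \<Longrightarrow> p \<asymp> p''"
  using oq_ideal_closed(1)[of "p - p'" "p' - p''"] by (simp add: equiv_mod_def)

lemma equiv_mod_mult: "p \<asymp> p' \<Longrightarrow> r \<in> carrier (free_ring n) \<Longrightarrow> r * p \<asymp> r * p'"
  "p \<asymp> p' \<Longrightarrow> r \<in> carrier (free_ring n) \<Longrightarrow> p * r \<asymp> p' * r"
  using oq_ideal_closed(2,3)[of "p - p'" r] by (simp_all add: equiv_mod_def algebra_simps)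

lemma equiv_mod_star: "p \<asymp> p' \<Longrightarrow> free_star p \<asymp> free_star p'"
  unfolding equiv_mod_def free_star_minus[symmetric] by (rule oq_ideal_star[OF n])

lemma const_left: "word w * (oq_const c * r) = oq_const c * (word w * r)" "oq_const c * (oq_const d * r) = oq_const (c * d) * r"
  using oq_const_commute[of "word w" c] by (simp_all add: oq_const_simps mult.assoc[symmetric])

lemma gen_carrier: "j \<in> {1..n} \<Longrightarrow> word [Gen j] \<in> carrier (free_ring n)"
  "j \<in> {1..n} \<Longrightarrow> word [Gen_star j] \<in> carrier (free_ring n)"
  by (auto intro: single_carrier)

lemma map_carrier: "set xs \<subseteq> {1..n} \<Longrightarrow> word (map Gen xs) \<in> carrier (free_ring n)"
  "set xs \<subseteq> {1..n} \<Longrightarrow> word (map Gen_star xs) \<in> carrier (free_ring n)"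
  by (rule single_carrier, simp add: image_image)+

section \<open>Sorting the letters of a monomial modulo the ideal\<close>

lemma swap_gens:
  assumes "1 \<le> j" "j < s" "s \<le> n"
  shows "word [Gen s] * word [Gen j] \<asymp> oq_const (1 / q) * (word [Gen j] * word [Gen s])"
proof -
  have "zgen j * zgen s - oq_const q * (zgen s * zgen j) \<in> oq_ideal q n"
    using relators_in_ideal assms unfolding oq_relators_def by blast
  \<comment> \<open>Multiplication of the relator by \<open>- 1 / q\<close> solves it for
    \<open>z_s z_j\<close>.\<close>
  from oq_ideal_closed(2)[OF this oq_const_carrier, of "- 1 / q"]
  have "oq_const (- 1 / q) * (zgen j * zgen s) - oq_const (- 1 / q) * (oq_const q * (zgen s * zgen j)) \<in> oq_ideal q n"
    by (simp add: right_diff_distrib)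
  moreover have "oq_const (- 1 / q) * (oq_const q * (zgen s * zgen j)) = - (zgen s * zgen j)"
  proof -
    have "complex_of_real (- 1 / q) * complex_of_real q = - 1" using q by simp
    moreover have "oq_const (- 1) = - 1" by (simp add: oq_const_def single_uminus one_free_alg)
    ultimately show ?thesis unfolding const_left(2) by simp
  qed
  moreover have "oq_const (- 1 / q) * p = - (oq_const (1 / q) * p)" for p
    by (simp add: oq_const_def single_uminus)
  ultimately show ?thesis
    by (simp add: equiv_mod_def zgen_def)
qed

text \<open>Only a spanning set is wanted, so the scalars produced by reordering stay
  existential.\<close>

lemma swap_gens_power:
  assumes "1 \<le> j" "j < s" "s \<le> n"
  shows "\<exists>c. word (Gen s # replicate N (Gen j)) \<asymp> oq_const c * word (replicate N (Gen j) @ [Gen s])"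
proof (induction N)
  case 0
  show ?case using equiv_mod_refl[of "word [Gen s]"] by (intro exI[of _ 1]) (simp add: oq_const_simps)
next
  case (Suc N)
  then obtain c where c: "word (Gen s # replicate N (Gen j)) \<asymp> oq_const c * word (replicate N (Gen j) @ [Gen s])"
    by blast
  have cj: "word [Gen j] \<in> carrier (free_ring n)" using assms by (intro gen_carrier) auto
  have cr: "word (replicate N (Gen j)) \<in> carrier (free_ring n)" using assms by (intro single_carrier) auto
  have "word (Gen s # replicate (Suc N) (Gen j)) = (word [Gen s] * word [Gen j]) * word (replicate N (Gen j))"
    by (simp add: mult_single plus_list_def)
  also have "\<dots> \<asymp> (oq_const (1 / q) * (word [Gen j] * word [Gen s])) * word (replicate N (Gen j))"
    by (rule equiv_mod_mult(2)[OF swap_gens[OF assms] cr])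
  also have "\<dots> = oq_const (1 / q) * (word [Gen j] * word (Gen s # replicate N (Gen j)))"
    by (simp only: mult.assoc word_Cons[of "Gen s" "replicate N (Gen j)"])
  also have "\<dots> \<asymp> oq_const (1 / q) * (word [Gen j] * (oq_const c * word (replicate N (Gen j) @ [Gen s])))"
    by (intro equiv_mod_mult(1) c cj oq_const_carrier)
  also have "\<dots> = oq_const (1 / q * c) * word (replicate (Suc N) (Gen j) @ [Gen s])"
    by (simp only: const_left replicate_Suc append_Cons word_Cons[of "Gen j" "replicate N (Gen j) @ [Gen s]"])
  finally show ?case by blast
qed

text \<open>One step of insertion sort: \<open>z_s\<close> passes the powers of smaller generators
  until it meets its own.\<close>

lemma insert_gen:
  assumes "sorted_wrt (<) js" "set js \<subseteq> {1..n}" "s \<in> set js"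
  shows "\<exists>c. word (Gen s # gens_word js a) \<asymp> oq_const c * word (gens_word js (a(s := a s + 1)))"
  using assms
proof (induction js)
  case (Cons j js)
  show ?case
  proof (cases "s = j")
    case True
    then have "s \<notin> set js" using Cons.prems by auto
    then have "gens_word js (a(s := a s + 1)) = gens_word js a"
      by (auto simp: gens_word_def intro!: arg_cong[of _ _ concat])
    then have "gens_word (j # js) (a(s := a s + 1)) = Gen s # gens_word (j # js) a"
      using True by simp
    then show ?thesis
      using equiv_mod_refl by (intro exI[of _ 1]) (simp only: oq_const_simps mult_1)
  next
    case False
    then have s: "s \<in> set js" "j < s" "1 \<le> j" "s \<le> n" using Cons.prems by auto
    have "\<exists>c. word (Gen s # gens_word js a) \<asymp> oq_const c * word (gens_word js (a(s := a s + 1)))"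
      by (rule Cons.IH) (use Cons.prems s in auto)
    then obtain c where c: "word (Gen s # gens_word js a) \<asymp> oq_const c * word (gens_word js (a(s := a s + 1)))"
      by (elim exE)
    obtain d where d: "word (Gen s # replicate (a j) (Gen j)) \<asymp> oq_const d * word (replicate (a j) (Gen j) @ [Gen s])"
      using swap_gens_power s by blast
    obtain xs where xs: "gens_word js a = map Gen xs" "set xs \<subseteq> set js" using gens_word_map by blast
    have cg: "word (gens_word js a) \<in> carrier (free_ring n)" unfolding xs(1) using xs(2) Cons.prems by (intro map_carrier) auto
    have cr: "word (replicate (a j) (Gen j)) \<in> carrier (free_ring n)" using s by (intro single_carrier) auto
    have "word (Gen s # gens_word (j # js) a) = word (Gen s # replicate (a j) (Gen j)) * word (gens_word js a)"
      by (simp flip: word_append)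
    also have "\<dots> \<asymp> (oq_const d * word (replicate (a j) (Gen j) @ [Gen s])) * word (gens_word js a)"
      by (rule equiv_mod_mult(2)[OF d cg])
    also have "\<dots> = oq_const d * (word (replicate (a j) (Gen j)) * word (Gen s # gens_word js a))"
      by (simp only: word_append word_Cons[of "Gen s" "gens_word js a"] mult.assoc)
    also have "\<dots> \<asymp> oq_const d * (word (replicate (a j) (Gen j)) * (oq_const c * word (gens_word js (a(s := a s + 1)))))"
      by (intro equiv_mod_mult(1) c cr oq_const_carrier)
    also have "\<dots> = oq_const (d * c) * word (gens_word (j # js) (a(s := a s + 1)))"
      using False by (simp add: const_left word_append)
    finally show ?thesis by blast
  qed
qed simp

definition all_gens :: "nat list" where "all_gens = [1..<Suc n]"

lemma set_all_gens [simp]: "set all_gens = {1..n}"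
  by (auto simp: all_gens_def)

lemma sorted_all_gens: "sorted_wrt (<) all_gens"
  unfolding all_gens_def by (rule sorted_wrt_upt)

lemma sort_gens:
  assumes "set xs \<subseteq> {1..n}"
  shows "\<exists>c a. a \<in> exponents n \<and> word (map Gen xs) \<asymp> oq_const c * word (gens_word all_gens a)"
  using assms
proof (induction xs)
  case Nil
  have "gens_word js (\<lambda>_. 0) = []" for js by (simp add: gens_word_def)
  then show ?case
    using equiv_mod_refl[of "word []"]
    by (intro exI[of _ 1] exI[of _ "\<lambda>_. 0"]) (simp add: oq_const_simps exponents_def)
next
  case (Cons s xs)
  then obtain c a where a: "a \<in> exponents n" "word (map Gen xs) \<asymp> oq_const c * word (gens_word all_gens a)" by auto
  have s: "s \<in> {1..n}" using Cons.prems by simp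
  from insert_gen[OF sorted_all_gens, of s a] s obtain d where
    d: "word (Gen s # gens_word all_gens a) \<asymp> oq_const d * word (gens_word all_gens (a(s := a s + 1)))" by auto
  have "word (map Gen (s # xs)) = word [Gen s] * word (map Gen xs)" by (simp add: word_Cons[of "Gen s" "map Gen xs"])
  also have "\<dots> \<asymp> word [Gen s] * (oq_const c * word (gens_word all_gens a))"
    by (rule equiv_mod_mult(1)[OF a(2) gen_carrier(1)[OF s]])
  also have "\<dots> = oq_const c * word (Gen s # gens_word all_gens a)"
    by (simp only: const_left word_Cons[of "Gen s" "gens_word all_gens a"])
  also have "\<dots> \<asymp> oq_const c * (oq_const d * word (gens_word all_gens (a(s := a s + 1))))"
    by (rule equiv_mod_mult(1)[OF d oq_const_carrier])
  finally have "word (map Gen (s # xs)) \<asymp> oq_const (c * d) * word (gens_word all_gens (a(s := a s + 1)))"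
    by (simp only: const_left)
  moreover have "a(s := a s + 1) \<in> exponents n" using a(1) s by (auto simp: exponents_def)
  ultimately show ?case by blast
qed

text \<open>The ideal is closed under the involution, so sorting starred letters reduces to sorting
  the reversed word of unstarred ones.\<close>

lemma sort_gen_stars:
  assumes "set ys \<subseteq> {1..n}"
  shows "\<exists>c b. b \<in> exponents n \<and> word (map Gen_star ys) \<asymp> oq_const c * word (word_star (gens_word all_gens b))"
proof -
  obtain c b where b: "b \<in> exponents n" "word (map Gen (rev ys)) \<asymp> oq_const c * word (gens_word all_gens b)"
    using sort_gens[of "rev ys"] assms by auto
  from equiv_mod_star[OF b(2)]
  have "word (map Gen_star ys) \<asymp> word (word_star (gens_word all_gens b)) * oq_const (cnj c)"
    by (simp add: free_star_mult free_star_word oq_const_simps word_star_map_Gen)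
  then show ?thesis using b(1) oq_const_commute by metis
qed

text \<open>The sum of the ideal and the span of the ordered monomials, as an inductive predicate,
  so that stability under multiplication by a letter is checked on monomials.\<close>

inductive normal_form :: "free_alg \<Rightarrow> bool" where
  ideal: "p \<in> oq_ideal q n \<Longrightarrow> normal_form p"
| mono: "a \<in> exponents n \<Longrightarrow> b \<in> exponents n \<Longrightarrow> normal_form (Poly_Mapping.single (normal_word all_gens a b) c)"
| add: "normal_form p \<Longrightarrow> normal_form p' \<Longrightarrow> normal_form (p + p')"

lemma normal_form_equiv: "normal_form p' \<Longrightarrow> p \<asymp> p' \<Longrightarrow> normal_form p"
  using normal_form.add[of "p - p'" p'] normal_form.ideal[of "p - p'"] by (simp add: equiv_mod_def)

lemma normal_form_scale: "normal_form p \<Longrightarrow> normal_form (oq_const c * p)"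
proof (induction rule: normal_form.induct)
  case (ideal p)
  then show ?case by (intro normal_form.ideal oq_ideal_closed(2) oq_const_carrier)
next
  case (mono a b d)
  then show ?case by (simp add: oq_const_def mult_single plus_list_def normal_form.mono)
next
  case (add p p')
  then show ?case by (simp add: distrib_left normal_form.add)
qed

lemma normal_form_sum: "(\<And>i. i \<in> S \<Longrightarrow> normal_form (f i)) \<Longrightarrow> normal_form (sum f S)"
  by (induction S rule: infinite_finite_induct)
    (auto intro: normal_form.add normal_form.ideal oq_ideal_closed(4))

lemma normal_form_ordered:
  assumes "set xs \<subseteq> {1..n}" "set ys \<subseteq> {1..n}"
  shows "normal_form (word (map Gen xs @ map Gen_star ys))"
proof -
  obtain c a where a: "a \<in> exponents n" "word (map Gen xs) \<asymp> oq_const c * word (gens_word all_gens a)"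
    using sort_gens[OF assms(1)] by blast
  obtain d b where b: "b \<in> exponents n"
    "word (map Gen_star ys) \<asymp> oq_const d * word (word_star (gens_word all_gens b))"
    using sort_gen_stars[OF assms(2)] by blast
  obtain zs where zs: "gens_word all_gens a = map Gen zs" "set zs \<subseteq> set all_gens" using gens_word_map by blast
  have ca: "word (gens_word all_gens a) \<in> carrier (free_ring n)"
    unfolding zs(1) using zs(2) by (intro map_carrier) auto
  have "word (map Gen xs @ map Gen_star ys) = word (map Gen xs) * word (map Gen_star ys)" by (rule word_append)
  also have "\<dots> \<asymp> (oq_const c * word (gens_word all_gens a)) * word (map Gen_star ys)"
    by (rule equiv_mod_mult(2)[OF a(2) map_carrier(2)[OF assms(2)]])
  also have "\<dots> = oq_const c * (word (gens_word all_gens a) * word (map Gen_star ys))" by (rule mult.assoc)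
  also have "\<dots> \<asymp> oq_const c * (word (gens_word all_gens a) * (oq_const d * word (word_star (gens_word all_gens b))))"
    by (intro equiv_mod_mult(1) b(2) ca oq_const_carrier)
  also have "\<dots> = oq_const (c * d) * word (normal_word all_gens a b)"
    by (simp only: const_left normal_word_def word_append)
  finally show ?thesis
    by (rule normal_form_equiv[OF normal_form_scale[OF normal_form.mono[OF a(1) b(1)]]])
qed

lemma normal_word_ordered:
  "\<exists>xs ys. normal_word all_gens a b = map Gen xs @ map Gen_star ys \<and> set xs \<subseteq> {1..n} \<and> set ys \<subseteq> {1..n}"
proof -
  obtain xs where xs: "gens_word all_gens a = map Gen xs" "set xs \<subseteq> set all_gens" using gens_word_map by blast
  obtain ys where ys: "gens_word all_gens b = map Gen ys" "set ys \<subseteq> set all_gens" using gens_word_map by blast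
  show ?thesis
    using xs(2) ys(2) unfolding normal_word_def xs(1) ys(1) word_star_map_Gen
    by (intro exI[of _ xs] exI[of _ "rev ys"]) auto
qed

lemma normal_form_gen: "normal_form p \<Longrightarrow> j \<in> {1..n} \<Longrightarrow> normal_form (word [Gen j] * p)"
proof (induction rule: normal_form.induct)
  case (ideal p)
  then show ?case by (intro normal_form.ideal oq_ideal_closed(2) gen_carrier)
next
  case (mono a b c)
  obtain xs ys where w: "normal_word all_gens a b = map Gen xs @ map Gen_star ys" "set xs \<subseteq> {1..n}" "set ys \<subseteq> {1..n}"
    using normal_word_ordered by blast
  have "normal_form (oq_const c * word (map Gen (j # xs) @ map Gen_star ys))"
    using w mono by (intro normal_form_scale normal_form_ordered) auto
  then show ?case by (simp add: oq_const_def mult_single plus_list_def w(1))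
next
  case (add p p')
  then show ?case by (simp add: distrib_left normal_form.add)
qed

lemma star_relation:
  assumes "j \<in> {1..n}"
  shows "word [Gen_star j] * word [Gen j] \<asymp> oq_const (q\<^sup>2) * (word [Gen j] * word [Gen_star j])
    - oq_const (1 - q\<^sup>2) * (\<Sum>i\<in>{j<..n}. word [Gen i] * word [Gen_star i]) + oq_const (1 - q\<^sup>2)"
proof (cases "j < n")
  case True
  then have "zgen_star j * zgen j - (oq_const (q\<^sup>2) * (zgen j * zgen_star j)
        - oq_const (1 - q\<^sup>2) * (\<Sum>i\<in>{j<..n}. zgen i * zgen_star i) + oq_const (1 - q\<^sup>2)) \<in> oq_relators q n"
    using assms unfolding oq_relators_def by auto
  then show ?thesis using relators_in_ideal unfolding equiv_mod_def zgen_def zgen_star_def by blast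
next
  case False
  then have "j = n" using assms by simp
  moreover have "zgen_star n * zgen n - (oq_const (q\<^sup>2) * (zgen n * zgen_star n) + oq_const (1 - q\<^sup>2)) \<in> oq_relators q n"
    unfolding oq_relators_def by blast
  ultimately show ?thesis using relators_in_ideal by (auto simp: equiv_mod_def zgen_def zgen_star_def)
qed

text \<open>Moving the star of \<open>z_j\<close> past \<open>z_s\<close> costs a scalar if
  \<open>s\<close> differs from \<open>j\<close>. Otherwise the relation also produces products of
  \<open>z_i\<close> with its star for \<open>i > j\<close>, and a constant. Each star has then
  passed one letter but may carry another index, so the induction on \<open>xs\<close> leaves
  \<open>j\<close> arbitrary.\<close>

lemma normal_form_star_ordered:
  assumes "set xs \<subseteq> {1..n}" "set ys \<subseteq> {1..n}" "j \<in> {1..n}"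
  shows "normal_form (word (Gen_star j # map Gen xs @ map Gen_star ys))"
  using assms(1,3)
proof (induction xs arbitrary: j)
  case Nil
  then show ?case using normal_form_ordered[of "[]" "j # ys"] assms(2) by simp
next
  case (Cons s xs)
  let ?u = "map Gen xs @ map Gen_star ys"
  have s: "s \<in> {1..n}" and IH: "\<And>j. j \<in> {1..n} \<Longrightarrow> normal_form (word (Gen_star j # ?u))"
    using Cons by auto
  have cu: "word ?u \<in> carrier (free_ring n)"
    unfolding word_append using Cons.prems assms(2) by (intro free_ring_closed map_carrier) auto
  have eq: "word (Gen_star j # map Gen (s # xs) @ map Gen_star ys) = (word [Gen_star j] * word [Gen s]) * word ?u"
    by (simp add: mult_single plus_list_def)
  have xy: "normal_form (word [Gen i] * (word [Gen_star i'] * word ?u))" if "i \<in> {1..n}" "i' \<in> {1..n}" for i i'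
    using normal_form_gen[OF IH[OF that(2)] that(1)] by (simp add: mult_single plus_list_def)
  show ?case
  proof (cases "s = j")
    case False
    have "zgen_star j * zgen s - oq_const q * (zgen s * zgen_star j) \<in> oq_relators q n"
      using False s Cons.prems unfolding oq_relators_def by blast
    then have "word [Gen_star j] * word [Gen s] \<asymp> oq_const q * (word [Gen s] * word [Gen_star j])"
      using relators_in_ideal by (auto simp: equiv_mod_def zgen_def zgen_star_def)
    from equiv_mod_mult(2)[OF this cu]
    have "(word [Gen_star j] * word [Gen s]) * word ?u \<asymp>
        oq_const q * (word [Gen s] * (word [Gen_star j] * word ?u))" by (simp only: mult.assoc)
    then show ?thesis unfolding eq
      by (rule normal_form_equiv[OF normal_form_scale[OF xy[OF s Cons.prems(2)]]])
  next
    case True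
    from equiv_mod_mult(2)[OF star_relation[OF Cons.prems(2)] cu]
    have "(word [Gen_star j] * word [Gen s]) * word ?u \<asymp>
        oq_const (q\<^sup>2) * (word [Gen j] * (word [Gen_star j] * word ?u)) +
        (oq_const (- (1 - q\<^sup>2)) * (\<Sum>i\<in>{j<..n}. word [Gen i] * (word [Gen_star i] * word ?u)) +
        oq_const (1 - q\<^sup>2) * word ?u)" (is "_ \<asymp> ?r")
      unfolding True
      by (simp add: distrib_right left_diff_distrib mult.assoc sum_distrib_right oq_const_def single_uminus single_diff algebra_simps)
    moreover have "normal_form ?r"
      using Cons.prems assms(2)
      by (intro normal_form.add normal_form_scale normal_form_sum xy normal_form_ordered) auto
    ultimately show ?thesis unfolding eq by (rule normal_form_equiv[rotated])
  qed
qed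

lemma normal_form_gen_star: "normal_form p \<Longrightarrow> j \<in> {1..n} \<Longrightarrow> normal_form (word [Gen_star j] * p)"
proof (induction rule: normal_form.induct)
  case (ideal p)
  then show ?case by (intro normal_form.ideal oq_ideal_closed(2) gen_carrier)
next
  case (mono a b c)
  obtain xs ys where w: "normal_word all_gens a b = map Gen xs @ map Gen_star ys" "set xs \<subseteq> {1..n}" "set ys \<subseteq> {1..n}"
    using normal_word_ordered by blast
  have "normal_form (oq_const c * word (Gen_star j # map Gen xs @ map Gen_star ys))"
    using w mono by (intro normal_form_scale normal_form_star_ordered) auto
  then show ?case by (simp add: oq_const_def mult_single plus_list_def w(1))
next
  case (add p p')
  then show ?case by (simp add: distrib_left normal_form.add)
qed

lemma normal_form_all:
  assumes p: "p \<in> carrier (free_ring n)" shows "normal_form p"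
proof -
  have w: "normal_form (word w)" if "w \<in> words n" for w
    using that
  proof (induction w)
    case Nil
    then show ?case using normal_form_ordered[of "[]" "[]"] by simp
  next
    case (Cons x w)
    then have "normal_form (word w)" "letter_index x \<in> {1..n}" by auto
    then show ?case unfolding word_Cons[of x w] by (cases x) (auto intro: normal_form_gen normal_form_gen_star)
  qed
  have "normal_form (\<Sum>w\<in>Poly_Mapping.keys p. Poly_Mapping.single w (Poly_Mapping.lookup p w))"
  proof (rule normal_form_sum)
    fix v assume "v \<in> Poly_Mapping.keys p"
    then have "normal_form (word v)" using p w by (auto simp: free_ring_carrier)
    then show "normal_form (Poly_Mapping.single v (Poly_Mapping.lookup p v))"
      by (subst single_const) (rule normal_form_scale)
  qed
  then show ?thesis by (simp only: free_alg_expand)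
qed

lemma normal_form_expand:
  assumes "p \<in> carrier (free_ring n)"
  shows "\<exists>F c. finite F \<and> F \<subseteq> exponents n \<times> exponents n \<and>
    p \<asymp> (\<Sum>x\<in>F. Poly_Mapping.single (normal_word all_gens (fst x) (snd x)) (c x))"
  using normal_form_all[OF assms]
proof (induction rule: normal_form.induct)
  case (ideal p)
  then show ?case by (intro exI[of _ "{}"]) (simp add: equiv_mod_def)
next
  case (mono a b c)
  then show ?case using equiv_mod_refl by (intro exI[of _ "{(a, b)}"] exI[of _ "\<lambda>_. c"]) simp
next
  case (add p p')
  let ?s = "\<lambda>F c. \<Sum>x\<in>F. Poly_Mapping.single (normal_word all_gens (fst x) (snd x)) (c x) :: free_alg"
  from add.IH obtain F c F' c' where F: "finite F" "F \<subseteq> exponents n \<times> exponents n" "p \<asymp> ?s F c"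
    and F': "finite F'" "F' \<subseteq> exponents n \<times> exponents n" "p' \<asymp> ?s F' c'" by blast
  \<comment> \<open>The coefficients are extended by 0 to the union of the two index sets, where
    they can be added.\<close>
  let ?e = "\<lambda>F c x. if x \<in> F then c x else (0 :: complex)"
  have "?s F c = ?s (F \<union> F') (?e F c)" "?s F' c' = ?s (F \<union> F') (?e F' c')"
    using F(1) F'(1) by (intro sum.mono_neutral_cong_left; auto)+
  then have "?s F c + ?s F' c' = ?s (F \<union> F') (\<lambda>x. ?e F c x + ?e F' c' x)"
    by (simp only: sum.distrib[symmetric] single_add)
  moreover have "p + p' \<asymp> ?s F c + ?s F' c'"
    using oq_ideal_closed(1)[OF F(3)[unfolded equiv_mod_def] F'(3)[unfolded equiv_mod_def]]
    by (simp add: equiv_mod_def algebra_simps)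
  ultimately show ?case
    using F F' by (intro exI[of _ "F \<union> F'"] exI[of _ "\<lambda>x. ?e F c x + ?e F' c' x"]) auto
qed

end

section \<open>Faithfulness for \<open>l = 0\<close>\<close>

text \<open>This is \<open>\<Psi>\<^sub>0 + R\<^sub>0 (\<Psi>\<^sub>1 + R\<^sub>1 (\<Psi>\<^sub>2 + \<dots>))\<close>.\<close>

primrec nested :: "nat \<Rightarrow> (nat \<Rightarrow> 'k::real_normed_vector) \<Rightarrow> (nat \<Rightarrow> nat \<Rightarrow> 'k \<Rightarrow> 'k) \<Rightarrow> nat \<Rightarrow> 'k" where
  "nested 0 \<Psi> R r = 0"
| "nested (Suc N) \<Psi> R r = \<Psi> 0 + R 0 r (nested N (\<lambda>t. \<Psi> (Suc t)) (\<lambda>t. R (Suc t)) r)"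

lemma nested_zero: "(\<And>t. t < N \<Longrightarrow> \<Psi> t = 0) \<Longrightarrow> (\<And>t r. R t r 0 = 0) \<Longrightarrow> nested N \<Psi> R r = 0"
  by (induction N arbitrary: \<Psi> R) simp_all

text \<open>\<open>R 0\<close> expands by a factor tending to infinity, so convergence of the whole
  forces the inner expression to 0. By induction its coefficients vanish, and what remains is the
  constant \<open>\<Psi> 0\<close>.\<close>

lemma nested_tendsto_zero:
  fixes \<Psi> :: "nat \<Rightarrow> 'k::real_normed_vector"
  assumes g: "filterlim g at_top sequentially"
    and R: "\<And>t r x. g r * norm x \<le> norm (R t r x)" "\<And>t r. R t r 0 = 0"
    and lim: "nested N \<Psi> R \<longlonglongrightarrow> 0" and t: "t < N"
  shows "\<Psi> t = 0"
  using R lim t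
proof (induction N arbitrary: \<Psi> R t)
  case (Suc N)
  let ?E = "nested N (\<lambda>t. \<Psi> (Suc t)) (\<lambda>t. R (Suc t))"
  let ?M = "norm (\<Psi> 0) + 1"
  have "\<forall>\<^sub>F r in sequentially. norm (nested (Suc N) \<Psi> R r) < 1"
    using tendstoD[OF Suc.prems(3), of 1] by simp
  moreover have "\<forall>\<^sub>F r in sequentially. 0 < g r" using g by (auto simp: filterlim_at_top_dense)
  ultimately have bd: "\<forall>\<^sub>F r in sequentially. norm (?E r) \<le> ?M / g r"
  proof eventually_elim
    case (elim r)
    have "norm (R 0 r (?E r)) = norm (nested (Suc N) \<Psi> R r - \<Psi> 0)" by simp
    also have "\<dots> \<le> norm (nested (Suc N) \<Psi> R r) + norm (\<Psi> 0)" by (rule norm_triangle_ineq4)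
    finally have "g r * norm (?E r) \<le> ?M" using Suc.prems(1)[of r "?E r" 0] elim by linarith
    then show ?case using elim by (simp add: field_simps)
  qed
  have "(\<lambda>r. ?M / g r) \<longlonglongrightarrow> 0" by (rule real_tendsto_divide_at_top[OF tendsto_const g])
  then have E: "?E \<longlonglongrightarrow> 0" by (rule Lim_null_comparison[OF bd])
  have tail: "\<Psi> (Suc t) = 0" if "t < N" for t
    by (rule Suc.IH[of "\<lambda>t. R (Suc t)" "\<lambda>t. \<Psi> (Suc t)"]) (use Suc.prems(1,2) E that in auto)
  then have "?E r = 0" for r using Suc.prems(2) by (intro nested_zero) auto
  then have "(\<lambda>r :: nat. \<Psi> 0) \<longlonglongrightarrow> 0" using Suc.prems(3) by (simp add: Suc.prems(2))
  then have "\<Psi> 0 = 0" by (simp add: LIMSEQ_const_iff)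
  then show ?case using tail Suc.prems(4) by (cases t) auto
qed simp

text \<open>Horner's scheme, with composition by \<open>R t\<close> in place of multiplication by a
  variable.\<close>

lemma sum_nested:
  fixes H :: "nat \<Rightarrow> nat \<Rightarrow> 'k::real_normed_vector \<Rightarrow> 'b::real_normed_vector"
  assumes H: "\<And>t x y. H t r (x + y) = H t r x + H t r y"
    and rec: "\<And>t x. H (Suc t) r x = H t r (R t r x)"
  shows "(\<Sum>t<N. H t r (\<Psi> t)) = H 0 r (nested N \<Psi> R r)"
  using assms
proof (induction N arbitrary: H \<Psi> R)
  case 0
  then show ?case using 0(1)[of 0 0 0] by simp
next
  case (Suc N)
  have "(\<Sum>t<Suc N. H t r (\<Psi> t)) = H 0 r (\<Psi> 0) + (\<Sum>t<N. H (Suc t) r (\<Psi> (Suc t)))"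
    by (rule sum.lessThan_Suc_shift)
  also have "(\<Sum>t<N. H (Suc t) r (\<Psi> (Suc t))) = H (Suc 0) r (nested N (\<lambda>t. \<Psi> (Suc t)) (\<lambda>t. R (Suc t)) r)"
    by (rule Suc.IH[of "\<lambda>t. H (Suc t)"]) (use Suc.prems in auto)
  finally show ?case by (simp add: Suc.prems)
qed

section \<open>Action of the ordered monomials for \<open>l = 0\<close>\<close>

locale series0 = series q m 0 k A v w
  for q :: real and m k :: nat and A v w :: "'k::complex_hilbert \<Rightarrow> 'k"
begin

definition eps :: "nat \<Rightarrow> int" where "eps j = (if k < j then 1 else - 1)"

text \<open>For \<open>l = 0\<close> the coefficient of \<open>z_j\<close> reads only the
  \<open>j\<close>-th entry, so a constant tuple can stand for the index.\<close>

abbreviation c where "c j r \<equiv> C j (\<lambda>_. r)"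

lemma shifts:
  assumes "j \<in> {1..n}"
  shows "up j i = i(j := i j + eps j)" "dn j i = i(j := i j - eps j)"
proof -
  have "sh j x = (if x = j then eps j else 0)" for x
    using assms unfolding sh_def eps_def by auto
  then show "up j i = i(j := i j + eps j)" "dn j i = i(j := i j - eps j)" by (auto simp: fun_eq_iff)
qed

lemma C_value: "j \<in> {1..n} \<Longrightarrow> C j i x = c j (i j) x" "j \<in> {1..n} \<Longrightarrow> Cs j i x = c j (i j) x"
  unfolding Cs_def C_def by auto

lemma sum_upd: "t \<notin> F \<Longrightarrow> (\<Sum>s\<in>F. (i(t := r)) s) = (\<Sum>s\<in>F. i s)"
  by (rule sum.cong) auto

text \<open>For \<open>l = 0\<close> the exponent of \<open>z_j\<close> involves only entries beyond
  \<open>j\<close>. This triangular dependence is what allows the coordinates to be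
  separated.\<close>

lemma ex_upd:
  assumes "j \<in> {1..n}" "t \<le> j" shows "ex j (i(t := r)) = ex j i"
proof -
  have "S (i(t := r)) = S i" if "j \<le> k" using that assms unfolding S_def by (intro sum_upd) auto
  moreover have "(\<Sum>s\<in>{j<..b}. (i(t := r)) s) = (\<Sum>s\<in>{j<..b}. i s)" for b
    using assms by (intro sum_upd) auto
  ultimately show ?thesis unfolding ex_def by auto
qed

text \<open>The product of the coefficients met by \<open>N\<close> applications of
  \<open>z_j\<close> starting at entry \<open>r\<close>, without the powers of \<open>q\<close>;
  \<open>bwd\<close> is the same for the adjoint.\<close>

primrec fwd :: "nat \<Rightarrow> nat \<Rightarrow> int \<Rightarrow> 'k \<Rightarrow> 'k" where
  "fwd j 0 r x = x"
| "fwd j (Suc N) r x = c j (r + eps j * int N) (fwd j N r x)"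

primrec bwd :: "nat \<Rightarrow> nat \<Rightarrow> int \<Rightarrow> 'k \<Rightarrow> 'k" where
  "bwd j 0 r x = x"
| "bwd j (Suc N) r x = c j (r - eps j * (int N + 1)) (bwd j N r x)"

lemma fwd_linear: "fwd j N r (x + y) = fwd j N r x + fwd j N r y" "fwd j N r (a *\<^sub>C x) = a *\<^sub>C fwd j N r x"
  "fwd j N r (s *\<^sub>R x) = s *\<^sub>R fwd j N r x" "fwd j N r 0 = 0"
  by (induction N) (simp_all add: C_linear)

lemma bwd_linear: "bwd j N r (x + y) = bwd j N r x + bwd j N r y" "bwd j N r (a *\<^sub>C x) = a *\<^sub>C bwd j N r x"
  "bwd j N r (s *\<^sub>R x) = s *\<^sub>R bwd j N r x" "bwd j N r 0 = 0"
  by (induction N) (simp_all add: C_linear)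

lemma C_fwd: "C j' i (fwd j N r x) = fwd j N r (C j' i x)"
  by (induction N) (simp_all add: C_comm(1)[of j'])

lemma C_bwd: "C j' i (bwd j N r x) = bwd j N r (C j' i x)"
  by (induction N) (simp_all add: C_comm(1)[of j'])

lemma fwd_Suc_right: "fwd j (Suc N) r x = fwd j N (r + eps j) (c j r x)"
  by (induction N) (simp_all add: algebra_simps)

lemma Z_power:
  assumes j: "j \<in> {1..n}"
  shows "(Z j ^^ N) (ket i x) = ket (i(j := i j + eps j * int N)) ((q powi ex j i) ^ N *\<^sub>R fwd j N (i j) x)"
proof (induction N)
  case (Suc N)
  let ?i = "i(j := i j + eps j * int N)"
  have "(Z j ^^ Suc N) (ket i x) = ket (up j ?i) (wt j ?i ((q powi ex j i) ^ N *\<^sub>R fwd j N (i j) x))"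
    unfolding funpow.simps(2) o_apply Suc Z_ket ..
  moreover have "up j ?i = i(j := i j + eps j * int (Suc N))"
    unfolding shifts(1)[OF j] by (rule ext) (simp add: algebra_simps)
  moreover have "wt j ?i ((q powi ex j i) ^ N *\<^sub>R fwd j N (i j) x) = (q powi ex j i) ^ Suc N *\<^sub>R fwd j (Suc N) (i j) x"
    unfolding wt_def C_value(1)[OF j, of ?i] ex_upd[OF j order_refl] by (simp add: C_linear)
  ultimately show ?case by (simp only:)
qed simp

lemma Y_power:
  assumes j: "j \<in> {1..n}"
  shows "(Y j ^^ N) (ket i x) = ket (i(j := i j - eps j * int N)) ((q powi ex j i) ^ N *\<^sub>R bwd j N (i j) x)"
proof (induction N)
  case (Suc N)
  let ?i = "i(j := i j - eps j * int N)"
  let ?i' = "i(j := i j - eps j * (int N + 1))"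
  have dn: "dn j ?i = ?i'" unfolding shifts(2)[OF j] by (rule ext) (simp add: algebra_simps)
  have "(Y j ^^ Suc N) (ket i x) = ket (dn j ?i) (wts j (dn j ?i) ((q powi ex j i) ^ N *\<^sub>R bwd j N (i j) x))"
    unfolding funpow.simps(2) o_apply Suc Z_ket ..
  moreover have "wts j ?i' ((q powi ex j i) ^ N *\<^sub>R bwd j N (i j) x) = (q powi ex j i) ^ Suc N *\<^sub>R bwd j (Suc N) (i j) x"
    unfolding wts_def C_value(2)[OF j, of ?i'] ex_upd[OF j order_refl] by (simp add: C_linear)
  moreover have "?i' = i(j := i j - eps j * int (Suc N))" by (simp add: algebra_simps)
  ultimately show ?case unfolding dn by (simp only:)
qed simp

definition target :: "nat list \<Rightarrow> (nat \<Rightarrow> nat) \<Rightarrow> (nat \<Rightarrow> nat) \<Rightarrow> (nat \<Rightarrow> int) \<Rightarrow> nat \<Rightarrow> int"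
  where "target js a b i t = i t + (if t \<in> set js then eps t * (int (a t) - int (b t)) else 0)"

text \<open>For increasing \<open>js\<close> the entry \<open>i j\<close> enters only through the factors of \<open>z\<^sub>j\<close> and
  \<open>z\<^sub>j\<^sup>*\<close>, so the coordinates can be separated one after the other.\<close>

primrec weight :: "nat list \<Rightarrow> (nat \<Rightarrow> nat) \<Rightarrow> (nat \<Rightarrow> nat) \<Rightarrow> (nat \<Rightarrow> int) \<Rightarrow> 'k \<Rightarrow> 'k" where
  "weight [] a b i x = x"
| "weight (j # js) a b i x = ((q powi ex j (target js a b i)) ^ a j * (q powi ex j i) ^ b j) *\<^sub>R
    fwd j (a j) (i j - eps j * int (b j)) (bwd j (b j) (i j) (weight js a b i x))"

lemma weight_linear: "weight js a b i (x + y) = weight js a b i x + weight js a b i y"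
  "weight js a b i (s *\<^sub>R x) = s *\<^sub>R weight js a b i x"
  by (induction js) (simp_all add: fwd_linear bwd_linear scaleR_add_right mult_ac)

lemma C_weight: "C j i' (weight js a b i x) = weight js a b i (C j i' x)"
  by (induction js) (simp_all add: C_linear C_fwd C_bwd)

lemma bwd_weight: "bwd j N r (weight js a b i x) = weight js a b i (bwd j N r x)"
  by (induction N) (simp_all add: C_weight)

lemma target_upd: "t \<notin> set js \<Longrightarrow> target js a b (i(t := r)) = (target js a b i)(t := r)"
  by (auto simp: target_def fun_eq_iff)

lemma weight_upd:
  assumes "set js \<subseteq> {1..n}" "\<And>s. s \<in> set js \<Longrightarrow> t < s"
  shows "weight js a b (i(t := r)) x = weight js a b i x"
  using assms
proof (induction js)
  case (Cons j js)
  have j: "j \<in> {1..n}" "t < j" "t \<notin> set js" using Cons.prems by auto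
  have IH: "weight js a b (i(t := r)) x = weight js a b i x"
    by (rule Cons.IH) (use Cons.prems in auto)
  have "(i(t := r)) j = i j" using j(2) by simp
  then show ?case
    unfolding weight.simps IH target_upd[OF j(3)] ex_upd[OF j(1) less_imp_le[OF j(2)]] by (simp only:)
qed simp

lemma word_act_power: "word_act Z Y (replicate N (Gen j)) d = (Z j ^^ N) d"
  "word_act Z Y (replicate N (Gen_star j)) d = (Y j ^^ N) d"
  by (induction N) simp_all

lemma normal_word_act:
  assumes "sorted_wrt (<) js" "set js \<subseteq> {1..n}"
  shows "word_act Z Y (normal_word js a b) (ket i x) = ket (target js a b i) (weight js a b i x)"
  using assms
proof (induction js arbitrary: i x)
  case Nil
  then show ?case by (simp add: normal_word_def target_def[abs_def])
next
  case (Cons j js)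
  have j: "j \<in> {1..n}" "j \<notin> set js" and lt: "\<And>s. s \<in> set js \<Longrightarrow> j < s" using Cons.prems by auto
  let ?i = "i(j := i j - eps j * int (b j))"
  let ?y = "(q powi ex j i) ^ b j *\<^sub>R bwd j (b j) (i j) x"
  have "word_act Z Y (normal_word (j # js) a b) (ket i x) =
      (Z j ^^ a j) (word_act Z Y (normal_word js a b) ((Y j ^^ b j) (ket i x)))"
    by (simp add: normal_word_def word_act_power)
  also have "\<dots> = (Z j ^^ a j) (ket (target js a b ?i) (weight js a b ?i ?y))"
    unfolding Y_power[OF j(1)] using Cons by simp
  also have "weight js a b ?i ?y = weight js a b i ?y"
    using Cons.prems lt by (intro weight_upd) auto
  also have "\<dots> = (q powi ex j i) ^ b j *\<^sub>R bwd j (b j) (i j) (weight js a b i x)"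
    by (simp add: weight_linear bwd_weight)
  also have "target js a b ?i = (target js a b i)(j := i j - eps j * int (b j))"
    by (rule target_upd[OF j(2)])
  also have "(Z j ^^ a j) (ket ((target js a b i)(j := i j - eps j * int (b j)))
      ((q powi ex j i) ^ b j *\<^sub>R bwd j (b j) (i j) (weight js a b i x))) =
    ket (target (j # js) a b i) (weight (j # js) a b i x)"
  proof -
    let ?t = "(target js a b i)(j := i j - eps j * int (b j))"
    have "?t(j := ?t j + eps j * int (a j)) = target (j # js) a b i"
      using j(2) by (intro ext) (auto simp: target_def algebra_simps)
    then show ?thesis
      unfolding Z_power[OF j(1)] ex_upd[OF j(1) order_refl] by (simp add: fwd_linear mult_ac)
  qed
  finally show ?case .
qed

text \<open>At entry \<open>r\<close> any power of the adjoint beyond \<open>r\<close> passes the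
  coefficient \<open>lambda_q q 0\<close>, which is 0. Evaluated at the least exponent with a
  nonzero coefficient, the sum has a single term, and all its factors are nonzero.\<close>

lemma fock_independent:
  assumes j: "k < j" "j \<le> n" and B: "finite B"
    and sum: "\<And>r. 0 \<le> r \<Longrightarrow> (\<Sum>\<beta>\<in>B. fwd j (nat (d + int \<beta>)) (r - eps j * int \<beta>) (bwd j \<beta> r (\<Psi> \<beta>))) = 0"
    and b: "b \<in> B"
  shows "\<Psi> b = 0"
proof (rule ccontr)
  assume "\<Psi> b \<noteq> 0"
  have j': "0 + k < j" using j by simp
  have e: "eps j = 1" using j by (simp add: eps_def)
  have cj: "c j r x = lambda_q q (r + 1) *\<^sub>R x" for r x using C_fock(1)[OF j'] .
  have bwd0: "bwd j N (int r) x = 0" if "r < N" for N r x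
    using that
  proof (induction N)
    case (Suc N)
    then show ?case by (cases "r = N") (auto simp: cj e C_linear)
  qed simp
  have bwd_inj: "x = 0" if "bwd j N (int r) x = 0" "N \<le> r" for N r x
    using that
  proof (induction N)
    case (Suc N)
    have "lambda_q q (int r - int N) \<noteq> 0" using Suc.prems by (intro lambda_q_nz) auto
    then have "bwd j N (int r) x = 0" using Suc.prems by (simp add: cj e)
    then show ?case using Suc by simp
  qed simp
  have fwd_inj: "x = 0" if "fwd j N 0 x = 0" for N x
    using that
  proof (induction N)
    case (Suc N)
    have "lambda_q q (int N + 1) \<noteq> 0" by (intro lambda_q_nz) auto
    then show ?case using Suc by (simp add: cj e)
  qed simp
  define b0 where "b0 = Min {\<beta> \<in> B. \<Psi> \<beta> \<noteq> 0}"
  have "b0 \<in> {\<beta> \<in> B. \<Psi> \<beta> \<noteq> 0}"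
    unfolding b0_def using B b \<open>\<Psi> b \<noteq> 0\<close> by (intro Min_in) auto
  then have b0: "b0 \<in> B" "\<Psi> b0 \<noteq> 0" by auto
  have min: "b0 \<le> \<beta>" if "\<beta> \<in> B" "\<Psi> \<beta> \<noteq> 0" for \<beta>
    unfolding b0_def using B that by (intro Min_le) auto
  let ?f = "\<lambda>\<beta>. fwd j (nat (d + int \<beta>)) (int b0 - eps j * int \<beta>) (bwd j \<beta> (int b0) (\<Psi> \<beta>))"
  have "?f \<beta> = 0" if "\<beta> \<in> B - {b0}" for \<beta>
  proof (cases "\<Psi> \<beta> = 0")
    case False
    then have "b0 < \<beta>" using min[of \<beta>] that by auto
    then show ?thesis by (simp add: bwd0 fwd_linear)
  qed (simp add: fwd_linear bwd_linear)
  then have "(\<Sum>\<beta>\<in>B. ?f \<beta>) = ?f b0"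
    using B b0(1) by (subst sum.remove[of _ b0]) auto
  then have "fwd j (nat (d + int b0)) 0 (bwd j b0 (int b0) (\<Psi> b0)) = 0"
    using sum[of "int b0"] by (simp add: e)
  then show False using fwd_inj bwd_inj b0(2) by blast
qed

text \<open>Here the adjoint raises the entry and never annihilates, so independence comes from
  growth: one more factor \<open>z_j\<close> together with its adjoint inserts the square of a
  coefficient, which tends to infinity with \<open>r\<close>.\<close>

lemma low_independent:
  assumes j: "1 \<le> j" "j \<le> k" and B: "finite B" "\<And>\<beta>. \<beta> \<in> B \<Longrightarrow> 0 \<le> d + int \<beta>"
    and sum: "\<And>r. 1 \<le> r \<Longrightarrow> (\<Sum>\<beta>\<in>B. fwd j (nat (d + int \<beta>)) (r - eps j * int \<beta>) (bwd j \<beta> r (\<Psi> \<beta>))) = 0"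
    and b: "b \<in> B"
  shows "\<Psi> b = 0"
proof -
  have jn: "j \<in> {1..n}" using j by simp
  have e: "eps j = - 1" using j by (simp add: eps_def)
  have c_inj: "x = 0" if "c j r x = 0" "2 \<le> r" for r x
  proof (cases "j = k")
    case True
    then show ?thesis using that(1) C_mid0(1)[of "\<lambda>_. r" x] by (simp add: mu_nz)
  next
    case False
    then have "j < k" using j by simp
    moreover have "beta_q q (r - 1) \<noteq> 0" using that(2) by (intro beta_q_nz) simp
    ultimately show ?thesis using that(1) by (simp add: C_low(1) A_nz)
  qed
  have AA: "q\<^sup>2 * norm x \<le> norm (A (A x))" for x
  proof -
    have "q * (q * norm x) \<le> q * norm (A x)" using A_low[of x] q by (intro mult_left_mono) auto
    also have "\<dots> \<le> norm (A (A x))" by (rule A_low)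
    finally show ?thesis by (simp add: power2_eq_square mult.assoc)
  qed
  \<comment> \<open>A lower bound common to both kinds of squared coefficient,
    \<open>1 + u A^2\<close> and \<open>(u - 1) A^2\<close> with
    \<open>u = q powi (- 2 * (s - 1))\<close>, using that \<open>A^2\<close> expands norms by at
    least \<open>q^2\<close>.\<close>
  define g where "g r = q\<^sup>2 * (1 / q\<^sup>2) ^ r - 1" for r
  have c_sq: "g r * norm x \<le> norm (c j s (c j s x))" if "int r + 1 \<le> s" for r s x
  proof -
    let ?u = "q powi (- 2 * (s - 1))"
    have "(1 / q\<^sup>2) ^ r = q powi (- 2 * int r)"
      using q by (simp add: power_int_minus power_int_mult power_one_over divide_inverse power_int_of_nat power_inverse)
    also have "\<dots> \<le> ?u" using q that by (intro power_int_decreasing) auto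
    finally have gu: "g r \<le> q\<^sup>2 * ?u - 1" using q by (simp add: g_def)
    have u1: "1 \<le> ?u"
    proof -
      have "q powi 0 \<le> ?u" using q that by (intro power_int_decreasing) auto
      then show ?thesis by simp
    qed
    show ?thesis
    proof (cases "j = k")
      case True
      have "c j s (c j s x) = x + ?u *\<^sub>R A (A x)"
        unfolding True using C_mid0(1)[OF refl, of "\<lambda>_. s"] by (simp add: mu(2))
      moreover have "norm (?u *\<^sub>R A (A x)) \<le> norm (x + ?u *\<^sub>R A (A x)) + norm x"
        using norm_triangle_ineq4[of "x + ?u *\<^sub>R A (A x)" x] by simp
      moreover have "?u * (q\<^sup>2 * norm x) \<le> norm (?u *\<^sub>R A (A x))"
        using u1 AA[of x] by (simp add: mult_left_mono)
      ultimately have "(q\<^sup>2 * ?u - 1) * norm x \<le> norm (c j s (c j s x))" by (simp add: algebra_simps)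
      then show ?thesis using mult_right_mono[OF gu, of "norm x"] by simp
    next
      case False
      then have jk: "j < k" using j by simp
      have b2: "beta_q q (s - 1) * beta_q q (s - 1) = ?u - 1" using q that by (intro beta_q_sq) auto
      have "c j s (c j s x) = (?u - 1) *\<^sub>R A (A x)"
        unfolding b2[symmetric] by (simp add: C_low(1)[OF jk] adjp_linear[OF A])
      then have "norm (c j s (c j s x)) = (?u - 1) * norm (A (A x))" using u1 by simp
      moreover have "(?u - 1) * (q\<^sup>2 * norm x) \<le> (?u - 1) * norm (A (A x))"
        using u1 AA[of x] by (intro mult_left_mono) auto
      moreover have "q\<^sup>2 * ?u - 1 \<le> (?u - 1) * q\<^sup>2"
      proof -
        have "q\<^sup>2 \<le> 1" using q by (simp add: power_le_one)
        then show ?thesis by (simp add: algebra_simps)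
      qed
      then have "(q\<^sup>2 * ?u - 1) * norm x \<le> (?u - 1) * q\<^sup>2 * norm x" by (intro mult_right_mono) auto
      ultimately show ?thesis using mult_right_mono[OF gu, of "norm x"] by (simp add: mult.assoc)
    qed
  qed
  have g_lim: "filterlim g at_top sequentially"
  proof -
    have "1 < 1 / q\<^sup>2" using q by (simp add: power_less_one_iff)
    then have "filterlim (\<lambda>r. (1 / q\<^sup>2) ^ r) at_top sequentially"
      using q by (intro filterlim_at_infinity_imp_filterlim_at_top filterlim_realpow_sequentially_gt1) auto
    then have "filterlim (\<lambda>r. q\<^sup>2 * (1 / q\<^sup>2) ^ r) at_top sequentially"
      using q by (intro filterlim_tendsto_pos_mult_at_top[OF tendsto_const]) auto
    then show ?thesis
      unfolding g_def diff_conv_add_uminus add.commute[of _ "- 1"]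
      by (intro filterlim_tendsto_add_at_top[OF tendsto_const])
  qed
  \<comment> \<open>The least exponent of the adjoint that leaves a nonnegative exponent
    \<open>d + \<beta>\<close> for \<open>z_j\<close>. All monomials then have exponents
    \<open>a0 + t\<close> and \<open>b0 + t\<close>.\<close>
  define b0 where "b0 = nat (- d)"
  define a0 where "a0 = nat (d + int b0)"
  have ab: "nat (d + int (b0 + t)) = a0 + t" for t
    using a0_def b0_def by linarith
  have b0: "b0 \<le> \<beta>" if "\<beta> \<in> B" for \<beta> using B(2)[OF that] by (simp add: b0_def)
  define H where "H t r x = fwd j (a0 + t) (int r + int (b0 + t)) (bwd j (b0 + t) (int r) x)" for t r x
  define R where "R t r x = c j (int r + int (b0 + t) + 1) (c j (int r + int (b0 + t) + 1) x)" for t r x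
  \<comment> \<open>Missing exponents are filled with 0, to obtain a sum over an initial
    segment.\<close>
  define \<Phi> where "\<Phi> t = (if b0 + t \<in> B then \<Psi> (b0 + t) else 0)" for t
  obtain N where N: "\<And>\<beta>. \<beta> \<in> B \<Longrightarrow> \<beta> < N" using finite_nat_set_iff_bounded[THEN iffD1, OF B(1)] by auto
  have H_add: "H t r (x + y) = H t r x + H t r y" for t r x y
    by (simp add: H_def fwd_linear bwd_linear)
  \<comment> \<open>The additional pair sits in the middle of the monomial, at the entry reached by
    the adjoint. Both its coefficients are taken there and can be moved onto
    \<open>x\<close>.\<close>
  have H_rec: "H (Suc t) r x = H t r (R t r x)" for t r x
  proof -
    let ?s = "int r + int (b0 + t) + 1"
    have s: "int r + int (b0 + Suc t) = ?s" "?s + eps j = int r + int (b0 + t)"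
      "int r - eps j * (int (b0 + t) + 1) = ?s" by (simp_all add: e)
    have "H (Suc t) r x = fwd j (Suc (a0 + t)) ?s (bwd j (Suc (b0 + t)) (int r) x)"
      unfolding H_def s(1) by simp
    also have "\<dots> = fwd j (a0 + t) (int r + int (b0 + t)) (c j ?s (c j ?s (bwd j (b0 + t) (int r) x)))"
      unfolding fwd_Suc_right s(2) bwd.simps s(3) ..
    finally show ?thesis by (simp add: H_def R_def C_bwd)
  qed
  \<comment> \<open>The bound on \<open>r\<close> keeps all entries met on the way at 2 or more,
    away from the zero of \<open>beta_q\<close>.\<close>
  have H_inj: "x = 0" if "H 0 r x = 0" "a0 + 2 \<le> r" for r x
  proof -
    have fwd_inj: "y = 0" if "fwd j M (int r + int b0) y = 0" "M \<le> a0" for M y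
      using that
    proof (induction M)
      case (Suc M)
      have "fwd j M (int r + int b0) y = 0"
        by (rule c_inj[of "int r + int b0 - int M"]) (use Suc.prems \<open>a0 + 2 \<le> r\<close> e in auto)
      then show ?case using Suc by simp
    qed simp
    have bwd_inj: "y = 0" if "bwd j M (int r) y = 0" for M y
      using that
    proof (induction M)
      case (Suc M)
      have s: "int r - eps j * (int M + 1) = int r + int M + 1" using e by simp
      have "c j (int r + int M + 1) (bwd j M (int r) y) = 0"
        using Suc.prems unfolding bwd.simps s .
      then have "bwd j M (int r) y = 0" by (rule c_inj) (use \<open>a0 + 2 \<le> r\<close> in simp)
      then show ?case using Suc by simp
    qed simp
    have "fwd j a0 (int r + int b0) (bwd j b0 (int r) x) = 0" using that(1) by (simp add: H_def)
    then have "bwd j b0 (int r) x = 0" by (rule fwd_inj) simp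
    then show ?thesis by (rule bwd_inj)
  qed
  have zero: "(\<Sum>t<N. H t r (\<Phi> t)) = 0" if "1 \<le> r" for r
  proof -
    have "0 = (\<Sum>\<beta>\<in>B. fwd j (nat (d + int \<beta>)) (int r - eps j * int \<beta>) (bwd j \<beta> (int r) (\<Psi> \<beta>)))"
      using sum[of "int r"] that by simp
    also have "\<dots> = (\<Sum>t | b0 + t \<in> B. H t r (\<Phi> t))"
    proof (rule sum.reindex_bij_witness[of _ "\<lambda>t. b0 + t" "\<lambda>\<beta>. \<beta> - b0"])
      fix \<beta> assume \<beta>: "\<beta> \<in> B"
      show "b0 + (\<beta> - b0) = \<beta>" "\<beta> - b0 \<in> {t. b0 + t \<in> B}" using b0[OF \<beta>] \<beta> by auto
      have "nat (d + int \<beta>) = a0 + (\<beta> - b0)" using ab[of "\<beta> - b0"] b0[OF \<beta>] by simp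
      then show "H (\<beta> - b0) r (\<Phi> (\<beta> - b0)) =
          fwd j (nat (d + int \<beta>)) (int r - eps j * int \<beta>) (bwd j \<beta> (int r) (\<Psi> \<beta>))"
        using b0[OF \<beta>] \<beta> by (simp add: H_def \<Phi>_def e)
    qed auto
    also have "\<dots> = (\<Sum>t<N. H t r (\<Phi> t))"
    proof (rule sum.mono_neutral_left)
      show "{t. b0 + t \<in> B} \<subseteq> {..<N}" 
      proof
        fix t assume "t \<in> {t. b0 + t \<in> B}"
        then show "t \<in> {..<N}" using N[of "b0 + t"] by simp
      qed
      show "\<forall>t\<in>{..<N} - {t. b0 + t \<in> B}. H t r (\<Phi> t) = 0"
        by (auto simp: \<Phi>_def H_def fwd_linear bwd_linear)
    qed simp
    finally show ?thesis by simp
  qed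
  have "nested N \<Phi> R r = 0" if "a0 + 2 \<le> r" for r
  proof (rule H_inj[OF _ that])
    show "H 0 r (nested N \<Phi> R r) = 0"
      using zero[of r] sum_nested[where H = H and R = R and \<Psi> = \<Phi> and N = N and r = r, OF H_add H_rec] that by simp
  qed
  then have "\<forall>\<^sub>F r in sequentially. nested N \<Phi> R r = 0" unfolding eventually_sequentially by blast
  then have lim: "nested N \<Phi> R \<longlonglongrightarrow> 0" by (rule tendsto_eventually)
  have "\<Phi> (b - b0) = 0"
  proof (rule nested_tendsto_zero[OF g_lim _ _ lim])
    show "g r * norm x \<le> norm (R t r x)" for t r x unfolding R_def by (rule c_sq) simp
    show "R t r 0 = 0" for t r by (simp add: R_def C_linear)
    show "b - b0 < N" using N[OF b] by simp
  qed
  then show ?thesis using b b0[OF b] by (simp add: \<Phi>_def)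
qed

end

section \<open>Linear independence of the ordered monomials\<close>

context series0 begin

lemma upd_index:
  assumes i: "i \<in> I" and j: "j \<in> {1..n}" and r: "k < j \<Longrightarrow> 0 \<le> r" "j < k \<Longrightarrow> 1 \<le> r"
  shows "i(j := r) \<in> I"
  unfolding index_iff
proof (intro conjI allI impI ballI)
  show "(i(j := r)) x = undefined" if "x \<notin> {1..k} \<union> {0 + k<..n}" for x
    using that i j unfolding index_iff by auto
  show "0 \<le> (i(j := r)) x" if "x \<in> {0 + k<..n}" for x
    using that i r(1) unfolding index_iff by (cases "x = j") auto
  show "1 \<le> (i(j := r)) x" if "1 \<le> x \<and> x < k" for x
    using that i r(2) unfolding index_iff by (cases "x = j") auto
qed

lemma fwd_sum: "fwd j N r (sum f T) = (\<Sum>x\<in>T. fwd j N r (f x))"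
  by (induction T rule: infinite_finite_induct) (simp_all add: fwd_linear)

lemma bwd_sum: "bwd j N r (sum f T) = (\<Sum>x\<in>T. bwd j N r (f x))"
  by (induction T rule: infinite_finite_induct) (simp_all add: bwd_linear)

lemma coordinate_independent:
  assumes j: "j \<in> {1..n}" and B: "finite B" "\<And>\<beta>. \<beta> \<in> B \<Longrightarrow> 0 \<le> d + int \<beta>" and i: "i \<in> I"
    and sum: "\<And>r. i(j := r) \<in> I \<Longrightarrow>
      (\<Sum>\<beta>\<in>B. fwd j (nat (d + int \<beta>)) (r - eps j * int \<beta>) (bwd j \<beta> r (\<Psi> \<beta>))) = 0"
    and b: "b \<in> B"
  shows "\<Psi> b = 0"
proof (cases "k < j")
  case True
  show ?thesis
  proof (rule fock_independent[OF True _ B(1) _ b])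
    show "j \<le> n" using j by simp
    show "(\<Sum>\<beta>\<in>B. fwd j (nat (d + int \<beta>)) (r - eps j * int \<beta>) (bwd j \<beta> r (\<Psi> \<beta>))) = 0" if "0 \<le> r" for r
      using True that by (intro sum upd_index[OF i j]) auto
  qed
next
  case False
  then have jk: "1 \<le> j" "j \<le> k" using j by auto
  show ?thesis
  proof (rule low_independent[OF jk B _ b])
    show "(\<Sum>\<beta>\<in>B. fwd j (nat (d + int \<beta>)) (r - eps j * int \<beta>) (bwd j \<beta> r (\<Psi> \<beta>))) = 0" if "1 \<le> r" for r
      using False that by (intro sum upd_index[OF i j]) auto
  qed
qed

text \<open>With the other entries fixed, varying \<open>i j\<close> separates the monomials by the
  exponent of the adjoint of \<open>z_j\<close>; \<open>deg\<close> then fixes that of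
  \<open>z_j\<close>. The coefficient of each group involves later coordinates only and is treated
  by induction on \<open>js\<close>.\<close>

lemma weight_independent:
  assumes nz: "\<exists>x::'k. x \<noteq> 0" and js: "sorted_wrt (<) js" "set js \<subseteq> {1..n}" and F: "finite F"
    and inj: "\<And>p p'. p \<in> F \<Longrightarrow> p' \<in> F \<Longrightarrow> (\<And>t. t \<in> set js \<Longrightarrow> fst p t = fst p' t \<and> snd p t = snd p' t) \<Longrightarrow> p = p'"
    and deg: "\<And>p t. p \<in> F \<Longrightarrow> t \<in> set js \<Longrightarrow> int (fst p t) - int (snd p t) = d t"
    and sum: "\<And>i x. i \<in> I \<Longrightarrow> (\<Sum>p\<in>F. \<gamma> p *\<^sub>C weight js (fst p) (snd p) i x) = 0"
    and p: "p \<in> F"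
  shows "\<gamma> p = 0"
  using js F inj deg sum p
proof (induction js arbitrary: F p)
  case Nil
  obtain x :: 'k where x: "x \<noteq> 0" using nz by blast
  have "p' = p" if "p' \<in> F" for p' by (rule Nil.prems(4)[OF that Nil.prems(7)]) simp
  then have "F = {p}" using Nil.prems(7) by blast
  then have "\<gamma> p *\<^sub>C x = 0" using Nil.prems(6)[OF om_index, where x = x] by simp
  then show ?case using x by simp
next
  case (Cons j js)
  have j: "j \<in> {1..n}" "j \<notin> set js" and lt: "\<And>s. s \<in> set js \<Longrightarrow> j < s" and jsn: "set js \<subseteq> {1..n}"
    using Cons.prems(1,2) by auto
  \<comment> \<open>Equal degrees give all monomials in \<open>F\<close> the same target, so within
    a group the powers of \<open>q\<close> agree and form the common nonzero factor
    \<open>\<kappa>\<close>.\<close>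
  define \<tau> where "\<tau> i t = i t + (if t \<in> set js then eps t * d t else 0)" for i t
  define \<kappa> where "\<kappa> \<beta> i = (q powi ex j (\<tau> i)) ^ nat (d j + int \<beta>) * (q powi ex j i) ^ \<beta>" for \<beta> i
  define \<Phi> where "\<Phi> \<beta> i x = (\<Sum>p\<in>{p \<in> F. snd p j = \<beta>}. \<gamma> p *\<^sub>C weight js (fst p) (snd p) i x)" for \<beta> i x
  let ?B = "(\<lambda>p. snd p j) ` F"
  have degj: "int (fst p j) - int (snd p j) = d j" if "p \<in> F" for p
    using Cons.prems(5)[OF that, of j] by simp
  have a_eq: "fst p j = nat (d j + int (snd p j))" if "p \<in> F" for p using degj[OF that] by simp
  have tau: "target js (fst p) (snd p) i = \<tau> i" if "p \<in> F" for p i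
    using Cons.prems(5)[OF that] by (auto simp: target_def \<tau>_def fun_eq_iff)
  have w: "weight (j # js) (fst p) (snd p) i x = fwd j (nat (d j + int \<beta>)) (i j - eps j * int \<beta>)
      (bwd j \<beta> (i j) (\<kappa> \<beta> i *\<^sub>R weight js (fst p) (snd p) i x))"
    if "p \<in> F" "snd p j = \<beta>" for p \<beta> i x
    using a_eq[OF that(1)] that(2) tau[OF that(1)] by (simp add: \<kappa>_def fwd_linear bwd_linear)
  have expand: "(\<Sum>p\<in>F. \<gamma> p *\<^sub>C weight (j # js) (fst p) (snd p) i x) =
      (\<Sum>\<beta>\<in>?B. fwd j (nat (d j + int \<beta>)) (i j - eps j * int \<beta>) (bwd j \<beta> (i j) (\<kappa> \<beta> i *\<^sub>R \<Phi> \<beta> i x)))" for i x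
  proof -
    have "(\<Sum>p\<in>F. \<gamma> p *\<^sub>C weight (j # js) (fst p) (snd p) i x) =
      (\<Sum>\<beta>\<in>?B. \<Sum>p\<in>{p \<in> F. snd p j = \<beta>}. \<gamma> p *\<^sub>C weight (j # js) (fst p) (snd p) i x)"
      by (rule sum.image_gen[OF Cons.prems(3)])
    also have "\<dots> = (\<Sum>\<beta>\<in>?B. \<Sum>p\<in>{p \<in> F. snd p j = \<beta>}. fwd j (nat (d j + int \<beta>)) (i j - eps j * int \<beta>)
      (bwd j \<beta> (i j) (\<kappa> \<beta> i *\<^sub>R (\<gamma> p *\<^sub>C weight js (fst p) (snd p) i x))))"
      by (intro sum.cong refl)
        (auto simp del: weight.simps simp: w fwd_linear bwd_linear scaleR_scaleC mult.commute)
    finally show ?thesis by (simp only: \<Phi>_def scaleR_sum_right bwd_sum fwd_sum)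
  qed
  have \<Phi>0: "\<Phi> b i x = 0" if i: "i \<in> I" and b: "b \<in> ?B" for b i x
  proof -
    have B0: "0 \<le> d j + int \<beta>" if "\<beta> \<in> ?B" for \<beta> using that degj by force
    have "\<kappa> b i *\<^sub>R \<Phi> b i x = 0"
    proof (rule coordinate_independent[OF j(1) _ B0 i _ b])
      show "finite ?B" using Cons.prems(3) by simp
      fix r assume r: "i(j := r) \<in> I"
      \<comment> \<open>Changing \<open>i j\<close> affects neither \<open>\<kappa>\<close> nor
        \<open>\<Phi>\<close>, whose exponents and weights see only entries beyond
        \<open>j\<close>.\<close>
      have "\<tau> (i(j := r)) = (\<tau> i)(j := r)" using j(2) by (auto simp: \<tau>_def fun_eq_iff)
      then have k_eq: "\<kappa> \<beta> (i(j := r)) = \<kappa> \<beta> i" for \<beta>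
        by (simp only: \<kappa>_def ex_upd[OF j(1) order_refl])
      have P_eq: "\<Phi> \<beta> (i(j := r)) x = \<Phi> \<beta> i x" for \<beta>
        unfolding \<Phi>_def by (simp only: weight_upd[OF jsn lt])
      have r_eq: "(i(j := r)) j = r" by simp
      show "(\<Sum>\<beta>\<in>?B. fwd j (nat (d j + int \<beta>)) (r - eps j * int \<beta>) (bwd j \<beta> r (\<kappa> \<beta> i *\<^sub>R \<Phi> \<beta> i x))) = 0"
        using Cons.prems(6)[OF r, of x] unfolding expand k_eq P_eq r_eq .
    qed
    then show ?thesis using q by (simp add: \<kappa>_def)
  qed
  let ?F = "{p' \<in> F. snd p' j = snd p j}"
  show ?case
  proof (rule Cons.IH[of ?F])
    show "sorted_wrt (<) js" "set js \<subseteq> {1..n}" "finite ?F" "p \<in> ?F" using Cons.prems by auto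
    show "p1 = p2" if "p1 \<in> ?F" "p2 \<in> ?F"
      "\<And>t. t \<in> set js \<Longrightarrow> fst p1 t = fst p2 t \<and> snd p1 t = snd p2 t" for p1 p2
    proof (rule Cons.prems(4))
      show "p1 \<in> F" "p2 \<in> F" using that by auto
      show "fst p1 t = fst p2 t \<and> snd p1 t = snd p2 t" if "t \<in> set (j # js)" for t
        using that \<open>p1 \<in> ?F\<close> \<open>p2 \<in> ?F\<close> a_eq[of p1] a_eq[of p2]
          \<open>\<And>t. t \<in> set js \<Longrightarrow> fst p1 t = fst p2 t \<and> snd p1 t = snd p2 t\<close> by auto
    qed
    show "int (fst p' t) - int (snd p' t) = d t" if "p' \<in> ?F" "t \<in> set js" for p' t
      using Cons.prems(5)[of p' t] that by auto
    show "(\<Sum>p'\<in>?F. \<gamma> p' *\<^sub>C weight js (fst p') (snd p') i x) = 0" if "i \<in> I" for i x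
      using \<Phi>0[OF that, of "snd p j" x] Cons.prems(7) by (simp add: \<Phi>_def)
  qed
qed

text \<open>An element acting by 0 is congruent to a combination of ordered monomials that also acts
  by 0, and \<open>weight_independent\<close> makes its coefficients vanish.\<close>

lemma faithful:
  assumes \<pi>: "series_rep q m 0 k A v \<pi>" and nz: "\<exists>x::'k. x \<noteq> 0"
  shows "faithful_rep (Oq q n) (series_dom m 0 k) \<pi>"
  unfolding faithful_rep_def series_dom_eq
proof (intro ballI impI)
  fix a b assume ab: "a \<in> carrier (Oq q n)" "b \<in> carrier (Oq q n)" and eq: "\<forall>d\<in>fdom I UNIV. \<pi> a d = \<pi> b d"
  interpret O: Oq_ops n "fdom I UNIV" Z Y q "fspace I UNIV" "{ket i \<eta> | i \<eta>. i \<in> I \<and> \<eta> \<in> UNIV}"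
    by (rule Oq_ops_ZY[OF reducing_UNIV])
  obtain p p' where p: "p \<in> carrier (free_ring n)" "a = oq_class q n p"
    "p' \<in> carrier (free_ring n)" "b = oq_class q n p'" using ab by (auto simp: Oq_carrier)
  let ?u = "p - p'"
  let ?js = "all_gens n"
  have u: "?u \<in> carrier (free_ring n)" using p by (simp add: free_ring_closed)
  have u0: "free_act Z Y ?u d = 0" if "d \<in> fdom I UNIV" for d
  proof -
    have "free_act Z Y p d = free_act Z Y p' d"
      using bspec[OF eq that] unfolding p(2,4) series_rep_act[OF \<pi> p(1) that] series_rep_act[OF \<pi> p(3) that] .
    then show ?thesis by (simp add: free_act_diff)
  qed
  obtain F \<gamma> where F: "finite F" "F \<subseteq> exponents n \<times> exponents n"
    and uF: "?u - (\<Sum>x\<in>F. Poly_Mapping.single (normal_word ?js (fst x) (snd x)) (\<gamma> x)) \<in> oq_ideal q n"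
    using normal_form_expand[OF q(1) n1 u] unfolding equiv_mod_def[OF q(1) n1] by blast
  have js: "sorted_wrt (<) ?js" "set ?js \<subseteq> {1..n}"
    using sorted_all_gens[OF q(1) n1] set_all_gens[OF q(1) n1] by auto
  have "\<gamma> x0 = 0" if x0: "x0 \<in> F" for x0
  proof -
    define d where "d t = int (fst x0 t) - int (snd x0 t)" for t
    \<comment> \<open>The monomials of the same multidegree as \<open>x0\<close>. Exactly these move
      \<open>i\<close> to the same index, so one component of the image isolates them.\<close>
    let ?G = "{x \<in> F. \<forall>t\<in>{1..n}. int (fst x t) - int (snd x t) = d t}"
    have tgt: "target ?js (fst x) (snd x) i = target ?js (fst x0) (snd x0) i \<longleftrightarrow> x \<in> ?G" if "x \<in> F" for x i
    proof -
      have "eps t \<noteq> 0" for t by (simp add: eps_def)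
      then show ?thesis
        using that set_all_gens[OF q(1) n1] by (auto simp: target_def fun_eq_iff d_def split: if_splits)
    qed
    show ?thesis
    proof (rule weight_independent[OF nz js, of ?G d])
      show "finite ?G" using F(1) by simp
      show "x0 \<in> ?G" using x0 by (simp add: d_def)
      show "x = y" if "x \<in> ?G" "y \<in> ?G" "\<And>t. t \<in> set ?js \<Longrightarrow> fst x t = fst y t \<and> snd x t = snd y t" for x y
      proof -
        have "fst x t = fst y t \<and> snd x t = snd y t" for t
        proof (cases "t \<in> {1..n}")
          case True
          then show ?thesis using that(3) set_all_gens[OF q(1) n1] by simp
        next
          case False
          have "x \<in> exponents n \<times> exponents n" "y \<in> exponents n \<times> exponents n" using that(1,2) F(2) by blast+
          then show ?thesis using False by (simp add: exponents_def mem_Times_iff)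
        qed
        then show ?thesis by (auto simp: prod_eq_iff fun_eq_iff)
      qed
      show "int (fst x t) - int (snd x t) = d t" if "x \<in> ?G" "t \<in> set ?js" for x t
        using that set_all_gens[OF q(1) n1] by simp
      fix i y assume i: "i \<in> I"
      have kD: "ket i (y :: 'k) \<in> fdom I UNIV" using i by (simp add: ket_in_fdom)
      let ?w = "\<lambda>x. weight ?js (fst x) (snd x) i y"
      let ?\<tau> = "target ?js (fst x0) (snd x0) i"
      have nw: "word_act Z Y (normal_word ?js a b) (ket i y) = ket (target ?js a b i) (weight ?js a b i y)" for a b
        by (rule normal_word_act[OF js])
      have "free_act Z Y (?u - (\<Sum>x\<in>F. Poly_Mapping.single (normal_word ?js (fst x) (snd x)) (\<gamma> x))) (ket i y) = 0"
        by (rule O.ideal_act_zero[OF uF kD])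
      then have "(\<Sum>x\<in>F. \<gamma> x *\<^sub>C ket (target ?js (fst x) (snd x) i) (?w x)) = 0"
        unfolding free_act_diff[of _ _ ?u] u0[OF kD] free_act_sum free_act_single nw by simp
      then have "coord (\<Sum>x\<in>F. \<gamma> x *\<^sub>C ket (target ?js (fst x) (snd x) i) (?w x)) ?\<tau> = 0" by simp
      moreover have "coord (\<Sum>x\<in>F. \<gamma> x *\<^sub>C ket (target ?js (fst x) (snd x) i) (?w x)) ?\<tau> =
          (\<Sum>x\<in>F. if x \<in> ?G then \<gamma> x *\<^sub>C ?w x else 0)"
        unfolding coord_sum
      proof (rule sum.cong[OF refl])
        have ket_coord: "coord (c *\<^sub>C ket i' (w :: 'k)) j' = (if b then c *\<^sub>C w else 0)" if "i' = j' \<longleftrightarrow> b" for c i' w j' b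
          using that by (auto simp: coord_ket)
        fix x assume "x \<in> F"
        then show "coord (\<gamma> x *\<^sub>C ket (target ?js (fst x) (snd x) i) (?w x)) ?\<tau> = (if x \<in> ?G then \<gamma> x *\<^sub>C ?w x else 0)"
          by (intro ket_coord tgt)
      qed
      ultimately have "(\<Sum>x\<in>F. if x \<in> ?G then \<gamma> x *\<^sub>C ?w x else 0) = 0" by simp
      then show "(\<Sum>x\<in>?G. \<gamma> x *\<^sub>C ?w x) = 0"
        using F(1) by (simp only: sum.inter_filter[symmetric] mem_Collect_eq) (simp add: sum.inter_filter cong: conj_cong)
    qed
  qed
  then have "(\<Sum>x\<in>F. Poly_Mapping.single (normal_word ?js (fst x) (snd x)) (\<gamma> x)) = 0" by (simp add: sum.neutral)
  then have "?u \<in> oq_ideal q n" using uF by simp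
  then show "a = b" using genideal_class_eq[OF n1 p(1,3)] p by simp
qed

end

theorem proposition4p1:
  fixes q :: real and n m l k :: nat
    and A v :: "'k::complex_hilbert \<Rightarrow> 'k"
  assumes "0 < q" and "q < 1" and "n \<ge> 1" and "m + l + k = n"
    and "\<exists>x::'k. x \<noteq> 0" and "admissible q l A v"
  shows
   "(\<exists>\<pi>. series_rep q m l k A v \<pi> \<and>
       (\<forall>\<pi>'. series_rep q m l k A v \<pi>' \<longrightarrow>
         (\<forall>a\<in>carrier (Oq q n). \<forall>d\<in>series_dom m l k. \<pi>' a d = \<pi> a d))) \<and>
    (\<forall>\<pi>. series_rep q m l k A v \<pi> \<longrightarrow>
       (\<forall>m' l' k' (A' :: 'k2::complex_hilbert \<Rightarrow> 'k2) v' \<pi>'.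
         m' + l' + k' = n \<and> (\<exists>x::'k2. x \<noteq> 0) \<and> admissible q l' A' v' \<and>
         series_rep q m' l' k' A' v' \<pi>' \<longrightarrow>
         ((m, l, k) \<noteq> (m', l', k') \<longrightarrow>
           \<not> unitarily_equivalent (Oq q n) (series_space m l k) (series_dom m l k) \<pi>
               (series_space m' l' k') (series_dom m' l' k') \<pi>') \<and>
         ((m, l, k) = (m', l', k') \<and> \<not> data_equivalent l k A v A' v' \<longrightarrow>
           \<not> unitarily_equivalent (Oq q n) (series_space m l k) (series_dom m l k) \<pi>
               (series_space m' l' k') (series_dom m' l' k') \<pi>'))) \<and>
    (\<forall>\<pi>. series_rep q m l k A v \<pi> \<longrightarrow>
       (irreducible_rep (Oq q n) (series_space m l k) (series_dom m l k) \<pi> \<longleftrightarrow>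
         (\<exists>U :: complex \<Rightarrow> 'k. unitary U))) \<and>
    (\<forall>U :: complex \<Rightarrow> 'k. unitary U \<longrightarrow>
       (l > 0 \<longrightarrow> (\<exists>w. cmod w = 1 \<and> (\<forall>x. v (U x) = U (w * x)))) \<and>
       (\<exists>a\<in>{q<..1}. \<forall>x. A (U x) = U (complex_of_real a * x))) \<and>
    (\<forall>\<pi>. series_rep q m l k A v \<pi> \<longrightarrow>
       (faithful_rep (Oq q n) (series_dom m l k) \<pi> \<longleftrightarrow> l = 0))"
proof -
  note n = \<open>m + l + k = n\<close>[symmetric]
  have mlk: "1 \<le> m + l + k" using assms(3,4) by simp
  interpret s: series q m l k A v "inv_into UNIV v"
    by (rule admissible_series[OF assms(1,2) mlk assms(6)])
  have ser: "series q m l k A v (inv_into UNIV v)" by (rule s.series_axioms)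
  have vu: "unitary v" if "0 < l" using assms(6) that by (simp add: admissible_def)
  have ne: "\<not> op_eigenvalue A (complex_of_real q)" using assms(6) by (simp add: admissible_def)
  have existence: "\<exists>\<pi>. series_rep q m l k A v \<pi> \<and>
       (\<forall>\<pi>'. series_rep q m l k A v \<pi>' \<longrightarrow>
         (\<forall>a\<in>carrier (Oq q n). \<forall>d\<in>series_dom m l k. \<pi>' a d = \<pi> a d))"
  proof -
    obtain \<pi> where \<pi>: "series_rep q m l k A v \<pi>" using s.series_rep_exists by blast
    have "\<pi>' a d = \<pi> a d" if \<pi>': "series_rep q m l k A v \<pi>'" and a: "a \<in> carrier (Oq q n)"
      and d: "d \<in> series_dom m l k" for \<pi>' a d
    proof -
      obtain p where p: "p \<in> carrier (free_ring n)" "a = oq_class q n p" using a by (auto simp: Oq_carrier)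
      show ?thesis
        using s.series_rep_act[OF \<pi>, of p d] s.series_rep_act[OF \<pi>', of p d] p d
        unfolding n s.series_dom_eq by simp
    qed
    then show ?thesis using \<pi> by blast
  qed
  have equivalence: "(m, l, k) = (m', l', k') \<and> data_equivalent l k A v A' v'"
    if \<pi>: "series_rep q m l k A v \<pi>" and n': "m' + l' + k' = n" and nz': "\<exists>x::'k2. x \<noteq> 0"
      and adm': "admissible q l' A' v'" and \<pi>': "series_rep q m' l' k' A' v' \<pi>'"
      and eq: "unitarily_equivalent (Oq q n) (series_space m l k) (series_dom m l k) \<pi>
               (series_space m' l' k') (series_dom m' l' k') \<pi>'"
    for \<pi> m' l' k' and A' v' :: "'k2 \<Rightarrow> 'k2" and \<pi>'
  proof -
    have "1 \<le> m' + l' + k'" using n' assms(3) by simp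
    then have ser': "series q m' l' k' A' v' (inv_into UNIV v')"
      by (rule admissible_series[OF assms(1,2) _ adm'])
    have same: "(m, l, k) = (m', l', k')"
      using equivalent_same_series[OF ser ser' _ \<pi> \<pi>' eq[unfolded n] assms(5) nz'] n n' by simp
    then show ?thesis
      using equivalent_data_equivalent[OF ser _ \<pi>, of A' v' "inv_into UNIV v'" \<pi>'] ser' \<pi>' eq n by simp
  qed
  have irreducible: "irreducible_rep (Oq q n) (series_space m l k) (series_dom m l k) \<pi> \<longleftrightarrow>
         (\<exists>U :: complex \<Rightarrow> 'k. unitary U)" if \<pi>: "series_rep q m l k A v \<pi>" for \<pi>
  proof
    assume irr: "irreducible_rep (Oq q n) (series_space m l k) (series_dom m l k) \<pi>"
    show "\<exists>U :: complex \<Rightarrow> 'k. unitary U"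
    proof (rule ccontr)
      assume dim: "\<not> (\<exists>U :: complex \<Rightarrow> 'k. unitary U)"
      \<comment> \<open>Admissibility constrains \<open>v\<close> only for \<open>l > 0\<close>;
        otherwise the identity stands in, so that \<open>commuting_reducing\<close> applies in both
        cases.\<close>
      define v0 where "v0 = (if 0 < l then v else (\<lambda>x. x))"
      have "unitary v0"
      proof (cases "0 < l")
        case True
        then show ?thesis using vu by (simp add: v0_def)
      next
        case False
        then show ?thesis by (simp add: v0_def unitary_on_def clinear_on_def)
      qed
      moreover have "A (v0 x) = v0 (A x)" for x using s.v(4) by (simp add: v0_def)
      ultimately obtain P where P: "nontrivial_projection P" "\<And>x. A (P x) = P (A x)" "\<And>x. v0 (P x) = P (v0 x)"
        using commuting_reducing[OF s.A _ _ dim assms(5), of v0] by blast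
      have "v (P x) = P (v x)" if "0 < l" for x using P(3)[of x] that by (simp add: v0_def)
      then show False using s.reducible[OF \<pi> P(1,2)] irr n by simp
    qed
  next
    assume "\<exists>U :: complex \<Rightarrow> 'k. unitary U"
    then obtain U :: "complex \<Rightarrow> 'k" where U: "unitary U" by blast
    show "irreducible_rep (Oq q n) (series_space m l k) (series_dom m l k) \<pi>"
      unfolding n by (rule s.one_dimensional_irreducible[OF \<pi> one_dimensional(1,3)[OF U]])
  qed
  have scalars: "(l > 0 \<longrightarrow> (\<exists>w. cmod w = 1 \<and> (\<forall>x. v (U x) = U (w * x)))) \<and>
       (\<exists>a\<in>{q<..1}. \<forall>x. A (U x) = U (complex_of_real a * x))" if U: "unitary U" for U :: "complex \<Rightarrow> 'k"
  proof -
    define e where "e = U 1"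
    have e: "norm e = 1" "\<And>c. U c = c *\<^sub>C e" "\<And>x. \<exists>c. x = c *\<^sub>C e"
      unfolding e_def using one_dimensional[OF U] by blast+
    have ee: "cinner e e = 1" using e(1) by (simp add: cinner_self)
    have e0: "e \<noteq> 0" using e(1) by auto
    have "\<exists>w. cmod w = 1 \<and> (\<forall>x. v (U x) = U (w * x))" if l: "0 < l"
    proof -
      obtain w where w: "v e = w *\<^sub>C e" using e(3) by blast
      have "cmod w = 1" using unitary_adjp(4)[OF vu[OF l], of e] by (simp add: w norm_scaleC e(1))
      moreover have "v (U x) = U (w * x)" for x
        by (simp add: e(2) adjp_linear(2)[OF s.v(1)[OF l]] w mult.commute)
      ultimately show ?thesis by blast
    qed
    moreover have "\<exists>a\<in>{q<..1}. \<forall>x. A (U x) = U (complex_of_real a * x)"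
    proof -
      obtain b where b: "A e = b *\<^sub>C e" using e(3) by blast
      define a where "a = Re b"
      have "cinner (A e) e = b" by (simp add: b cinner_simps ee)
      then have ba: "b = complex_of_real a" using adjp_self_real[OF s.A, of e] by (simp add: a_def)
      have "q \<le> a" using s.A_pos[of e] by (simp add: b cinner_simps ee e(1) a_def)
      \<comment> \<open>The endpoint is excluded because \<open>e\<close> would be an eigenvector
        for \<open>q\<close>.\<close>
      moreover have "a \<noteq> q" using ne e0 b ba by (auto simp: op_eigenvalue_def)
      moreover have "a \<le> 1" using s.A_le[of e] by (simp add: b norm_scaleC e(1) ba)
      moreover have "A (U x) = U (complex_of_real a * x)" for x
        by (simp add: e(2) adjp_linear(2)[OF s.A] b ba mult.commute)
      ultimately show ?thesis by (intro bexI[of _ a]) auto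
    qed
    ultimately show ?thesis by blast
  qed
  have faithful: "faithful_rep (Oq q n) (series_dom m l k) \<pi> \<longleftrightarrow> l = 0"
    if \<pi>: "series_rep q m l k A v \<pi>" for \<pi>
  proof
    assume "faithful_rep (Oq q n) (series_dom m l k) \<pi>"
    then show "l = 0" using not_faithful[OF ser \<pi> _ assms(5)] unfolding n by blast
  next
    assume l: "l = 0"
    have "series0 q m k A v (inv_into UNIV v)" using ser unfolding l series0_def .
    then show "faithful_rep (Oq q n) (series_dom m l k) \<pi>"
      using series0.faithful[of q m k A v _ \<pi>] \<pi> assms(5) unfolding n l by blast
  qed
  show ?thesis
    using existence equivalence irreducible scalars faithful by blast
qed

end
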